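(* Let $\Omega\subset\mathbb{R}^n$ be open, let $U\Subset\Omega$ be an open set, let $1\le p\le\infty$, and let $F\in\mathcal{DM}^p(\Omega)$. Then, for any $\phi\in C^0(\Omega)$ with $\nabla\phi\in L^{p'}(\Omega;\mathbb{R}^n)$, there exists a sequence of bounded open sets $V_k$ with boundary of class $C^\infty$ such that $U\Subset V_k\subset\Omega$, $\bigcap_kV_k=\overline U$, and $$\langle F\cdot\nu,\phi\rangle_{\partial\overline U}=-\lim_{k\to\infty}\int_{\partial V_k}\phi\,F\cdot\nu_{V_k}\,d\mathcal{H}^{n-1},\qquad( * )$$ where $\nu_{V_k}$ is the classical inner unit normal to $V_k$. In addition, $( * )$ holds also for any open set $U$ satisfying $\overline U\subset\Omega$, provided that $\mathrm{supp}(\phi)$ is compact in $\Omega$.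
   Context: $A\Subset B$ means that the closure of $A$ is a compact subset of $B$. $p'=p/(p-1)$ is the conjugate exponent. $\mathcal{DM}^p(\Omega)$ is the space of vector fields $F\in L^p(\Omega;\mathbb{R}^n)$ whose distributional divergence $\mathrm{div}F$ is a real finite Radon measure on $\Omega$. The normal trace of $F$ on the boundary of a Borel set $E\subset\Omega$ is the functional $\langle F\cdot\nu,\phi\rangle_{\partial E}:=\int_E\phi\,d\,\mathrm{div}F+\int_E F\cdot\nabla\phi\,dx$; the notation $\langle F\cdot\nu,\cdot\rangle_{\partial\overline U}$ means that $E=\overline U$. $\mathcal{H}^{n-1}$ is the $(n-1)$-dimensional Hausdorff measure. *)

theory Defs
  imports "HOL-Analysis.Analysis"
begin

text \<open>
  The space \<open>\<real>\<^sup>n\<close> is an arbitrary type of class \<open>euclidean_space\<close>, with \<open>n = DIM('a)\<close>.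
  Functions and vector fields on \<open>\<Omega>\<close> are total functions of which only the values on \<open>\<Omega>\<close>
  are ever used.
\<close>

definition compactly_contained :: "'a::topological_space set \<Rightarrow> 'a set \<Rightarrow> bool"  (infix "\<Subset>" 50)
  where "A \<Subset> B \<longleftrightarrow> compact (closure A) \<and> closure A \<subseteq> B"

text \<open>The support of a function on \<open>\<Omega>\<close>.  It is compact in \<open>\<Omega>\<close> iff this closure, taken in the
  whole space, is a compact subset of \<open>\<Omega>\<close>.\<close>

definition supp_on :: "'a::topological_space set \<Rightarrow> ('a \<Rightarrow> real) \<Rightarrow> 'a set"
  where "supp_on \<Omega> \<phi> = closure {x \<in> \<Omega>. \<phi> x \<noteq> 0}"

subsection \<open>Smooth functions\<close>

definition grad :: "('a::euclidean_space \<Rightarrow> real) \<Rightarrow> 'a \<Rightarrow> 'a"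
  where "grad f x = (\<Sum>b\<in>Basis. frechet_derivative f (at x) b *\<^sub>R b)"

text \<open>\<open>k\<close> times continuously differentiable on an open set \<open>S\<close>.\<close>

fun Ck_on :: "nat \<Rightarrow> 'a::euclidean_space set \<Rightarrow> ('a \<Rightarrow> real) \<Rightarrow> bool" where
  "Ck_on 0 S f \<longleftrightarrow> continuous_on S f"
| "Ck_on (Suc k) S f \<longleftrightarrow>
     (\<forall>x\<in>S. f differentiable (at x)) \<and>
     (\<forall>b\<in>Basis. Ck_on k S (\<lambda>x. frechet_derivative f (at x) b))"

definition smooth_on :: "'a::euclidean_space set \<Rightarrow> ('a \<Rightarrow> real) \<Rightarrow> bool"
  where "smooth_on S f \<longleftrightarrow> (\<forall>k. Ck_on k S f)"

definition test_functions :: "'a::euclidean_space set \<Rightarrow> ('a \<Rightarrow> real) set"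
  where "test_functions \<Omega> =
    {\<psi>. smooth_on UNIV \<psi> \<and> compact (closure {x. \<psi> x \<noteq> 0}) \<and> closure {x. \<psi> x \<noteq> 0} \<subseteq> \<Omega>}"

subsection \<open>Lebesgue spaces and weak gradients\<close>

definition Lp :: "ennreal \<Rightarrow> 'a::euclidean_space set \<Rightarrow> ('a \<Rightarrow> 'a) set"
  where "Lp p \<Omega> =
    {F. F \<in> borel_measurable (lebesgue_on \<Omega>) \<and>
        (if p = \<infinity> then \<exists>C. AE x in lebesgue_on \<Omega>. norm (F x) \<le> C
         else integrable (lebesgue_on \<Omega>) (\<lambda>x. norm (F x) powr enn2real p))}"

definition conj_exponent :: "ennreal \<Rightarrow> ennreal"
  where "conj_exponent p = (if p = 1 then \<infinity> else if p = \<infinity> then 1 else p / (p - 1))"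

definition locally_integrable_on :: "'a::euclidean_space set \<Rightarrow> ('a \<Rightarrow> 'a) \<Rightarrow> bool"
  where "locally_integrable_on \<Omega> g \<longleftrightarrow>
    (\<forall>K. compact K \<and> K \<subseteq> \<Omega> \<longrightarrow> set_integrable lebesgue K g)"

definition has_weak_gradient :: "'a::euclidean_space set \<Rightarrow> ('a \<Rightarrow> real) \<Rightarrow> ('a \<Rightarrow> 'a) \<Rightarrow> bool"
  where "has_weak_gradient \<Omega> \<phi> g \<longleftrightarrow>
    locally_integrable_on \<Omega> g \<and>
    (\<forall>\<psi>\<in>test_functions \<Omega>.
       (LINT x:\<Omega>|lebesgue. \<phi> x *\<^sub>R grad \<psi> x) = - (LINT x:\<Omega>|lebesgue. \<psi> x *\<^sub>R g x))"

definition weakly_differentiable_on :: "'a::euclidean_space set \<Rightarrow> ('a \<Rightarrow> real) \<Rightarrow> bool"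
  where "weakly_differentiable_on \<Omega> \<phi> \<longleftrightarrow> (\<exists>g. has_weak_gradient \<Omega> \<phi> g)"

text \<open>A weak gradient is unique up to Lebesgue null sets, so it does not matter which one is
  chosen.\<close>

definition weak_grad :: "'a::euclidean_space set \<Rightarrow> ('a \<Rightarrow> real) \<Rightarrow> 'a \<Rightarrow> 'a"
  where "weak_grad \<Omega> \<phi> = (SOME g. has_weak_gradient \<Omega> \<phi> g)"

subsection \<open>Real finite Radon measures\<close>

text \<open>On an open subset of \<open>\<real>\<^sup>n\<close> every finite Borel measure is regular, so a real finite Radon
  measure is just a real-valued countably additive function on the Borel subsets of \<open>\<Omega>\<close>.
  Its values on other sets are irrelevant.\<close>

definition real_radon_measure :: "'a::euclidean_space set \<Rightarrow> ('a set \<Rightarrow> real) \<Rightarrow> bool"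
  where "real_radon_measure \<Omega> \<mu> \<longleftrightarrow>
    \<mu> {} = 0 \<and>
    (\<forall>A::nat \<Rightarrow> 'a set.
       range A \<subseteq> sets (restrict_space borel \<Omega>) \<and> disjoint_family A \<longrightarrow>
       (\<lambda>i. \<mu> (A i)) sums \<mu> (\<Union>i. A i))"

text \<open>The positive part \<open>\<mu>\<^sup>+(E) = sup {\<mu>(A) | A \<subseteq> E}\<close> of the Jordan decomposition.  Negative values
  of \<open>\<mu>(A)\<close> are truncated to \<open>0\<close> by \<open>ennreal\<close>, harmlessly since \<open>\<mu>({}) = 0\<close>.\<close>

definition pos_part :: "'a::euclidean_space set \<Rightarrow> ('a set \<Rightarrow> real) \<Rightarrow> 'a measure"
  where "pos_part \<Omega> \<mu> =
    measure_of \<Omega> (sets (restrict_space borel \<Omega>))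
      (\<lambda>E. SUP A\<in>{A \<in> sets (restrict_space borel \<Omega>). A \<subseteq> E}. ennreal (\<mu> A))"

definition neg_part :: "'a::euclidean_space set \<Rightarrow> ('a set \<Rightarrow> real) \<Rightarrow> 'a measure"
  where "neg_part \<Omega> \<mu> = pos_part \<Omega> (\<lambda>A. - \<mu> A)"

text \<open>The integral over \<open>E \<subseteq> \<Omega>\<close> with respect to a real measure on \<open>\<Omega>\<close>.\<close>

definition real_measure_integral ::
  "'a::euclidean_space set \<Rightarrow> ('a set \<Rightarrow> real) \<Rightarrow> 'a set \<Rightarrow> ('a \<Rightarrow> real) \<Rightarrow> real"
  where "real_measure_integral \<Omega> \<mu> E f =
    (LINT x:E|pos_part \<Omega> \<mu>. f x) - (LINT x:E|neg_part \<Omega> \<mu>. f x)"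

subsection \<open>Divergence-measure fields and their normal traces\<close>

definition has_divergence_measure ::
  "'a::euclidean_space set \<Rightarrow> ('a \<Rightarrow> 'a) \<Rightarrow> ('a set \<Rightarrow> real) \<Rightarrow> bool"
  where "has_divergence_measure \<Omega> F \<mu> \<longleftrightarrow>
    real_radon_measure \<Omega> \<mu> \<and>
    (\<forall>\<psi>\<in>test_functions \<Omega>.
       real_measure_integral \<Omega> \<mu> \<Omega> \<psi> = - (LINT x:\<Omega>|lebesgue. F x \<bullet> grad \<psi> x))"

definition DM :: "ennreal \<Rightarrow> 'a::euclidean_space set \<Rightarrow> ('a \<Rightarrow> 'a) set"
  where "DM p \<Omega> = {F \<in> Lp p \<Omega>. \<exists>\<mu>. has_divergence_measure \<Omega> F \<mu>}"

text \<open>The divergence measure is unique on the Borel subsets of \<open>\<Omega>\<close>.\<close>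

definition div_measure :: "'a::euclidean_space set \<Rightarrow> ('a \<Rightarrow> 'a) \<Rightarrow> 'a set \<Rightarrow> real"
  where "div_measure \<Omega> F = (SOME \<mu>. has_divergence_measure \<Omega> F \<mu>)"

definition normal_trace ::
  "'a::euclidean_space set \<Rightarrow> ('a \<Rightarrow> 'a) \<Rightarrow> 'a set \<Rightarrow> ('a \<Rightarrow> real) \<Rightarrow> real"
  where "normal_trace \<Omega> F E \<phi> =
    real_measure_integral \<Omega> (div_measure \<Omega> F) E \<phi> +
    (LINT x:E|lebesgue. F x \<bullet> weak_grad \<Omega> \<phi> x)"

subsection \<open>Hausdorff measure\<close>

text \<open>Normalised so that in dimension \<open>d\<close> it agrees with Lebesgue measure.  The empty set has to
  be given size \<open>0\<close> explicitly, because \<open>0 ^ 0 = 1\<close>; the boundedness condition is needed because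
  \<open>diameter\<close> is meaningless on unbounded sets.\<close>

definition hausdorff_size :: "nat \<Rightarrow> 'a::euclidean_space set \<Rightarrow> ennreal"
  where "hausdorff_size d C =
    (if C = {} then 0 else ennreal (unit_ball_vol (real d) * (diameter C / 2) ^ d))"

definition hausdorff_premeasure :: "nat \<Rightarrow> real \<Rightarrow> 'a::euclidean_space set \<Rightarrow> ennreal"
  where "hausdorff_premeasure d \<delta> A =
    (INF C\<in>{C::nat \<Rightarrow> 'a set. A \<subseteq> (\<Union>i. C i) \<and> (\<forall>i. bounded (C i) \<and> diameter (C i) \<le> \<delta>)}.
       \<Sum>i. hausdorff_size d (C i))"

definition hausdorff_outer_measure :: "nat \<Rightarrow> 'a::euclidean_space set \<Rightarrow> ennreal"
  where "hausdorff_outer_measure d A = (SUP \<delta>\<in>{0<..}. hausdorff_premeasure d \<delta> A)"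

text \<open>The measure on all Caratheodory-measurable sets; in particular it is complete.\<close>

definition hausdorff_measure :: "nat \<Rightarrow> 'a::euclidean_space measure"
  where "hausdorff_measure d =
    measure_of UNIV (lambda_system UNIV (Pow UNIV) (hausdorff_outer_measure d))
      (hausdorff_outer_measure d)"

subsection \<open>Open sets with smooth boundary\<close>

text \<open>\<open>\<rho>\<close> is a local defining function of \<open>V\<close> near \<open>x\<close>: in the ball, \<open>V\<close> lies on one side of the
  smooth hypersurface \<open>\<rho> = 0\<close>.\<close>

definition local_defining_function ::
  "'a::euclidean_space set \<Rightarrow> 'a \<Rightarrow> real \<Rightarrow> ('a \<Rightarrow> real) \<Rightarrow> bool"
  where "local_defining_function V x r \<rho> \<longleftrightarrow>
    0 < r \<and> smooth_on (ball x r) \<rho> \<and> (\<forall>y\<in>ball x r. grad \<rho> y \<noteq> 0) \<and>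
    V \<inter> ball x r = {y \<in> ball x r. 0 < \<rho> y}"

definition smooth_boundary :: "'a::euclidean_space set \<Rightarrow> bool"
  where "smooth_boundary V \<longleftrightarrow> (\<forall>x\<in>frontier V. \<exists>r \<rho>. local_defining_function V x r \<rho>)"

text \<open>Since \<open>\<rho>\<close> is positive inside \<open>V\<close>, its normalised gradient points inwards.\<close>

definition inner_unit_normal :: "'a::euclidean_space set \<Rightarrow> 'a \<Rightarrow> 'a"
  where "inner_unit_normal V x =
    (THE \<nu>. \<exists>r \<rho>. local_defining_function V x r \<rho> \<and> \<nu> = grad \<rho> x /\<^sub>R norm (grad \<rho> x))"

text \<open>That the integral below exists is not built into the Bochner integral, hence is recorded
  separately, together with the fact that \<open>\<partial>V\<close> lies in the domain \<open>\<Omega>\<close> of \<open>\<phi>\<close> and \<open>F\<close>.\<close>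

definition boundary_flux_exists ::
  "'a::euclidean_space set \<Rightarrow> ('a \<Rightarrow> 'a) \<Rightarrow> ('a \<Rightarrow> real) \<Rightarrow> 'a set \<Rightarrow> bool"
  where "boundary_flux_exists \<Omega> F \<phi> V \<longleftrightarrow>
    frontier V \<subseteq> \<Omega> \<and>
    set_integrable (hausdorff_measure (DIM('a) - 1)) (frontier V)
      (\<lambda>x. \<phi> x * (F x \<bullet> inner_unit_normal V x))"

definition boundary_flux ::
  "('a::euclidean_space \<Rightarrow> 'a) \<Rightarrow> ('a \<Rightarrow> real) \<Rightarrow> 'a set \<Rightarrow> real"
  where "boundary_flux F \<phi> V =
    (LINT x:frontier V|hausdorff_measure (DIM('a) - 1). \<phi> x * (F x \<bullet> inner_unit_normal V x))"

end

theory Submission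
  imports Defs
begin

text \<open>
  If \<open>\<psi> = h \<circ> v\<close> is a smooth cutoff equal to \<open>1\<close> on \<open>A = closure U\<close> and to \<open>0\<close> outside a
  neighbourhood \<open>W\<close> of \<open>A\<close>, with \<open>v\<close> smooth and \<open>h\<close> a transition from \<open>0\<close> to \<open>1\<close> with derivative
  \<open>c\<close>, then mollifying \<open>\<phi>\<close> in the definition of the divergence gives
  \<open>\<integral> c(v) \<phi> F \<bullet> grad v dx = - \<integral> \<psi> \<phi> d(div F) - \<integral> \<psi> F \<bullet> grad \<phi> dx\<close>.  The right-hand
  side differs from minus the normal trace on \<open>A\<close> by at most the integrals of \<open>\<bar>\<phi>\<bar>\<close> and
  \<open>\<bar>F \<bullet> grad \<phi>\<bar>\<close> over \<open>W - A\<close>, a bound that does not depend on \<open>c\<close> and vanishes as \<open>W\<close> shrinks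
  to \<open>A\<close>.  By the coarea formula the left-hand side is the average, with weight \<open>c\<close>, of the fluxes
  through the level sets of \<open>v\<close>.  Since \<open>c\<close> is arbitrary, almost every level obeys the same
  bound, and almost every level is regular after a small perturbation of \<open>v\<close>.
\<close>

section \<open>Hausdorff measures\<close>

text \<open>The boundary integrals evaluate \<open>F\<close>, which is determined only up to
  Lebesgue null sets, on a hypersurface, and \<open>div F\<close> may charge hypersurfaces. No
  surface can therefore be prescribed in advance; it is selected from a one-parameter family so that
  an exceptional null set of \<open>F\<close> is invisible to surface measure. The same coarea
  formula that produces the average shows that almost every level meets this null set in a set of
  surface measure zero.

  That formula is used with its exact constant, for a Hausdorff measure defined by coverings with
  arbitrary sets. The constant enters through the isodiametric inequality, by which this measure is
  Lebesgue measure on every coordinate subspace. From hyperplanes the formula passes to functions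
  without critical points because charts exist whose distortion of distances is as close to 1 as
  desired. Critical points cause no loss: the density in the formula vanishes there, and the
  selected level avoids them.\<close>

lemma hausdorff_size_mono:
  fixes A B :: "'a::euclidean_space set"
  assumes "A \<subseteq> B" "bounded B"
  shows "hausdorff_size d A \<le> hausdorff_size d B"
proof -
  have "diameter A \<le> diameter B" using diameter_subset assms by blast
  moreover have "0 \<le> diameter A" using assms diameter_ge_0 bounded_subset by blast
  ultimately show ?thesis using assms
    by (auto simp: hausdorff_size_def intro!: ennreal_leI mult_left_mono power_mono)
qed

text \<open>The restriction on the covering sets is a predicate, so that the premeasures of all
  scales and the Hausdorff content (\<open>P = bounded\<close>) share their lemmas. The content,
  being scale-free, is what the comparison with cubes works with.\<close>

definition cover_content :: "nat \<Rightarrow> ('a::euclidean_space set \<Rightarrow> bool) \<Rightarrow> 'a set \<Rightarrow> ennreal" where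
  "cover_content d P A = (INF C\<in>{C::nat \<Rightarrow> 'a set. A \<subseteq> (\<Union>i. C i) \<and> (\<forall>i. P (C i))}. \<Sum>i. hausdorff_size d (C i))"

lemma hausdorff_premeasure_eq:
  "hausdorff_premeasure d \<delta> = cover_content d (\<lambda>C. bounded C \<and> diameter C \<le> \<delta>)"
  by (simp add: fun_eq_iff hausdorff_premeasure_def cover_content_def)

lemma cover_content_mono: "A \<subseteq> B \<Longrightarrow> cover_content d P A \<le> cover_content d P B"
  unfolding cover_content_def by (rule INF_superset_mono) auto

lemma cover_content_le:
  assumes "A \<subseteq> (\<Union>i. C i)" "\<And>i. P (C i)"
  shows "cover_content d P A \<le> (\<Sum>i. hausdorff_size d (C i))"
  unfolding cover_content_def by (rule INF_lower) (use assms in auto)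

lemma hausdorff_size_empty [simp]: "hausdorff_size d {} = 0"
  by (simp add: hausdorff_size_def)

lemma cover_content_le_size:
  assumes "A \<subseteq> C" "P C" "P {}"
  shows "cover_content d P A \<le> hausdorff_size d C"
proof -
  have "cover_content d P A \<le> (\<Sum>i::nat. hausdorff_size d (if i = 0 then C else {}))"
    by (rule cover_content_le) (use assms in auto)
  also have "\<dots> = hausdorff_size d C"
    by (subst suminf_finite[of "{0}"]) auto
  finally show ?thesis .
qed

lemma cover_content_empty [simp]: "P {} \<Longrightarrow> cover_content d P {} = 0"
  using cover_content_le_size[of "{}" "{}" P d] by simp

lemma cover_content_UN_le:
  fixes A :: "nat \<Rightarrow> 'a::euclidean_space set"
  shows "cover_content d P (\<Union>i. A i) \<le> (\<Sum>i. cover_content d P (A i))"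
proof (rule ennreal_le_epsilon)
  fix e :: real assume "0 < e" "(\<Sum>n. cover_content d P (A n)) < top"
  then have *: "\<And>n. cover_content d P (A n) < cover_content d P (A n) + e * (1/2)^Suc n"
    by (auto simp add: less_top dest!: ennreal_suminf_lessD)
  have "\<exists>C. A n \<subseteq> (\<Union>i. C i) \<and> (\<forall>i. P (C i)) \<and>
      (\<Sum>i. hausdorff_size d (C i)) < cover_content d P (A n) + e * (1/2)^Suc n" for n
    using *[of n] unfolding cover_content_def[of d P "A n"] INF_less_iff by auto
  then obtain B where B: "\<And>n. A n \<subseteq> (\<Union>i. B n i)" "\<And>n i. P (B n i)"
    "\<And>n. (\<Sum>i. hausdorff_size d (B n i)) < cover_content d P (A n) + e * (1/2)^Suc n"
    by metis
  define C where "C = case_prod B o prod_decode"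
  have "(\<Union>i. A i) \<subseteq> (\<Union>i. C i)"
    using B(1) by (auto simp add: C_def subset_eq) (metis prod.case prod_encode_inverse)
  then have "cover_content d P (\<Union>i. A i) \<le> (\<Sum>i. hausdorff_size d (C i))"
    by (rule cover_content_le) (auto simp: C_def B split: prod.split)
  also have "\<dots> = (\<Sum>n. \<Sum>i. hausdorff_size d (B n i))"
    using suminf_ennreal_2dimen[of "\<lambda>n. \<Sum>i. hausdorff_size d (B n i)" "\<lambda>p. hausdorff_size d (case_prod B p)"]
    unfolding C_def comp_def by simp
  also have "\<dots> \<le> (\<Sum>n. cover_content d P (A n) + e * (1/2) ^ Suc n)"
    using B(3) by (intro suminf_le suminf_nonneg allI) (auto intro: less_imp_le)
  also have "... = (\<Sum>n. cover_content d P (A n)) + (\<Sum>n. ennreal e * ennreal ((1/2) ^ Suc n))"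
    using \<open>0 < e\<close> by (subst suminf_add[symmetric])
                     (auto simp del: ennreal_suminf_cmult simp add: ennreal_mult[symmetric])
  also have "\<dots> = (\<Sum>n. cover_content d P (A n)) + e"
    unfolding ennreal_suminf_cmult
    by (subst suminf_ennreal_eq[OF zero_le_power power_half_series]) auto
  finally show "cover_content d P (\<Union>i. A i) \<le> (\<Sum>n. cover_content d P (A n)) + e" .
qed

lemma hausdorff_premeasure_antimono:
  assumes "\<delta> \<le> \<delta>'"
  shows "hausdorff_premeasure d \<delta>' A \<le> hausdorff_premeasure d \<delta> A"
  unfolding hausdorff_premeasure_def by (rule INF_superset_mono) (use assms in \<open>auto intro: order_trans\<close>)

lemma hausdorff_premeasure_le_outer:
  "0 < \<delta> \<Longrightarrow> hausdorff_premeasure d \<delta> A \<le> hausdorff_outer_measure d A"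
  unfolding hausdorff_outer_measure_def by (rule SUP_upper) auto

lemma hausdorff_outer_leI:
  "(\<And>\<delta>. 0 < \<delta> \<Longrightarrow> hausdorff_premeasure d \<delta> A \<le> c) \<Longrightarrow> hausdorff_outer_measure d A \<le> c"
  unfolding hausdorff_outer_measure_def by (rule SUP_least) auto

lemma hausdorff_outer_mono: "A \<subseteq> B \<Longrightarrow> hausdorff_outer_measure d A \<le> hausdorff_outer_measure d B"
  unfolding hausdorff_outer_measure_def hausdorff_premeasure_eq
  by (rule SUP_mono) (auto intro: cover_content_mono)

lemma hausdorff_outer_empty [simp]: "hausdorff_outer_measure d {} = 0"
  by (rule antisym, rule hausdorff_outer_leI) (auto simp: hausdorff_premeasure_eq)

lemma hausdorff_outer_UN_le:
  fixes A :: "nat \<Rightarrow> 'a::euclidean_space set"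
  shows "hausdorff_outer_measure d (\<Union>i. A i) \<le> (\<Sum>i. hausdorff_outer_measure d (A i))"
proof (rule hausdorff_outer_leI)
  fix \<delta> :: real assume "0 < \<delta>"
  have "hausdorff_premeasure d \<delta> (\<Union>i. A i) \<le> (\<Sum>i. hausdorff_premeasure d \<delta> (A i))"
    unfolding hausdorff_premeasure_eq by (rule cover_content_UN_le)
  also have "\<dots> \<le> (\<Sum>i. hausdorff_outer_measure d (A i))"
    by (intro suminf_le allI hausdorff_premeasure_le_outer \<open>0 < \<delta>\<close>) auto
  finally show "hausdorff_premeasure d \<delta> (\<Union>i. A i) \<le> \<dots>" .
qed

lemma outer_measure_space_hausdorff:
  "outer_measure_space (Pow (UNIV::'a::euclidean_space set)) (hausdorff_outer_measure d)"
  unfolding outer_measure_space_def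
  by (auto simp: positive_def increasing_def countably_subadditive_def
      intro: hausdorff_outer_mono hausdorff_outer_UN_le)

lemma hausdorff_outer_Un_le:
  fixes A :: "'a::euclidean_space set"
  shows "hausdorff_outer_measure d (A \<union> B) \<le> hausdorff_outer_measure d A + hausdorff_outer_measure d B"
proof -
  have "(\<Union>i::nat. if i = 0 then A else if i = 1 then B else {}) = A \<union> B"
    by (auto split: if_splits intro: exI[of _ 0] exI[of _ "1::nat"])
  moreover have "(\<Sum>i::nat. hausdorff_outer_measure d (if i = 0 then A else if i = 1 then B else {}))
     = hausdorff_outer_measure d A + hausdorff_outer_measure d B"
    by (subst suminf_finite[of "{0,1}"]) auto
  ultimately show ?thesis
    using hausdorff_outer_UN_le[of d "\<lambda>i. if i = 0 then A else if i = 1 then B else {}"] by simp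
qed

text \<open>At scales below \<open>e\<close> no covering set meets both \<open>A\<close> and
  \<open>B\<close>, so a fine cover of the union splits into covers of the two parts without
  increasing the total size. This metric property is what makes closed sets measurable.\<close>

lemma hausdorff_outer_separated:
  fixes A B :: "'a::euclidean_space set"
  assumes "0 < e" and sep: "\<And>x y. x \<in> A \<Longrightarrow> y \<in> B \<Longrightarrow> e \<le> dist x y"
  shows "hausdorff_outer_measure d A + hausdorff_outer_measure d B \<le> hausdorff_outer_measure d (A \<union> B)"
proof -
  have small: "hausdorff_premeasure d \<delta> A + hausdorff_premeasure d \<delta> B \<le> hausdorff_premeasure d \<delta> (A \<union> B)"
    if \<delta>: "0 < \<delta>" "\<delta> < e" for \<delta>
    unfolding hausdorff_premeasure_def[of d \<delta> "A \<union> B"]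
  proof (rule INF_greatest, clarsimp)
    fix C :: "nat \<Rightarrow> 'a set"
    assume C: "A \<subseteq> \<Union> (range C)" "B \<subseteq> \<Union> (range C)" "\<forall>i. bounded (C i) \<and> diameter (C i) \<le> \<delta>"
    have P: "bounded (C i \<inter> S) \<and> diameter (C i \<inter> S) \<le> \<delta>" for i S
      using C(3) diameter_subset[of "C i \<inter> S" "C i"] by (auto intro: order_trans bounded_subset)
    have "hausdorff_premeasure d \<delta> A \<le> (\<Sum>i. hausdorff_size d (C i \<inter> A))"
      unfolding hausdorff_premeasure_eq using C P by (intro cover_content_le) auto
    moreover have "hausdorff_premeasure d \<delta> B \<le> (\<Sum>i. hausdorff_size d (C i \<inter> B))"
      unfolding hausdorff_premeasure_eq using C P by (intro cover_content_le) auto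
    ultimately have "hausdorff_premeasure d \<delta> A + hausdorff_premeasure d \<delta> B
       \<le> (\<Sum>i. hausdorff_size d (C i \<inter> A)) + (\<Sum>i. hausdorff_size d (C i \<inter> B))"
      by (rule add_mono)
    also have "\<dots> = (\<Sum>i. hausdorff_size d (C i \<inter> A) + hausdorff_size d (C i \<inter> B))"
      by (rule suminf_add) auto
    also have "\<dots> \<le> (\<Sum>i. hausdorff_size d (C i))"
    proof (intro suminf_le allI)
      fix i
      have "C i \<inter> A = {} \<or> C i \<inter> B = {}"
      proof (rule ccontr)
        assume "\<not> ?thesis"
        then obtain x y where "x \<in> C i" "x \<in> A" "y \<in> C i" "y \<in> B" by auto
        moreover from this have "dist x y \<le> diameter (C i)" using C(3) diameter_bounded_bound by blast
        ultimately show False using sep[of x y] \<delta> C(3) by (smt (verit))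
      qed
      moreover have "hausdorff_size d (C i \<inter> S) \<le> hausdorff_size d (C i)" for S
        using C(3) by (intro hausdorff_size_mono) auto
      ultimately show "hausdorff_size d (C i \<inter> A) + hausdorff_size d (C i \<inter> B) \<le> hausdorff_size d (C i)"
        by auto
    qed auto
    finally show "hausdorff_premeasure d \<delta> A + hausdorff_premeasure d \<delta> B \<le> (\<Sum>i. hausdorff_size d (C i))" .
  qed
  \<comment> \<open>The two outer measures are suprema over independent scales; a common scale below
    both of them and below \<open>e\<close> reduces the claim to \<open>small\<close>.\<close>
  have *: "hausdorff_premeasure d \<delta> A + hausdorff_premeasure d \<delta>' B \<le> hausdorff_outer_measure d (A \<union> B)"
    if "\<delta> \<in> {0<..}" "\<delta>' \<in> {0<..}" for \<delta> \<delta>'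
  proof -
    define \<eta> where "\<eta> = min (min \<delta> \<delta>') (e/2)"
    have \<eta>: "0 < \<eta>" "\<eta> < e" "\<eta> \<le> \<delta>" "\<eta> \<le> \<delta>'" using that \<open>0 < e\<close> by (auto simp: \<eta>_def)
    have "hausdorff_premeasure d \<delta> A + hausdorff_premeasure d \<delta>' B \<le> hausdorff_premeasure d \<eta> A + hausdorff_premeasure d \<eta> B"
      using \<eta> by (intro add_mono hausdorff_premeasure_antimono)
    also have "\<dots> \<le> hausdorff_premeasure d \<eta> (A \<union> B)" using small \<eta> by auto
    also have "\<dots> \<le> hausdorff_outer_measure d (A \<union> B)" by (rule hausdorff_premeasure_le_outer) fact
    finally show ?thesis .
  qed
  have ne: "{0::real<..} \<noteq> {}" by (metis empty_iff greaterThan_iff zero_less_one)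
  have "hausdorff_premeasure d \<delta> A + hausdorff_outer_measure d B \<le> hausdorff_outer_measure d (A \<union> B)"
    if "\<delta> \<in> {0<..}" for \<delta>
    unfolding hausdorff_outer_measure_def[of d B]
    using that by (subst ennreal_SUP_add_right[OF ne]) (auto intro!: SUP_least *)
  then show ?thesis
    unfolding hausdorff_outer_measure_def[of d A]
    by (subst ennreal_SUP_add_left[OF ne, symmetric]) (auto intro!: SUP_least)
qed

text \<open>Caratheodory's criterion: the part of \<open>X - C\<close> at distance less than \<open>1/(k+1)\<close> from \<open>C\<close>
  splits into layers, every second of which are separated, so that its measure tends to \<open>0\<close>.\<close>

lemma closed_in_lambda_system_hausdorff:
  fixes C :: "'a::euclidean_space set"
  assumes "closed C"
  shows "C \<in> lambda_system UNIV (Pow UNIV) (hausdorff_outer_measure d)"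
proof -
  let ?H = "hausdorff_outer_measure d"
  have main: "?H (X \<inter> C) + ?H (X - C) \<le> ?H X" for X
  proof (cases "C = {} \<or> ?H X = top")
    case True then show ?thesis by auto
  next
    case False
    then have ne: "C \<noteq> {}" and fin: "?H X < top" by (auto simp: less_top)
    define A where "A k = {x \<in> X. 1 / real (Suc k) \<le> infdist x C}" for k
    define R where "R k = A (Suc k) - A k" for k
    have A_mono: "A k \<subseteq> A l" if "k \<le> l" for k l
    proof -
      have "1 / real (Suc l) \<le> 1 / real (Suc k)" using that by (simp add: frac_le)
      then show ?thesis unfolding A_def by auto
    qed
    have A_C: "A k \<inter> C = {}" for k by (auto simp: A_def)
    have A_sub: "A k \<subseteq> X" for k by (auto simp: A_def)
    have sep1: "?H (X \<inter> C) + ?H (A k) \<le> ?H X" for k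
    proof -
      have "?H (X \<inter> C) + ?H (A k) \<le> ?H ((X \<inter> C) \<union> A k)"
      proof (rule hausdorff_outer_separated[of "1 / real (Suc k)"])
        fix x y assume "x \<in> X \<inter> C" "y \<in> A k"
        then show "1 / real (Suc k) \<le> dist x y"
          using infdist_le[of x C y] by (auto simp: A_def dist_commute)
      qed auto
      also have "\<dots> \<le> ?H X" by (rule hausdorff_outer_mono) (use A_sub in auto)
      finally show ?thesis .
    qed
    have layers: "(\<Sum>i<N. ?H (R (2*i+c))) \<le> ?H (\<Union>i<N. R (2*i+c))" for N c
    proof (induction N)
      case (Suc N)
      let ?U = "\<Union>i<N. R (2*i+c)"
      have "?H (R (2*N+c)) + ?H ?U \<le> ?H (R (2*N+c) \<union> ?U)"
      proof (rule hausdorff_outer_separated)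
        \<comment> \<open>Points of the earlier layers are at distance at least
          \<open>1 / (2*N+c)\<close> from \<open>C\<close>, points of the new layer at distance less
          than \<open>1 / (2*N+c+1)\<close>; the difference is the gap. For \<open>N = 0\<close>
          there are no earlier layers and any positive number serves.\<close>
        have "1 / real (2*N+c+1) < 1 / real (2*N+c)" if "N \<noteq> 0" using that by (intro divide_strict_left_mono) auto
        then show "0 < (if N = 0 then 1 else 1 / real (2*N+c) - 1 / real (2*N+c+1))" by auto
        fix x y assume xy: "x \<in> R (2*N+c)" "y \<in> ?U"
        then obtain i where i: "i < N" "y \<in> R (2*i+c)" by auto
        have le: "2*i+c+1 \<le> 2*N+c-1" using i(1) by arith
        have "y \<in> A (2*i+c+1)" using i by (auto simp: R_def)
        then have "y \<in> A (2*N+c-1)" using A_mono[of "2*i+c+1" "2*N+c-1"] le by blast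
        then have "1 / real (2*N+c) \<le> infdist y C" using i by (auto simp: A_def)
        moreover have "infdist x C < 1 / real (2*N+c+1)" using xy(1) by (auto simp: A_def R_def)
        moreover have "infdist y C \<le> infdist x C + dist y x" by (rule infdist_triangle)
        ultimately show "(if N = 0 then 1 else 1 / real (2*N+c) - 1 / real (2*N+c+1)) \<le> dist x y"
          using i by (auto simp: dist_commute)
      qed
      moreover have "R (2*N+c) \<union> ?U = (\<Union>i<Suc N. R (2*i+c))" by (auto simp: lessThan_Suc)
      ultimately show ?case using Suc by (auto simp: add.commute intro: order_trans[OF add_mono] )
    qed auto
    have fin_sum: "(\<Sum>i. ?H (R (2*i+c))) \<le> ?H X" for c
    proof (rule suminf_le_const[OF summableI])
      fix N show "(\<Sum>i<N. ?H (R (2*i+c))) \<le> ?H X"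
        by (rule order_trans[OF layers hausdorff_outer_mono]) (auto simp: R_def A_def)
    qed
    have "(\<Sum>i<N. ?H (R i)) \<le> ?H X + ?H X" for N
    proof -
      have "(\<Sum>i<N. ?H (R i)) \<le> (\<Sum>i<2*N. ?H (R i))" by (rule sum_mono2) auto
      also have "\<dots> = (\<Sum>i<N. ?H (R (2*i+0))) + (\<Sum>i<N. ?H (R (2*i+1)))"
        by (induction N) (auto simp: algebra_simps)
      also have "\<dots> \<le> ?H X + ?H X"
        by (intro add_mono order_trans[OF sum_le_suminf[OF summableI] fin_sum]) auto
      finally show ?thesis .
    qed
    then have "(\<Sum>i. ?H (R i)) \<le> ?H X + ?H X"
      by (intro suminf_le_const[OF summableI])
    also have "\<dots> < top" using fin by (simp add: less_top)
    finally have finR: "(\<Sum>i. ?H (R i)) < top" .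
    define r where "r i = enn2real (?H (R i))" for i
    have r: "?H (R i) = ennreal (r i)" "0 \<le> r i" for i
      using ennreal_suminf_lessD[OF finR, of i] by (auto simp: r_def ennreal_enn2real)
    have "summable r" using finR r
      by (intro summable_suminf_not_top) (auto simp: less_top)
    have XC: "?H (X - C) \<le> ?H (A k) + (\<Sum>i. ?H (R (i + k)))" for k
    proof -
      have "X - C \<subseteq> A k \<union> (\<Union>i. R (i + k))"
      proof
        fix x assume x: "x \<in> X - C"
        then have "0 < infdist x C"
          using in_closed_iff_infdist_zero[OF assms ne] infdist_nonneg[of x C] by (auto simp: less_le)
        then obtain n where n: "1 / real (Suc n) \<le> infdist x C"
          by (metis nat_approx_posE less_imp_le)
        then have xn: "x \<in> A n" using x by (auto simp: A_def)
        show "x \<in> A k \<union> (\<Union>i. R (i + k))"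
        proof (cases "x \<in> A k")
          case False
          define m where "m = (LEAST m. x \<in> A m)"
          have m: "x \<in> A m" unfolding m_def using xn by (rule LeastI)
          have "k < m" using False A_mono[of m k] m by (meson not_le subsetD)
          have "x \<notin> A (m - 1)" unfolding m_def using \<open>k < m\<close>
            by (metis One_nat_def diff_less gr_implies_not0 lessI m_def not_gr_zero not_less_Least)
          then have "x \<in> R ((m - 1 - k) + k)" using m \<open>k < m\<close> by (auto simp: R_def)
          then show ?thesis by blast
        qed auto
      qed
      then have "?H (X - C) \<le> ?H (A k \<union> (\<Union>i. R (i + k)))" by (rule hausdorff_outer_mono)
      also have "\<dots> \<le> ?H (A k) + ?H (\<Union>i. R (i + k))" by (rule hausdorff_outer_Un_le)
      also have "\<dots> \<le> ?H (A k) + (\<Sum>i. ?H (R (i + k)))" by (intro add_mono hausdorff_outer_UN_le order_refl)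
      finally show ?thesis .
    qed
    show ?thesis
    proof (rule ennreal_le_epsilon)
      fix e :: real assume "0 < e"
      then obtain k where k: "norm (\<Sum>i. r (i + k)) < e"
        using suminf_exist_split[OF _ \<open>summable r\<close>] by blast
      have "(\<Sum>i. ?H (R (i + k))) = ennreal (\<Sum>i. r (i + k))"
        unfolding r using r \<open>summable r\<close> by (intro suminf_ennreal2) (auto simp: summable_iff_shift)
      also have "\<dots> \<le> ennreal e" using k by (intro ennreal_leI) auto
      finally have tail: "(\<Sum>i. ?H (R (i + k))) \<le> ennreal e" .
      have "?H (X \<inter> C) + ?H (X - C) \<le> ?H (X \<inter> C) + (?H (A k) + (\<Sum>i. ?H (R (i + k))))"
        by (intro add_mono XC order_refl)
      also have "\<dots> \<le> ?H X + ennreal e"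
        unfolding add.assoc[symmetric] by (intro add_mono sep1 tail)
      finally show "?H (X \<inter> C) + ?H (X - C) \<le> ?H X + ennreal e" .
    qed
  qed
  have "?H (C \<inter> X) + ?H ((UNIV - C) \<inter> X) = ?H X" for X
  proof (rule antisym)
    have "C \<inter> X = X \<inter> C" "(UNIV - C) \<inter> X = X - C" by auto
    with main[of X] show "?H (C \<inter> X) + ?H ((UNIV - C) \<inter> X) \<le> ?H X" by metis
    have "?H X \<le> ?H ((C \<inter> X) \<union> ((UNIV - C) \<inter> X))" by (rule hausdorff_outer_mono) auto
    also have "\<dots> \<le> ?H (C \<inter> X) + ?H ((UNIV - C) \<inter> X)" by (rule hausdorff_outer_Un_le)
    finally show "?H X \<le> \<dots>" .
  qed
  then show ?thesis by (auto simp: lambda_system_def)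
qed

lemma measure_space_hausdorff:
  "measure_space (UNIV::'a::euclidean_space set) (lambda_system UNIV (Pow UNIV) (hausdorff_outer_measure d))
     (hausdorff_outer_measure d)"
  by (rule sigma_algebra.caratheodory_lemma[OF sigma_algebra_Pow outer_measure_space_hausdorff])

lemma space_hausdorff [simp]: "space (hausdorff_measure d :: 'a::euclidean_space measure) = UNIV"
  and sets_hausdorff:
    "sets (hausdorff_measure d :: 'a::euclidean_space measure) = lambda_system UNIV (Pow UNIV) (hausdorff_outer_measure d)"
  and emeasure_hausdorff:
    "A \<in> sets (hausdorff_measure d) \<Longrightarrow> emeasure (hausdorff_measure d) A = hausdorff_outer_measure d (A::'a set)"
proof -
  interpret sigma_algebra UNIV "lambda_system UNIV (Pow UNIV) (hausdorff_outer_measure d :: 'a set \<Rightarrow> _)"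
    using measure_space_hausdorff[of d, where 'a='a] unfolding measure_space_def by blast
  show sp: "space (hausdorff_measure d :: 'a measure) = UNIV" unfolding hausdorff_measure_def
    by (simp add: space_measure_of_conv)
  show s: "sets (hausdorff_measure d :: 'a measure) = lambda_system UNIV (Pow UNIV) (hausdorff_outer_measure d)"
    unfolding hausdorff_measure_def by (rule sets_measure_of_eq)
  show "emeasure (hausdorff_measure d) A = hausdorff_outer_measure d A" if "A \<in> sets (hausdorff_measure d)"
    using that[unfolded s] measure_space_hausdorff[of d, where 'a='a] unfolding measure_space_def hausdorff_measure_def
    by (intro emeasure_measure_of_sigma) blast+
qed

lemma borel_sets_hausdorff: "A \<in> sets borel \<Longrightarrow> A \<in> sets (hausdorff_measure d :: 'a::euclidean_space measure)"
proof -
  have "sigma_sets UNIV (Collect closed) \<subseteq> sets (hausdorff_measure d :: 'a measure)"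
    using sets.sigma_sets_subset[of "Collect closed" "hausdorff_measure d :: 'a measure"]
      closed_in_lambda_system_hausdorff by (auto simp: sets_hausdorff)
  then show "A \<in> sets borel \<Longrightarrow> A \<in> sets (hausdorff_measure d :: 'a measure)"
    by (auto simp: borel_eq_closed)
qed

lemma emeasure_hausdorff_borel:
  "A \<in> sets borel \<Longrightarrow> emeasure (hausdorff_measure d) A = hausdorff_outer_measure d (A::'a::euclidean_space set)"
  by (simp add: borel_sets_hausdorff emeasure_hausdorff)

text \<open>Completeness of Caratheodory's construction, for sets that need not be Borel. It makes
  arbitrary changes of an integrand on an exceptional set harmless for measurability.\<close>

lemma hausdorff_null_sets:
  fixes A :: "'a::euclidean_space set"
  assumes "hausdorff_outer_measure d A = 0"
  shows "A \<in> null_sets (hausdorff_measure d)"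
proof -
  have "hausdorff_outer_measure d (A \<inter> X) + hausdorff_outer_measure d ((UNIV - A) \<inter> X) = hausdorff_outer_measure d X" for X
  proof -
    have 0: "hausdorff_outer_measure d (A \<inter> X) = 0"
      using hausdorff_outer_mono[of "A \<inter> X" A d] assms by simp
    have "hausdorff_outer_measure d X \<le> hausdorff_outer_measure d ((A \<inter> X) \<union> ((UNIV - A) \<inter> X))"
      by (rule hausdorff_outer_mono) auto
    also have "\<dots> \<le> hausdorff_outer_measure d (A \<inter> X) + hausdorff_outer_measure d ((UNIV - A) \<inter> X)"
      by (rule hausdorff_outer_Un_le)
    finally show ?thesis using 0 hausdorff_outer_mono[of "(UNIV - A) \<inter> X" X d] by auto
  qed
  then have "A \<in> sets (hausdorff_measure d)" by (auto simp: sets_hausdorff lambda_system_def)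
  with emeasure_hausdorff[OF this] assms show ?thesis by (simp add: null_sets_def)
qed

section \<open>Hausdorff measure under Lipschitz maps\<close>

lemma hausdorff_size_image:
  assumes "bounded C" "bounded (f ` C)" and lip: "\<And>x y. x \<in> C \<Longrightarrow> y \<in> C \<Longrightarrow> dist (f x) (f y) \<le> L * dist x y" "0 \<le> L"
  shows "hausdorff_size d (f ` C) \<le> ennreal (L ^ d) * hausdorff_size d C" "diameter (f ` C) \<le> L * diameter C"
proof -
  show dm: "diameter (f ` C) \<le> L * diameter C"
  proof (cases "C = {}")
    case False
    have "dist (f x) (f y) \<le> L * diameter C" if "x \<in> C" "y \<in> C" for x y
      using lip(1)[OF that] diameter_bounded_bound[OF assms(1) that] lip(2)
      by (meson mult_left_mono order_trans)
    then show ?thesis using False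
      by (auto simp: diameter_def[of "f ` C"] intro!: cSUP_least)
  qed auto
  have "(diameter (f ` C) / 2) ^ d \<le> (L * diameter C / 2) ^ d"
    using dm diameter_ge_0[OF assms(2)] by (intro power_mono) auto
  then have "unit_ball_vol (real d) * (diameter (f ` C) / 2) ^ d \<le> unit_ball_vol (real d) * (L * diameter C / 2) ^ d"
    by (rule mult_left_mono) auto
  also have "\<dots> = L ^ d * (unit_ball_vol (real d) * (diameter C / 2) ^ d)"
    by (simp add: power_mult_distrib power_divide)
  finally have "unit_ball_vol (real d) * (diameter (f ` C) / 2) ^ d \<le> L ^ d * (unit_ball_vol (real d) * (diameter C / 2) ^ d)" .
  then show "hausdorff_size d (f ` C) \<le> ennreal (L ^ d) * hausdorff_size d C"
    using lip(2) diameter_ge_0[OF assms(1)] by (auto simp: hausdorff_size_def ennreal_mult[symmetric] intro!: ennreal_leI)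
qed

text \<open>Each covering set is cut down to \<open>A\<close>, the only place where \<open>f\<close>
  is Lipschitz, before it is mapped. The premise \<open>PQ\<close> records how admissibility of
  covering sets changes under \<open>f\<close>: for premeasures the scale is multiplied by
  \<open>L\<close>, for the content nothing changes.\<close>

lemma cover_content_image_le:
  assumes lip: "\<And>x y. x \<in> A \<Longrightarrow> y \<in> A \<Longrightarrow> dist (f x) (f y) \<le> L * dist x y" "0 < L"
    and PQ: "\<And>C. P C \<Longrightarrow> bounded C \<and> bounded (f ` (C \<inter> A)) \<and> Q (f ` (C \<inter> A))"
  shows "cover_content d Q (f ` A) \<le> ennreal (L ^ d) * cover_content d P A"
proof -
  have L0: "ennreal (L ^ d) \<noteq> 0" "ennreal (L ^ d) \<noteq> top" using lip(2) by auto
  have "cover_content d Q (f ` A) / ennreal (L ^ d) \<le> cover_content d P A"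
    unfolding cover_content_def[of d P]
  proof (rule INF_greatest, clarsimp)
    fix C :: "nat \<Rightarrow> 'a set" assume C: "A \<subseteq> \<Union> (range C)" "\<forall>i. P (C i)"
    have "cover_content d Q (f ` A) \<le> (\<Sum>i. hausdorff_size d (f ` (C i \<inter> A)))"
    proof (rule cover_content_le)
      show "f ` A \<subseteq> (\<Union>i. f ` (C i \<inter> A))" using C(1) by blast
      show "Q (f ` (C i \<inter> A))" for i using C(2) PQ by blast
    qed
    also have "\<dots> \<le> (\<Sum>i. ennreal (L ^ d) * hausdorff_size d (C i))"
    proof (intro suminf_le allI)
      fix i
      have "hausdorff_size d (f ` (C i \<inter> A)) \<le> ennreal (L ^ d) * hausdorff_size d (C i \<inter> A)"
      proof (rule hausdorff_size_image)
        show "bounded (C i \<inter> A)" "bounded (f ` (C i \<inter> A))" using C(2) PQ[of "C i"] by auto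
      qed (use lip in auto)
      also have "\<dots> \<le> ennreal (L ^ d) * hausdorff_size d (C i)"
        using C(2) PQ[of "C i"] by (intro mult_left_mono hausdorff_size_mono) auto
      finally show "hausdorff_size d (f ` (C i \<inter> A)) \<le> ennreal (L ^ d) * hausdorff_size d (C i)" .
    qed auto
    also have "\<dots> = ennreal (L ^ d) * (\<Sum>i. hausdorff_size d (C i))" by simp
    finally show "cover_content d Q (f ` A) / ennreal (L ^ d) \<le> (\<Sum>i. hausdorff_size d (C i))"
      using L0 by (intro divide_le_posI_ennreal) (auto simp: zero_less_iff_neq_zero mult.commute)
  qed
  then have "cover_content d Q (f ` A) / ennreal (L ^ d) * ennreal (L ^ d) \<le> cover_content d P A * ennreal (L ^ d)"
    by (rule mult_right_mono) auto
  moreover have "cover_content d Q (f ` A) / ennreal (L ^ d) * ennreal (L ^ d) = cover_content d Q (f ` A)"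
    using L0 by (subst ennreal_divide_times) (simp add: ennreal_mult_divide_eq)
  ultimately show ?thesis by (simp add: mult.commute)
qed

lemma bounded_Lipschitz_image:
  assumes "bounded C" "\<And>x y. x \<in> C \<Longrightarrow> y \<in> C \<Longrightarrow> dist (f x) (f y) \<le> L * dist x y" "0 \<le> L"
  shows "bounded (f ` C)"
proof (cases "C = {}")
  case False
  then obtain c where "c \<in> C" by auto
  obtain e where e: "\<And>y. y \<in> C \<Longrightarrow> dist c y \<le> e" using assms(1) bounded_any_center[of C c] by auto
  have "dist (f c) (f y) \<le> L * e" if "y \<in> C" for y
    using assms(2)[OF \<open>c \<in> C\<close> that] mult_left_mono[OF e[OF that] assms(3)] by simp
  then show ?thesis unfolding bounded_def by auto
qed auto

lemma hausdorff_outer_image_le: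
  fixes f :: "'a::euclidean_space \<Rightarrow> 'b::euclidean_space"
  assumes lip: "\<And>x y. x \<in> A \<Longrightarrow> y \<in> A \<Longrightarrow> dist (f x) (f y) \<le> L * dist x y" "0 < L"
  shows "hausdorff_outer_measure d (f ` A) \<le> ennreal (L ^ d) * hausdorff_outer_measure d A"
proof (rule hausdorff_outer_leI)
  fix \<delta> :: real assume \<delta>: "0 < \<delta>"
  have "hausdorff_premeasure d \<delta> (f ` A) \<le> ennreal (L ^ d) * hausdorff_premeasure d (\<delta> / L) A"
    unfolding hausdorff_premeasure_eq
  proof (rule cover_content_image_le[OF lip])
    fix C :: "'a set" assume C: "bounded C \<and> diameter C \<le> \<delta> / L"
    have 1: "bounded (C \<inter> A)" using C by auto
    have 2: "bounded (f ` (C \<inter> A))" using 1 lip by (intro bounded_Lipschitz_image) auto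
    have "diameter (f ` (C \<inter> A)) \<le> L * diameter (C \<inter> A)"
      using 1 2 lip by (intro hausdorff_size_image) auto
    also have "\<dots> \<le> L * (\<delta> / L)" using C lip(2) diameter_subset[of "C \<inter> A" C]
      by (intro mult_left_mono) (auto intro: order_trans)
    finally show "bounded C \<and> bounded (f ` (C \<inter> A)) \<and> bounded (f ` (C \<inter> A)) \<and> diameter (f ` (C \<inter> A)) \<le> \<delta>"
      using C 2 lip(2) by auto
  qed auto
  also have "\<dots> \<le> ennreal (L ^ d) * hausdorff_outer_measure d A"
    using \<delta> lip(2) by (intro mult_left_mono hausdorff_premeasure_le_outer) auto
  finally show "hausdorff_premeasure d \<delta> (f ` A) \<le> ennreal (L ^ d) * hausdorff_outer_measure d A" .
qed

interpretation plb: product_sigma_finite "\<lambda>_::'i. lborel :: real measure"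
  by standard

section \<open>The isodiametric inequality and coordinate subspaces\<close>

text \<open>The symmetrized slice. Comparing extended numbers treats slices of length zero, of
  finite length and of infinite length by one formula.\<close>

lemma emeasure_lborel_symmetric_interval: "emeasure lborel {y::real. ennreal (2 * \<bar>y\<bar>) < c} = c"
proof (cases c)
  case (real r)
  then have "{y::real. ennreal (2 * \<bar>y\<bar>) < c} = {-r/2<..<r/2}"
    by (auto simp: ennreal_less_iff)
  then show ?thesis using real by (simp add: field_simps)
next
  case top
  then have "{y::real. ennreal (2 * \<bar>y\<bar>) < c} = UNIV" by (auto simp: ennreal_less_top)
  then show ?thesis using top by simp
qed

text \<open>The lengths of the convex hulls of \<open>S\<close> and \<open>T\<close> add up to
  \<open>(Sup S - Inf T) + (Sup T - Inf S)\<close>, hence to at most \<open>2 * K\<close>. Since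
  \<open>\<bar>x\<bar>\<close> and \<open>\<bar>y\<bar>\<close> are below half of these lengths,
  their sum is at most \<open>K\<close>.\<close>

lemma sum_lborel_slices_le:
  fixes S T :: "real set"
  assumes "S \<noteq> {}" "T \<noteq> {}" and K: "\<And>s t. s \<in> S \<Longrightarrow> t \<in> T \<Longrightarrow> \<bar>s - t\<bar> \<le> K"
    and x: "ennreal (2 * \<bar>x\<bar>) < emeasure lborel S" and y: "ennreal (2 * \<bar>y\<bar>) < emeasure lborel T"
  shows "\<bar>x - y\<bar> \<le> K"
proof -
  obtain s0 t0 where st: "s0 \<in> S" "t0 \<in> T" using assms by auto
  have bS: "t0 - K \<le> s" "s \<le> t0 + K" if "s \<in> S" for s using K[OF that st(2)] by (auto simp: abs_le_iff)
  have bT: "s0 - K \<le> t" "t \<le> s0 + K" if "t \<in> T" for t using K[OF st(1) that] by (auto simp: abs_le_iff)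
  have bdd: "bdd_above S" "bdd_below S" "bdd_above T" "bdd_below T"
    by (rule bdd_aboveI[OF bS(2)] bdd_belowI[OF bS(1)] bdd_aboveI[OF bT(2)] bdd_belowI[OF bT(1)], assumption)+
  have gen: "2 * \<bar>z\<bar> < Sup R - Inf R" if "ennreal (2 * \<bar>z\<bar>) < emeasure lborel R" "R \<noteq> {}" "bdd_above R" "bdd_below R" for R and z :: real
  proof -
    have sub: "R \<subseteq> {Inf R..Sup R}" using that by (auto intro: cInf_lower cSup_upper)
    then have le: "Inf R \<le> Sup R" using that(2) by auto
    have "emeasure lborel R \<le> emeasure lborel {Inf R..Sup R}" by (rule emeasure_mono[OF sub]) auto
    also have "\<dots> = ennreal (Sup R - Inf R)" using le by simp
    finally have "ennreal (2 * \<bar>z\<bar>) < ennreal (Sup R - Inf R)" using that(1) by simp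
    then show ?thesis by (simp add: ennreal_less_iff)
  qed
  have "Sup S \<le> t + K" if "t \<in> T" for t
    using K[OF _ that] assms(1) by (intro cSup_least) (auto simp: abs_le_iff algebra_simps)
  then have "Sup S - K \<le> Inf T" using assms(2) by (intro cInf_greatest) (auto simp: algebra_simps)
  moreover have "Sup T \<le> s + K" if "s \<in> S" for s
    using K[OF that] assms(2) by (intro cSup_least) (auto simp: abs_le_iff algebra_simps)
  then have "Sup T - K \<le> Inf S" using assms(1) by (intro cInf_greatest) (auto simp: algebra_simps)
  ultimately show ?thesis using gen[OF x] gen[OF y] assms(1,2) bdd by auto
qed

text \<open>Steiner symmetrization in the coordinate \<open>j\<close>.  The strict inequality in the definition of the
  symmetrized set keeps it empty over empty slices.\<close>

lemma steiner_symmetrization: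
  fixes A :: "('i \<Rightarrow> real) set"
  assumes I: "finite I" "j \<in> I" and A [measurable]: "A \<in> sets (Pi\<^sub>M I (\<lambda>_. lborel))"
    and diam: "\<And>f g. f \<in> A \<Longrightarrow> g \<in> A \<Longrightarrow> (\<Sum>i\<in>I. (f i - g i)\<^sup>2) \<le> D"
  obtains B where "B \<in> sets (Pi\<^sub>M I (\<lambda>_. lborel))"
    "emeasure (Pi\<^sub>M I (\<lambda>_. lborel)) B = emeasure (Pi\<^sub>M I (\<lambda>_. lborel)) A"
    "\<And>f g. f \<in> B \<Longrightarrow> g \<in> B \<Longrightarrow> (\<Sum>i\<in>I. (f i - g i)\<^sup>2) \<le> D"
    "\<And>f. f \<in> B \<Longrightarrow> f(j := - f j) \<in> B"
    "\<And>i f. \<lbrakk>i \<in> I; i \<noteq> j; \<And>f. f \<in> A \<Longrightarrow> f(i := - f i) \<in> A; f \<in> B\<rbrakk> \<Longrightarrow> f(i := - f i) \<in> B"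
proof -
  let ?M = "\<lambda>I. Pi\<^sub>M I (\<lambda>_::'i. lborel :: real measure)"
  define L where "L f = emeasure lborel {t. f(j := t) \<in> A}" for f
  define J where "J = I - {j}"
  have IJ: "I = insert j J" "finite J" "j \<notin> J" using I by (auto simp: J_def)
  define B where "B = {f \<in> space (?M I). ennreal (2 * \<bar>f j\<bar>) < L f}"
  have upd [measurable]: "(\<lambda>(f, t). f(j := t)) \<in> measurable (?M I \<Otimes>\<^sub>M lborel) (?M I)"
    unfolding split_beta' by (rule measurable_fun_upd[where J = I]) (use I in auto)
  have slice: "{t. f(j := t) \<in> A} \<in> sets lborel" if "f \<in> space (?M I)" for f
  proof -
    have "(\<lambda>t. f(j := t)) \<in> measurable lborel (?M I)"
      by (rule measurable_fun_upd[where J = I]) (use I that in auto)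
    from measurable_sets[OF this A] show ?thesis by (simp add: vimage_def)
  qed
  have L_eq: "L f = (\<integral>\<^sup>+t. indicator A (f(j := t)) \<partial>lborel)" if "f \<in> space (?M I)" for f
  proof -
    have "L f = (\<integral>\<^sup>+t. indicator {t. f(j := t) \<in> A} t \<partial>lborel)"
      unfolding L_def using slice[OF that] by simp
    then show ?thesis by (simp add: indicator_def)
  qed
  have "(\<lambda>f. \<integral>\<^sup>+t. indicator A (f(j := t)) \<partial>lborel) \<in> borel_measurable (?M I)"
    by measurable
  then have [measurable]: "L \<in> borel_measurable (?M I)"
    by (subst measurable_cong[OF L_eq]) auto
  have [measurable]: "(\<lambda>f. f j) \<in> borel_measurable (?M I)"
    using I by measurable
  have Bm [measurable]: "B \<in> sets (?M I)" unfolding B_def by measurable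
  have L_upd: "L (f(j := s)) = L f" for f s by (simp add: L_def)
  have upd_space: "x(j := y) \<in> space (?M I)" if "x \<in> space (?M J)" for x y
    using that IJ by (auto simp: space_PiM PiE_def extensional_def)
  have "emeasure (?M I) B = (\<integral>\<^sup>+x. (\<integral>\<^sup>+y. indicator B (x(j := y)) \<partial>lborel) \<partial>?M J)"
    using plb.product_nn_integral_insert[OF IJ(2,3), of "indicator B"] Bm unfolding IJ(1)[symmetric] by simp
  also have "\<dots> = (\<integral>\<^sup>+x. (\<integral>\<^sup>+y. indicator A (x(j := y)) \<partial>lborel) \<partial>?M J)"
  proof (rule nn_integral_cong)
    fix x assume x: "x \<in> space (?M J)"
    have "(\<integral>\<^sup>+y. indicator B (x(j := y)) \<partial>lborel) = (\<integral>\<^sup>+y. indicator {y. ennreal (2 * \<bar>y\<bar>) < L x} y \<partial>lborel)"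
      using upd_space[OF x] by (intro nn_integral_cong) (auto simp: indicator_def B_def L_upd)
    also have "\<dots> = L x" by (simp add: emeasure_lborel_symmetric_interval)
    also have "\<dots> = L (x(j := 0))" by (simp add: L_upd)
    also have "\<dots> = (\<integral>\<^sup>+y. indicator A (x(j := y)) \<partial>lborel)"
      using L_eq[OF upd_space[OF x, of 0]] by simp
    finally show "(\<integral>\<^sup>+y. indicator B (x(j := y)) \<partial>lborel) = (\<integral>\<^sup>+y. indicator A (x(j := y)) \<partial>lborel)" .
  qed
  also have "\<dots> = emeasure (?M I) A"
    using plb.product_nn_integral_insert[OF IJ(2,3), of "indicator A"] A unfolding IJ(1)[symmetric] by simp
  finally have em: "emeasure (?M I) B = emeasure (?M I) A" .
  show ?thesis
  proof (rule that[OF Bm em])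
    fix f g assume fg: "f \<in> B" "g \<in> B"
    let ?S = "{t. f(j := t) \<in> A}" and ?T = "{t. g(j := t) \<in> A}"
    define R where "R = (\<Sum>i\<in>J. (f i - g i)\<^sup>2)"
    have "{t. h(j := t) \<in> A} \<noteq> {}" if "h \<in> B" for h
    proof
      assume "{t. h(j := t) \<in> A} = {}"
      then have "L h = 0" by (simp add: L_def)
      then show False using that by (simp add: B_def)
    qed
    then have ne: "?S \<noteq> {}" "?T \<noteq> {}" using fg by blast+
    have D: "(s - t)\<^sup>2 + R \<le> D" if "s \<in> ?S" "t \<in> ?T" for s t
    proof -
      have "(\<Sum>i\<in>I. ((f(j := s)) i - (g(j := t)) i)\<^sup>2) = (s - t)\<^sup>2 + R"
        unfolding IJ(1) R_def using IJ(2,3) by (subst sum.insert) (auto intro!: sum.cong)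
      then show ?thesis using diam[of "f(j := s)" "g(j := t)"] that by simp
    qed
    have "0 \<le> D - R"
    proof -
      obtain s t where "s \<in> ?S" "t \<in> ?T" using ne by auto
      from D[OF this] zero_le_power2[of "s - t"] show ?thesis by linarith
    qed
    \<comment> \<open>The other coordinates contribute the same \<open>R\<close> to the distance of
      any two points over these slices, so the slices are within \<open>sqrt (D - R)\<close> of each
      other, and so are the centred intervals that replace them.\<close>
    have "\<bar>f j - g j\<bar> \<le> sqrt (D - R)"
    proof (rule sum_lborel_slices_le[OF ne])
      show "\<bar>s - t\<bar> \<le> sqrt (D - R)" if "s \<in> ?S" "t \<in> ?T" for s t
        using D[OF that] by (intro real_le_rsqrt) auto
    qed (use fg in \<open>auto simp: B_def L_def\<close>)
    then have "(f j - g j)\<^sup>2 \<le> D - R"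
      using \<open>0 \<le> D - R\<close> by (metis abs_ge_zero power2_abs power_mono real_sqrt_pow2)
    moreover have "(\<Sum>i\<in>I. (f i - g i)\<^sup>2) = (f j - g j)\<^sup>2 + R"
      unfolding IJ(1) R_def using IJ(2,3) by (subst sum.insert) auto
    ultimately show "(\<Sum>i\<in>I. (f i - g i)\<^sup>2) \<le> D" by simp
  next
    fix f assume "f \<in> B"
    then show "f(j := - f j) \<in> B" using I by (auto simp: B_def L_upd space_PiM PiE_def extensional_def)
  next
    fix i f assume i: "i \<in> I" "i \<noteq> j" and sym: "\<And>f. f \<in> A \<Longrightarrow> f(i := - f i) \<in> A" and f: "f \<in> B"
    \<comment> \<open>Reflecting coordinate \<open>i\<close> commutes with filling in coordinate
      \<open>j\<close>. Hence symmetries obtained by earlier symmetrizations survive this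
      one.\<close>
    have "f(i := - f i, j := t) \<in> A \<longleftrightarrow> f(j := t) \<in> A" for t
    proof -
      have eq: "f(i := - f i, j := t) = (f(j := t))(i := - (f(j := t)) i)"
        "f(j := t) = (f(i := - f i, j := t))(i := - (f(i := - f i, j := t)) i)"
        using i(2) by (auto simp: fun_eq_iff)
      show ?thesis using sym[of "f(j := t)"] sym[of "f(i := - f i, j := t)"] eq by metis
    qed
    then have "L (f(i := - f i)) = L f" by (simp add: L_def)
    then show "f(i := - f i) \<in> B" using f i by (auto simp: B_def space_PiM PiE_def extensional_def)
  qed
qed

text \<open>Symmetrizing in all coordinates one after the other gives a set of the same measure that
  is invariant under \<open>f \<mapsto> - f\<close>. The diameter bound between \<open>f\<close> and
  \<open>- f\<close> then places it in the ball of radius \<open>D / 2\<close>, although the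
  original set need not lie in such a ball.\<close>

lemma isodiametric_PiM:
  fixes A :: "('i \<Rightarrow> real) set"
  assumes I: "finite I" and A: "A \<in> sets (Pi\<^sub>M I (\<lambda>_. lborel))" and D: "0 \<le> D"
    and diam: "\<And>f g. f \<in> A \<Longrightarrow> g \<in> A \<Longrightarrow> (\<Sum>i\<in>I. (f i - g i)\<^sup>2) \<le> D\<^sup>2"
  shows "emeasure (Pi\<^sub>M I (\<lambda>_. lborel)) A \<le> ennreal (unit_ball_vol (real (card I)) * (D / 2) ^ card I)"
proof -
  let ?M = "Pi\<^sub>M I (\<lambda>_::'i. lborel :: real measure)"
  have "\<exists>B \<in> sets ?M. emeasure ?M B = emeasure ?M A \<and> (\<forall>f\<in>B. \<forall>g\<in>B. (\<Sum>i\<in>I. (f i - g i)\<^sup>2) \<le> D\<^sup>2) \<and>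
      (\<forall>j\<in>J. \<forall>f\<in>B. f(j := - f j) \<in> B)" if "J \<subseteq> I" for J
    using finite_subset[OF that I] that
  proof (induction J rule: finite_induct)
    case empty then show ?case using A diam by auto
  next
    case (insert j J)
    then obtain B where B: "B \<in> sets ?M" "emeasure ?M B = emeasure ?M A"
      "\<And>f g. f \<in> B \<Longrightarrow> g \<in> B \<Longrightarrow> (\<Sum>i\<in>I. (f i - g i)\<^sup>2) \<le> D\<^sup>2" "\<And>j f. j \<in> J \<Longrightarrow> f \<in> B \<Longrightarrow> f(j := - f j) \<in> B"
      using insert.IH insert.prems by (meson insert_subset)
    have "j \<in> I" using insert by auto
    from steiner_symmetrization[OF I this B(1,3)] obtain C where C: "C \<in> sets ?M" "emeasure ?M C = emeasure ?M B"
      "\<And>f g. f \<in> C \<Longrightarrow> g \<in> C \<Longrightarrow> (\<Sum>i\<in>I. (f i - g i)\<^sup>2) \<le> D\<^sup>2"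
      "\<And>f. f \<in> C \<Longrightarrow> f(j := - f j) \<in> C"
      "\<And>i f. \<lbrakk>i \<in> I; i \<noteq> j; \<And>f. f \<in> B \<Longrightarrow> f(i := - f i) \<in> B; f \<in> C\<rbrakk> \<Longrightarrow> f(i := - f i) \<in> C"
      by blast
    have inC: "f(i := - f i) \<in> C" if "i \<in> insert j J" "f \<in> C" for i f
    proof (cases "i = j")
      case True then show ?thesis using C(4)[OF that(2)] by simp
    next
      case False
      then have "i \<in> J" "i \<in> I" using that insert.prems by auto
      then show ?thesis using C(5)[OF _ False B(4)] that(2) by simp
    qed
    show ?case
    proof (rule bexI[OF _ C(1)], intro conjI ballI)
      show "emeasure ?M C = emeasure ?M A" using C(2) B(2) by simp
    qed (use C(3) inC in blast)+
  qed
  from this[of I] obtain B where B: "B \<in> sets ?M" "emeasure ?M B = emeasure ?M A"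
      "\<And>f g. f \<in> B \<Longrightarrow> g \<in> B \<Longrightarrow> (\<Sum>i\<in>I. (f i - g i)\<^sup>2) \<le> D\<^sup>2" "\<And>j f. j \<in> I \<Longrightarrow> f \<in> B \<Longrightarrow> f(j := - f j) \<in> B"
      using subset_refl[of I] by blast
  have flip: "(\<lambda>i. if i \<in> J then - f i else f i) \<in> B" if "J \<subseteq> I" "f \<in> B" for J f
    using finite_subset[OF that(1) I] that
  proof (induction J rule: finite_induct)
    case (insert j J)
    let ?f = "\<lambda>i. if i \<in> J then - f i else f i"
    have "j \<in> I" "?f \<in> B" using insert by auto
    then have "?f(j := - ?f j) \<in> B" by (rule B(4))
    moreover have "?f(j := - ?f j) = (\<lambda>i. if i \<in> insert j J then - f i else f i)"
      using insert by (auto simp: fun_eq_iff)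
    ultimately show ?case by simp
  qed auto
  have ball: "B \<subseteq> {f. sqrt (\<Sum>i\<in>I. (f i)\<^sup>2) \<le> D / 2} \<inter> space ?M"
  proof
    fix f assume f: "f \<in> B"
    have "(\<Sum>i\<in>I. (f i - (if i \<in> I then - f i else f i))\<^sup>2) \<le> D\<^sup>2"
      by (rule B(3)[OF f flip[OF _ f]]) auto
    also have "(\<Sum>i\<in>I. (f i - (if i \<in> I then - f i else f i))\<^sup>2) = 4 * (\<Sum>i\<in>I. (f i)\<^sup>2)"
      by (auto simp: sum_distrib_left power2_eq_square algebra_simps intro!: sum.cong)
    finally have "(\<Sum>i\<in>I. (f i)\<^sup>2) \<le> (D / 2)\<^sup>2" by (simp add: power_divide)
    then have "sqrt (\<Sum>i\<in>I. (f i)\<^sup>2) \<le> D / 2"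
      using D by (intro real_le_lsqrt) (auto intro: sum_nonneg)
    moreover have "f \<in> space ?M" using f sets.sets_into_space[OF B(1)] by blast
    ultimately show "f \<in> {f. sqrt (\<Sum>i\<in>I. (f i)\<^sup>2) \<le> D / 2} \<inter> space ?M" by blast
  qed
  \<comment> \<open>The volume formula for balls requires a positive radius. Radii
    \<open>r > D / 2\<close> are used first, and the limit from the right then covers
    \<open>D = 0\<close> as well.\<close>
  have le: "emeasure ?M A \<le> ennreal (unit_ball_vol (real (card I)) * r ^ card I)" if "D / 2 \<le> r" "0 < r" for r
  proof -
    have "B \<subseteq> {f. sqrt (\<Sum>i\<in>I. (f i)\<^sup>2) \<le> r} \<inter> space ?M" using ball that(1) by (auto intro: order_trans)
    moreover have "{f. sqrt (\<Sum>i\<in>I. (f i)\<^sup>2) \<le> r} \<inter> space ?M \<in> sets ?M"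
    proof -
      have "(\<lambda>f. f i) \<in> borel_measurable ?M" if "i \<in> I" for i using that by measurable
      then have "(\<lambda>f. sqrt (\<Sum>i\<in>I. (f i)\<^sup>2)) \<in> borel_measurable ?M" by measurable
      then have "{f \<in> space ?M. sqrt (\<Sum>i\<in>I. (f i)\<^sup>2) \<le> r} \<in> sets ?M" by measurable
      then show ?thesis by (simp add: Int_def conj_commute)
    qed
    ultimately have "emeasure ?M B \<le> emeasure ?M ({f. sqrt (\<Sum>i\<in>I. (f i)\<^sup>2) \<le> r} \<inter> space ?M)"
      by (rule emeasure_mono)
    also have "\<dots> = ennreal (unit_ball_vol (real (card I)) * r ^ card I)"
      by (rule emeasure_cball_aux[OF I that(2)])
    finally show ?thesis using B(2) by simp
  qed
  have "((\<lambda>r. ennreal (unit_ball_vol (real (card I)) * r ^ card I)) \<longlongrightarrow>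
      ennreal (unit_ball_vol (real (card I)) * (D / 2) ^ card I)) (at_right (D / 2))"
    by (intro tendsto_intros tendsto_ennrealI)
  moreover have "eventually (\<lambda>r. emeasure ?M A \<le> ennreal (unit_ball_vol (real (card I)) * r ^ card I)) (at_right (D / 2))"
    using D by (auto simp: eventually_at_right_field intro!: exI[of _ "D/2+1"] le)
  ultimately show ?thesis by (rule tendsto_lowerbound) simp
qed

section \<open>Coordinate subspaces and their Lebesgue measure\<close>

definition basis_span :: "'a::euclidean_space set \<Rightarrow> 'a set" where
  "basis_span I = {x. \<forall>b\<in>Basis - I. x \<bullet> b = 0}"

definition basis_sum :: "'a::euclidean_space set \<Rightarrow> ('a \<Rightarrow> real) \<Rightarrow> 'a" where
  "basis_sum I f = (\<Sum>i\<in>I. f i *\<^sub>R i)"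

text \<open>Lebesgue measure of dimension \<open>card I\<close>, carried by the coordinate subspace
  but regarded as a Borel measure on the whole space. In this form it can be compared with Hausdorff
  measure without a change of type.\<close>

definition lebesgue_span :: "'a::euclidean_space set \<Rightarrow> 'a measure" where
  "lebesgue_span I = distr (Pi\<^sub>M I (\<lambda>_. lborel)) borel (basis_sum I)"

lemma basis_sum_inner:
  assumes "I \<subseteq> Basis" "b \<in> Basis"
  shows "basis_sum I f \<bullet> b = (if b \<in> I then f b else 0)"
proof -
  have "finite I" using assms finite_Basis finite_subset by blast
  have "basis_sum I f \<bullet> b = (\<Sum>i\<in>I. if i = b then f i else 0)"
    unfolding basis_sum_def inner_sum_left using assms by (intro sum.cong) (auto simp: inner_Basis)
  then show ?thesis using \<open>finite I\<close> by (simp add: sum.delta)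
qed

lemma basis_sum_in_span: "I \<subseteq> Basis \<Longrightarrow> basis_sum I f \<in> basis_span I"
  by (auto simp: basis_span_def basis_sum_inner)

lemma norm_basis_sum:
  assumes "I \<subseteq> Basis" shows "(norm (basis_sum I f))\<^sup>2 = (\<Sum>i\<in>I. (f i)\<^sup>2)"
proof -
  have "basis_sum I f \<bullet> basis_sum I f = (\<Sum>i\<in>I. f i * (basis_sum I f \<bullet> i))"
    by (subst (2) basis_sum_def) (simp add: inner_sum_right)
  also have "\<dots> = (\<Sum>i\<in>I. (f i)\<^sup>2)"
    using assms by (intro sum.cong) (auto simp: basis_sum_inner power2_eq_square subset_eq)
  finally show ?thesis by (simp add: power2_norm_eq_inner)
qed

lemma basis_sum_diff: "basis_sum I f - basis_sum I g = basis_sum I (\<lambda>i. f i - g i)"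
  by (simp add: basis_sum_def sum_subtractf algebra_simps)

lemma basis_sum_measurable [measurable]: "basis_sum I \<in> measurable (Pi\<^sub>M I (\<lambda>_. lborel)) borel"
proof -
  have "(\<lambda>f. f i *\<^sub>R i) \<in> borel_measurable (Pi\<^sub>M I (\<lambda>_. lborel :: real measure))" if "i \<in> I" for i
  proof -
    have "(\<lambda>f. f i) \<in> borel_measurable (Pi\<^sub>M I (\<lambda>_. lborel :: real measure))" using that by measurable
    then show ?thesis by measurable
  qed
  then show ?thesis unfolding basis_sum_def[abs_def] by (rule borel_measurable_sum)
qed

lemma sets_lebesgue_span [simp, measurable_cong]: "sets (lebesgue_span I) = sets borel"
  and space_lebesgue_span [simp]: "space (lebesgue_span I) = UNIV"
  by (auto simp: lebesgue_span_def)

lemma emeasure_lebesgue_span: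
  "A \<in> sets borel \<Longrightarrow> emeasure (lebesgue_span I) A =
     emeasure (Pi\<^sub>M I (\<lambda>_. lborel)) {f \<in> space (Pi\<^sub>M I (\<lambda>_. lborel)). basis_sum I f \<in> A}"
  unfolding lebesgue_span_def by (subst emeasure_distr) (auto simp: vimage_def Int_def conj_commute)

lemma lebesgue_span_Basis: "lebesgue_span Basis = lborel"
  unfolding lebesgue_span_def basis_sum_def[abs_def] by (subst lborel_def) (simp add: lborel_eq_real)

lemma lebesgue_span_le_hausdorff_size:
  assumes "I \<subseteq> Basis" "closed C" "bounded C"
  shows "emeasure (lebesgue_span I) C \<le> hausdorff_size (card I) C"
proof (cases "C = {}")
  case False
  have I: "finite I" using assms finite_Basis finite_subset by blast
  let ?M = "Pi\<^sub>M I (\<lambda>_. lborel :: real measure)"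
  have [measurable]: "C \<in> sets borel" using assms by auto
  have "emeasure ?M {f \<in> space ?M. basis_sum I f \<in> C} \<le>
     ennreal (unit_ball_vol (real (card I)) * (diameter C / 2) ^ card I)"
  proof (rule isodiametric_PiM[OF I])
    show "{f \<in> space ?M. basis_sum I f \<in> C} \<in> sets ?M" by measurable
    show "0 \<le> diameter C" using assms diameter_ge_0 by blast
    fix f g assume "f \<in> {f \<in> space ?M. basis_sum I f \<in> C}" "g \<in> {f \<in> space ?M. basis_sum I f \<in> C}"
    then have "dist (basis_sum I f) (basis_sum I g) \<le> diameter C"
      using diameter_bounded_bound[OF assms(3)] by auto
    then have "(norm (basis_sum I f - basis_sum I g))\<^sup>2 \<le> (diameter C)\<^sup>2"
      unfolding dist_norm by (intro power_mono) auto
    then show "(\<Sum>i\<in>I. (f i - g i)\<^sup>2) \<le> (diameter C)\<^sup>2"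
      by (simp add: basis_sum_diff norm_basis_sum[OF assms(1)])
  qed
  then show ?thesis using False by (simp add: hausdorff_size_def emeasure_lebesgue_span)
qed auto

text \<open>By the isodiametric inequality every covering set has at most the measure that
  \<open>hausdorff_size\<close> assigns to it. Passing to closures makes the covering sets
  measurable and leaves their diameters unchanged. The inequality holds for sets of any size, so the
  scale \<open>1\<close> in the proof is arbitrary.\<close>

lemma lebesgue_span_le_hausdorff:
  assumes "I \<subseteq> Basis" "A \<in> sets borel"
  shows "emeasure (lebesgue_span I) A \<le> hausdorff_outer_measure (card I) A"
proof -
  have "emeasure (lebesgue_span I) A \<le> hausdorff_premeasure (card I) 1 A"
    unfolding hausdorff_premeasure_def
  proof (rule INF_greatest, clarsimp)
    fix C :: "nat \<Rightarrow> 'a set" assume C: "A \<subseteq> \<Union> (range C)" "\<forall>i. bounded (C i) \<and> diameter (C i) \<le> 1"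
    have cl: "closure (C i) \<in> sets borel" for i by auto
    have "emeasure (lebesgue_span I) A \<le> emeasure (lebesgue_span I) (\<Union>i. closure (C i))"
    proof (rule emeasure_mono)
      show "A \<subseteq> (\<Union>i. closure (C i))" using C(1) closure_subset by blast
    qed simp
    also have "\<dots> \<le> (\<Sum>i. emeasure (lebesgue_span I) (closure (C i)))"
      by (rule emeasure_subadditive_countably) auto
    also have "\<dots> \<le> (\<Sum>i. hausdorff_size (card I) (closure (C i)))"
      using C(2) assms by (intro suminf_le allI lebesgue_span_le_hausdorff_size) auto
    also have "\<dots> = (\<Sum>i. hausdorff_size (card I) (C i))"
    proof -
      have "hausdorff_size (card I) (closure (C i)) = hausdorff_size (card I) (C i)" for i
        using C(2)[rule_format, of i] by (simp add: hausdorff_size_def diameter_closure)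
      then show ?thesis by simp
    qed
    finally show "emeasure (lebesgue_span I) A \<le> (\<Sum>i. hausdorff_size (card I) (C i))" .
  qed
  also have "\<dots> \<le> hausdorff_outer_measure (card I) A" by (rule hausdorff_premeasure_le_outer) auto
  finally show ?thesis .
qed

section \<open>Dyadic cubes and the upper bound for Hausdorff measure\<close>

lemma cover_content_Union_le:
  assumes "countable \<D>" "P {}"
  shows "cover_content d P (\<Union>\<D>) \<le> (\<integral>\<^sup>+D. cover_content d P D \<partial>count_space \<D>)"
proof -
  let ?f = "to_nat_on \<D>" and ?g = "from_nat_into \<D>"
  define N where "N = ?f ` \<D>"
  have bij: "bij_betw ?f \<D> N" using inj_on_to_nat_on[OF assms(1)] by (simp add: N_def inj_on_imp_bij_betw)
  have "\<Union>\<D> \<subseteq> (\<Union>n. if n \<in> N then ?g n else {})"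
  proof
    fix x assume "x \<in> \<Union>\<D>"
    then obtain D where "D \<in> \<D>" "x \<in> D" by auto
    then have "?f D \<in> N" "?g (?f D) = D" using assms(1) by (auto simp: N_def)
    then show "x \<in> (\<Union>n. if n \<in> N then ?g n else {})" using \<open>x \<in> D\<close> by (intro UN_I[of "?f D"]) auto
  qed
  then have "cover_content d P (\<Union>\<D>) \<le> cover_content d P (\<Union>n. if n \<in> N then ?g n else {})"
    by (rule cover_content_mono)
  also have "\<dots> \<le> (\<Sum>n. cover_content d P (if n \<in> N then ?g n else {}))" by (rule cover_content_UN_le)
  also have "\<dots> = (\<Sum>n. cover_content d P (?g n) * indicator N n)"
    using assms(2) by (intro suminf_cong) auto
  also have "\<dots> = (\<integral>\<^sup>+n. cover_content d P (?g n) * indicator N n \<partial>count_space UNIV)"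
    by (simp add: nn_integral_count_space_nat)
  also have "\<dots> = (\<integral>\<^sup>+n. cover_content d P (?g n) \<partial>count_space N)"
    by (subst nn_integral_count_space_indicator) auto
  also have "\<dots> = (\<integral>\<^sup>+D. cover_content d P (?g (?f D)) \<partial>count_space \<D>)"
    by (rule nn_integral_bij_count_space[OF bij, symmetric])
  also have "\<dots> = (\<integral>\<^sup>+D. cover_content d P D \<partial>count_space \<D>)"
    using assms(1) by (intro nn_integral_cong) auto
  finally show ?thesis .
qed

text \<open>The half-open cube of side \<open>2 ^ - n\<close> around \<open>x\<close> in the
  subspace. Describing it by floors turns the nesting of cubes of different generations into integer
  division.\<close>

definition dyadic_cell :: "'a::euclidean_space set \<Rightarrow> nat \<Rightarrow> 'a \<Rightarrow> 'a set" where
  "dyadic_cell I n x = {y \<in> basis_span I. \<forall>i\<in>I. \<lfloor>2 ^ n * (y \<bullet> i)\<rfloor> = \<lfloor>2 ^ n * (x \<bullet> i)\<rfloor>}"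

lemma floor_pow2_antimono:
  fixes s t :: real
  assumes "\<lfloor>2 ^ n * s\<rfloor> = \<lfloor>2 ^ n * t\<rfloor>" "m \<le> n"
  shows "\<lfloor>2 ^ m * s\<rfloor> = \<lfloor>2 ^ m * t\<rfloor>"
proof -
  have "\<lfloor>2 ^ m * r\<rfloor> = \<lfloor>2 ^ n * r\<rfloor> div 2 ^ (n - m)" for r :: real
  proof -
    have "(2::real) ^ n = 2 ^ m * 2 ^ (n - m)"
      using assms(2) by (simp add: power_add[symmetric])
    then have "2 ^ m * r = 2 ^ n * r / real_of_int (2 ^ (n - m))" by simp
    then show ?thesis using floor_divide_real_eq_div[of "2 ^ (n - m)" "2 ^ n * r"] by simp
  qed
  then show ?thesis using assms(1) by simp
qed

lemma dyadic_cell_cong: "y \<in> dyadic_cell I n x \<Longrightarrow> dyadic_cell I n y = dyadic_cell I n x"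
  by (auto simp: dyadic_cell_def)

lemma dyadic_cell_antimono: "m \<le> n \<Longrightarrow> dyadic_cell I n x \<subseteq> dyadic_cell I m x"
  unfolding dyadic_cell_def using floor_pow2_antimono by blast

lemma basis_span_eq_basis_sum:
  assumes "I \<subseteq> Basis" "x \<in> basis_span I"
  shows "x = basis_sum I (\<lambda>i. x \<bullet> i)"
  by (rule euclidean_eqI) (use assms in \<open>auto simp: basis_sum_inner basis_span_def\<close>)

lemma basis_span_diff: "x \<in> basis_span I \<Longrightarrow> y \<in> basis_span I \<Longrightarrow> x - y \<in> basis_span I"
  and basis_span_add: "x \<in> basis_span I \<Longrightarrow> y \<in> basis_span I \<Longrightarrow> x + y \<in> basis_span I"
  and basis_span_scaleR: "x \<in> basis_span I \<Longrightarrow> c *\<^sub>R x \<in> basis_span I"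
  by (auto simp: basis_span_def inner_diff_left inner_add_left)

lemma norm_le_in_basis_span:
  assumes I: "I \<subseteq> Basis" and x: "x \<in> basis_span I" and le: "\<And>i. i \<in> I \<Longrightarrow> \<bar>x \<bullet> i\<bar> \<le> c"
  shows "norm x \<le> real (card I) * c"
proof -
  have "norm x \<le> (\<Sum>i\<in>I. norm ((x \<bullet> i) *\<^sub>R i))"
    using norm_sum[of "\<lambda>i. (x \<bullet> i) *\<^sub>R i" I] basis_span_eq_basis_sum[OF I x] by (simp add: basis_sum_def)
  also have "\<dots> \<le> (\<Sum>i\<in>I. c)"
    using I le by (intro sum_mono) (auto simp: norm_Basis subset_eq)
  finally show ?thesis by simp
qed

lemma dist_dyadic_cell:
  assumes I: "I \<subseteq> Basis" and "y \<in> dyadic_cell I n x" "z \<in> dyadic_cell I n x"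
  shows "dist y z \<le> card I / 2 ^ n"
proof -
  have "norm (y - z) \<le> real (card I) * (1 / 2 ^ n)"
  proof (rule norm_le_in_basis_span[OF I])
    show "y - z \<in> basis_span I" using assms by (auto simp: dyadic_cell_def intro: basis_span_diff)
    fix i assume "i \<in> I"
    then have "\<lfloor>2 ^ n * (y \<bullet> i)\<rfloor> = \<lfloor>2 ^ n * (z \<bullet> i)\<rfloor>" using assms by (auto simp: dyadic_cell_def)
    then have "\<bar>2 ^ n * (y \<bullet> i) - 2 ^ n * (z \<bullet> i)\<bar> \<le> 1" by linarith
    then have "2 ^ n * \<bar>(y - z) \<bullet> i\<bar> \<le> 1"
      by (simp add: inner_diff_left right_diff_distrib[symmetric] abs_mult)
    then show "\<bar>(y - z) \<bullet> i\<bar> \<le> 1 / 2 ^ n" by (simp add: field_simps)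
  qed
  then show ?thesis by (simp add: dist_norm)
qed

lemma borel_basis_span [measurable]: "basis_span I \<in> sets borel"
proof -
  have "basis_span I = (\<Inter>b\<in>Basis - I. {x. x \<bullet> b = 0})" by (auto simp: basis_span_def)
  moreover have "closed {x. x \<bullet> b = 0}" for b :: 'a
    by (intro closed_Collect_eq continuous_intros)
  ultimately have "closed (basis_span I)" by auto
  then show ?thesis by simp
qed

lemma borel_dyadic_cell [measurable]: "I \<subseteq> Basis \<Longrightarrow> dyadic_cell I n x \<in> sets borel"
proof -
  assume "I \<subseteq> Basis"
  then have [simp]: "finite I" using finite_Basis finite_subset by blast
  show ?thesis unfolding dyadic_cell_def by measurable
qed

lemma emeasure_lebesgue_span_box:
  assumes I: "I \<subseteq> Basis" and S: "\<And>i. i \<in> I \<Longrightarrow> S i \<in> sets borel"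
  shows "emeasure (lebesgue_span I) {y \<in> basis_span I. \<forall>i\<in>I. y \<bullet> i \<in> S i} = (\<Prod>i\<in>I. emeasure lborel (S i))"
proof -
  have fin: "finite I" using I finite_Basis finite_subset by blast
  have [measurable]: "Measurable.pred borel (\<lambda>y. y \<bullet> i \<in> S i)" if "i \<in> I" for i
    using S[OF that] by measurable
  have m: "{y \<in> basis_span I. \<forall>i\<in>I. y \<bullet> i \<in> S i} \<in> sets borel" using fin by measurable
  have "{f \<in> space (Pi\<^sub>M I (\<lambda>_. lborel)). basis_sum I f \<in> {y \<in> basis_span I. \<forall>i\<in>I. y \<bullet> i \<in> S i}} = Pi\<^sub>E I S"
    using I by (auto simp: space_PiM PiE_def Pi_def basis_sum_inner basis_sum_in_span subset_eq)
  then show ?thesis using S by (simp add: emeasure_lebesgue_span[OF m] plb.emeasure_PiM[OF fin])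
qed

lemma emeasure_dyadic_cell:
  assumes I: "I \<subseteq> Basis"
  shows "emeasure (lebesgue_span I) (dyadic_cell I n x) = ennreal ((1 / 2 ^ n) ^ card I)"
proof -
  let ?S = "\<lambda>i. {of_int \<lfloor>2 ^ n * (x \<bullet> i)\<rfloor> / 2 ^ n ..< (of_int \<lfloor>2 ^ n * (x \<bullet> i)\<rfloor> + 1) / 2 ^ n :: real}"
  have "\<lfloor>2 ^ n * t\<rfloor> = k \<longleftrightarrow> t \<in> {of_int k / 2 ^ n ..< (of_int k + 1) / 2 ^ n}" for t :: real and k
    by (auto simp: floor_eq_iff field_simps)
  then have "dyadic_cell I n x = {y \<in> basis_span I. \<forall>i\<in>I. y \<bullet> i \<in> ?S i}"
    by (simp add: dyadic_cell_def)
  moreover have "emeasure lborel (?S i) = ennreal (1 / 2 ^ n)" for i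
    by (subst emeasure_lborel_Ico) (auto simp: field_simps)
  ultimately show ?thesis
    using emeasure_lebesgue_span_box[OF I, of ?S] by (simp add: ennreal_power)
qed

text \<open>Every point of \<open>G\<close> receives its largest cell of generation at least
  \<open>N\<close> that fits into \<open>G\<close>. Since cells are nested or disjoint, the maximal
  ones form a partition. The lower bound \<open>N\<close> lets all cells be as small as a given
  scale demands.\<close>

lemma open_dyadic_partition:
  assumes I: "I \<subseteq> Basis" and "open G"
  obtains \<D> where "countable \<D>" "disjoint \<D>" "\<Union>\<D> = G \<inter> basis_span I"
    "\<And>D. D \<in> \<D> \<Longrightarrow> \<exists>n x. N \<le> n \<and> D = dyadic_cell I n x"
proof -
  have fin: "finite I" using I finite_Basis finite_subset by blast
  let ?P = "\<lambda>x n. N \<le> n \<and> dyadic_cell I n x \<subseteq> G"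
  have ex: "\<exists>n. ?P x n" if "x \<in> G" "x \<in> basis_span I" for x
  proof -
    have xG: "x \<in> G" by fact
    obtain e where e: "0 < e" "ball x e \<subseteq> G" using openE[OF \<open>open G\<close> xG] by blast
    have "(\<lambda>n. real (card I) / 2 ^ n) \<longlonglongrightarrow> 0" by (rule LIMSEQ_divide_realpow_zero) simp
    then have "eventually (\<lambda>n. real (card I) / 2 ^ n < e) sequentially"
      using e(1) by (rule order_tendstoD)
    then obtain n0 where n0: "\<And>n. n0 \<le> n \<Longrightarrow> real (card I) / 2 ^ n < e" by (auto simp: eventually_sequentially)
    have x: "x \<in> dyadic_cell I (max n0 N) x" using that by (simp add: dyadic_cell_def)
    have "dyadic_cell I (max n0 N) x \<subseteq> ball x e"
      using dist_dyadic_cell[OF I x] n0[of "max n0 N"] by (force simp: ball_def)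
    then show ?thesis using e by (intro exI[of _ "max n0 N"]) auto
  qed
  define \<nu> where "\<nu> x = (LEAST n. ?P x n)" for x
  have \<nu>: "?P x (\<nu> x)" if "x \<in> G \<inter> basis_span I" for x
    unfolding \<nu>_def using that by (intro LeastI_ex[OF ex]) auto
  have \<nu>_le: "\<nu> x \<le> n" if "?P x n" for x n unfolding \<nu>_def by (rule Least_le) (use that in auto)
  define cell where "cell x = dyadic_cell I (\<nu> x) x" for x
  have self: "x \<in> cell x" if "x \<in> G \<inter> basis_span I" for x
    using that by (simp add: cell_def dyadic_cell_def)
  \<comment> \<open>Minimality of \<open>\<nu>\<close> is used at both points: the cell of
    \<open>x\<close> is a candidate for \<open>y\<close>, so \<open>y\<close> has a cell at least as
    large, and that cell in turn is a candidate for \<open>x\<close>.\<close>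
  have cell_eq: "cell y = cell x" if x: "x \<in> G \<inter> basis_span I" and y: "y \<in> cell x" for x y
  proof -
    have c: "dyadic_cell I (\<nu> x) y = dyadic_cell I (\<nu> x) x" using y by (intro dyadic_cell_cong) (simp add: cell_def)
    have yG: "y \<in> G \<inter> basis_span I" using y \<nu>[OF x] by (auto simp: cell_def dyadic_cell_def)
    have le: "\<nu> y \<le> \<nu> x" using \<nu>[OF x] c by (intro \<nu>_le) auto
    have "x \<in> dyadic_cell I (\<nu> x) y" using self[OF x] c by (simp add: cell_def)
    then have "x \<in> dyadic_cell I (\<nu> y) y" using dyadic_cell_antimono[OF le] by blast
    then have c': "dyadic_cell I (\<nu> y) x = dyadic_cell I (\<nu> y) y" by (rule dyadic_cell_cong)
    then have "\<nu> x \<le> \<nu> y" using \<nu>[OF yG] by (intro \<nu>_le) auto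
    then show ?thesis using le c' by (simp add: cell_def)
  qed
  let ?D = "cell ` (G \<inter> basis_span I)"
  show ?thesis
  proof
    have "?D \<subseteq> (\<lambda>(n, z). {y \<in> basis_span I. \<forall>i\<in>I. \<lfloor>2 ^ n * (y \<bullet> i)\<rfloor> = z i}) ` ((UNIV::nat set) \<times> (I \<rightarrow>\<^sub>E (UNIV::int set)))"
    proof
      fix D assume "D \<in> ?D"
      then obtain x where x: "D = cell x" by auto
      show "D \<in> (\<lambda>(n, z). {y \<in> basis_span I. \<forall>i\<in>I. \<lfloor>2 ^ n * (y \<bullet> i)\<rfloor> = z i}) ` ((UNIV::nat set) \<times> (I \<rightarrow>\<^sub>E (UNIV::int set)))"
        by (rule image_eqI[of _ _ "(\<nu> x, restrict (\<lambda>i. \<lfloor>2 ^ \<nu> x * (x \<bullet> i)\<rfloor>) I)"])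
           (auto simp: x cell_def dyadic_cell_def)
    qed
    moreover have "countable (I \<rightarrow>\<^sub>E (UNIV::int set))" using fin by (intro countable_PiE) auto
    ultimately show "countable ?D" by (meson countable_SIGMA countable_image countable_subset countableI_type)
    show "disjoint ?D"
    proof (rule disjointI)
      fix C D assume "C \<in> ?D" "D \<in> ?D" "C \<noteq> D"
      then obtain x y where xy: "x \<in> G \<inter> basis_span I" "C = cell x" "y \<in> G \<inter> basis_span I" "D = cell y" by auto
      show "C \<inter> D = {}"
      proof (rule ccontr)
        assume "C \<inter> D \<noteq> {}"
        then obtain z where z: "z \<in> cell x" "z \<in> cell y" using xy by auto
        have "cell z = cell x" "cell z = cell y" by (rule cell_eq[OF xy(1) z(1)], rule cell_eq[OF xy(3) z(2)])
        then show False using xy \<open>C \<noteq> D\<close> by simp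
      qed
    qed
    show "\<Union>?D = G \<inter> basis_span I"
      using self \<nu> by (force simp: cell_def dyadic_cell_def)
    show "\<exists>n x. N \<le> n \<and> D = dyadic_cell I n x" if "D \<in> ?D" for D
      using that \<nu> by (auto simp: cell_def)
  qed
qed

lemma lebesgue_span_concentrated:
  assumes "I \<subseteq> Basis" "A \<in> sets borel"
  shows "emeasure (lebesgue_span I) (A \<inter> basis_span I) = emeasure (lebesgue_span I) A"
  using assms by (subst (1 2) emeasure_lebesgue_span) (auto simp: basis_sum_in_span)

text \<open>A bound on cells passes to relatively open sets by partition into cells and countable
  subadditivity, and from there to bounded Borel sets by outer regularity.\<close>

lemma cover_content_le_lebesgue_span:
  assumes I: "I \<subseteq> Basis" and P: "P {}" and c: "c < top"
    and cell: "\<And>n x. N \<le> n \<Longrightarrow> cover_content d P (dyadic_cell I n x) \<le> c * emeasure (lebesgue_span I) (dyadic_cell I n x)"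
    and B: "B \<in> sets borel" "bounded B" "B \<subseteq> basis_span I"
  shows "cover_content d P B \<le> c * emeasure (lebesgue_span I) B"
proof -
  let ?M = "lebesgue_span I"
  have op: "cover_content d P (G \<inter> basis_span I) \<le> c * emeasure ?M G" if "open G" for G
  proof -
    have G: "open G" by fact
    obtain \<D> where \<D>: "countable \<D>" "disjoint \<D>" "\<Union>\<D> = G \<inter> basis_span I"
      "\<And>D. D \<in> \<D> \<Longrightarrow> \<exists>n x. N \<le> n \<and> D = dyadic_cell I n x"
      using open_dyadic_partition[OF I G, of N] by metis
    have "cover_content d P (\<Union>\<D>) \<le> (\<integral>\<^sup>+D. cover_content d P D \<partial>count_space \<D>)"
      by (rule cover_content_Union_le) fact+
    also have "\<dots> \<le> (\<integral>\<^sup>+D. c * emeasure ?M D \<partial>count_space \<D>)"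
    proof (rule nn_integral_mono)
      fix D assume "D \<in> space (count_space \<D>)"
      then obtain n x where "N \<le> n" "D = dyadic_cell I n x" using \<D>(4)[of D] by auto
      then show "cover_content d P D \<le> c * emeasure ?M D" using cell by simp
    qed
    also have "\<dots> = c * (\<integral>\<^sup>+D. emeasure ?M D \<partial>count_space \<D>)" by (rule nn_integral_cmult) auto
    also have "(\<integral>\<^sup>+D. emeasure ?M D \<partial>count_space \<D>) = emeasure ?M (\<Union>D\<in>\<D>. D)"
    proof (rule emeasure_UN_countable[symmetric])
      show "D \<in> sets ?M" if "D \<in> \<D>" for D using \<D>(4)[OF that] borel_dyadic_cell[OF I] by auto
      show "disjoint_family_on (\<lambda>D. D) \<D>" using \<D>(2) by (simp add: disjoint_def disjoint_family_on_def)
    qed fact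
    also have "\<dots> = emeasure ?M G" using \<D>(3) G lebesgue_span_concentrated[OF I, of G] by simp
    finally show ?thesis using \<D>(3) by simp
  qed
  obtain R where R: "B \<subseteq> ball 0 R" using bounded_subset_ballD[OF B(2), of 0] by auto
  \<comment> \<open>Outer regularity is applied to a finite measure, hence the restriction to a ball
    that contains \<open>B\<close>. The approximating open set is intersected with this ball as
    well.\<close>
  define M' where "M' = density ?M (indicator (ball 0 R))"
  have M'1: "sets M' = sets borel" by (simp add: M'_def)
  have M'2: "emeasure M' A = emeasure ?M (A \<inter> ball 0 R)" if "A \<in> sets borel" for A
  proof -
    have "emeasure M' A = (\<integral>\<^sup>+x. indicator (ball 0 R) x * indicator A x \<partial>?M)"
      unfolding M'_def using that by (intro emeasure_density borel_measurable_indicator) auto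
    also have "\<dots> = (\<integral>\<^sup>+x. indicator (A \<inter> ball 0 R) x \<partial>?M)"
      by (intro nn_integral_cong) (auto simp: indicator_def)
    finally show ?thesis using that by simp
  qed
  note M' = M'1 M'2
  have fin: "emeasure ?M (ball 0 R) < top"
  proof -
    have "emeasure ?M (ball 0 R) \<le> emeasure ?M (cball 0 R)" by (intro emeasure_mono) auto
    also have "\<dots> \<le> hausdorff_size (card I) (cball (0::'a) R)" by (intro lebesgue_span_le_hausdorff_size I) auto
    also have "\<dots> < top" by (simp add: hausdorff_size_def)
    finally show ?thesis .
  qed
  have BR: "emeasure M' B = emeasure ?M B" using R B M'(2) by (simp add: Int_absorb2)
  have approx: "cover_content d P B \<le> c * emeasure ?M B + ennreal e" if "0 < e" for e
  proof -
    have outer: "emeasure M' B = (INF U\<in>{U. B \<subseteq> U \<and> open U}. emeasure M' U)"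
    proof (rule outer_regular)
      show "emeasure M' (space M') \<noteq> \<infinity>"
        using fin sets_eq_imp_space_eq[OF M'(1)] M'(2)[of UNIV] by (simp add: less_top)
    qed (use M' B in auto)
    \<comment> \<open>The factor \<open>c\<close> may vanish; a positive real bound \<open>k\<close>
      is needed so that an excess of measure \<open>e / k\<close> costs at most
      \<open>e\<close>.\<close>
    obtain k :: real where k: "c \<le> ennreal k" "0 < k"
      using c by (cases c) (auto intro!: that[of "enn2real c + 1"] ennreal_leI)
    have "emeasure ?M B < top"
      using R fin emeasure_mono[OF R, of ?M] by (auto intro: le_less_trans)
    then have "emeasure M' B < emeasure M' B + ennreal (e / k)"
      using BR k that by (simp add: ennreal_zero_less_divide less_top)
    then have "(INF U\<in>{U. B \<subseteq> U \<and> open U}. emeasure M' U) < emeasure M' B + ennreal (e / k)"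
      by (simp only: outer[symmetric])
    then obtain U where U: "B \<subseteq> U" "open U" "emeasure M' U < emeasure M' B + ennreal (e / k)"
      unfolding INF_less_iff by auto
    have "cover_content d P B \<le> cover_content d P ((U \<inter> ball 0 R) \<inter> basis_span I)"
      using U R B by (intro cover_content_mono) auto
    also have "\<dots> \<le> c * emeasure ?M (U \<inter> ball 0 R)" using U by (intro op) auto
    also have "\<dots> \<le> c * (emeasure ?M B + ennreal (e / k))"
      using U M'(2)[of U] BR by (intro mult_left_mono) auto
    also have "\<dots> = c * emeasure ?M B + c * ennreal (e / k)" by (rule distrib_left)
    also have "\<dots> \<le> c * emeasure ?M B + ennreal k * ennreal (e / k)"
      using k by (intro add_left_mono mult_right_mono) auto
    also have "ennreal k * ennreal (e / k) = ennreal e" using k that by (simp add: ennreal_mult[symmetric])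
    finally show ?thesis .
  qed
  show ?thesis by (rule ennreal_le_epsilon, rule approx)
qed

text \<open>With \<open>h\<close> the content of a cube \<open>Q\<close> of side \<open>2\<close>, cover the unit-diameter ball inside \<open>Q\<close> by itself and the rest
  of \<open>Q\<close> by dyadic cubes: \<open>h \<le> v + h (1 - v / 2^d)\<close> with \<open>v\<close> the volume of the ball, hence
  \<open>h \<le> 2^d\<close>.  This replaces a Vitali covering by balls.\<close>

lemma cover_content_dyadic_cell_le:
  assumes I: "I \<subseteq> Basis"
  shows "cover_content (card I) bounded (dyadic_cell I n x) \<le> emeasure (lebesgue_span I) (dyadic_cell I n x)"
proof -
  let ?M = "lebesgue_span I" and ?d = "card I"
  have fin: "finite I" using I finite_Basis finite_subset by blast
  define Q where "Q = {y \<in> basis_span I. \<forall>i\<in>I. y \<bullet> i \<in> {-1..<1}}"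
  define h where "h = cover_content ?d bounded Q"
  have Qm [measurable]: "Q \<in> sets borel" unfolding Q_def using fin by measurable
  have bQ: "bounded Q" unfolding bounded_iff
  proof (intro exI ballI)
    fix x assume "x \<in> Q"
    then show "norm x \<le> real (card I) * 1" by (intro norm_le_in_basis_span[OF I]) (auto simp: Q_def abs_le_iff)
  qed
  \<comment> \<open>Finiteness of \<open>h\<close> is essential: the inequality \<open>main\<close>
    below has \<open>h\<close> on both sides and can be solved only for a finite value.\<close>
  have "h \<le> hausdorff_size ?d Q" unfolding h_def by (rule cover_content_le_size) (use bQ in auto)
  also have "\<dots> < top" by (simp add: hausdorff_size_def)
  finally have h_fin: "h < top" .
  have eQ: "emeasure ?M Q = ennreal (2 ^ ?d)"
    using emeasure_lebesgue_span_box[OF I, of "\<lambda>_. {-1..<1}"] unfolding Q_def[symmetric]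
    by (simp add: ennreal_power[symmetric])
  \<comment> \<open>The content of \<open>Q\<close> per unit volume. Every cell is contained in a
    scaled copy of \<open>Q\<close> of the same volume, so the cell bound holds with this factor
    before anything is known about its size, and the general estimate can be applied to
    \<open>Q\<close> without its inner ball.\<close>
  define c where "c = h / ennreal (2 ^ ?d)"
  have c_fin: "c < top" using h_fin by (auto simp: c_def ennreal_divide_eq_top_iff less_top[symmetric])
  have cell: "cover_content ?d bounded (dyadic_cell I n x) \<le> c * emeasure ?M (dyadic_cell I n x)" for n x
  proof -
    \<comment> \<open>The centre of the cell. As \<open>Q\<close> has side \<open>2\<close>, a cell
      of side \<open>1 / 2 ^ n\<close> is covered by \<open>Q\<close> scaled by
      \<open>1 / 2 ^ Suc n\<close>.\<close>
    define ctr where "ctr = basis_sum I (\<lambda>i. (of_int \<lfloor>2 ^ n * (x \<bullet> i)\<rfloor> + 1/2) / 2 ^ n)"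
    define f where "f q = ctr + (1 / 2 ^ Suc n) *\<^sub>R q" for q
    have "dyadic_cell I n x \<subseteq> f ` Q"
    proof
      fix y assume y: "y \<in> dyadic_cell I n x"
      let ?q = "(2 ^ Suc n) *\<^sub>R (y - ctr)"
      have "y = f ?q" by (simp add: f_def)
      moreover have "?q \<in> Q" unfolding Q_def
      proof safe
        show "?q \<in> basis_span I"
          using y I by (auto simp: ctr_def dyadic_cell_def intro!: basis_span_scaleR basis_span_diff basis_sum_in_span)
        fix i assume i: "i \<in> I"
        then have "\<lfloor>2 ^ n * (y \<bullet> i)\<rfloor> = \<lfloor>2 ^ n * (x \<bullet> i)\<rfloor>" using y by (auto simp: dyadic_cell_def)
        then have "of_int \<lfloor>2 ^ n * (x \<bullet> i)\<rfloor> \<le> 2 ^ n * (y \<bullet> i)" "2 ^ n * (y \<bullet> i) < of_int \<lfloor>2 ^ n * (x \<bullet> i)\<rfloor> + 1"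
          by linarith+
        moreover have "?q \<bullet> i = 2 * (2 ^ n * (y \<bullet> i) - of_int \<lfloor>2 ^ n * (x \<bullet> i)\<rfloor> - 1/2)"
          using i I by (simp add: ctr_def basis_sum_inner subset_eq inner_diff_left field_simps)
        ultimately show "?q \<bullet> i \<in> {-1..<1}" by auto
      qed
      ultimately show "y \<in> f ` Q" by blast
    qed
    then have "cover_content ?d bounded (dyadic_cell I n x) \<le> cover_content ?d bounded (f ` Q)"
      by (rule cover_content_mono)
    also have "\<dots> \<le> ennreal ((1 / 2 ^ Suc n) ^ ?d) * cover_content ?d bounded Q"
    proof (rule cover_content_image_le)
      show "dist (f x) (f y) \<le> 1 / 2 ^ Suc n * dist x y" for x y
        by (simp add: f_def dist_norm scaleR_diff_right[symmetric])
      then show "bounded C \<and> bounded (f ` (C \<inter> Q)) \<and> bounded (f ` (C \<inter> Q))" if "bounded C" for C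
        using that bounded_Lipschitz_image[of "C \<inter> Q" f "1 / 2 ^ Suc n"] by auto
    qed auto
    also have "\<dots> = c * emeasure ?M (dyadic_cell I n x)"
    proof -
      have "c * ennreal ((1 / 2 ^ n) ^ ?d) = h * (ennreal ((1 / 2 ^ n) ^ ?d) / ennreal (2 ^ ?d))"
        unfolding c_def by (rule ennreal_divide_times)
      also have "ennreal ((1 / 2 ^ n) ^ ?d) / ennreal (2 ^ ?d) = ennreal ((1 / 2 ^ Suc n) ^ ?d)"
        by (subst divide_ennreal) (auto simp: power_divide power_mult_distrib)
      finally show ?thesis by (simp add: emeasure_dyadic_cell[OF I] h_def mult.commute)
    qed
    finally show ?thesis .
  qed
  define v where "v = unit_ball_vol (real ?d) * (1/2) ^ ?d"
  have v: "0 < v" by (simp add: v_def)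
  let ?B = "cball (0::'a) (1/2) \<inter> basis_span I"
  have BQ: "?B \<subseteq> Q"
  proof
    fix y assume y: "y \<in> ?B"
    have "\<bar>y \<bullet> i\<bar> \<le> 1/2" if "i \<in> I" for i
      using Basis_le_norm[of i y] that I y by auto
    then show "y \<in> Q" using y unfolding Q_def by force
  qed
  have eB: "emeasure ?M ?B = ennreal v"
  proof -
    have "emeasure ?M ?B = emeasure (Pi\<^sub>M I (\<lambda>_. lborel)) ({f. sqrt (\<Sum>i\<in>I. (f i)\<^sup>2) \<le> 1/2} \<inter> space (Pi\<^sub>M I (\<lambda>_. lborel :: real measure)))"
      unfolding lebesgue_span_concentrated[OF I borel_closed[OF closed_cball]]
      by (subst emeasure_lebesgue_span)
         (auto intro!: arg_cong[where f = "emeasure _"] simp: norm_basis_sum[OF I, symmetric] dist_norm)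
    also have "\<dots> = ennreal v" unfolding v_def by (rule emeasure_cball_aux[OF fin]) auto
    finally show ?thesis .
  qed
  have szB: "hausdorff_size ?d ?B \<le> ennreal v"
  proof -
    have bd: "bounded ?B" by auto
    have "diameter ?B \<le> diameter (cball (0::'a) (1/2))" by (rule diameter_subset) auto
    then have "diameter ?B \<le> 1" by simp
    moreover have "0 \<le> diameter ?B" using diameter_ge_0[OF bd] .
    ultimately have "(diameter ?B / 2) ^ ?d \<le> (1/2) ^ ?d" by (intro power_mono) auto
    then show ?thesis unfolding hausdorff_size_def v_def by (auto intro!: ennreal_leI mult_left_mono)
  qed
  have "h \<le> cover_content ?d bounded ?B + cover_content ?d bounded (Q - ?B)"
  proof -
    have "Q \<subseteq> (\<Union>i::nat. if i = 0 then ?B else if i = 1 then Q - ?B else {})"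
      by (auto split: if_splits)
    then have "h \<le> (\<Sum>i::nat. cover_content ?d bounded (if i = 0 then ?B else if i = 1 then Q - ?B else {}))"
      unfolding h_def by (rule order_trans[OF cover_content_mono cover_content_UN_le])
    also have "\<dots> = cover_content ?d bounded ?B + cover_content ?d bounded (Q - ?B)"
      by (subst suminf_finite[of "{0,1}"]) auto
    finally show ?thesis .
  qed
  also have "\<dots> \<le> ennreal v + c * emeasure ?M (Q - ?B)"
  proof (rule add_mono)
    show "cover_content ?d bounded ?B \<le> ennreal v"
      by (rule order_trans[OF cover_content_le_size szB]) auto
    show "cover_content ?d bounded (Q - ?B) \<le> c * emeasure ?M (Q - ?B)"
    proof (rule cover_content_le_lebesgue_span[OF I _ c_fin cell])
      show "Q - ?B \<in> sets borel" by measurable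
      show "bounded (Q - ?B)" using bQ by (rule bounded_subset) auto
      show "Q - ?B \<subseteq> basis_span I" by (auto simp: Q_def)
    qed auto
  qed
  also have "emeasure ?M (Q - ?B) = ennreal (2 ^ ?d - v)"
    using BQ eQ eB v by (subst emeasure_Diff) (auto simp: ennreal_minus)
  finally have main: "h \<le> ennreal v + c * ennreal (2 ^ ?d - v)" .
  have v_le: "v \<le> 2 ^ ?d" using emeasure_mono[OF BQ, of ?M] eQ eB v by (simp add: ennreal_le_iff)
  obtain r where r: "h = ennreal r" "0 \<le> r" using h_fin by (cases h) auto
  have cr: "c = ennreal (r / 2 ^ ?d)" using r unfolding c_def r(1) by (simp add: divide_ennreal)
  have "ennreal r \<le> ennreal (v + r / 2 ^ ?d * (2 ^ ?d - v))"
    using main r v v_le unfolding cr r(1)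
    by (simp add: ennreal_mult[symmetric] ennreal_plus[symmetric] del: ennreal_plus)
  then have "r \<le> v + r / 2 ^ ?d * (2 ^ ?d - v)"
    using v v_le r by (subst (asm) ennreal_le_iff) auto
  then have "r / 2 ^ ?d * v \<le> 1 * v" by (simp add: field_simps)
  then have "r / 2 ^ ?d \<le> 1" using v by (simp only: mult_le_cancel_right_pos)
  then have "c \<le> 1" unfolding cr by (simp add: ennreal_le_1)
  then have "c * emeasure ?M (dyadic_cell I n x) \<le> 1 * emeasure ?M (dyadic_cell I n x)"
    by (rule mult_right_mono) auto
  then show ?thesis using cell[of n x] by simp
qed

text \<open>Cubes have content at most their volume, but with covering sets of any diameter.
  Intersecting such a cover with a cell of diameter at most \<open>\<delta>\<close> makes all its
  members small without increasing any size, so the same bound holds for the premeasure at scale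
  \<open>\<delta>\<close>.\<close>

theorem hausdorff_outer_eq_lebesgue_span:
  assumes I: "I \<subseteq> Basis" and B: "B \<in> sets borel" "B \<subseteq> basis_span I"
  shows "hausdorff_outer_measure (card I) B = emeasure (lebesgue_span I) B"
proof (rule antisym)
  let ?M = "lebesgue_span I" and ?d = "card I"
  have bdd: "hausdorff_outer_measure ?d B \<le> emeasure ?M B"
    if B: "B \<in> sets borel" "bounded B" "B \<subseteq> basis_span I" for B
  proof (rule hausdorff_outer_leI)
    fix \<delta> :: real assume \<delta>: "0 < \<delta>"
    have "(\<lambda>n. real (card I) / 2 ^ n) \<longlonglongrightarrow> 0" by (rule LIMSEQ_divide_realpow_zero) simp
    then have "eventually (\<lambda>n. real (card I) / 2 ^ n < \<delta>) sequentially"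
      using \<delta> by (rule order_tendstoD)
    then obtain N where N: "\<And>n. N \<le> n \<Longrightarrow> real (card I) / 2 ^ n < \<delta>" by (auto simp: eventually_sequentially)
    have "hausdorff_premeasure ?d \<delta> B \<le> 1 * emeasure ?M B"
      unfolding hausdorff_premeasure_eq
    proof (rule cover_content_le_lebesgue_span[OF I _ _ _ B, where N = N])
      fix n x assume n: "N \<le> n"
      let ?c = "dyadic_cell I n x"
      have bc: "bounded ?c \<and> diameter ?c \<le> \<delta>"
      proof
        show "bounded ?c" using dist_dyadic_cell[OF I] unfolding bounded_two_points by blast
        have "diameter ?c \<le> card I / 2 ^ n"
          using dist_dyadic_cell[OF I] by (intro diameter_le) (auto simp: dist_norm)
        then show "diameter ?c \<le> \<delta>" using N[OF n] by simp
      qed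
      have "cover_content ?d (\<lambda>C. bounded C \<and> diameter C \<le> \<delta>) ?c \<le> cover_content ?d bounded ?c"
        unfolding cover_content_def[of ?d bounded]
      proof (rule INF_greatest, clarsimp)
        fix C :: "nat \<Rightarrow> 'a set" assume C: "?c \<subseteq> \<Union> (range C)" "\<forall>i. bounded (C i)"
        have "cover_content ?d (\<lambda>C. bounded C \<and> diameter C \<le> \<delta>) ?c \<le> (\<Sum>i. hausdorff_size ?d (C i \<inter> ?c))"
        proof (rule cover_content_le)
          show "?c \<subseteq> (\<Union>i. C i \<inter> ?c)" using C(1) by blast
          show "bounded (C i \<inter> ?c) \<and> diameter (C i \<inter> ?c) \<le> \<delta>" for i
            using bc diameter_subset[of "C i \<inter> ?c" ?c] by auto
        qed
        also have "\<dots> \<le> (\<Sum>i. hausdorff_size ?d (C i))"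
          using C(2) by (intro suminf_le allI hausdorff_size_mono) auto
        finally show "cover_content ?d (\<lambda>C. bounded C \<and> diameter C \<le> \<delta>) ?c \<le> (\<Sum>i. hausdorff_size ?d (C i))" .
      qed
      also have "\<dots> \<le> emeasure ?M ?c" by (rule cover_content_dyadic_cell_le[OF I])
      finally show "cover_content ?d (\<lambda>C. bounded C \<and> diameter C \<le> \<delta>) ?c \<le> 1 * emeasure ?M ?c" by simp
    qed (use \<delta> in auto)
    then show "hausdorff_premeasure ?d \<delta> B \<le> emeasure ?M B" by simp
  qed
  \<comment> \<open>The bound just proved is for bounded sets; \<open>B\<close> is cut into disjoint
    shells so that the measures on the right add up exactly.\<close>
  define R where "R k = B \<inter> (ball 0 (real (Suc k)) - ball 0 (real k))" for k
  have UR: "B = (\<Union>k. R k)"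
  proof
    show "B \<subseteq> (\<Union>k. R k)"
    proof
      fix x assume "x \<in> B"
      moreover have "x \<in> ball 0 (real (Suc (nat \<lfloor>norm x\<rfloor>))) - ball 0 (real (nat \<lfloor>norm x\<rfloor>))"
        by (simp add: dist_norm) linarith
      ultimately show "x \<in> (\<Union>k. R k)" unfolding R_def by blast
    qed
  qed (auto simp: R_def)
  have disj: "disjoint_family R" unfolding disjoint_family_on_def R_def
  proof (intro ballI impI)
    fix m n :: nat assume "m \<noteq> n"
    then have "Suc m \<le> n \<or> Suc n \<le> m" by linarith
    then have "real (Suc m) \<le> real n \<or> real (Suc n) \<le> real m" by (metis of_nat_le_iff)
    then show "B \<inter> (ball 0 (real (Suc m)) - ball 0 (real m)) \<inter> (B \<inter> (ball 0 (real (Suc n)) - ball 0 (real n))) = {}"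
      by auto
  qed
  have "hausdorff_outer_measure ?d B \<le> (\<Sum>k. hausdorff_outer_measure ?d (R k))"
    by (subst UR) (rule hausdorff_outer_UN_le)
  also have "\<dots> \<le> (\<Sum>k. emeasure ?M (R k))"
  proof (intro suminf_le allI bdd)
    fix k show "bounded (R k)" by (rule bounded_subset[of "ball 0 (real (Suc k))"]) (auto simp: R_def)
    show "R k \<subseteq> basis_span I" using B by (auto simp: R_def)
    show "R k \<in> sets borel" using B by (auto simp: R_def)
  qed auto
  also have "\<dots> = emeasure ?M (\<Union>k. R k)"
  proof (rule suminf_emeasure[OF _ disj])
    show "range R \<subseteq> sets ?M" using B by (auto simp: R_def)
  qed
  also have "\<dots> = emeasure ?M B" by (simp only: UR[symmetric])
  finally show "hausdorff_outer_measure ?d B \<le> emeasure ?M B" .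
qed (rule lebesgue_span_le_hausdorff[OF I B(1)])

corollary hausdorff_outer_eq_lborel:
  "B \<in> sets borel \<Longrightarrow> hausdorff_outer_measure DIM('a) B = emeasure lborel (B :: 'a::euclidean_space set)"
  using hausdorff_outer_eq_lebesgue_span[of Basis B] by (simp add: lebesgue_span_Basis basis_span_def)

lemma hausdorff_outer_isometry:
  assumes "\<And>x y. x \<in> A \<Longrightarrow> y \<in> A \<Longrightarrow> dist (f x) (f y) = dist x y"
  shows "hausdorff_outer_measure d (f ` A) = hausdorff_outer_measure d A"
proof (rule antisym)
  show "hausdorff_outer_measure d (f ` A) \<le> hausdorff_outer_measure d A"
    using hausdorff_outer_image_le[of A f 1 d] assms by auto
  have inj: "inj_on f A" by (intro inj_onI) (metis assms dist_eq_0_iff)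
  have "hausdorff_outer_measure d (inv_into A f ` f ` A) \<le> ennreal (1 ^ d) * hausdorff_outer_measure d (f ` A)"
    by (rule hausdorff_outer_image_le) (use assms inj in \<open>auto simp: inv_into_f_f\<close>)
  then show "hausdorff_outer_measure d A \<le> hausdorff_outer_measure d (f ` A)"
    using inj by (simp add: inv_into_image_cancel)
qed

text \<open>Each slice is a translate of a set in the coordinate hyperplane, where Hausdorff and
  Lebesgue measure agree. The claims are therefore measurability and equality in Fubini's theorem
  for the coordinate \<open>b\<close>.\<close>

lemma basis_slices:
  fixes B :: "'a::euclidean_space set"
  assumes b: "b \<in> Basis" and B: "B \<in> sets borel"
  shows "(\<lambda>s. hausdorff_outer_measure (DIM('a) - 1) (B \<inter> {x. x \<bullet> b = s})) \<in> borel_measurable borel" (is ?m)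
    and "(\<integral>\<^sup>+s. hausdorff_outer_measure (DIM('a) - 1) (B \<inter> {x. x \<bullet> b = s}) \<partial>lborel) = emeasure lborel B" (is ?e)
proof -
  define I where "I = Basis - {b}"
  have I: "I \<subseteq> Basis" "finite I" "b \<notin> I" "insert b I = Basis" "card I = DIM('a) - 1"
    using b by (auto simp: I_def)
  let ?P = "Pi\<^sub>M I (\<lambda>_. lborel :: real measure)"
  interpret P: finite_product_sigma_finite "\<lambda>_. lborel :: real measure" I
    by standard (rule I)
  have slice: "hausdorff_outer_measure (DIM('a) - 1) (B \<inter> {x. x \<bullet> b = s})
      = (\<integral>\<^sup>+f. indicator B (basis_sum I f + s *\<^sub>R b) \<partial>?P)" for s
  proof -
    let ?S = "{y. y + s *\<^sub>R b \<in> B}"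
    have Sm: "?S \<in> sets borel"
      using measurable_sets[of "\<lambda>y. y + s *\<^sub>R b" borel borel B] B by (simp add: vimage_def)
    have span: "y \<in> basis_span I \<longleftrightarrow> y \<bullet> b = 0" for y
      using b by (auto simp: basis_span_def I_def)
    have "B \<inter> {x. x \<bullet> b = s} = (\<lambda>y. y + s *\<^sub>R b) ` (?S \<inter> basis_span I)"
    proof (intro set_eqI iffI)
      fix x assume x: "x \<in> B \<inter> {x. x \<bullet> b = s}"
      show "x \<in> (\<lambda>y. y + s *\<^sub>R b) ` (?S \<inter> basis_span I)"
        by (rule image_eqI[of _ _ "x - s *\<^sub>R b"]) (use x b in \<open>auto simp: span inner_diff_left\<close>)
    qed (use b in \<open>auto simp: span inner_add_left\<close>)
    then have "hausdorff_outer_measure (DIM('a) - 1) (B \<inter> {x. x \<bullet> b = s})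
        = hausdorff_outer_measure (card I) (?S \<inter> basis_span I)"
      by (simp add: hausdorff_outer_isometry I)
    also have "\<dots> = emeasure (lebesgue_span I) ?S"
      using Sm by (subst hausdorff_outer_eq_lebesgue_span[OF I(1)]) (auto simp: lebesgue_span_concentrated[OF I(1)])
    also have "\<dots> = (\<integral>\<^sup>+y. indicator ?S y \<partial>lebesgue_span I)" using Sm by simp
    also have "\<dots> = (\<integral>\<^sup>+f. indicator ?S (basis_sum I f) \<partial>?P)"
      unfolding lebesgue_span_def using Sm by (intro nn_integral_distr) auto
    finally show ?thesis by (simp add: indicator_def)
  qed
  have [measurable]: "(\<lambda>p. basis_sum I (snd p) + fst p *\<^sub>R b) \<in> measurable (borel \<Otimes>\<^sub>M ?P) borel"
    by measurable
  have [measurable]: "(\<lambda>(s, f). indicator B (basis_sum I f + s *\<^sub>R b) :: ennreal) \<in> borel_measurable (borel \<Otimes>\<^sub>M ?P)"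
    using B unfolding split_beta' by measurable
  show ?m unfolding slice
    by (rule P.borel_measurable_nn_integral) measurable
  have "emeasure lborel B = emeasure (lebesgue_span Basis) B" by (simp add: lebesgue_span_Basis)
  also have "\<dots> = (\<integral>\<^sup>+y. indicator B y \<partial>lebesgue_span Basis)" using B by simp
  also have "\<dots> = (\<integral>\<^sup>+f. indicator B (basis_sum Basis f) \<partial>Pi\<^sub>M Basis (\<lambda>_. lborel))"
    unfolding lebesgue_span_def using B by (intro nn_integral_distr) auto
  also have "\<dots> = (\<integral>\<^sup>+s. (\<integral>\<^sup>+f. indicator B (basis_sum Basis (f(b := s))) \<partial>?P) \<partial>lborel)"
  proof -
    have "(\<lambda>f. indicator B (basis_sum Basis f) :: ennreal) \<in> borel_measurable (Pi\<^sub>M (insert b I) (\<lambda>_. lborel))"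
      using B unfolding I(4) by measurable
    from plb.product_nn_integral_insert_rev[OF I(2,3) this] show ?thesis unfolding I(4) .
  qed
  also have "\<dots> = (\<integral>\<^sup>+s. (\<integral>\<^sup>+f. indicator B (basis_sum I f + s *\<^sub>R b) \<partial>?P) \<partial>lborel)"
  proof -
    have "basis_sum Basis (f(b := s)) = basis_sum I f + s *\<^sub>R b" for f s
      unfolding basis_sum_def I(4)[symmetric] using I(2,3)
      by (subst sum.insert) (auto simp: add.commute intro!: sum.cong)
    then show ?thesis by simp
  qed
  finally show ?e unfolding slice by simp
qed

section \<open>The coarea formula for regular functions\<close>

text \<open>Reflection in the hyperplane orthogonal to \<open>v\<close>. For \<open>v = 0\<close>
  division by zero makes it the identity, so that \<open>householder (\<nu> - b)\<close> exchanges
  two unit vectors also when they coincide.\<close>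

definition householder :: "'a::real_inner \<Rightarrow> 'a \<Rightarrow> 'a" where
  "householder v x = x - (2 * (x \<bullet> v) / (v \<bullet> v)) *\<^sub>R v"

lemma householder_inner: "householder v x \<bullet> y = x \<bullet> householder v y"
  by (simp add: householder_def inner_diff_left inner_diff_right inner_commute)

lemma householder_invol [simp]: "householder v (householder v x) = x"
  by (cases "v = 0") (simp_all add: householder_def inner_diff_left field_simps flip: scaleR_left_distrib)

lemma householder_diff: "householder v x - householder v y = householder v (x - y)"
  by (simp add: householder_def inner_diff_left algebra_simps diff_divide_distrib)

lemma norm_householder [simp]: "norm (householder v x) = norm x"
  by (simp add: norm_eq_sqrt_inner householder_inner)

lemma dist_householder [simp]: "dist (householder v x) (householder v y) = dist x y"
  by (simp add: dist_norm householder_diff)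

lemma householder_swap:
  assumes "norm \<nu> = 1" "norm b = 1"
  shows "householder (\<nu> - b) b = \<nu>"
proof (cases "\<nu> = b")
  case False
  have 1: "\<nu> \<bullet> \<nu> = 1" "b \<bullet> b = 1" using assms by (auto simp: norm_eq_1)
  then have "(\<nu> - b) \<bullet> (\<nu> - b) = 2 - 2 * (b \<bullet> \<nu>)"
    by (simp add: inner_diff_left inner_diff_right inner_commute)
  moreover have "b \<bullet> (\<nu> - b) = - (1 - b \<bullet> \<nu>)" using 1 by (simp add: inner_diff_right)
  moreover have "(\<nu> - b) \<bullet> (\<nu> - b) \<noteq> 0" using False by simp
  ultimately have "2 * (b \<bullet> (\<nu> - b)) / ((\<nu> - b) \<bullet> (\<nu> - b)) = -1" by (simp add: field_simps)
  then show ?thesis by (simp add: householder_def)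
qed (simp add: householder_def)

text \<open>A reflection that carries a basis vector to \<open>\<nu>\<close> is an isometry and
  preserves Hausdorff measure in every dimension. Invariance of Lebesgue measure is the case of full
  dimension.\<close>

lemma hyperplane_slices:
  fixes B :: "'a::euclidean_space set"
  assumes \<nu>: "norm \<nu> = 1" and B: "B \<in> sets borel"
  shows "(\<lambda>s. hausdorff_outer_measure (DIM('a) - 1) (B \<inter> {x. x \<bullet> \<nu> = s})) \<in> borel_measurable borel" (is ?m)
    and "(\<integral>\<^sup>+s. hausdorff_outer_measure (DIM('a) - 1) (B \<inter> {x. x \<bullet> \<nu> = s}) \<partial>lborel) = emeasure lborel B" (is ?e)
proof -
  obtain b :: 'a where b: "b \<in> Basis" using nonempty_Basis by blast
  let ?T = "householder (\<nu> - b)"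
  have Tb: "x \<bullet> \<nu> = ?T x \<bullet> b" for x
    using householder_swap[OF \<nu>, of b] b by (simp add: householder_inner)
  have "continuous_on UNIV ?T"
    unfolding householder_def[abs_def] by (cases "\<nu> = b") (auto intro!: continuous_intros)
  then have [measurable]: "?T \<in> measurable borel borel" by (rule borel_measurable_continuous_onI)
  have "?T ` B = ?T -` B" using householder_invol[of "\<nu> - b"] by (force intro: image_eqI[where x = "?T _"])
  then have TB: "?T ` B \<in> sets borel" using measurable_sets[of ?T borel borel B] B by simp
  have sl: "hausdorff_outer_measure (DIM('a) - 1) (B \<inter> {x. x \<bullet> \<nu> = s}) =
     hausdorff_outer_measure (DIM('a) - 1) (?T ` B \<inter> {x. x \<bullet> b = s})" for s
  proof -
    have "?T ` B \<inter> {x. x \<bullet> b = s} = ?T ` (B \<inter> {x. x \<bullet> \<nu> = s})" by (auto simp: Tb)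
    then show ?thesis by (simp add: hausdorff_outer_isometry)
  qed
  show ?m unfolding sl by (rule basis_slices[OF b TB])
  have "emeasure lborel (?T ` B) = emeasure lborel B"
    using hausdorff_outer_isometry[of B ?T "DIM('a)"] TB B by (simp add: hausdorff_outer_eq_lborel)
  then show ?e unfolding sl using basis_slices(2)[OF b TB] by simp
qed

text \<open>Near a regular point \<open>w\<close> is flattened by \<open>\<Psi> x = x + ((w x - w x0) / m - (x - x0) \<bullet> \<nu>) \<nu>\<close>, where
  \<open>m \<nu>\<close> is the gradient at \<open>x0\<close>.  The derivative of \<open>\<Psi>\<close> at \<open>x0\<close> is the identity, so \<open>\<Psi>\<close>
  distorts small balls arbitrarily little.\<close>

lemma flattening_chart:
  fixes w :: "'a::euclidean_space \<Rightarrow> real"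
  assumes Z: "open Z" "x0 \<in> Z" and w: "\<And>x. x \<in> Z \<Longrightarrow> (w has_derivative (\<lambda>h. G x \<bullet> h)) (at x)"
    and G: "continuous_on Z G" "G x0 \<noteq> 0" and q: "1 < q"
  obtains r \<nu> m \<Psi> where "0 < r" "cball x0 r \<subseteq> Z" "norm \<nu> = 1" "0 < m"
    "\<And>x y. x \<in> cball x0 r \<Longrightarrow> y \<in> cball x0 r \<Longrightarrow> dist (\<Psi> x) (\<Psi> y) \<le> q * dist x y"
    "\<And>x y. x \<in> cball x0 r \<Longrightarrow> y \<in> cball x0 r \<Longrightarrow> dist x y \<le> q * dist (\<Psi> x) (\<Psi> y)"
    "\<And>x. x \<in> cball x0 r \<Longrightarrow> norm (G x) \<le> q * m \<and> m \<le> q * norm (G x)"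
    "\<And>x. x \<in> cball x0 r \<Longrightarrow> \<Psi> x \<bullet> \<nu> = x0 \<bullet> \<nu> + (w x - w x0) / m"
proof -
  define m where "m = norm (G x0)"
  define \<nu> where "\<nu> = G x0 /\<^sub>R m"
  have m: "0 < m" and \<nu>: "norm \<nu> = 1" "G x0 = m *\<^sub>R \<nu>" "\<nu> \<bullet> \<nu> = 1"
    using G(2) by (auto simp: m_def \<nu>_def power2_norm_eq_inner[symmetric] power2_eq_square)
  \<comment> \<open>Chosen so that the lower distortion factor \<open>1 - \<epsilon>\<close> is
    exactly \<open>1 / q\<close>. The upper factor satisfies \<open>1 + \<epsilon> \<le> q\<close>
    because \<open>(q - 1)\<^sup>2 / q\<close> is nonnegative.\<close>
  define \<epsilon> where "\<epsilon> = 1 - 1 / q"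
  have \<epsilon>: "0 < \<epsilon>" "\<epsilon> < 1" "1 / (1 - \<epsilon>) = q" using q by (auto simp: \<epsilon>_def)
  have "0 \<le> (q - 1)\<^sup>2 / q" using q by simp
  then have q2: "1 + \<epsilon> \<le> q" using q by (simp add: \<epsilon>_def power2_eq_square field_simps)
  obtain e where e: "0 < e" "cball x0 e \<subseteq> Z" using Z open_contains_cball by blast
  have "continuous (at x0) G" using G(1) Z continuous_on_eq_continuous_at by blast
  then obtain d where d: "0 < d" "\<And>x. dist x x0 < d \<Longrightarrow> dist (G x) (G x0) < \<epsilon> * m"
    unfolding continuous_at_eps_delta using \<epsilon>(1) m by (metis mult_pos_pos)
  define r where "r = min e (d / 2)"
  have r: "0 < r" "cball x0 r \<subseteq> Z" using e d by (auto simp: r_def)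
  have near: "norm (G x - G x0) \<le> \<epsilon> * m" if "x \<in> cball x0 r" for x
    using d(2)[of x] that d(1) by (auto simp: r_def dist_norm norm_minus_commute)
  \<comment> \<open>The displacement along \<open>\<nu>\<close> that makes \<open>\<Psi>\<close>
    send levels of \<open>w\<close> to hyperplanes. Its gradient \<open>G x / m - \<nu>\<close>
    vanishes at \<open>x0\<close>, hence \<open>E\<close> is Lipschitz with a small constant
    nearby.\<close>
  define E where "E x = (w x - w x0) / m - (x - x0) \<bullet> \<nu>" for x
  define \<Psi> where "\<Psi> x = x + E x *\<^sub>R \<nu>" for x
  have E_der: "(E has_derivative (\<lambda>h. (G x /\<^sub>R m - \<nu>) \<bullet> h)) (at x within cball x0 r)" if "x \<in> cball x0 r" for x
  proof -
    have xZ: "x \<in> Z" using that r(2) by blast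
    note w' = has_derivative_at_withinI[OF w[OF xZ]]
    have "(E has_derivative (\<lambda>h. (G x \<bullet> h) / m - h \<bullet> \<nu>)) (at x within cball x0 r)"
      unfolding E_def[abs_def] using m
      by (auto intro!: derivative_eq_intros w' simp: field_simps)
    moreover have "(\<lambda>h. (G x \<bullet> h) / m - h \<bullet> \<nu>) = (\<lambda>h. (G x /\<^sub>R m - \<nu>) \<bullet> h)"
      by (simp add: fun_eq_iff inner_diff_left inner_commute[of \<nu>] divide_inverse mult.commute)
    ultimately show ?thesis by simp
  qed
  have E_lip: "\<bar>E x - E y\<bar> \<le> \<epsilon> * dist x y" if "x \<in> cball x0 r" "y \<in> cball x0 r" for x y
  proof -
    have "norm (E x - E y) \<le> \<epsilon> * norm (x - y)"
    proof (rule differentiable_bound[OF convex_cball E_der _ that])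
      fix z assume z: "z \<in> cball x0 r"
      show "onorm (\<lambda>h. (G z /\<^sub>R m - \<nu>) \<bullet> h) \<le> \<epsilon>"
      proof (rule onorm_bound)
        fix h :: 'a
        have "G z /\<^sub>R m - \<nu> = (G z - G x0) /\<^sub>R m" using m by (simp add: \<nu>(2) algebra_simps)
        then have "norm (G z /\<^sub>R m - \<nu>) = norm (G z - G x0) / m" using m by (simp add: divide_inverse mult.commute)
        also have "\<dots> \<le> \<epsilon>" using near[OF z] m by (simp add: pos_divide_le_eq)
        finally have "norm (G z /\<^sub>R m - \<nu>) * norm h \<le> \<epsilon> * norm h" by (rule mult_right_mono) auto
        then show "norm ((G z /\<^sub>R m - \<nu>) \<bullet> h) \<le> \<epsilon> * norm h"
          using Cauchy_Schwarz_ineq2[of "G z /\<^sub>R m - \<nu>" h] unfolding real_norm_def by (rule order_trans[rotated])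
      qed (use \<epsilon> in auto)
    qed auto
    then show ?thesis by (simp add: dist_norm)
  qed
  have \<Psi>_diff: "\<bar>dist (\<Psi> x) (\<Psi> y) - dist x y\<bar> \<le> \<epsilon> * dist x y" if "x \<in> cball x0 r" "y \<in> cball x0 r" for x y
  proof -
    have "\<Psi> x - \<Psi> y = (x - y) + (E x - E y) *\<^sub>R \<nu>" by (simp add: \<Psi>_def algebra_simps)
    then have "\<bar>dist (\<Psi> x) (\<Psi> y) - dist x y\<bar> \<le> norm ((E x - E y) *\<^sub>R \<nu>)"
      unfolding dist_norm by (metis add_diff_cancel_left' norm_triangle_ineq3)
    then show ?thesis using E_lip[OF that] \<nu>(1) by simp
  qed
  show ?thesis
  proof (rule that[OF r \<nu>(1) m])
    fix x y assume xy: "x \<in> cball x0 r" "y \<in> cball x0 r"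
    have "dist (\<Psi> x) (\<Psi> y) \<le> (1 + \<epsilon>) * dist x y" using \<Psi>_diff[OF xy] by (simp add: algebra_simps)
    also have "\<dots> \<le> q * dist x y" using q2 by (intro mult_right_mono) auto
    finally show "dist (\<Psi> x) (\<Psi> y) \<le> q * dist x y" .
    have "(1 - \<epsilon>) * dist x y \<le> dist (\<Psi> x) (\<Psi> y)" using \<Psi>_diff[OF xy] by (simp add: algebra_simps)
    then show "dist x y \<le> q * dist (\<Psi> x) (\<Psi> y)"
      unfolding \<epsilon>(3)[symmetric] using \<epsilon>(2) by (simp add: pos_le_divide_eq mult.commute)
  next
    fix x assume x: "x \<in> cball x0 r"
    have "\<bar>norm (G x) - m\<bar> \<le> \<epsilon> * m" using near[OF x] norm_triangle_ineq3[of "G x" "G x0"] by (simp add: m_def)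
    then have 1: "norm (G x) \<le> (1 + \<epsilon>) * m" "(1 - \<epsilon>) * m \<le> norm (G x)" by (auto simp: algebra_simps)
    have "(1 + \<epsilon>) * m \<le> q * m" using q2 m by simp
    moreover have "m \<le> q * norm (G x)" 
      unfolding \<epsilon>(3)[symmetric] using 1(2) \<epsilon>(2) by (simp add: pos_le_divide_eq mult.commute)
    ultimately show "norm (G x) \<le> q * m \<and> m \<le> q * norm (G x)" using 1 by simp
    show "\<Psi> x \<bullet> \<nu> = x0 \<bullet> \<nu> + (w x - w x0) / m"
      using \<nu>(3) by (simp add: \<Psi>_def E_def inner_add_left inner_diff_left)
  qed
qed

text \<open>The coarea formula up to a factor \<open>C\<close>. The function \<open>g\<close> is a
  measurable substitute for the measure of the level sets, whose own measurability in
  \<open>t\<close> is a consequence of these bounds and cannot be presupposed in the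
  integrals.\<close>

definition coarea_bounds :: "('a::euclidean_space \<Rightarrow> real) \<Rightarrow> ('a \<Rightarrow> 'a) \<Rightarrow> real \<Rightarrow> 'a set \<Rightarrow> (real \<Rightarrow> ennreal) \<Rightarrow> bool" where
  "coarea_bounds w G C A g \<longleftrightarrow> g \<in> borel_measurable borel \<and>
     (\<forall>t. g t \<le> ennreal C * hausdorff_outer_measure (DIM('a) - 1) (A \<inter> {x. w x = t}) \<and>
          hausdorff_outer_measure (DIM('a) - 1) (A \<inter> {x. w x = t}) \<le> ennreal C * g t) \<and>
     (\<integral>\<^sup>+t. g t \<partial>lborel) \<le> ennreal C * (\<integral>\<^sup>+x. ennreal (norm (G x)) * indicator A x \<partial>lborel) \<and>
     (\<integral>\<^sup>+x. ennreal (norm (G x)) * indicator A x \<partial>lborel) \<le> ennreal C * (\<integral>\<^sup>+t. g t \<partial>lborel)"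

text \<open>On the compact set \<open>K\<close> the inverse of \<open>\<Psi>\<close> is continuous,
  so the image of \<open>A\<close> is the preimage of \<open>A\<close> under a continuous map on a
  compact set.\<close>

lemma borel_image_bilipschitz:
  fixes \<Psi> :: "'a::euclidean_space \<Rightarrow> 'a"
  assumes K: "compact K" "A \<subseteq> K" "A \<in> sets borel"
    and lip: "\<And>x y. x \<in> K \<Longrightarrow> y \<in> K \<Longrightarrow> dist (\<Psi> x) (\<Psi> y) \<le> q * dist x y"
      "\<And>x y. x \<in> K \<Longrightarrow> y \<in> K \<Longrightarrow> dist x y \<le> q * dist (\<Psi> x) (\<Psi> y)" and q: "0 < q"
  shows "\<Psi> ` A \<in> sets borel"
proof -
  have cont: "continuous_on K \<Psi>"
    using lip(1) q by (intro lipschitz_on_continuous_on[of q] lipschitz_onI) auto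
  have inj: "inj_on \<Psi> K" using lip(2) by (force intro: inj_onI)
  define h where "h = the_inv_into K \<Psi>"
  have "continuous_on (\<Psi> ` K) h"
    unfolding h_def by (rule continuous_on_inv_into[OF cont K(1) inj])
  then have "h \<in> borel_measurable (restrict_space borel (\<Psi> ` K))" by (rule borel_measurable_continuous_on_restrict)
  then have "h -` A \<inter> \<Psi> ` K \<in> sets (restrict_space borel (\<Psi> ` K))"
    using K(3) measurable_sets[of h] by (fastforce simp: space_restrict_space)
  moreover have "\<Psi> ` K \<in> sets borel" using compact_continuous_image[OF cont K(1)] by (simp add: borel_compact)
  ultimately have "h -` A \<inter> \<Psi> ` K \<in> sets borel" by (simp add: sets_restrict_space_iff)
  moreover have "h -` A \<inter> \<Psi> ` K = \<Psi> ` A" using inj K(2) by (auto simp: h_def the_inv_into_f_f subset_eq)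
  ultimately show ?thesis by simp
qed

text \<open>In the chart the levels are slices by parallel hyperplanes, for which the formula is
  exact. Surface measure, volume and gradient are distorted by at most \<open>q\<close> to the
  powers \<open>n - 1\<close>, \<open>n\<close> and \<open>1\<close>; the root \<open>q\<close> of
  \<open>C\<close> of order \<open>n + 1\<close> absorbs the volume and gradient factors
  together.\<close>

lemma coarea_bounds_local:
  fixes w :: "'a::euclidean_space \<Rightarrow> real"
  assumes Z: "open Z" "x0 \<in> Z" and w: "\<And>x. x \<in> Z \<Longrightarrow> (w has_derivative (\<lambda>h. G x \<bullet> h)) (at x)"
    and G: "continuous_on Z G" "G x0 \<noteq> 0" and C: "1 < C"
  shows "\<exists>r>0. \<forall>A\<in>sets borel. A \<subseteq> ball x0 r \<longrightarrow> (\<exists>g. coarea_bounds w G C A g)"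
proof -
  let ?d = "DIM('a) - 1" and ?H = "hausdorff_outer_measure (DIM('a) - 1) :: 'a set \<Rightarrow> ennreal"
  define q where "q = root (DIM('a) + 1) C"
  have q: "1 < q" using C by (auto simp: q_def)
  have qC: "q ^ (DIM('a) + 1) = C" unfolding q_def by (rule real_root_pow_pos2) (use C in auto)
  have q_le: "q ^ i \<le> C" if "i \<le> DIM('a) + 1" for i
    using power_increasing[OF that, of q] q qC by simp
  from flattening_chart[OF Z w G q] obtain r \<nu> m \<Psi> where r: "0 < r" "cball x0 r \<subseteq> Z" and \<nu>: "norm \<nu> = 1" and m: "0 < m"
    and lip: "\<And>x y. x \<in> cball x0 r \<Longrightarrow> y \<in> cball x0 r \<Longrightarrow> dist (\<Psi> x) (\<Psi> y) \<le> q * dist x y"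
    "\<And>x y. x \<in> cball x0 r \<Longrightarrow> y \<in> cball x0 r \<Longrightarrow> dist x y \<le> q * dist (\<Psi> x) (\<Psi> y)"
    and Gm: "\<And>x. x \<in> cball x0 r \<Longrightarrow> norm (G x) \<le> q * m \<and> m \<le> q * norm (G x)"
    and level: "\<And>x. x \<in> cball x0 r \<Longrightarrow> \<Psi> x \<bullet> \<nu> = x0 \<bullet> \<nu> + (w x - w x0) / m"
    by metis
  have "\<exists>g. coarea_bounds w G C A g" if A: "A \<in> sets borel" "A \<subseteq> ball x0 r" for A
  proof -
    have AK: "A \<subseteq> cball x0 r" using A by auto
    have im: "\<Psi> ` A \<in> sets borel"
      by (rule borel_image_bilipschitz[OF compact_cball AK A(1) lip]) (use q in auto)
    have inj: "inj_on \<Psi> A" using lip(2) AK by (force intro: inj_onI)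
    define s where "s t = x0 \<bullet> \<nu> - w x0 / m + (1 / m) * t" for t
    define g where "g t = ?H (\<Psi> ` A \<inter> {z. z \<bullet> \<nu> = s t})" for t
    have im_level: "\<Psi> ` A \<inter> {z. z \<bullet> \<nu> = s t} = \<Psi> ` (A \<inter> {x. w x = t})" for t
    proof -
      have "\<Psi> x \<bullet> \<nu> = s t \<longleftrightarrow> w x = t" if "x \<in> A" for x
      proof -
        have "x \<in> cball x0 r" using that AK by blast
        from level[OF this] have "\<Psi> x \<bullet> \<nu> - s t = (w x - t) / m" by (simp add: s_def diff_divide_distrib)
        then show ?thesis using m by (auto simp: field_simps)
      qed
      then show ?thesis by blast
    qed
    have inv_lip: "hausdorff_outer_measure d B \<le> ennreal (q ^ d) * hausdorff_outer_measure d (\<Psi> ` B)" if "B \<subseteq> A" for B d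
    proof -
      have injB: "inj_on \<Psi> B" using inj that inj_on_subset by blast
      have "hausdorff_outer_measure d (inv_into B \<Psi> ` \<Psi> ` B) \<le> ennreal (q ^ d) * hausdorff_outer_measure d (\<Psi> ` B)"
        by (rule hausdorff_outer_image_le) (use lip(2) q that AK injB in \<open>auto simp: inv_into_f_f subset_eq\<close>)
      then show ?thesis using injB by (simp add: inv_into_image_cancel)
    qed
    have fwd_lip: "hausdorff_outer_measure d (\<Psi> ` B) \<le> ennreal (q ^ d) * hausdorff_outer_measure d B" if "B \<subseteq> A" for B d
      by (rule hausdorff_outer_image_le) (use lip(1) q that AK in \<open>auto simp: subset_eq\<close>)
    have gm: "g \<in> borel_measurable borel"
    proof -
      have "s \<in> borel_measurable borel" unfolding s_def[abs_def] by measurable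
      from measurable_compose[OF this hyperplane_slices(1)[OF \<nu> im]] show ?thesis unfolding g_def .
    qed
    have cC: "ennreal (q ^ ?d) \<le> ennreal C" using q_le[of ?d] by (intro ennreal_leI) auto
    \<comment> \<open>The factor \<open>m\<close> is the Jacobian of the affine substitution between
      the level \<open>t\<close> of \<open>w\<close> and the height \<open>s t\<close> of the
      corresponding hyperplane.\<close>
    have int_g: "(\<integral>\<^sup>+t. g t \<partial>lborel) = ennreal m * emeasure lborel (\<Psi> ` A)"
    proof -
      let ?h = "\<lambda>u. ?H (\<Psi> ` A \<inter> {z. z \<bullet> \<nu> = u})"
      have "emeasure lborel (\<Psi> ` A) = (\<integral>\<^sup>+u. ?h u \<partial>lborel)" using hyperplane_slices(2)[OF \<nu> im] by simp
      also have "\<dots> = ennreal \<bar>1 / m\<bar> * (\<integral>\<^sup>+t. ?h (x0 \<bullet> \<nu> - w x0 / m + (1 / m) * t) \<partial>lborel)"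
        by (rule nn_integral_real_affine) (use hyperplane_slices(1)[OF \<nu> im] m in auto)
      finally have "emeasure lborel (\<Psi> ` A) = ennreal (1 / m) * (\<integral>\<^sup>+t. g t \<partial>lborel)"
        using m by (simp add: g_def s_def)
      then have "ennreal m * emeasure lborel (\<Psi> ` A) = ennreal (m * (1 / m)) * (\<integral>\<^sup>+t. g t \<partial>lborel)"
        using m by (simp add: ennreal_mult mult.assoc del: times_divide_eq_right)
      then show ?thesis using m by simp
    qed
    have GA1: "(\<integral>\<^sup>+x. ennreal (norm (G x)) * indicator A x \<partial>lborel) \<le> ennreal (q * m) * emeasure lborel A"
    proof -
      have "(\<integral>\<^sup>+x. ennreal (norm (G x)) * indicator A x \<partial>lborel) \<le> (\<integral>\<^sup>+x. ennreal (q * m) * indicator A x \<partial>lborel)"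
        using Gm AK by (intro nn_integral_mono) (auto simp: indicator_def intro!: ennreal_leI)
      then show ?thesis using A(1) by (simp add: nn_integral_cmult_indicator)
    qed
    have GA2: "ennreal m * emeasure lborel A \<le> ennreal q * (\<integral>\<^sup>+x. ennreal (norm (G x)) * indicator A x \<partial>lborel)"
    proof -
      have "continuous_on (cball x0 r) G" using G(1) r(2) continuous_on_subset by blast
      then have "(\<lambda>x. indicator (cball x0 r) x *\<^sub>R G x) \<in> borel_measurable borel"
        by (intro borel_measurable_continuous_on_indicator) auto
      then have "(\<lambda>x. ennreal (norm (indicator (cball x0 r) x *\<^sub>R G x)) * indicator A x) \<in> borel_measurable borel"
        using A(1) by measurable
      moreover have "(\<lambda>x. ennreal (norm (indicator (cball x0 r) x *\<^sub>R G x)) * indicator A x) = (\<lambda>x. ennreal (norm (G x)) * indicator A x)"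
        using AK by (auto simp: fun_eq_iff indicator_def)
      ultimately have [measurable]: "(\<lambda>x. ennreal (norm (G x)) * indicator A x) \<in> borel_measurable borel" by simp
      have "ennreal m * emeasure lborel A = (\<integral>\<^sup>+x. ennreal m * indicator A x \<partial>lborel)"
        using A(1) by (simp add: nn_integral_cmult_indicator)
      also have "\<dots> \<le> (\<integral>\<^sup>+x. ennreal q * (ennreal (norm (G x)) * indicator A x) \<partial>lborel)"
        using Gm AK q by (intro nn_integral_mono) (auto simp: indicator_def ennreal_mult[symmetric] intro!: ennreal_leI)
      finally show ?thesis by (simp add: nn_integral_cmult)
    qed
    have LA: "emeasure lborel (\<Psi> ` A) \<le> ennreal (q ^ DIM('a)) * emeasure lborel A"
      "emeasure lborel A \<le> ennreal (q ^ DIM('a)) * emeasure lborel (\<Psi> ` A)"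
      using fwd_lip[of A "DIM('a)"] inv_lip[of A "DIM('a)"] A(1) im by (auto simp: hausdorff_outer_eq_lborel)
    show ?thesis unfolding coarea_bounds_def
    proof (intro exI[of _ g] conjI allI gm)
      fix t
      have "g t \<le> ennreal (q ^ ?d) * ?H (A \<inter> {x. w x = t})" unfolding g_def im_level by (rule fwd_lip) auto
      also have "\<dots> \<le> ennreal C * ?H (A \<inter> {x. w x = t})" by (intro mult_right_mono cC) auto
      finally show "g t \<le> ennreal C * ?H (A \<inter> {x. w x = t})" .
      have "?H (A \<inter> {x. w x = t}) \<le> ennreal (q ^ ?d) * g t" unfolding g_def im_level by (rule inv_lip) auto
      also have "\<dots> \<le> ennreal C * g t" by (intro mult_right_mono cC) auto
      finally show "?H (A \<inter> {x. w x = t}) \<le> ennreal C * g t" .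
    next
      have "(\<integral>\<^sup>+t. g t \<partial>lborel) \<le> ennreal m * (ennreal (q ^ DIM('a)) * emeasure lborel A)"
        unfolding int_g by (intro mult_left_mono LA) auto
      also have "\<dots> = ennreal (q ^ DIM('a)) * (ennreal m * emeasure lborel A)" by (simp add: ac_simps)
      also have "\<dots> \<le> ennreal (q ^ DIM('a)) * (ennreal q * (\<integral>\<^sup>+x. ennreal (norm (G x)) * indicator A x \<partial>lborel))"
        by (intro mult_left_mono GA2) auto
      also have "\<dots> = ennreal C * (\<integral>\<^sup>+x. ennreal (norm (G x)) * indicator A x \<partial>lborel)"
        using q by (simp add: mult.assoc[symmetric] ennreal_mult[symmetric] qC[symmetric] mult.commute)
      finally show "(\<integral>\<^sup>+t. g t \<partial>lborel) \<le> \<dots>" .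
      have "(\<integral>\<^sup>+x. ennreal (norm (G x)) * indicator A x \<partial>lborel) \<le> ennreal (q * m) * (ennreal (q ^ DIM('a)) * emeasure lborel (\<Psi> ` A))"
        by (rule order_trans[OF GA1]) (intro mult_left_mono LA, auto)
      also have "\<dots> = ennreal C * (ennreal m * emeasure lborel (\<Psi> ` A))"
      proof -
        have "ennreal (q * m) * ennreal (q ^ DIM('a)) = ennreal C * ennreal m"
          using q m C by (simp add: ennreal_mult[symmetric] qC[symmetric] ac_simps)
        then show ?thesis by (simp add: mult.assoc[symmetric])
      qed
      finally show "(\<integral>\<^sup>+x. ennreal (norm (G x)) * indicator A x \<partial>lborel) \<le> ennreal C * (\<integral>\<^sup>+t. g t \<partial>lborel)"
        by (simp add: int_g)
    qed
  qed
  then show ?thesis using r(1) by blast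
qed

lemma hausdorff_outer_UN_disjoint:
  fixes A :: "nat \<Rightarrow> 'a::euclidean_space set"
  assumes "\<And>i. A i \<in> sets borel" "disjoint_family A"
  shows "hausdorff_outer_measure d (\<Union>i. A i) = (\<Sum>i. hausdorff_outer_measure d (A i))"
proof -
  have "(\<Sum>i. emeasure (hausdorff_measure d) (A i)) = emeasure (hausdorff_measure d) (\<Union>i. A i)"
    using assms by (intro suminf_emeasure) (auto intro: borel_sets_hausdorff)
  moreover have "(\<Union>i. A i) \<in> sets borel" using assms by auto
  ultimately show ?thesis using assms by (simp add: emeasure_hausdorff_borel)
qed

lemma coarea_bounds_UN:
  fixes w :: "'a::euclidean_space \<Rightarrow> real"
  assumes w: "w \<in> borel_measurable borel" and A: "\<And>n::nat. A n \<in> sets borel" "disjoint_family A"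
    and G: "\<And>n. (\<lambda>x. ennreal (norm (G x)) * indicator (A n) x) \<in> borel_measurable borel"
    and g: "\<And>n. coarea_bounds w G C (A n) (g n)"
  shows "coarea_bounds w G C (\<Union>n. A n) (\<lambda>t. \<Sum>n. g n t)"
proof -
  let ?H = "hausdorff_outer_measure (DIM('a) - 1) :: 'a set \<Rightarrow> ennreal"
  let ?m = "\<lambda>A. \<integral>\<^sup>+x. ennreal (norm (G x)) * indicator A x \<partial>lborel"
  have g: "g n \<in> borel_measurable borel"
    "g n t \<le> ennreal C * ?H (A n \<inter> {x. w x = t})"
    "?H (A n \<inter> {x. w x = t}) \<le> ennreal C * g n t"
    "(\<integral>\<^sup>+t. g n t \<partial>lborel) \<le> ennreal C * ?m (A n)"
    "?m (A n) \<le> ennreal C * (\<integral>\<^sup>+t. g n t \<partial>lborel)" for n t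
    using g[of n] unfolding coarea_bounds_def by blast+
  have level: "{x. w x = t} \<in> sets borel" for t
    using measurable_sets[OF w, of "{t}"] by (simp add: vimage_def)
  have HU: "?H ((\<Union>n. A n) \<inter> {x. w x = t}) = (\<Sum>n. ?H (A n \<inter> {x. w x = t}))" for t
  proof -
    have eq: "(\<Union>n. A n) \<inter> {x. w x = t} = (\<Union>n. A n \<inter> {x. w x = t})" by auto
    show ?thesis unfolding eq
    proof (rule hausdorff_outer_UN_disjoint)
      show "A n \<inter> {x. w x = t} \<in> sets borel" for n by (rule sets.Int[OF A(1) level])
      show "disjoint_family (\<lambda>n. A n \<inter> {x. w x = t})"
        using A(2) by (auto simp: disjoint_family_on_def)
    qed
  qed
  have mU: "?m (\<Union>n. A n) = (\<Sum>n. ?m (A n))"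
  proof -
    have eq: "ennreal (norm (G x)) * indicator (\<Union>n. A n) x = (\<Sum>n. ennreal (norm (G x)) * indicator (A n) x)" for x
      using suminf_indicator[OF A(2), of x] by simp
    show ?thesis unfolding eq using G by (intro nn_integral_suminf) auto
  qed
  show ?thesis unfolding coarea_bounds_def
  proof (intro conjI allI)
    show "(\<lambda>t. \<Sum>n. g n t) \<in> borel_measurable borel" using g(1) by measurable
    fix t
    have "(\<Sum>n. g n t) \<le> (\<Sum>n. ennreal C * ?H (A n \<inter> {x. w x = t}))" by (intro suminf_le allI g) auto
    then show "(\<Sum>n. g n t) \<le> ennreal C * ?H ((\<Union>n. A n) \<inter> {x. w x = t})" by (simp only: HU ennreal_suminf_cmult)
    have "(\<Sum>n. ?H (A n \<inter> {x. w x = t})) \<le> (\<Sum>n. ennreal C * g n t)" by (intro suminf_le allI g) auto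
    then show "?H ((\<Union>n. A n) \<inter> {x. w x = t}) \<le> ennreal C * (\<Sum>n. g n t)" by (simp only: HU ennreal_suminf_cmult)
  next
    have int: "(\<integral>\<^sup>+t. (\<Sum>n. g n t) \<partial>lborel) = (\<Sum>n. \<integral>\<^sup>+t. g n t \<partial>lborel)"
      using g(1) by (intro nn_integral_suminf) auto
    have "(\<Sum>n. \<integral>\<^sup>+t. g n t \<partial>lborel) \<le> (\<Sum>n. ennreal C * ?m (A n))" by (intro suminf_le allI g) auto
    then show "(\<integral>\<^sup>+t. (\<Sum>n. g n t) \<partial>lborel) \<le> ennreal C * ?m (\<Union>n. A n)" by (simp only: int mU ennreal_suminf_cmult)
    have "(\<Sum>n. ?m (A n)) \<le> (\<Sum>n. ennreal C * (\<integral>\<^sup>+t. g n t \<partial>lborel))" by (intro suminf_le allI g) auto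
    then show "?m (\<Union>n. A n) \<le> ennreal C * (\<integral>\<^sup>+t. (\<Sum>n. g n t) \<partial>lborel)" by (simp only: int mU ennreal_suminf_cmult)
  qed
qed

text \<open>Only the open set \<open>Z\<close> of regular points matters, since the density
  \<open>norm (G x)\<close> of the coarea formula vanishes elsewhere and the levels chosen later
  contain no critical point. The function \<open>w\<close> itself is global, which makes its levels
  Borel sets.\<close>

locale regular_function =
  fixes w :: "'a::euclidean_space \<Rightarrow> real" and G :: "'a \<Rightarrow> 'a" and Z :: "'a set"
  assumes open_Z: "open Z" and deriv: "\<And>x. x \<in> Z \<Longrightarrow> (w has_derivative (\<lambda>h. G x \<bullet> h)) (at x)"
    and cont_G: "continuous_on Z G" and nz: "\<And>x. x \<in> Z \<Longrightarrow> G x \<noteq> 0"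
    and w_borel [measurable]: "w \<in> borel_measurable borel"
begin

lemma borel_Z [measurable]: "Z \<in> sets borel" using open_Z by simp

lemma level_borel [measurable]: "{x. w x = t} \<in> sets borel"
  using measurable_sets[OF w_borel, of "{t}"] by (simp add: vimage_def)

lemma G_borel [measurable]: "(\<lambda>x. indicator Z x *\<^sub>R G x) \<in> borel_measurable borel"
  by (rule borel_measurable_continuous_on_indicator[OF _ cont_G]) simp

lemma norm_G_borel:
  assumes [measurable]: "A \<in> sets borel" and "A \<subseteq> Z"
  shows "(\<lambda>x. ennreal (norm (G x)) * indicator A x) \<in> borel_measurable borel"
proof -
  have "(\<lambda>x. ennreal (norm (indicator Z x *\<^sub>R G x)) * indicator A x) \<in> borel_measurable borel" by measurable
  moreover have "(\<lambda>x. ennreal (norm (indicator Z x *\<^sub>R G x)) * indicator A x) = (\<lambda>x. ennreal (norm (G x)) * indicator A x)"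
    using assms by (auto simp: fun_eq_iff indicator_def)
  ultimately show ?thesis by simp
qed

lemma comparable:
  assumes A: "A \<in> sets borel" "A \<subseteq> Z" and C: "1 < C"
  shows "\<exists>g. coarea_bounds w G C A g"
proof -
  have "\<forall>x\<in>Z. \<exists>r>0. \<forall>A\<in>sets borel. A \<subseteq> ball x r \<longrightarrow> (\<exists>g. coarea_bounds w G C A g)"
    using coarea_bounds_local[OF open_Z _ deriv cont_G nz C] by blast
  then obtain r where r: "\<And>x. x \<in> Z \<Longrightarrow> 0 < r x"
    "\<And>x A. x \<in> Z \<Longrightarrow> A \<in> sets borel \<Longrightarrow> A \<subseteq> ball x (r x) \<Longrightarrow> \<exists>g. coarea_bounds w G C A g" by metis
  let ?F = "(\<lambda>x. ball x (r x)) ` Z"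
  obtain F' where F': "F' \<subseteq> ?F" "countable F'" "\<Union>F' = \<Union>?F"
    by (rule Lindelof[of ?F]) auto
  \<comment> \<open>The empty set is added because an empty \<open>Z\<close> has an empty subcover,
    which no sequence enumerates.\<close>
  define S where "S = from_nat_into (insert {} F')"
  have rS: "range S = insert {} F'" unfolding S_def using F'(2) by (intro range_from_nat_into) auto
  have ZS: "Z \<subseteq> (\<Union>n. S n)"
  proof
    fix x assume "x \<in> Z"
    then have "x \<in> \<Union>F'" unfolding F'(3) using r(1) by force
    then show "x \<in> (\<Union>n. S n)" using rS by blast
  qed
  have "S n \<in> sets borel \<and> (\<forall>B\<in>sets borel. B \<subseteq> S n \<longrightarrow> (\<exists>g. coarea_bounds w G C B g))" for n
  proof -
    have "S n \<in> insert {} F'" using rS by auto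
    then consider "S n = {}" | x where "x \<in> Z" "S n = ball x (r x)" using F'(1) by auto
    then show ?thesis
    proof cases
      case 1
      have "coarea_bounds w G C {} (\<lambda>_. 0)" unfolding coarea_bounds_def by auto
      then show ?thesis using 1 by auto
    next
      case 2 then show ?thesis using r(2)[of x] by auto
    qed
  qed
  then have S: "S n \<in> sets borel" "B \<in> sets borel \<Longrightarrow> B \<subseteq> S n \<Longrightarrow> \<exists>g. coarea_bounds w G C B g" for n B by auto
  let ?A = "\<lambda>n. A \<inter> disjointed S n"
  have dS: "disjointed S n \<in> sets borel" for n
    using sets.range_disjointed_sets[of S borel] S(1) by blast
  have "\<exists>g. coarea_bounds w G C (?A n) g" for n
    using A dS disjointed_subset[of S n] by (intro S(2)[of _ n]) auto
  then obtain g where g: "\<And>n. coarea_bounds w G C (?A n) (g n)" by metis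
  have "coarea_bounds w G C (\<Union>n. ?A n) (\<lambda>t. \<Sum>n. g n t)"
  proof (rule coarea_bounds_UN[OF w_borel _ _ _ g])
    show "?A n \<in> sets borel" for n using A dS by auto
    show "disjoint_family ?A" using disjoint_family_disjointed[of S] by (auto simp: disjoint_family_on_def)
    show "(\<lambda>x. ennreal (norm (G x)) * indicator (?A n) x) \<in> borel_measurable borel" for n
      using A dS by (intro norm_G_borel) auto
  qed
  moreover have "(\<Union>n. ?A n) = A"
  proof -
    have "(\<Union>n. ?A n) = A \<inter> (\<Union>n. S n)" using UN_disjointed_eq[of S] by blast
    moreover have "A \<subseteq> (\<Union>n. S n)" by (rule order_trans[OF A(2) ZS])
    ultimately show ?thesis by (simp only: Int_absorb2)
  qed
  ultimately show ?thesis by auto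
qed

text \<open>The bounds hold for every factor above 1, so both inequalities become equalities as the
  factors \<open>C n\<close> tend to 1. The measure of the levels is the infimum of the measurable
  functions \<open>C n * g n\<close>, which proves its measurability.\<close>

lemma coarea_set:
  assumes A: "A \<in> sets borel" "A \<subseteq> Z"
  shows "(\<lambda>t. hausdorff_outer_measure (DIM('a) - 1) (A \<inter> {x. w x = t})) \<in> borel_measurable borel" (is ?m)
    and "(\<integral>\<^sup>+t. hausdorff_outer_measure (DIM('a) - 1) (A \<inter> {x. w x = t}) \<partial>lborel)
        = (\<integral>\<^sup>+x. ennreal (norm (G x)) * indicator A x \<partial>lborel)" (is ?e)
proof -
  let ?h = "\<lambda>t. hausdorff_outer_measure (DIM('a) - 1) (A \<inter> {x. w x = t})"
  let ?J = "\<integral>\<^sup>+x. ennreal (norm (G x)) * indicator A x \<partial>lborel"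
  define C where "C n = 1 + 1 / real (Suc n)" for n
  have C1: "1 < C n" for n by (simp add: C_def)
  have C: "C \<longlonglongrightarrow> 1" unfolding C_def
    using tendsto_add[OF tendsto_const[of 1] LIMSEQ_inverse_real_of_nat] by (simp add: inverse_eq_divide)
  obtain g where "\<And>n. coarea_bounds w G (C n) A (g n)" using comparable[OF A C1] by metis
  then have g: "g n \<in> borel_measurable borel" "g n t \<le> ennreal (C n) * ?h t"
    "?h t \<le> ennreal (C n) * g n t"
    "(\<integral>\<^sup>+t. g n t \<partial>lborel) \<le> ennreal (C n) * ?J" "?J \<le> ennreal (C n) * (\<integral>\<^sup>+t. g n t \<partial>lborel)" for n t
    unfolding coarea_bounds_def by blast+
  \<comment> \<open>The factor occurs twice because the two quantities are compared through
    \<open>g n\<close> and each of the two comparisons costs one factor.\<close>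
  have lim: "x = y" if "\<And>n. x \<le> ennreal (C n) * (ennreal (C n) * y)" "\<And>n. y \<le> ennreal (C n) * (ennreal (C n) * x)" for x y
  proof -
    have le: "x \<le> y" if "\<And>n. x \<le> ennreal (C n) * (ennreal (C n) * y)" for x y
    proof (cases "y = top")
      case False
      have "(\<lambda>n. ennreal (C n) * (ennreal (C n) * y)) \<longlonglongrightarrow> ennreal 1 * (ennreal 1 * y)"
        using C False by (intro tendsto_mult_ennreal tendsto_ennrealI tendsto_const)
           (auto simp: ennreal_mult_eq_top_iff)
      then show ?thesis using that by (intro LIMSEQ_le_const[of _ y x]) auto
    qed auto
    show ?thesis using le that by (intro antisym) blast+
  qed
  have h_eq: "?h t = (INF n. ennreal (C n) * g n t)" for t
  proof (rule lim)
    fix n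
    have "?h t \<le> (INF n. ennreal (C n) * g n t)" by (intro INF_greatest g)
    also have "\<dots> \<le> ennreal (C n) * (ennreal (C n) * (INF n. ennreal (C n) * g n t))"
    proof -
      have "1 * (1 * (INF n. ennreal (C n) * g n t)) \<le> ennreal (C n) * (ennreal (C n) * (INF n. ennreal (C n) * g n t))"
        using C1[of n] by (intro mult_mono) auto
      then show ?thesis by simp
    qed
    finally show "?h t \<le> ennreal (C n) * (ennreal (C n) * (INF n. ennreal (C n) * g n t))" .
    have "(INF n. ennreal (C n) * g n t) \<le> ennreal (C n) * g n t" by (rule INF_lower) simp
    also have "\<dots> \<le> ennreal (C n) * (ennreal (C n) * ?h t)" by (intro mult_left_mono g) auto
    finally show "(INF n. ennreal (C n) * g n t) \<le> ennreal (C n) * (ennreal (C n) * ?h t)" .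
  qed
  show m: ?m unfolding h_eq using g(1) by measurable
  show ?e
  proof (rule lim)
    fix n
    have "(\<integral>\<^sup>+t. ?h t \<partial>lborel) \<le> (\<integral>\<^sup>+t. ennreal (C n) * g n t \<partial>lborel)" by (intro nn_integral_mono g)
    also have "\<dots> = ennreal (C n) * (\<integral>\<^sup>+t. g n t \<partial>lborel)" using g(1) by (intro nn_integral_cmult) auto
    also have "\<dots> \<le> ennreal (C n) * (ennreal (C n) * ?J)" by (intro mult_left_mono g) auto
    finally show "(\<integral>\<^sup>+t. ?h t \<partial>lborel) \<le> ennreal (C n) * (ennreal (C n) * ?J)" .
    have "?J \<le> ennreal (C n) * (\<integral>\<^sup>+t. g n t \<partial>lborel)" by (rule g)
    also have "\<dots> \<le> ennreal (C n) * (\<integral>\<^sup>+t. ennreal (C n) * ?h t \<partial>lborel)"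
      by (intro mult_left_mono nn_integral_mono g) auto
    also have "\<dots> = ennreal (C n) * (ennreal (C n) * (\<integral>\<^sup>+t. ?h t \<partial>lborel))"
      using m by (subst nn_integral_cmult) auto
    finally show "?J \<le> ennreal (C n) * (ennreal (C n) * (\<integral>\<^sup>+t. ?h t \<partial>lborel))" .
  qed
qed

lemma hausdorff_measurable_of_borel:
  "f \<in> borel_measurable borel \<Longrightarrow> f \<in> borel_measurable (hausdorff_measure d :: 'a measure)"
  for f :: "'a \<Rightarrow> 'b::topological_space"
proof (rule measurableI)
  fix A :: "'b set" assume "f \<in> borel_measurable borel" "A \<in> sets borel"
  then have "f -` A \<inter> space borel \<in> sets borel" by (rule measurable_sets)
  then show "f -` A \<inter> space (hausdorff_measure d) \<in> sets (hausdorff_measure d)"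
    by (simp add: borel_sets_hausdorff)
qed simp

text \<open>Measurability and equality are carried through one induction, since each step for the
  equality integrates inner integrals whose measurability is the other half of the
  hypothesis.\<close>

lemma coarea:
  fixes f :: "'a \<Rightarrow> ennreal"
  assumes f: "f \<in> borel_measurable borel"
  shows "(\<lambda>t. \<integral>\<^sup>+x. f x * indicator (Z \<inter> {x. w x = t}) x \<partial>hausdorff_measure (DIM('a) - 1)) \<in> borel_measurable borel
    \<and> (\<integral>\<^sup>+t. (\<integral>\<^sup>+x. f x * indicator (Z \<inter> {x. w x = t}) x \<partial>hausdorff_measure (DIM('a) - 1)) \<partial>lborel)
      = (\<integral>\<^sup>+x. f x * (ennreal (norm (G x)) * indicator Z x) \<partial>lborel)"
  using f
proof (induction rule: borel_measurable_induct)
  case (cong f g)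
  then have "f = g" by (auto simp: fun_eq_iff)
  then show ?case using cong by simp
next
  case (set A)
  have eq: "(\<integral>\<^sup>+x. indicator A x * indicator (Z \<inter> {x. w x = t}) x \<partial>hausdorff_measure (DIM('a) - 1))
     = hausdorff_outer_measure (DIM('a) - 1) ((A \<inter> Z) \<inter> {x. w x = t})" for t
  proof -
    have m: "(A \<inter> Z) \<inter> {x. w x = t} \<in> sets borel" using set by auto
    have "(\<integral>\<^sup>+x. indicator A x * indicator (Z \<inter> {x. w x = t}) x \<partial>hausdorff_measure (DIM('a) - 1))
      = (\<integral>\<^sup>+x. indicator ((A \<inter> Z) \<inter> {x. w x = t}) x \<partial>hausdorff_measure (DIM('a) - 1))"
      by (intro nn_integral_cong) (auto simp: indicator_def)
    also have "\<dots> = emeasure (hausdorff_measure (DIM('a) - 1)) ((A \<inter> Z) \<inter> {x. w x = t})"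
      using borel_sets_hausdorff[OF m] by simp
    finally show ?thesis using m by (simp add: emeasure_hausdorff_borel)
  qed
  have "(\<integral>\<^sup>+x. indicator A x * (ennreal (norm (G x)) * indicator Z x) \<partial>lborel) = (\<integral>\<^sup>+x. ennreal (norm (G x)) * indicator (A \<inter> Z) x \<partial>lborel)"
    by (intro nn_integral_cong) (auto simp: indicator_def)
  then show ?case unfolding eq using coarea_set[of "A \<inter> Z"] set by simp
next
  case (mult u c)
  have hm: "(\<lambda>x. u x * indicator (Z \<inter> {x. w x = t}) x) \<in> borel_measurable (hausdorff_measure (DIM('a) - 1))" for t
    by (rule hausdorff_measurable_of_borel) (use mult(2) in measurable)
  have "(\<integral>\<^sup>+x. (c * u x) * indicator (Z \<inter> {x. w x = t}) x \<partial>hausdorff_measure (DIM('a) - 1))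
    = c * (\<integral>\<^sup>+x. u x * indicator (Z \<inter> {x. w x = t}) x \<partial>hausdorff_measure (DIM('a) - 1))" for t
    unfolding mult.assoc by (intro nn_integral_cmult hm)
  moreover have "(\<integral>\<^sup>+x. (c * u x) * (ennreal (norm (G x)) * indicator Z x) \<partial>lborel)
     = c * (\<integral>\<^sup>+x. u x * (ennreal (norm (G x)) * indicator Z x) \<partial>lborel)"
    unfolding mult.assoc using mult(2) norm_G_borel[of Z] by (intro nn_integral_cmult) auto
  moreover note [measurable] = conjunct1[OF mult(4)]
  have "(\<lambda>t. c * (\<integral>\<^sup>+x. u x * indicator (Z \<inter> {x. w x = t}) x \<partial>hausdorff_measure (DIM('a) - 1))) \<in> borel_measurable borel"
    by measurable
  ultimately show ?case using mult(4) by (simp add: nn_integral_cmult)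
next
  case (add u v)
  have hm: "(\<lambda>x. u x * indicator (Z \<inter> {x. w x = t}) x) \<in> borel_measurable (hausdorff_measure (DIM('a) - 1))"
    if "u \<in> borel_measurable borel" for t and u :: "'a \<Rightarrow> ennreal"
    by (rule hausdorff_measurable_of_borel) (use that in measurable)
  have "(\<integral>\<^sup>+x. (v x + u x) * indicator (Z \<inter> {x. w x = t}) x \<partial>hausdorff_measure (DIM('a) - 1))
    = (\<integral>\<^sup>+x. v x * indicator (Z \<inter> {x. w x = t}) x \<partial>hausdorff_measure (DIM('a) - 1))
     + (\<integral>\<^sup>+x. u x * indicator (Z \<inter> {x. w x = t}) x \<partial>hausdorff_measure (DIM('a) - 1))" for t
    unfolding distrib_right using add by (intro nn_integral_add hm)
  moreover have "(\<integral>\<^sup>+x. (v x + u x) * (ennreal (norm (G x)) * indicator Z x) \<partial>lborel)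
     = (\<integral>\<^sup>+x. v x * (ennreal (norm (G x)) * indicator Z x) \<partial>lborel) + (\<integral>\<^sup>+x. u x * (ennreal (norm (G x)) * indicator Z x) \<partial>lborel)"
    unfolding distrib_right using add norm_G_borel[of Z] by (intro nn_integral_add) auto
  moreover note [measurable] = conjunct1[OF add(6)] conjunct1[OF add(7)]
  have "(\<lambda>t. (\<integral>\<^sup>+x. v x * indicator (Z \<inter> {x. w x = t}) x \<partial>hausdorff_measure (DIM('a) - 1))
     + (\<integral>\<^sup>+x. u x * indicator (Z \<inter> {x. w x = t}) x \<partial>hausdorff_measure (DIM('a) - 1))) \<in> borel_measurable borel"
    by measurable
  ultimately show ?case using add(6,7) by (simp add: nn_integral_add)
next
  case (seq U)
  have hm: "(\<lambda>x. u x * indicator (Z \<inter> {x. w x = t}) x) \<in> borel_measurable (hausdorff_measure (DIM('a) - 1))"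
    if "u \<in> borel_measurable borel" for t and u :: "'a \<Rightarrow> ennreal"
    by (rule hausdorff_measurable_of_borel) (use that in measurable)
  have sup: "(\<integral>\<^sup>+x. (SUP i. U i) x * indicator (Z \<inter> {x. w x = t}) x \<partial>hausdorff_measure (DIM('a) - 1))
    = (SUP i. \<integral>\<^sup>+x. U i x * indicator (Z \<inter> {x. w x = t}) x \<partial>hausdorff_measure (DIM('a) - 1))" for t
    unfolding SUP_apply SUP_mult_right_ennreal using seq(1,3)
    by (intro nn_integral_monotone_convergence_SUP hm)
       (auto intro!: mult_right_mono simp: incseq_def le_fun_def)
  have inc: "incseq (\<lambda>i t. \<integral>\<^sup>+x. U i x * indicator (Z \<inter> {x. w x = t}) x \<partial>hausdorff_measure (DIM('a) - 1))"
    using seq(3) by (auto simp: incseq_def le_fun_def intro!: nn_integral_mono mult_right_mono)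
  have "(\<integral>\<^sup>+x. (SUP i. U i) x * (ennreal (norm (G x)) * indicator Z x) \<partial>lborel)
    = (SUP i. \<integral>\<^sup>+x. U i x * (ennreal (norm (G x)) * indicator Z x) \<partial>lborel)"
    unfolding SUP_apply SUP_mult_right_ennreal using seq(1,3) norm_G_borel[of Z]
    by (intro nn_integral_monotone_convergence_SUP) (auto intro!: mult_right_mono simp: incseq_def le_fun_def)
  moreover have [measurable]: "(\<lambda>t. \<integral>\<^sup>+x. U i x * indicator (Z \<inter> {x. w x = t}) x \<partial>hausdorff_measure (DIM('a) - 1))
      \<in> borel_measurable borel" for i
    using seq.IH by blast
  have "(\<lambda>t. SUP i. \<integral>\<^sup>+x. U i x * indicator (Z \<inter> {x. w x = t}) x \<partial>hausdorff_measure (DIM('a) - 1))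
      \<in> borel_measurable borel"
    by measurable
  ultimately show ?case unfolding sup using seq.IH inc
    by (subst nn_integral_monotone_convergence_SUP) auto
qed

end

section \<open>Smooth functions\<close>

lemma frechet_derivative_eq: "(f has_derivative D) (at x) \<Longrightarrow> frechet_derivative f (at x) = D"
  by (rule frechet_derivative_at[symmetric])

lemma Ck_on_cong:
  assumes "open S" "\<And>x. x \<in> S \<Longrightarrow> f x = g x"
  shows "Ck_on k S f \<longleftrightarrow> Ck_on k S g"
  using assms(2)
proof (induction k arbitrary: f g)
  case 0 then show ?case using continuous_on_cong[of S S f g] by simp
next
  case (Suc k)
  have *: "(f has_derivative D) (at x) \<longleftrightarrow> (g has_derivative D) (at x)" if "x \<in> S" for x D
    using has_derivative_transform_within_open[OF _ assms(1) that, of f D UNIV g]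
      has_derivative_transform_within_open[OF _ assms(1) that, of g D UNIV f] Suc.prems that by auto
  then have "f differentiable (at x) \<longleftrightarrow> g differentiable (at x)" if "x \<in> S" for x
    using that by (simp add: differentiable_def)
  moreover have "frechet_derivative f (at x) = frechet_derivative g (at x)" if "x \<in> S" for x
    unfolding frechet_derivative_def using *[OF that] by simp
  then have "Ck_on k S (\<lambda>x. frechet_derivative f (at x) b) \<longleftrightarrow> Ck_on k S (\<lambda>x. frechet_derivative g (at x) b)" for b
    by (intro Suc.IH) simp
  ultimately show ?case by simp
qed

text \<open>\<open>Ck_on\<close> refers to \<open>frechet_derivative\<close>, while proofs provide
  an explicit derivative on \<open>S\<close> only. On an open set the two agree near every point, so
  one may replace the other at all higher orders too.\<close>

lemma Ck_on_SucI:
  assumes "open S" "\<And>x. x \<in> S \<Longrightarrow> (f has_derivative D x) (at x)" "\<And>b. b \<in> Basis \<Longrightarrow> Ck_on k S (\<lambda>x. D x b)"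
  shows "Ck_on (Suc k) S f"
proof -
  have "Ck_on k S (\<lambda>x. frechet_derivative f (at x) b) \<longleftrightarrow> Ck_on k S (\<lambda>x. D x b)" for b
    by (rule Ck_on_cong[OF assms(1)]) (simp add: frechet_derivative_eq[OF assms(2)])
  then show ?thesis using assms(2,3) by (auto simp: differentiable_def)
qed

lemma Ck_on_SucD:
  assumes "Ck_on (Suc k) S f" "x \<in> S"
  shows "(f has_derivative frechet_derivative f (at x)) (at x)"
  using assms by (simp add: frechet_derivative_works)

lemma Ck_on_Suc_imp: "Ck_on (Suc k) S f \<Longrightarrow> Ck_on k S f"
proof (induction k arbitrary: f)
  case 0
  then show ?case
    by (auto intro!: differentiable_imp_continuous_on differentiable_at_imp_differentiable_on)
qed auto

lemma Ck_on_subset: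
  assumes "T \<subseteq> S" shows "Ck_on k S f \<Longrightarrow> Ck_on k T f"
proof (induction k arbitrary: f)
  case 0
  then have "continuous_on S f" by simp
  then have "continuous_on T f" using assms by (rule continuous_on_subset)
  then show ?case by simp
next
  case (Suc k)
  have "Ck_on k T (\<lambda>x. frechet_derivative f (at x) b)" if "b \<in> Basis" for b
    by (rule Suc.IH) (use Suc.prems that in simp)
  then show ?case using Suc.prems assms by auto
qed

lemma Ck_on_locally:
  assumes "\<And>x. x \<in> S \<Longrightarrow> \<exists>T. open T \<and> x \<in> T \<and> Ck_on k T f"
  shows "Ck_on k S f"
  using assms
proof (induction k arbitrary: f)
  case 0
  have "continuous (at x within S) f" if "x \<in> S" for x
    using 0[OF that] by (auto simp: continuous_on_eq_continuous_at intro: continuous_at_imp_continuous_within)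
  then show ?case by (simp add: continuous_on_eq_continuous_within)
next
  case (Suc k)
  have "f differentiable (at x)" if "x \<in> S" for x using Suc.prems[OF that] by auto
  moreover have "Ck_on k S (\<lambda>x. frechet_derivative f (at x) b)" if "b \<in> Basis" for b
  proof (rule Suc.IH)
    fix x assume "x \<in> S"
    from Suc.prems[OF this] obtain T where "open T" "x \<in> T" "Ck_on (Suc k) T f" by blast
    then show "\<exists>T. open T \<and> x \<in> T \<and> Ck_on k T (\<lambda>x. frechet_derivative f (at x) b)"
      using that by (intro exI[of _ T]) simp
  qed
  ultimately show ?case by simp
qed

lemma Ck_on_const: "open S \<Longrightarrow> Ck_on k S (\<lambda>_. c)"
proof (induction k arbitrary: c)
  case (Suc k)
  then show ?case by (intro Ck_on_SucI[where D = "\<lambda>_ _. 0"]) auto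
qed auto

lemma Ck_on_inner: "open S \<Longrightarrow> Ck_on k S (\<lambda>x. x \<bullet> c)"
proof (cases k)
  case (Suc n)
  assume "open S"
  then show ?thesis unfolding Suc
    by (intro Ck_on_SucI[where D = "\<lambda>_ h. h \<bullet> c"] Ck_on_const) (auto intro!: derivative_eq_intros)
qed (auto intro: continuous_intros)

lemma Ck_on_add: "open S \<Longrightarrow> Ck_on k S f \<Longrightarrow> Ck_on k S g \<Longrightarrow> Ck_on k S (\<lambda>x. f x + g x)"
proof (induction k arbitrary: f g)
  case (Suc k)
  show ?case
  proof (rule Ck_on_SucI)
    fix x assume "x \<in> S"
    then show "((\<lambda>x. f x + g x) has_derivative (\<lambda>h. frechet_derivative f (at x) h + frechet_derivative g (at x) h)) (at x)"
      using Suc.prems by (intro has_derivative_add Ck_on_SucD)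
  qed (use Suc in auto)
qed (auto intro: continuous_intros)

lemma Ck_on_mult: "open S \<Longrightarrow> Ck_on k S f \<Longrightarrow> Ck_on k S g \<Longrightarrow> Ck_on k S (\<lambda>x. f x * g x)"
proof (induction k arbitrary: f g)
  case (Suc k)
  show ?case
  proof (rule Ck_on_SucI)
    fix x assume "x \<in> S"
    then show "((\<lambda>x. f x * g x) has_derivative (\<lambda>h. f x * frechet_derivative g (at x) h + frechet_derivative f (at x) h * g x)) (at x)"
      using Suc.prems by (intro has_derivative_mult Ck_on_SucD)
  next
    have "Ck_on k S f" "Ck_on k S g" using Suc.prems Ck_on_Suc_imp by blast+
    then show "Ck_on k S (\<lambda>x. f x * frechet_derivative g (at x) b + frechet_derivative f (at x) b * g x)" if "b \<in> Basis" for b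
      using Suc that by (intro Ck_on_add Suc.IH) auto
  qed (use Suc in auto)
qed (auto intro: continuous_intros)

lemma Ck_on_sum: "open S \<Longrightarrow> (\<And>i. i \<in> I \<Longrightarrow> Ck_on k S (f i)) \<Longrightarrow> Ck_on k S (\<lambda>x. \<Sum>i\<in>I. f i x)"
proof (induction I rule: infinite_finite_induct)
  case (insert i I)
  have "Ck_on k S (\<lambda>x. f i x + (\<Sum>i\<in>I. f i x))"
    by (rule Ck_on_add) (use insert in simp_all)
  then show ?case using insert.hyps by simp
qed (simp_all add: Ck_on_const)

lemma Ck_on_compose_real:
  fixes g :: "real \<Rightarrow> real" and f :: "'b::euclidean_space \<Rightarrow> real"
  assumes "open S"
  shows "Ck_on k UNIV g \<Longrightarrow> Ck_on k S f \<Longrightarrow> Ck_on k S (\<lambda>x. g (f x))"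
proof (induction k arbitrary: f g)
  case 0 then show ?case using continuous_on_compose2[of UNIV g S f] by auto
next
  case (Suc k)
  show ?case
  proof (rule Ck_on_SucI[OF assms])
    fix x assume x: "x \<in> S"
    have g: "(g has_derivative frechet_derivative g (at (f x))) (at (f x))" by (rule Ck_on_SucD[OF Suc.prems(1)]) simp
    then have lin: "frechet_derivative g (at (f x)) y = frechet_derivative g (at (f x)) 1 * y" for y
      using linear_scale[OF has_derivative_linear[OF g], of y 1] by simp
    have "((\<lambda>x. g (f x)) has_derivative (\<lambda>h. frechet_derivative g (at (f x)) (frechet_derivative f (at x) h))) (at x)"
      using has_derivative_compose[OF Ck_on_SucD[OF Suc.prems(2) x] g] .
    then show "((\<lambda>x. g (f x)) has_derivative (\<lambda>h. frechet_derivative g (at (f x)) 1 * frechet_derivative f (at x) h)) (at x)"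
      by (simp only: lin[of "frechet_derivative f (at x) h" for h])
  next
    fix b :: 'b assume b: "b \<in> Basis"
    have g': "Ck_on k UNIV (\<lambda>y. frechet_derivative g (at y) 1)" using Suc.prems(1) by simp
    have "Ck_on k S f" using Suc.prems(2) by (rule Ck_on_Suc_imp)
    from Suc.IH[OF g' this]
    show "Ck_on k S (\<lambda>x. frechet_derivative g (at (f x)) 1 * frechet_derivative f (at x) b)"
      using Suc.prems(2) b by (intro Ck_on_mult[OF assms]) simp_all
  qed
qed

lemma Ck_on_real_SucI:
  fixes g :: "real \<Rightarrow> real"
  assumes "\<And>x. (g has_real_derivative g' x) (at x)" "Ck_on k UNIV g'"
  shows "Ck_on (Suc k) UNIV g"
  by (rule Ck_on_SucI[where D = "\<lambda>x h. g' x * h"]) (use assms in \<open>auto simp: has_field_derivative_def\<close>)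

lemma Ck_on_compose_affine:
  fixes f :: "'a::euclidean_space \<Rightarrow> real"
  shows "Ck_on k UNIV f \<Longrightarrow> Ck_on k UNIV (\<lambda>x. f (a + c *\<^sub>R x))"
proof (induction k arbitrary: f)
  case 0
  have "continuous_on UNIV (\<lambda>x. a + c *\<^sub>R x)" by (intro continuous_intros)
  then show ?case using 0 continuous_on_compose2[of UNIV f UNIV "\<lambda>x. a + c *\<^sub>R x"] by simp
next
  case (Suc k)
  show ?case
  proof (rule Ck_on_SucI[OF open_UNIV])
    fix x
    have f: "(f has_derivative frechet_derivative f (at (a + c *\<^sub>R x))) (at (a + c *\<^sub>R x))"
      by (rule Ck_on_SucD[OF Suc.prems(1)]) simp
    have "((\<lambda>x. a + c *\<^sub>R x) has_derivative (\<lambda>h. c *\<^sub>R h)) (at x)" by (auto intro!: derivative_eq_intros)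
    from has_derivative_compose[OF this f]
    show "((\<lambda>x. f (a + c *\<^sub>R x)) has_derivative (\<lambda>h. c * frechet_derivative f (at (a + c *\<^sub>R x)) h)) (at x)"
      using linear_scale[OF has_derivative_linear[OF f], of c] by simp
  next
    fix b :: 'a assume "b \<in> Basis"
    then have "Ck_on k UNIV (\<lambda>x. frechet_derivative f (at x) b)" using Suc.prems by simp
    from Suc.IH[OF this] show "Ck_on k UNIV (\<lambda>x. c * frechet_derivative f (at (a + c *\<^sub>R x)) b)"
      by (intro Ck_on_mult Ck_on_const open_UNIV)
  qed
qed

lemma smooth_onI: "(\<And>k. Ck_on k S f) \<Longrightarrow> smooth_on S f"
  and smooth_onD: "smooth_on S f \<Longrightarrow> Ck_on k S f"
  by (simp_all add: smooth_on_def)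

lemma smooth_on_const: "open S \<Longrightarrow> smooth_on S (\<lambda>_. c)"
  by (rule smooth_onI, rule Ck_on_const)

lemma smooth_on_inner: "open S \<Longrightarrow> smooth_on S (\<lambda>x. x \<bullet> v)"
  by (rule smooth_onI, rule Ck_on_inner)

lemma smooth_on_add: "open S \<Longrightarrow> smooth_on S f \<Longrightarrow> smooth_on S g \<Longrightarrow> smooth_on S (\<lambda>x. f x + g x)"
  by (rule smooth_onI, rule Ck_on_add, assumption, (erule smooth_onD)+)

lemma smooth_on_mult: "open S \<Longrightarrow> smooth_on S f \<Longrightarrow> smooth_on S g \<Longrightarrow> smooth_on S (\<lambda>x. f x * g x)"
  by (rule smooth_onI, rule Ck_on_mult, assumption, (erule smooth_onD)+)

lemma smooth_on_sum:
  "open S \<Longrightarrow> (\<And>i. i \<in> I \<Longrightarrow> smooth_on S (f i)) \<Longrightarrow> smooth_on S (\<lambda>x. \<Sum>i\<in>I. f i x)"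
  by (rule smooth_onI, rule Ck_on_sum, assumption, rule smooth_onD)

lemma smooth_on_compose_real:
  fixes g :: "real \<Rightarrow> real"
  shows "open S \<Longrightarrow> smooth_on UNIV g \<Longrightarrow> smooth_on S f \<Longrightarrow> smooth_on S (\<lambda>x. g (f x))"
  by (rule smooth_onI, rule Ck_on_compose_real, assumption, (erule smooth_onD)+)

lemma smooth_on_compose_affine: "smooth_on UNIV f \<Longrightarrow> smooth_on UNIV (\<lambda>x. f (a + c *\<^sub>R x))"
  by (rule smooth_onI, rule Ck_on_compose_affine, erule smooth_onD)

lemma smooth_on_subset: "smooth_on S f \<Longrightarrow> T \<subseteq> S \<Longrightarrow> smooth_on T f"
  by (rule smooth_onI, rule Ck_on_subset, assumption, erule smooth_onD)

lemma smooth_on_minus: "open S \<Longrightarrow> smooth_on S f \<Longrightarrow> smooth_on S g \<Longrightarrow> smooth_on S (\<lambda>x. f x - g x)"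
  using smooth_on_add[of S f "\<lambda>x. (-1) * g x"] smooth_on_mult[of S "\<lambda>_. -1" g] smooth_on_const[of S "-1"] by simp

text \<open>Bootstrapping: a differential equation that expresses \<open>g'\<close> through
  \<open>g\<close> gives \<open>g'\<close> the regularity already known for \<open>g\<close>, and
  thus \<open>g\<close> one order more. For \<open>tanh\<close> the equation is
  \<open>tanh' = 1 - tanh * tanh\<close>.\<close>

lemma smooth_on_real_ODE:
  fixes g :: "real \<Rightarrow> real"
  assumes "\<And>x. (g has_real_derivative g' x) (at x)" "\<And>k. Ck_on k UNIV g \<Longrightarrow> Ck_on k UNIV g'"
  shows "smooth_on UNIV g"
  unfolding smooth_on_def
proof
  fix k show "Ck_on k UNIV g"
  proof (induction k)
    case 0
    have "continuous_on UNIV g" using assms(1) by (intro continuous_at_imp_continuous_on ballI) (rule DERIV_isCont)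
    then show ?case by simp
  next
    case (Suc k) show ?case by (rule Ck_on_real_SucI[OF assms(1) assms(2)[OF Suc]])
  qed
qed

lemma smooth_on_tanh: "smooth_on UNIV (tanh :: real \<Rightarrow> real)"
proof (rule smooth_on_real_ODE)
  show "(tanh has_real_derivative 1 + (-1) * (tanh x * tanh x)) (at x)" for x :: real
    by (auto intro!: derivative_eq_intros simp: power2_eq_square)
  show "Ck_on k UNIV (\<lambda>x. 1 + (-1) * (tanh x * tanh x))" if "Ck_on k UNIV (tanh :: real \<Rightarrow> real)" for k
    using that by (intro Ck_on_add Ck_on_mult Ck_on_const) auto
qed

lemma smooth_on_deriv:
  assumes "smooth_on S f" "b \<in> Basis"
  shows "smooth_on S (\<lambda>x. frechet_derivative f (at x) b)"
  using assms unfolding smooth_on_def by (metis Ck_on.simps(2))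

lemma smooth_on_has_derivative:
  "smooth_on S f \<Longrightarrow> x \<in> S \<Longrightarrow> (f has_derivative frechet_derivative f (at x)) (at x)"
  unfolding smooth_on_def using Ck_on_SucD by blast

lemma smooth_on_continuous: "smooth_on S f \<Longrightarrow> continuous_on S f"
  unfolding smooth_on_def by (metis Ck_on.simps(1))

lemma grad_inner:
  assumes "(f has_derivative D) (at x)"
  shows "grad f x \<bullet> h = D h"
proof -
  have lin: "linear D" using assms has_derivative_linear by blast
  have "D h = D (\<Sum>b\<in>Basis. (h \<bullet> b) *\<^sub>R b)" by (simp add: euclidean_representation)
  also have "\<dots> = (\<Sum>b\<in>Basis. (h \<bullet> b) * D b)" by (simp add: linear_sum[OF lin] linear_scale[OF lin])
  also have "\<dots> = (\<Sum>b\<in>Basis. D b * (b \<bullet> h))" by (simp add: inner_commute[of h] mult.commute)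
  finally show ?thesis
    by (simp add: grad_def frechet_derivative_eq[OF assms] inner_sum_left)
qed

lemma grad_eqI: "(f has_derivative (\<lambda>h. g \<bullet> h)) (at x) \<Longrightarrow> grad f x = g"
  by (metis grad_inner vector_eq_rdot)

lemma has_derivative_grad:
  "(f has_derivative D) (at x) \<Longrightarrow> (f has_derivative (\<lambda>h. grad f x \<bullet> h)) (at x)"
  using grad_inner[of f D x] by simp

lemma smooth_has_derivative_grad:
  "smooth_on S f \<Longrightarrow> x \<in> S \<Longrightarrow> (f has_derivative (\<lambda>h. grad f x \<bullet> h)) (at x)"
  by (rule has_derivative_grad[OF smooth_on_has_derivative])

lemma continuous_on_grad: "smooth_on S f \<Longrightarrow> continuous_on S (grad f)"
  unfolding grad_def by (intro continuous_intros smooth_on_continuous smooth_on_deriv)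

lemma grad_mult:
  assumes "(f has_derivative (\<lambda>h. a \<bullet> h)) (at x)" "(g has_derivative (\<lambda>h. b \<bullet> h)) (at x)"
  shows "grad (\<lambda>x. f x * g x) x = f x *\<^sub>R b + g x *\<^sub>R a"
  by (rule grad_eqI, rule has_derivative_eq_rhs[OF has_derivative_mult[OF assms]])
     (auto simp: inner_add_left algebra_simps)

section \<open>Bump functions and smooth cutoffs\<close>

definition smooth_step :: "nat \<Rightarrow> real \<Rightarrow> real" where
  "smooth_step m s = (if 0 < s then exp (- 1 / s) / s ^ m else 0)"

lemma smooth_step_tendsto_0: "(smooth_step m \<longlongrightarrow> 0) (at_right 0)"
proof -
  have "((\<lambda>y::real. y ^ m / exp y) \<longlongrightarrow> 0) at_top" by (rule tendsto_power_div_exp_0)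
  then have "((\<lambda>s::real. inverse s ^ m / exp (inverse s)) \<longlongrightarrow> 0) (at_right 0)"
    by (rule filterlim_compose[OF _ filterlim_inverse_at_top_right])
  moreover have "eventually (\<lambda>s. inverse s ^ m / exp (inverse s) = smooth_step m s) (at_right 0)"
    by (auto simp: smooth_step_def eventually_at_right_field exp_minus field_simps power_inverse intro!: exI[of _ 1])
  ultimately show ?thesis using tendsto_cong by force
qed

text \<open>The exponent \<open>m\<close> is a parameter because the family is then closed under
  differentiation up to linear combinations. Smoothness follows by one induction over the order, for
  all \<open>m\<close> at once, including the point 0.\<close>

lemma DERIV_smooth_step:
  "(smooth_step m has_real_derivative smooth_step (m + 2) s + (- real m) * smooth_step (m + 1) s) (at s)"
proof -
  consider "0 < s" | "s < 0" | "s = 0" by linarith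
  then show ?thesis
  proof cases
    case 1
    have "((\<lambda>s. exp (- 1 / s) / s ^ m) has_real_derivative smooth_step (m + 2) s + (- real m) * smooth_step (m + 1) s) (at s)"
    proof -
      have d1: "((\<lambda>s. exp (- 1 / s)) has_real_derivative exp (- 1 / s) / s\<^sup>2) (at s)"
        using 1 by (auto intro!: derivative_eq_intros simp: power2_eq_square)
      have d2: "((\<lambda>s. inverse s ^ m) has_real_derivative - (real m * inverse s ^ Suc m)) (at s)"
      proof (cases m)
        case (Suc n)
        then show ?thesis using DERIV_power_Suc[OF DERIV_inverse[of s], of n] 1 by (simp add: algebra_simps)
      qed simp
      show ?thesis using DERIV_mult[OF d1 d2] 1
        by (simp add: smooth_step_def divide_inverse power_inverse power2_eq_square algebra_simps)
    qed
    moreover have ev: "eventually (\<lambda>s. exp (- 1 / s) / s ^ m = smooth_step m s) (nhds s)"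
      using 1 by (intro eventually_nhds_in_open[THEN eventually_mono, of "{0<..}"]) (auto simp: smooth_step_def)
    ultimately show ?thesis using DERIV_cong_ev[OF refl ev refl] by simp
  next
    case 2
    have "((\<lambda>s. 0) has_real_derivative smooth_step (m + 2) s + (- real m) * smooth_step (m + 1) s) (at s)"
      using 2 by (simp add: smooth_step_def)
    moreover have ev: "eventually (\<lambda>s. 0 = smooth_step m s) (nhds s)"
      using 2 by (intro eventually_nhds_in_open[THEN eventually_mono, of "{..<0}"]) (auto simp: smooth_step_def)
    ultimately show ?thesis using DERIV_cong_ev[OF refl ev refl] by simp
  next
    case 3
    have "((\<lambda>h. (smooth_step m (0 + h) - smooth_step m 0) / h) \<longlongrightarrow> 0) (at 0)"
      unfolding filterlim_at_split
    proof
      have "eventually (\<lambda>h. (smooth_step m (0 + h) - smooth_step m 0) / h = 0) (at_left 0)"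
        by (auto simp: smooth_step_def eventually_at_left_field intro!: exI[of _ "-1"])
      then show "((\<lambda>h. (smooth_step m (0 + h) - smooth_step m 0) / h) \<longlongrightarrow> 0) (at_left 0)"
        by (rule tendsto_eventually)
      \<comment> \<open>Division by \<open>h\<close> merely raises the exponent, so the right
        difference quotient at 0 is again a member of the family and tends to 0.\<close>
      have "eventually (\<lambda>h. smooth_step (Suc m) h = (smooth_step m (0 + h) - smooth_step m 0) / h) (at_right 0)"
        by (auto simp: smooth_step_def eventually_at_right_field intro!: exI[of _ 1])
      then show "((\<lambda>h. (smooth_step m (0 + h) - smooth_step m 0) / h) \<longlongrightarrow> 0) (at_right 0)"
        using smooth_step_tendsto_0[of "Suc m"] tendsto_cong by force
    qed
    then show ?thesis using 3 by (simp add: DERIV_def smooth_step_def)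
  qed
qed

lemma smooth_on_smooth_step: "smooth_on UNIV (smooth_step m)"
  unfolding smooth_on_def
proof
  fix k show "Ck_on k UNIV (smooth_step m)"
  proof (induction k arbitrary: m)
    case 0
    have "continuous_on UNIV (smooth_step m)"
      using DERIV_smooth_step by (intro continuous_at_imp_continuous_on ballI) (rule DERIV_isCont)
    then show ?case by simp
  next
    case (Suc k)
    show ?case by (rule Ck_on_real_SucI[OF DERIV_smooth_step]) (intro Ck_on_add Ck_on_mult Ck_on_const Suc open_UNIV)
  qed
qed

text \<open>The squared norm makes the argument a polynomial in the coordinates, so the centre
  \<open>c\<close> needs no special treatment.\<close>

definition ball_bump :: "'a::euclidean_space \<Rightarrow> real \<Rightarrow> 'a \<Rightarrow> real" where
  "ball_bump c r x = smooth_step 0 (r\<^sup>2 - (norm (x - c))\<^sup>2)"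

lemma smooth_on_ball_bump: "smooth_on UNIV (ball_bump c r)"
proof -
  have "(norm (x - c))\<^sup>2 = (\<Sum>b\<in>Basis. (x \<bullet> b - c \<bullet> b) * (x \<bullet> b - c \<bullet> b))" for x
    unfolding power2_norm_eq_inner by (subst euclidean_inner) (simp add: inner_diff_left)
  then have "ball_bump c r = (\<lambda>x. smooth_step 0 (r\<^sup>2 - (\<Sum>b\<in>Basis. (x \<bullet> b - c \<bullet> b) * (x \<bullet> b - c \<bullet> b))))"
    by (simp add: fun_eq_iff ball_bump_def)
  then show ?thesis
    by (auto intro!: smooth_on_compose_real[OF _ smooth_on_smooth_step] smooth_on_minus smooth_on_sum smooth_on_mult
         smooth_on_const smooth_on_inner)
qed

lemma ball_bump_nonneg: "0 \<le> ball_bump c r x"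
  by (simp add: ball_bump_def smooth_step_def)

lemma ball_bump_pos_iff: "0 < r \<Longrightarrow> 0 < ball_bump c r x \<longleftrightarrow> x \<in> ball c r"
proof -
  assume r: "0 < r"
  have "0 < ball_bump c r x \<longleftrightarrow> (norm (x - c))\<^sup>2 < r\<^sup>2" by (simp add: ball_bump_def smooth_step_def)
  also have "\<dots> \<longleftrightarrow> norm (x - c) < r"
    using r power2_less_imp_less[of "norm (x - c)" r] power_strict_mono[of "norm (x - c)" r 2] by auto
  finally show ?thesis by (simp add: dist_norm norm_minus_commute)
qed

text \<open>Finitely many bumps are positive on all of \<open>K\<close>, and dividing by their
  minimum there gives the lower bound 1. An upper bound is not asserted; where a cutoff with values
  in \<open>[0, 1]\<close> is wanted, a transition function is composed with the result.\<close>

lemma smooth_cutoff_compact: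
  fixes K W :: "'a::euclidean_space set"
  assumes "compact K" "open W" "K \<subseteq> W"
  obtains f where "smooth_on UNIV f" "\<And>x. 0 \<le> f x" "\<And>x. x \<in> K \<Longrightarrow> 1 \<le> f x" "\<And>x. x \<notin> W \<Longrightarrow> f x = 0"
proof (cases "K = {}")
  case True
  show ?thesis by (rule that[of "\<lambda>_. 0"]) (use True in \<open>auto intro: smooth_on_const\<close>)
next
  case False
  have "\<forall>x\<in>K. \<exists>r>0. ball x r \<subseteq> W" using assms openE[OF assms(2)] by (metis subsetD)
  then obtain r where r: "\<And>x. x \<in> K \<Longrightarrow> 0 < r x" "\<And>x. x \<in> K \<Longrightarrow> ball x (r x) \<subseteq> W" by metis
  have "K \<subseteq> (\<Union>x\<in>K. ball x (r x))" using r(1) by force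
  then obtain C where C: "C \<subseteq> K" "finite C" "K \<subseteq> (\<Union>x\<in>C. ball x (r x))"
    by (rule compactE_image[OF assms(1), rotated]) auto
  define f where "f x = (\<Sum>c\<in>C. ball_bump c (r c) x)" for x
  have sm: "smooth_on UNIV f" unfolding f_def by (intro smooth_on_sum smooth_on_ball_bump open_UNIV)
  have f0: "0 \<le> f x" for x unfolding f_def by (intro sum_nonneg ball_bump_nonneg)
  have fpos: "0 < f x" if "x \<in> K" for x
  proof -
    obtain c where c: "c \<in> C" "x \<in> ball c (r c)" using C(3) \<open>x \<in> K\<close> by blast
    then have "0 < ball_bump c (r c) x" using ball_bump_pos_iff r(1) C(1) by blast
    also have "\<dots> \<le> f x" unfolding f_def using C(2) c(1) by (intro member_le_sum ball_bump_nonneg) auto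
    finally show ?thesis .
  qed
  have fout: "f x = 0" if "x \<notin> W" for x
    unfolding f_def
  proof (rule sum.neutral, rule ballI)
    fix c assume c: "c \<in> C"
    then have "\<not> 0 < ball_bump c (r c) x" using ball_bump_pos_iff[of "r c"] r C(1) that by blast
    then show "ball_bump c (r c) x = 0" using ball_bump_nonneg[of c "r c" x] by linarith
  qed
  obtain x0 where x0: "x0 \<in> K" "\<And>x. x \<in> K \<Longrightarrow> f x0 \<le> f x"
    using continuous_attains_inf[OF assms(1) False, of f] smooth_on_continuous[OF sm] continuous_on_subset by blast
  show ?thesis
  proof (rule that[of "\<lambda>x. (1 / f x0) * f x"])
    show "smooth_on UNIV (\<lambda>x. (1 / f x0) * f x)" by (intro smooth_on_mult smooth_on_const sm open_UNIV)
    show "0 \<le> (1 / f x0) * f x" for x using f0 by simp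
    show "1 \<le> (1 / f x0) * f x" if "x \<in> K" for x using x0(2)[OF that] fpos[OF x0(1)] by (simp add: field_simps)
    show "(1 / f x0) * f x = 0" if "x \<notin> W" for x using fout[OF that] by simp
  qed
qed

text \<open>When only \<open>\<phi>\<close> has compact support, \<open>closure U\<close> may be
  unbounded. Such a set is cut into compact shells, and the cutoffs of the shells form a locally
  finite sum.\<close>

lemma smooth_cutoff_closed:
  fixes A W :: "'a::euclidean_space set"
  assumes "closed A" "open W" "A \<subseteq> W"
  obtains f where "smooth_on UNIV f" "\<And>x. 0 \<le> f x" "\<And>x. x \<in> A \<Longrightarrow> 1 \<le> f x" "\<And>x. x \<notin> W \<Longrightarrow> f x = 0"
proof -
  define K where "K j = A \<inter> (cball 0 (real j + 1) - ball 0 (real j))" for j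
  \<comment> \<open>A neighbourhood of the shell \<open>K j\<close> that meets only the neighbouring
    shells; for \<open>j = 0\<close> the ball removed has radius \<open>- 1\<close> and is
    empty.\<close>
  define V where "V j = W \<inter> (ball 0 (real j + 2) - cball 0 (real j - 1))" for j
  have "compact (K j)" for j
    using assms(1) unfolding K_def Int_Diff[symmetric]
    by (intro compact_diff closed_Int_compact) auto
  moreover have "open (V j)" for j using assms(2) unfolding V_def by (intro open_Int open_Diff) auto
  moreover have "K j \<subseteq> V j" for j using assms(3) by (auto simp: K_def V_def)
  ultimately have "\<exists>f. smooth_on UNIV f \<and> (\<forall>x. 0 \<le> f x) \<and> (\<forall>x\<in>K j. 1 \<le> f x) \<and> (\<forall>x. x \<notin> V j \<longrightarrow> f x = 0)" for j
    using smooth_cutoff_compact[of "K j" "V j"] by metis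
  then obtain f where f: "\<And>j. smooth_on UNIV (f j)" "\<And>j x. 0 \<le> f j x" "\<And>j x. x \<in> K j \<Longrightarrow> 1 \<le> f j x"
    "\<And>j x. x \<notin> V j \<Longrightarrow> f j x = 0" by metis
  \<comment> \<open>At each point only finitely many terms are nonzero. On the ball of radius
    \<open>N\<close> the sum agrees with the fixed finite sum over \<open>j < N + 1\<close>, from
    which smoothness is read off.\<close>
  define w where "w x = (\<Sum>j | f j x \<noteq> 0. f j x)" for x
  have large: "f j x = 0" if "norm x < real N" "N + 1 \<le> j" for x j N
    using that by (intro f(4)) (auto simp: V_def)
  have w_eq: "w x = (\<Sum>j<N+1. f j x)" if "norm x < real N" for x N
    unfolding w_def
    by (rule sum.mono_neutral_left) (use large[OF that] in \<open>auto simp: not_less[symmetric]\<close>)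
  show ?thesis
  proof (rule that[of w])
    show "smooth_on UNIV w" unfolding smooth_on_def
    proof (intro allI Ck_on_locally)
      fix k and x :: 'a
      obtain N where N: "norm x < real N" using reals_Archimedean2 by blast
      have "Ck_on k (ball 0 (real N)) (\<lambda>x. \<Sum>j<N+1. f j x)"
        using f(1) by (intro Ck_on_sum) (auto simp: smooth_on_def intro: Ck_on_subset)
      then have "Ck_on k (ball 0 (real N)) w"
        using Ck_on_cong[of "ball 0 (real N)" w "\<lambda>x. \<Sum>j<N+1. f j x"] w_eq by (simp del: sum.lessThan_Suc)
      then show "\<exists>T. open T \<and> x \<in> T \<and> Ck_on k T w" using N by (intro exI[of _ "ball 0 (real N)"]) auto
    qed
    show "0 \<le> w x" for x unfolding w_def by (intro sum_nonneg f)
    show "w x = 0" if "x \<notin> W" for x unfolding w_def using f(4) that by (intro sum.neutral) (auto simp: V_def)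
    show "1 \<le> w x" if "x \<in> A" for x
    proof -
      define j where "j = nat \<lfloor>norm x\<rfloor>"
      have jx: "real j \<le> norm x" "norm x < real j + 1" by (auto simp: j_def)
      then have "x \<in> K j" using \<open>x \<in> A\<close> by (auto simp: K_def)
      then have "1 \<le> f j x" by (rule f(3))
      also have "\<dots> \<le> (\<Sum>j<j+1+1. f j x)" using f(2) by (intro member_le_sum) auto
      also have "\<dots> = w x" using jx by (intro w_eq[symmetric]) auto
      finally show ?thesis .
    qed
  qed
qed

text \<open>Almost all levels are regular, without Sard's theorem: for the perturbations
  \<open>u x + (\<Sum>b. (a \<bullet> b) * tanh (x \<bullet> b))\<close> the pairs of a parameter \<open>a\<close> and a critical value \<open>t\<close>
  form the image of the lower-dimensional space under a differentiable map \<open>\<Theta>\<close>.\<close>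

lemma regular_perturbation:
  fixes u :: "'a::euclidean_space \<Rightarrow> real"
  assumes u: "smooth_on UNIV u" and \<delta>: "0 < \<delta>"
  obtains v where "smooth_on UNIV v" "\<And>x. \<bar>v x - u x\<bar> < \<delta>"
    "AE t in lborel. \<forall>x. v x = t \<longrightarrow> grad v x \<noteq> 0"
proof -
  \<comment> \<open>A linear perturbation would be unbounded on the whole space. The function
    \<open>tanh\<close> is bounded, so small \<open>a\<close> gives a uniformly small change, and
    its derivative never vanishes, so a critical point still determines \<open>a\<close>.\<close>
  define P where "P a x = u x + (\<Sum>b\<in>Basis. (a \<bullet> b) * tanh (x \<bullet> b))" for a x :: 'a
  define du where "du x b = frechet_derivative u (at x) b" for x b
  \<comment> \<open>The only parameter for which \<open>x\<close> is critical: each partial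
    derivative vanishes iff \<open>a \<bullet> b\<close> is \<open>- du x b\<close> divided by
    \<open>1 - tanh\<^sup>2\<close>, and the latter is the reciprocal of
    \<open>cosh\<^sup>2\<close>.\<close>
  define g where "g x = (\<Sum>b\<in>Basis. (- du x b * (cosh (x \<bullet> b))\<^sup>2) *\<^sub>R b)" for x :: 'a
  define \<Theta> where "\<Theta> x = (g x, P (g x) x)" for x :: 'a
  have P_smooth: "smooth_on UNIV (P a)" for a
    unfolding P_def
    by (intro smooth_on_add smooth_on_sum smooth_on_mult smooth_on_const smooth_on_compose_real[OF _ smooth_on_tanh]
        smooth_on_inner u open_UNIV)
  have crit: "a = g x" if "grad (P a) x = 0" for a x
  proof (rule euclidean_eqI)
    fix b :: 'a assume b: "b \<in> Basis"
    have tanh_der: "((\<lambda>x. tanh (x \<bullet> i)) has_derivative (\<lambda>h. (1 - (tanh (x \<bullet> i))\<^sup>2) * (h \<bullet> i))) (at x)" for i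
    proof -
      have "(tanh has_derivative (\<lambda>y. (1 - (tanh (x \<bullet> i))\<^sup>2) * y)) (at (x \<bullet> i))"
        unfolding has_field_derivative_def[symmetric]
        by (auto intro!: derivative_eq_intros)
      moreover have "((\<lambda>x. x \<bullet> i) has_derivative (\<lambda>h. h \<bullet> i)) (at x)" by (auto intro!: derivative_eq_intros)
      ultimately show ?thesis
        using has_derivative_compose[of "\<lambda>x. x \<bullet> i" "\<lambda>h. h \<bullet> i" x UNIV tanh] by blast
    qed
    have "(P a has_derivative (\<lambda>h. frechet_derivative u (at x) h + (\<Sum>i\<in>Basis. (a \<bullet> i) * ((1 - (tanh (x \<bullet> i))\<^sup>2) * (h \<bullet> i))))) (at x)"
      unfolding P_def
      by (intro has_derivative_add has_derivative_sum has_derivative_mult_right tanh_der smooth_on_has_derivative[OF u]) auto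
    from grad_inner[OF this, of b] that
    have "0 = du x b + (\<Sum>i\<in>Basis. (a \<bullet> i) * ((1 - (tanh (x \<bullet> i))\<^sup>2) * (b \<bullet> i)))"
      by (simp add: du_def)
    also have "(\<Sum>i\<in>Basis. (a \<bullet> i) * ((1 - (tanh (x \<bullet> i))\<^sup>2) * (b \<bullet> i))) = (\<Sum>i\<in>Basis. if i = b then (a \<bullet> i) * (1 - (tanh (x \<bullet> i))\<^sup>2) else 0)"
      using b by (intro sum.cong) (auto simp: inner_Basis)
    also have "\<dots> = (a \<bullet> b) * (1 - (tanh (x \<bullet> b))\<^sup>2)" using b by (simp add: sum.delta)
    finally have "(a \<bullet> b) * (1 - (tanh (x \<bullet> b))\<^sup>2) = - du x b" by simp
    moreover have c: "(cosh (x \<bullet> b))\<^sup>2 \<noteq> 0" using cosh_real_pos[of "x \<bullet> b"] by simp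
    then have "1 - (tanh (x \<bullet> b))\<^sup>2 = ((cosh (x \<bullet> b))\<^sup>2 - (sinh (x \<bullet> b))\<^sup>2) / (cosh (x \<bullet> b))\<^sup>2"
      by (simp add: tanh_def power_divide diff_divide_distrib)
    then have "1 - (tanh (x \<bullet> b))\<^sup>2 = 1 / (cosh (x \<bullet> b))\<^sup>2" by (simp add: hyperbolic_pythagoras)
    ultimately have "(a \<bullet> b) / (cosh (x \<bullet> b))\<^sup>2 = - du x b" by simp
    then have "a \<bullet> b = - du x b * (cosh (x \<bullet> b))\<^sup>2" using c by (simp add: divide_eq_eq)
    then show "a \<bullet> b = g x \<bullet> b" using b unfolding g_def by (subst inner_sum_left_Basis) auto
  qed
  have du_diff: "(\<lambda>x. du x b) differentiable (at x)" if "b \<in> Basis" for b x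
    unfolding du_def using smooth_on_has_derivative[OF smooth_on_deriv[OF u that], of x] by (auto simp: differentiable_def)
  have inner_diff: "(\<lambda>x. x \<bullet> b) differentiable (at x)" for b x :: 'a by simp
  have real_comp: "(\<lambda>x. k (x \<bullet> b)) differentiable (at x)" if "\<And>y. (k has_real_derivative k' y) (at y)" for b x :: 'a and k k'
  proof -
    have "k differentiable (at (x \<bullet> b))" using that by (auto simp: differentiable_def has_field_derivative_def)
    then show ?thesis using differentiable_chain_at[of "\<lambda>x. x \<bullet> b" x k] inner_diff by (simp add: o_def)
  qed
  have cosh_diff: "(\<lambda>x. cosh (x \<bullet> b)) differentiable (at x)" for b x :: 'a
    by (rule real_comp[of _ sinh]) (auto intro!: derivative_eq_intros)
  have tanh_diff: "(\<lambda>x. tanh (x \<bullet> b)) differentiable (at x)" for b x :: 'a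
    by (rule real_comp[of _ "\<lambda>y. 1 - (tanh y)\<^sup>2"]) (auto intro!: derivative_eq_intros)
  have g_diff: "g differentiable (at x)" for x
    unfolding g_def
    by (intro differentiable_sum ballI differentiable_scaleR differentiable_mult differentiable_minus differentiable_power
        du_diff cosh_diff differentiable_const finite_Basis)
  have "(\<lambda>x. P (g x) x) differentiable (at x)" for x
    unfolding P_def using smooth_on_has_derivative[OF u, of x]
    by (intro differentiable_add differentiable_sum ballI differentiable_mult differentiable_inner g_diff
        differentiable_const tanh_diff finite_Basis) (auto simp: differentiable_def)
  then have "\<Theta> differentiable_on UNIV"
    unfolding \<Theta>_def differentiable_on_def using g_diff by (auto intro!: differentiable_Pair)
  \<comment> \<open>The target has one dimension more than the domain. By Fubini almost every
    \<open>a\<close> then has the property that almost every \<open>t\<close> is a regular value of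
    \<open>P a\<close>.\<close>
  then have "negligible (range \<Theta>)" by (intro negligible_differentiable_image_lowdim) auto
  then have "range \<Theta> \<in> null_sets lebesgue" by (simp add: negligible_iff_null_sets)
  then have "AE p in lborel. p \<notin> range \<Theta>" by (metis AE_not_in AE_completion_iff)
  then have "AE p in (lborel :: 'a measure) \<Otimes>\<^sub>M (lborel :: real measure). p \<notin> range \<Theta>" unfolding lborel_prod .
  then have AE2: "AE a in lborel. AE t in lborel. (a, t) \<notin> range \<Theta>" by (rule lborel_pair.AE_pair)
  \<comment> \<open>The perturbation has one term for each basis vector, each smaller than
    \<open>norm a\<close> times 1 in absolute value or equal to it, so
    \<open>norm a < \<epsilon>\<close> keeps the total below \<open>\<delta>\<close>.\<close>
  define \<epsilon> where "\<epsilon> = \<delta> / real DIM('a)"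
  have \<epsilon>: "0 < \<epsilon>" using \<delta> by (simp add: \<epsilon>_def)
  have "\<exists>a\<in>ball 0 \<epsilon>. AE t in lborel. (a, t) \<notin> range \<Theta>"
  proof (rule ccontr)
    assume no: "\<not> ?thesis"
    from AE2 have "AE a in lborel. a \<notin> ball (0::'a) \<epsilon>"
      by eventually_elim (use no in blast)
    then have "ball (0::'a) \<epsilon> \<in> null_sets lborel" by (subst AE_iff_null_sets) auto
    then have "measure lborel (ball (0::'a) \<epsilon>) = 0" by (simp add: measure_eq_0_null_sets)
    then show False using content_ball_pos[OF \<epsilon>, of "0::'a"] by simp
  qed
  then obtain a where a: "a \<in> ball 0 \<epsilon>" "AE t in lborel. (a, t) \<notin> range \<Theta>" by blast
  show ?thesis
  proof (rule that[OF P_smooth[of a]])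
    fix x
    have "\<bar>P a x - u x\<bar> \<le> (\<Sum>b\<in>Basis. \<bar>(a \<bullet> b) * tanh (x \<bullet> b)\<bar>)" by (simp add: P_def sum_abs)
    also have "\<dots> < (\<Sum>b\<in>(Basis::'a set). \<epsilon>)"
    proof (rule sum_strict_mono)
      fix b :: 'a assume b: "b \<in> Basis"
      have "\<bar>a \<bullet> b\<bar> * \<bar>tanh (x \<bullet> b)\<bar> \<le> \<bar>a \<bullet> b\<bar> * 1"
        using tanh_real_bounds[of "x \<bullet> b"] by (intro mult_left_mono) (auto simp: abs_le_iff)
      also have "\<dots> < \<epsilon>" using a(1) Basis_le_norm[OF b, of a] by simp
      finally show "\<bar>(a \<bullet> b) * tanh (x \<bullet> b)\<bar> < \<epsilon>" by (simp add: abs_mult)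
    qed auto
    also have "\<dots> = \<delta>" by (simp add: \<epsilon>_def)
    finally show "\<bar>P a x - u x\<bar> < \<delta>" .
  next
    show "AE t in lborel. \<forall>x. P a x = t \<longrightarrow> grad (P a) x \<noteq> 0"
      using a(2)
    proof eventually_elim
      case (elim t)
      then show ?case using crit[of a] by (metis \<Theta>_def rangeI)
    qed
  qed
qed

section \<open>Translations and mollification\<close>

lemma lborel_distr_reflect: "distr lborel borel (\<lambda>x. a - x) = (lborel :: 'a::euclidean_space measure)"
  using lborel_affine[of "-1" a] by (simp add: density_1)

lemma lborel_distr_shift: "distr lborel borel (\<lambda>x. x - a) = (lborel :: 'a::euclidean_space measure)"
proof -
  have "(+) (- a) = (\<lambda>x. x - a)" by (auto simp: fun_eq_iff)
  then show ?thesis using lborel_distr_plus[of "- a"] by simp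
qed

lemma integrable_shift:
  fixes f :: "'a::euclidean_space \<Rightarrow> 'b::{banach, second_countable_topology}"
  assumes "integrable lborel f"
  shows "integrable lborel (\<lambda>x. f (x - a))" and "(\<integral>x. f (x - a) \<partial>lborel) = (\<integral>x. f x \<partial>lborel)"
proof -
  have "integrable (distr lborel borel (\<lambda>x. x - a)) f" using assms by (simp add: lborel_distr_shift)
  then show "integrable lborel (\<lambda>x. f (x - a))" by (rule integrable_distr[rotated]) simp
  have "(\<integral>x. f x \<partial>lborel) = (\<integral>x. f x \<partial>distr lborel borel (\<lambda>x. x - a))" by (simp add: lborel_distr_shift)
  also have "\<dots> = (\<integral>x. f (x - a) \<partial>lborel)"
    by (rule integral_distr) (use assms in \<open>auto intro: borel_measurable_integrable\<close>)
  finally show "(\<integral>x. f (x - a) \<partial>lborel) = (\<integral>x. f x \<partial>lborel)" by simp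
qed

lemma integrable_reflect:
  fixes f :: "'a::euclidean_space \<Rightarrow> 'b::{banach, second_countable_topology}"
  assumes "integrable lborel f"
  shows "integrable lborel (\<lambda>x. f (a - x))"
proof -
  have "integrable (distr lborel borel (\<lambda>x. a - x)) f" using assms by (simp add: lborel_distr_reflect)
  then show ?thesis by (rule integrable_distr[rotated]) simp
qed

lemma integral_reflect:
  fixes f :: "'a::euclidean_space \<Rightarrow> 'b::{banach, second_countable_topology}"
  assumes "f \<in> borel_measurable borel"
  shows "(\<integral>x. f (a - x) \<partial>lborel) = (\<integral>x. f x \<partial>lborel)"
proof -
  have "(\<integral>x. f x \<partial>lborel) = (\<integral>x. f x \<partial>distr lborel borel (\<lambda>x. a - x))" by (simp add: lborel_distr_reflect)
  also have "\<dots> = (\<integral>x. f (a - x) \<partial>lborel)" by (rule integral_distr) (use assms in auto)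
  finally show ?thesis by simp
qed

text \<open>Functions whose translations converge in mean form a closed set: the approximation error
  occurs twice, once translated, and translation does not change its integral. This serves both the
  passage from open to measurable sets and the limit step of the induction.\<close>

lemma L1_translation_approx:
  fixes f :: "'a::euclidean_space \<Rightarrow> 'b::{banach, second_countable_topology}"
  assumes f: "integrable lborel f"
    and ap: "\<And>e. 0 < e \<Longrightarrow> \<exists>g. integrable lborel g \<and> (\<integral>x. norm (f x - g x) \<partial>lborel) \<le> e \<and>
        (\<lambda>j. \<integral>x. norm (g (x - z j) - g x) \<partial>lborel) \<longlonglongrightarrow> 0"
  shows "(\<lambda>j. \<integral>x. norm (f (x - z j) - f x) \<partial>lborel) \<longlonglongrightarrow> 0"
proof (rule LIMSEQ_I)
  fix e :: real assume "0 < e"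
  then obtain g where g: "integrable lborel g" "(\<integral>x. norm (f x - g x) \<partial>lborel) \<le> e / 4"
    "(\<lambda>j. \<integral>x. norm (g (x - z j) - g x) \<partial>lborel) \<longlonglongrightarrow> 0"
    using ap[of "e / 4"] by auto
  from g(3) have "eventually (\<lambda>j. (\<integral>x. norm (g (x - z j) - g x) \<partial>lborel) < e / 4) sequentially"
    using \<open>0 < e\<close> by (intro order_tendstoD) auto
  then obtain N where N: "\<And>j. N \<le> j \<Longrightarrow> (\<integral>x. norm (g (x - z j) - g x) \<partial>lborel) < e / 4"
    by (auto simp: eventually_sequentially)
  have "norm ((\<integral>x. norm (f (x - z j) - f x) \<partial>lborel) - 0) < e" if j: "N \<le> j" for j
  proof -
    note fz = integrable_shift[OF f, of "z j"] and gz = integrable_shift[OF g(1), of "z j"]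
    have fg: "integrable lborel (\<lambda>x. norm (f x - g x))" using f g by auto
    have "(\<integral>x. norm (f (x - z j) - f x) \<partial>lborel) \<le>
       (\<integral>x. norm (f (x - z j) - g (x - z j)) + norm (g (x - z j) - g x) + norm (f x - g x) \<partial>lborel)"
    proof (rule integral_mono)
      fix x
      have "f (x - z j) - f x = (f (x - z j) - g (x - z j)) + (g (x - z j) - g x) - (f x - g x)" by simp
      then show "norm (f (x - z j) - f x) \<le> norm (f (x - z j) - g (x - z j)) + norm (g (x - z j) - g x) + norm (f x - g x)"
        by (metis norm_triangle_ineq norm_triangle_ineq4 add_right_mono order_trans)
    qed (use f g fz gz in auto)
    also have "\<dots> = (\<integral>x. norm (f (x - z j) - g (x - z j)) \<partial>lborel) + (\<integral>x. norm (g (x - z j) - g x) \<partial>lborel) + (\<integral>x. norm (f x - g x) \<partial>lborel)"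
      using f g fz gz by (subst Bochner_Integration.integral_add, auto)+
    also have "(\<integral>x. norm (f (x - z j) - g (x - z j)) \<partial>lborel) = (\<integral>x. norm (f x - g x) \<partial>lborel)"
      using integrable_shift(2)[OF fg, of "z j"] by simp
    finally have "(\<integral>x. norm (f (x - z j) - f x) \<partial>lborel) < e" using g(2) N[OF j] \<open>0 < e\<close> by linarith
    moreover have "0 \<le> (\<integral>x. norm (f (x - z j) - f x) \<partial>lborel)" by simp
    ultimately show ?thesis by simp
  qed
  then show "\<exists>N. \<forall>j\<ge>N. norm ((\<integral>x. norm (f (x - z j) - f x) \<partial>lborel) - 0) < e" by blast
qed

text \<open>For an open set \<open>U\<close> the functions \<open>indicator U x * indicator U (x - z)\<close> converge pointwise as
  \<open>z\<close> tends to \<open>0\<close>.\<close>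

lemma L1_translation_open:
  fixes U :: "'a::euclidean_space set" and c :: "'b::{banach, second_countable_topology}"
  assumes U: "open U" "emeasure lborel U < \<infinity>" and z: "z \<longlonglongrightarrow> 0"
  shows "(\<lambda>j. \<integral>x. norm (indicator U (x - z j) *\<^sub>R c - indicator U x *\<^sub>R c) \<partial>lborel) \<longlonglongrightarrow> 0"
proof -
  have Um [measurable]: "U \<in> sets borel" using U by simp
  have iU: "integrable lborel (indicator U :: 'a \<Rightarrow> real)" using U by simp
  note iUz = integrable_shift[OF iU]
  have lim: "(\<lambda>j. \<integral>x. indicator U x * indicator U (x - z j) \<partial>lborel) \<longlonglongrightarrow> (\<integral>x. indicator U x \<partial>lborel :: real)"
  proof (rule integral_dominated_convergence[where w = "indicator U"])
    show "AE x in lborel. (\<lambda>j. indicator U x * indicator U (x - z j) :: real) \<longlonglongrightarrow> indicator U x"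
    proof (rule AE_I2)
      fix x
      show "(\<lambda>j. indicator U x * indicator U (x - z j) :: real) \<longlonglongrightarrow> indicator U x"
      proof (cases "x \<in> U")
        case True
        have "(\<lambda>j. x - z j) \<longlonglongrightarrow> x - 0" by (intro tendsto_intros z)
        then have "eventually (\<lambda>j. x - z j \<in> U) sequentially"
          using U(1) True by (intro topological_tendstoD) auto
        then have "eventually (\<lambda>j. indicator U x * indicator U (x - z j) = (indicator U x :: real)) sequentially"
          by eventually_elim (use True in simp)
        then show ?thesis by (rule tendsto_eventually)
      qed simp
    qed
  qed (use iU in \<open>auto simp: indicator_def\<close>)
  \<comment> \<open>For indicators the distance in mean is twice the measure of \<open>U\<close>
    minus twice the overlap with its translate, so convergence of the overlap is enough.\<close>
  have eq: "(\<integral>x. norm (indicator U (x - z j) *\<^sub>R c - indicator U x *\<^sub>R c) \<partial>lborel)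
      = norm c * (2 * (\<integral>x. indicator U x \<partial>lborel) - 2 * (\<integral>x. indicator U x * indicator U (x - z j) \<partial>lborel))" for j
  proof -
    have int: "integrable lborel (\<lambda>x. indicator U x * indicator U (x - z j) :: real)"
      by (rule Bochner_Integration.integrable_bound[OF iU]) (auto simp: indicator_def)
    have "(\<integral>x. norm (indicator U (x - z j) *\<^sub>R c - indicator U x *\<^sub>R c) \<partial>lborel)
      = (\<integral>x. norm c * (indicator U (x - z j) + indicator U x - 2 * (indicator U x * indicator U (x - z j))) \<partial>lborel)"
      by (intro Bochner_Integration.integral_cong) (auto simp: indicator_def)
    also have "\<dots> = norm c * ((\<integral>x. indicator U (x - z j) \<partial>lborel) + (\<integral>x. indicator U x \<partial>lborel)
        - 2 * (\<integral>x. indicator U x * indicator U (x - z j) \<partial>lborel))"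
      using iU iUz(1)[of "z j"] int by simp
    finally show ?thesis using iUz(2)[of "z j"] by simp
  qed
  have "(\<lambda>j. norm c * (2 * (\<integral>x. indicator U x \<partial>lborel) - 2 * (\<integral>x. indicator U x * indicator U (x - z j) \<partial>lborel)))
     \<longlonglongrightarrow> norm c * (2 * (\<integral>x. indicator U x \<partial>lborel) - 2 * (\<integral>x. indicator U x \<partial>lborel))"
    by (intro tendsto_intros lim)
  then show ?thesis unfolding eq by simp
qed

lemma L1_translation_continuous:
  fixes f :: "'a::euclidean_space \<Rightarrow> 'b::{banach, second_countable_topology}"
  assumes f: "integrable lborel f" and z: "z \<longlonglongrightarrow> 0"
  shows "(\<lambda>j. \<integral>x. norm (f (x - z j) - f x) \<partial>lborel) \<longlonglongrightarrow> 0"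
  using f
proof (induction rule: integrable_induct)
  case (base A c)
  then have A: "A \<in> sets borel" by simp
  have intA: "integrable lborel (\<lambda>x. indicator A x *\<^sub>R c)" using base by auto
  show ?case
  proof (rule L1_translation_approx[OF intA])
    fix e :: real assume e: "0 < e"
    define e' where "e' = e / (norm c + 1)"
    have e': "0 < e'" "norm c * e' \<le> e"
      using e by (auto simp: e'_def field_simps add_pos_nonneg)
    obtain U where U: "open U" "A \<subseteq> U" "emeasure lborel (U - A) \<le> ennreal e'"
      using outer_regular_lborel_le[OF A e'(1)] by metis
    have "emeasure lborel U \<le> emeasure lborel A + emeasure lborel (U - A)"
      using U A by (subst plus_emeasure) (auto intro!: emeasure_mono)
    also have "\<dots> < \<infinity>" using U(3) base(2) by (auto simp: less_top[symmetric] ennreal_add_eq_top top_unique)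
    finally have Ufin: "emeasure lborel U < \<infinity>" .
    show "\<exists>g. integrable lborel g \<and> (\<integral>x. norm (indicator A x *\<^sub>R c - g x) \<partial>lborel) \<le> e \<and>
        (\<lambda>j. \<integral>x. norm (g (x - z j) - g x) \<partial>lborel) \<longlonglongrightarrow> 0"
    proof (intro exI[of _ "\<lambda>x. indicator U x *\<^sub>R c"] conjI L1_translation_open U Ufin z)
      show "integrable lborel (\<lambda>x. indicator U x *\<^sub>R c)" using U(1) Ufin by auto
      have "(\<integral>x. norm (indicator A x *\<^sub>R c - indicator U x *\<^sub>R c) \<partial>lborel) = (\<integral>x. norm c * indicator (U - A) x \<partial>lborel)"
        using U(2) by (intro Bochner_Integration.integral_cong) (auto simp: indicator_def)
      also have "\<dots> = norm c * measure lborel (U - A)" using U A by simp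
      also have "\<dots> \<le> norm c * e'"
        using U(3) e'(1) by (intro mult_left_mono) (auto simp: measure_def intro!: enn2real_leI)
      finally show "(\<integral>x. norm (indicator A x *\<^sub>R c - indicator U x *\<^sub>R c) \<partial>lborel) \<le> e" using e'(2) by linarith
    qed
  qed
next
  case (add f g)
  note fz = integrable_shift(1)[OF add(1)] and gz = integrable_shift(1)[OF add(2)]
  show ?case
  proof (rule Lim_null_comparison)
    show "eventually (\<lambda>j. norm (\<integral>x. norm (f (x - z j) + g (x - z j) - (f x + g x)) \<partial>lborel)
       \<le> (\<integral>x. norm (f (x - z j) - f x) \<partial>lborel) + (\<integral>x. norm (g (x - z j) - g x) \<partial>lborel)) sequentially"
    proof (intro always_eventually allI)
      fix j
      have "(\<integral>x. norm (f (x - z j) + g (x - z j) - (f x + g x)) \<partial>lborel)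
         \<le> (\<integral>x. norm (f (x - z j) - f x) + norm (g (x - z j) - g x) \<partial>lborel)"
        using add fz gz by (intro integral_mono) (auto simp: add_diff_add intro: norm_triangle_ineq)
      then show "norm (\<integral>x. norm (f (x - z j) + g (x - z j) - (f x + g x)) \<partial>lborel)
         \<le> (\<integral>x. norm (f (x - z j) - f x) \<partial>lborel) + (\<integral>x. norm (g (x - z j) - g x) \<partial>lborel)"
        using add fz gz by simp
    qed
    show "(\<lambda>j. (\<integral>x. norm (f (x - z j) - f x) \<partial>lborel) + (\<integral>x. norm (g (x - z j) - g x) \<partial>lborel)) \<longlonglongrightarrow> 0"
      using tendsto_add[OF add(3,4)] by simp
  qed
next
  case (lim f s)
  show ?case
  proof (rule L1_translation_approx[OF lim(4)])
    fix e :: real assume "0 < e"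
    have sm: "s i \<in> borel_measurable lborel" for i using lim(1) by (rule borel_measurable_integrable)
    have "(\<lambda>i. \<integral>x. norm (f x - s i x) \<partial>lborel) \<longlonglongrightarrow> integral\<^sup>L lborel (\<lambda>x::'a. 0)"
    proof (rule integral_dominated_convergence[where w = "\<lambda>x. 3 * norm (f x)"])
      show "AE x in lborel. (\<lambda>i. norm (f x - s i x)) \<longlonglongrightarrow> 0"
      proof (rule AE_I2)
        fix x
        have "(\<lambda>i. f x - s i x) \<longlonglongrightarrow> f x - f x" by (intro tendsto_intros lim(2)) simp
        then show "(\<lambda>i. norm (f x - s i x)) \<longlonglongrightarrow> 0" using tendsto_norm_zero by simp
      qed
      show "AE x in lborel. norm (norm (f x - s i x)) \<le> 3 * norm (f x)" for i
      proof (rule AE_I2)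
        fix x show "norm (norm (f x - s i x)) \<le> 3 * norm (f x)"
          using lim(3)[of x i] norm_triangle_ineq4[of "f x" "s i x"] by simp
      qed
    qed (use lim(4) sm in auto)
    then have "eventually (\<lambda>i. (\<integral>x. norm (f x - s i x) \<partial>lborel) < e) sequentially"
      using \<open>0 < e\<close> by (intro order_tendstoD) auto
    then obtain i where "(\<integral>x. norm (f x - s i x) \<partial>lborel) < e" by (auto simp: eventually_sequentially)
    then show "\<exists>g. integrable lborel g \<and> (\<integral>x. norm (f x - g x) \<partial>lborel) \<le> e \<and>
        (\<lambda>j. \<integral>x. norm (g (x - z j) - g x) \<partial>lborel) \<longlonglongrightarrow> 0"
      using lim(1,5) by (intro exI[of _ "s i"]) (auto intro: less_imp_le)
  qed
qed

text \<open>A weight \<open>k > 0\<close> and the homeomorphism \<open>y \<mapsto> y / (1 + |y|)\<close> onto the unit ball reduce an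
  arbitrary Borel function to an integrable one.\<close>

lemma translation_AE_subseq:
  fixes G :: "'a::euclidean_space \<Rightarrow> 'b::euclidean_space"
  assumes G [measurable]: "G \<in> borel_measurable borel" and z: "z \<longlonglongrightarrow> 0"
  obtains r :: "nat \<Rightarrow> nat" where "strict_mono r" "AE x in lborel. (\<lambda>j. G (x - z (r j))) \<longlonglongrightarrow> G x"
proof -
  obtain k :: "'a \<Rightarrow> real" where k: "k \<in> borel_measurable lborel" "\<And>x. 0 < k x" "\<And>x. k x \<le> 1" "integrable lborel k"
    using sigma_finite_measure.obtain_positive_integrable_function[OF sigma_finite_lborel] by metis
  have [measurable]: "k \<in> borel_measurable borel" using k(1) by simp
  define S where "S y = y /\<^sub>R (1 + norm y)" for y :: 'b
  have [measurable]: "S \<in> borel_measurable borel" unfolding S_def by measurable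
  have pos: "1 + norm y > 0" for y :: 'b by (simp add: add_pos_nonneg)
  have nS: "norm (S y) = norm y / (1 + norm y)" for y using pos[of y] by (simp add: S_def divide_inverse mult.commute)
  have S1: "norm (S y) < 1" for y using pos[of y] by (simp add: nS)
  have S_inv: "S y /\<^sub>R (1 - norm (S y)) = y" for y
  proof -
    have "1 - norm (S y) = inverse (1 + norm y)" using pos[of y] by (simp add: nS field_simps)
    then show ?thesis using pos[of y] by (simp add: S_def)
  qed
  \<comment> \<open>The weight is carried along as the first component, so that its translates
    converge as well and it can be divided out of the second component in the limit.\<close>
  define H where "H x = (k x, k x *\<^sub>R S (G x))" for x
  have "integrable lborel H"
  proof (rule Bochner_Integration.integrable_bound)
    show "integrable lborel (\<lambda>x. 2 * k x)" using k(4) by simp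
    show "H \<in> borel_measurable lborel" unfolding H_def by measurable
    show "AE x in lborel. norm (H x) \<le> norm (2 * k x)"
    proof (rule AE_I2)
      fix x
      have "norm (H x) \<le> norm (k x) + norm (k x *\<^sub>R S (G x))" unfolding H_def by (rule norm_Pair_le)
      also have "\<dots> \<le> k x + k x * 1"
        using k(2)[of x] S1[of "G x"] by (simp add: mult_left_le)
      finally show "norm (H x) \<le> norm (2 * k x)" using k(2)[of x] by simp
    qed
  qed
  note HL = this L1_translation_continuous[OF this z]
  have "integrable lborel (\<lambda>x. H (x - z j) - H x)" for j
    using HL(1) integrable_shift(1)[OF HL(1)] by auto
  from tendsto_L1_AE_subseq[OF this HL(2)] obtain r where r: "strict_mono r"
    "AE x in lborel. (\<lambda>j. H (x - z (r j)) - H x) \<longlonglongrightarrow> 0" by blast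
  have "AE x in lborel. (\<lambda>j. G (x - z (r j))) \<longlonglongrightarrow> G x"
    using r(2)
  proof eventually_elim
    case (elim x)
    then have H: "(\<lambda>j. H (x - z (r j))) \<longlonglongrightarrow> H x" by (simp add: LIM_zero_iff)
    have k1: "(\<lambda>j. k (x - z (r j))) \<longlonglongrightarrow> k x" using tendsto_fst[OF H] by (simp add: H_def)
    have k2: "(\<lambda>j. k (x - z (r j)) *\<^sub>R S (G (x - z (r j)))) \<longlonglongrightarrow> k x *\<^sub>R S (G x)" using tendsto_snd[OF H] by (simp add: H_def)
    have "(\<lambda>j. (k (x - z (r j)) *\<^sub>R S (G (x - z (r j)))) /\<^sub>R k (x - z (r j))) \<longlonglongrightarrow> (k x *\<^sub>R S (G x)) /\<^sub>R k x"
      using k(2)[of x] by (intro tendsto_intros k1 k2) auto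
    then have S: "(\<lambda>j. S (G (x - z (r j)))) \<longlonglongrightarrow> S (G x)"
      using k(2) by (simp add: less_imp_neq[symmetric])
    have "(\<lambda>j. S (G (x - z (r j))) /\<^sub>R (1 - norm (S (G (x - z (r j)))))) \<longlonglongrightarrow> S (G x) /\<^sub>R (1 - norm (S (G x)))"
      using S1[of "G x"] by (intro tendsto_intros S) auto
    then show ?case by (simp only: S_inv)
  qed
  then show ?thesis using r(1) that by blast
qed

text \<open>Clipping \<open>F x \<bullet> G (x - z)\<close> at \<open>A + B\<close> yields a dominated sequence; the error is at most
  \<open>|B (x - z) - B x|\<close>.\<close>

locale dominated_pair =
  fixes F G :: "'a::euclidean_space \<Rightarrow> 'a" and A B :: "'a \<Rightarrow> real"
  assumes F [measurable]: "F \<in> borel_measurable borel" and G [measurable]: "G \<in> borel_measurable borel"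
    and A: "integrable lborel A" and B: "integrable lborel B"
    and dom: "\<And>x y. norm (F x) * norm (G y) \<le> A x + B y"
begin

lemma integrable_inner_shift: "integrable lborel (\<lambda>x. F x \<bullet> G (x - z))"
proof (rule Bochner_Integration.integrable_bound)
  show "integrable lborel (\<lambda>x. A x + B (x - z))" using A integrable_shift(1)[OF B] by simp
  show "AE x in lborel. norm (F x \<bullet> G (x - z)) \<le> norm (A x + B (x - z))"
  proof (rule AE_I2)
    fix x show "norm (F x \<bullet> G (x - z)) \<le> norm (A x + B (x - z))"
      using dom[of x "x - z"] Cauchy_Schwarz_ineq2[of "F x" "G (x - z)"] by simp
  qed
qed measurable

lemma integral_inner_shift_tendsto:
  assumes z: "z \<longlonglongrightarrow> 0"
  shows "(\<lambda>j. \<integral>x. F x \<bullet> G (x - z j) \<partial>lborel) \<longlonglongrightarrow> (\<integral>x. F x \<bullet> G x \<partial>lborel)"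
proof -
  \<comment> \<open>Almost everywhere convergence of the translates holds only along a subsequence.
    It is therefore shown for any null sequence that some subsequence has the right limit, which
    excludes a subsequence of \<open>z\<close> staying away from it.\<close>
  have sub: "\<exists>r::nat\<Rightarrow>nat. strict_mono r \<and> (\<lambda>j. \<integral>x. F x \<bullet> G (x - y (r j)) \<partial>lborel) \<longlonglongrightarrow> (\<integral>x. F x \<bullet> G x \<partial>lborel)"
    if y: "y \<longlonglongrightarrow> 0" for y :: "nat \<Rightarrow> 'a"
  proof -
    obtain r :: "nat \<Rightarrow> nat" where r: "strict_mono r" "AE x in lborel. (\<lambda>j. G (x - y (r j))) \<longlonglongrightarrow> G x"
      using translation_AE_subseq[OF G y] by blast
    have yr: "(\<lambda>j. y (r j)) \<longlonglongrightarrow> 0" using LIMSEQ_subseq_LIMSEQ[OF y r(1)] by (simp add: o_def)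
    define D where "D x = A x + B x" for x
    have D: "integrable lborel D" unfolding D_def using A B by simp
    have [measurable]: "D \<in> borel_measurable borel" "A \<in> borel_measurable borel" "B \<in> borel_measurable borel"
      using D A B borel_measurable_integrable by auto
    define f where "f j x = F x \<bullet> G (x - y (r j))" for j x
    define h where "h j x = max (- D x) (min (D x) (f j x))" for j x
    have D0: "0 \<le> D x" for x unfolding D_def using dom[of x x] by (meson mult_nonneg_nonneg norm_ge_zero order_trans)
    have lim_h: "(\<lambda>j. \<integral>x. h j x \<partial>lborel) \<longlonglongrightarrow> (\<integral>x. F x \<bullet> G x \<partial>lborel)"
    proof (rule integral_dominated_convergence[where w = D])
      show "AE x in lborel. (\<lambda>j. h j x) \<longlonglongrightarrow> F x \<bullet> G x"
        using r(2)
      proof eventually_elim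
        case (elim x)
        have "\<bar>F x \<bullet> G x\<bar> \<le> D x"
          unfolding D_def using dom[of x x] Cauchy_Schwarz_ineq2[of "F x" "G x"] by linarith
        then have "max (- D x) (min (D x) (F x \<bullet> G x)) = F x \<bullet> G x" by auto
        moreover have "(\<lambda>j. h j x) \<longlonglongrightarrow> max (- D x) (min (D x) (F x \<bullet> G x))"
          unfolding h_def f_def by (intro tendsto_intros elim)
        ultimately show ?case by simp
      qed
      show "AE x in lborel. norm (h j x) \<le> D x" for j
        using D0 by (intro AE_I2) (auto simp: h_def abs_le_iff max_def min_def)
      show "(\<lambda>x. F x \<bullet> G x) \<in> borel_measurable lborel" by measurable
      show "h j \<in> borel_measurable lborel" for j unfolding h_def f_def by measurable
    qed fact
    have hint: "integrable lborel (h j)" for j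
    proof (rule Bochner_Integration.integrable_bound[OF D])
      show "h j \<in> borel_measurable lborel" unfolding h_def f_def by measurable
      show "AE x in lborel. norm (h j x) \<le> norm (D x)"
        using D0 by (intro AE_I2) (auto simp: h_def abs_le_iff max_def min_def)
    qed
    have fint: "integrable lborel (f j)" for j unfolding f_def by (rule integrable_inner_shift)
    have lim_d: "(\<lambda>j. (\<integral>x. f j x \<partial>lborel) - (\<integral>x. h j x \<partial>lborel)) \<longlonglongrightarrow> 0"
    proof (rule Lim_null_comparison)
      show "(\<lambda>j. \<integral>x. norm (B (x - y (r j)) - B x) \<partial>lborel) \<longlonglongrightarrow> 0"
        by (rule L1_translation_continuous[OF B yr])
      show "eventually (\<lambda>j. norm ((\<integral>x. f j x \<partial>lborel) - (\<integral>x. h j x \<partial>lborel)) \<le> (\<integral>x. norm (B (x - y (r j)) - B x) \<partial>lborel)) sequentially"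
      proof (intro always_eventually allI)
        fix j
        have pt: "\<bar>f j x - h j x\<bar> \<le> norm (B (x - y (r j)) - B x)" for x
        proof -
          have "\<bar>f j x\<bar> \<le> A x + B (x - y (r j))"
            unfolding f_def using dom[of x "x - y (r j)"] Cauchy_Schwarz_ineq2[of "F x" "G (x - y (r j))"] by linarith
          then show ?thesis using D0[of x] unfolding h_def D_def by (auto simp: max_def min_def abs_le_iff)
        qed
        have "\<bar>(\<integral>x. f j x \<partial>lborel) - (\<integral>x. h j x \<partial>lborel)\<bar> = \<bar>\<integral>x. f j x - h j x \<partial>lborel\<bar>"
          using fint hint by simp
        also have "\<dots> \<le> (\<integral>x. norm (B (x - y (r j)) - B x) \<partial>lborel)"
          using Bochner_Integration.integral_norm_bound_integral[of lborel "\<lambda>x. f j x - h j x" "\<lambda>x. norm (B (x - y (r j)) - B x)"]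
            fint hint B integrable_shift(1)[OF B] pt by simp
        finally show "norm ((\<integral>x. f j x \<partial>lborel) - (\<integral>x. h j x \<partial>lborel)) \<le> (\<integral>x. norm (B (x - y (r j)) - B x) \<partial>lborel)" by simp
      qed
    qed
    from tendsto_add[OF lim_d lim_h] have "(\<lambda>j. \<integral>x. f j x \<partial>lborel) \<longlonglongrightarrow> (\<integral>x. F x \<bullet> G x \<partial>lborel)" by simp
    then show ?thesis using r(1) unfolding f_def by blast
  qed
  show ?thesis
  proof (rule ccontr)
    assume "\<not> ?thesis"
    then obtain e where e: "0 < e" "\<not> eventually (\<lambda>j. dist (\<integral>x. F x \<bullet> G (x - z j) \<partial>lborel) (\<integral>x. F x \<bullet> G x \<partial>lborel) < e) sequentially"
      unfolding tendsto_iff by blast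
    define N where "N = {j. \<not> dist (\<integral>x. F x \<bullet> G (x - z j) \<partial>lborel) (\<integral>x. F x \<bullet> G x \<partial>lborel) < e}"
    have "infinite N" using e(2) unfolding N_def eventually_sequentially infinite_nat_iff_unbounded_le by auto
    then obtain s :: "nat \<Rightarrow> nat" where s: "strict_mono s" "\<And>j. s j \<in> N" using infinite_enumerate by blast
    have "(\<lambda>j. z (s j)) \<longlonglongrightarrow> 0" using LIMSEQ_subseq_LIMSEQ[OF z s(1)] by (simp add: o_def)
    from sub[OF this] obtain r :: "nat \<Rightarrow> nat" where
      "(\<lambda>j. \<integral>x. F x \<bullet> G (x - z (s (r j))) \<partial>lborel) \<longlonglongrightarrow> (\<integral>x. F x \<bullet> G x \<partial>lborel)" by blast
    then have "eventually (\<lambda>j. dist (\<integral>x. F x \<bullet> G (x - z (s (r j))) \<partial>lborel) (\<integral>x. F x \<bullet> G x \<partial>lborel) < e) sequentially"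
      using e(1) by (rule tendstoD)
    then obtain j where "dist (\<integral>x. F x \<bullet> G (x - z (s (r j))) \<partial>lborel) (\<integral>x. F x \<bullet> G x \<partial>lborel) < e"
      by (auto simp: eventually_sequentially)
    then show False using s(2)[of "r j"] by (simp add: N_def)
  qed
qed

end

section \<open>Mollifiers\<close>

definition mollifier :: "real \<Rightarrow> 'a::euclidean_space \<Rightarrow> real" where
  "mollifier e x = ball_bump 0 e x / (\<integral>y. ball_bump 0 e (y::'a) \<partial>lborel)"

lemma continuous_ball_bump: "continuous_on UNIV (ball_bump c r)"
  using smooth_on_ball_bump smooth_on_continuous by blast

lemma ball_bump_outside: "0 < r \<Longrightarrow> x \<notin> ball c r \<Longrightarrow> ball_bump c r x = 0"
  using ball_bump_pos_iff[of r c x] ball_bump_nonneg[of c r x] by linarith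

lemma integrable_ball_bump: "0 < r \<Longrightarrow> integrable lborel (ball_bump (c::'a::euclidean_space) r)"
proof -
  assume r: "0 < r"
  have "integrable lborel (\<lambda>x. indicator (cball c r) x *\<^sub>R ball_bump c r x)"
    by (rule borel_integrable_compact) (auto intro: continuous_on_subset[OF continuous_ball_bump])
  moreover have "(\<lambda>x. indicator (cball c r) x *\<^sub>R ball_bump c r x) = ball_bump c r"
    using ball_bump_outside[OF r] by (force simp: fun_eq_iff indicator_def)
  ultimately show ?thesis by simp
qed

lemma integral_ball_bump_pos:
  assumes r: "0 < r" shows "0 < (\<integral>y. ball_bump 0 r (y::'a::euclidean_space) \<partial>lborel)"
proof -
  have "(\<integral>y. ball_bump 0 r (y::'a) \<partial>lborel) \<noteq> 0"
  proof
    assume "(\<integral>y. ball_bump 0 r (y::'a) \<partial>lborel) = 0"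
    then have "AE y in lborel. ball_bump 0 r (y::'a) = 0"
      using integral_nonneg_eq_0_iff_AE[OF integrable_ball_bump[OF r, of "0::'a"]] ball_bump_nonneg by auto
    then have "AE y in lborel. y \<notin> ball (0::'a) r"
      by eventually_elim (use ball_bump_pos_iff[OF r, of "0::'a"] in force)
    then have "ball (0::'a) r \<in> null_sets lborel" by (subst AE_iff_null_sets) auto
    then have "measure lborel (ball (0::'a) r) = 0" by (simp add: measure_eq_0_null_sets)
    then show False using content_ball_pos[OF r, of "0::'a"] by simp
  qed
  moreover have "0 \<le> (\<integral>y. ball_bump 0 r (y::'a) \<partial>lborel)" using ball_bump_nonneg by (intro integral_nonneg_AE) auto
  ultimately show ?thesis by simp
qed

lemma mollifier_nonneg: "0 < e \<Longrightarrow> 0 \<le> mollifier e x"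
  unfolding mollifier_def by (intro divide_nonneg_pos integral_ball_bump_pos ball_bump_nonneg)

lemma mollifier_outside: "0 < e \<Longrightarrow> e \<le> norm x \<Longrightarrow> mollifier e x = 0"
  unfolding mollifier_def by (subst ball_bump_outside) auto

lemma smooth_on_mollifier: "smooth_on UNIV (mollifier e)"
  unfolding mollifier_def[abs_def] divide_inverse by (intro smooth_on_mult smooth_on_const smooth_on_ball_bump open_UNIV)

lemma integral_mollifier: "0 < e \<Longrightarrow> (\<integral>x. mollifier e (x::'a::euclidean_space) \<partial>lborel) = 1"
  unfolding mollifier_def using integral_ball_bump_pos[of e, where 'a='a] by simp

lemma integrable_mollifier: "0 < e \<Longrightarrow> integrable lborel (mollifier e)"
  unfolding mollifier_def by (intro integrable_divide_zero integrable_ball_bump)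

lemma continuous_mollifier: "continuous_on UNIV (mollifier e)"
  using smooth_on_mollifier smooth_on_continuous by blast

lemma borel_mollifier [measurable]: "mollifier e \<in> borel_measurable borel"
  using continuous_mollifier by (rule borel_measurable_continuous_onI)

lemma mollifier_bounded:
  assumes "0 < e" obtains M where "0 \<le> M" "\<And>x::'a::euclidean_space. mollifier e x \<le> M"
proof -
  have le: "ball_bump 0 e x \<le> 1" for x :: 'a by (simp add: ball_bump_def smooth_step_def)
  define M where "M = 1 / (\<integral>y. ball_bump 0 e (y::'a) \<partial>lborel)"
  have I: "0 < (\<integral>y. ball_bump 0 e (y::'a) \<partial>lborel)" by (rule integral_ball_bump_pos[OF assms])
  show ?thesis
  proof (rule that)
    show "0 \<le> M" unfolding M_def using I by simp
    show "mollifier e x \<le> M" for x :: 'a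
      unfolding mollifier_def M_def using le[of x] I by (intro divide_right_mono) auto
  qed
qed

context dominated_pair
begin

text \<open>By Fubini, pairing \<open>F\<close> with a mollification of \<open>G\<close> is an
  average over \<open>z\<close> of the pairings \<open>T z\<close> with translates of
  \<open>G\<close>. These depend continuously on \<open>z\<close> at 0, and the averages concentrate
  there.\<close>

lemma mollified_pairing:
  assumes e: "\<And>j. 0 < e j" "e \<longlonglongrightarrow> 0"
  shows "(\<lambda>j. \<integral>x. F x \<bullet> (\<integral>y. mollifier (e j) (x - y) *\<^sub>R G y \<partial>lborel) \<partial>lborel) \<longlonglongrightarrow> (\<integral>x. F x \<bullet> G x \<partial>lborel)"
proof -
  define T where "T z = (\<integral>x. F x \<bullet> G (x - z) \<partial>lborel)" for z
  have T0: "T 0 = (\<integral>x. F x \<bullet> G x \<partial>lborel)" by (simp add: T_def)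
  have cont: "continuous (at 0) T"
  proof (rule continuous_at_sequentiallyI)
    fix u :: "nat \<Rightarrow> 'a" assume "u \<longlonglongrightarrow> 0"
    from integral_inner_shift_tendsto[OF this] show "(\<lambda>n. T (u n)) \<longlonglongrightarrow> T 0" by (simp add: T_def)
  qed
  have main: "(\<integral>x. F x \<bullet> (\<integral>y. mollifier \<epsilon> (x - y) *\<^sub>R G y \<partial>lborel) \<partial>lborel) = (\<integral>z. mollifier \<epsilon> z * T z \<partial>lborel)"
    and intT: "integrable lborel (\<lambda>z. mollifier \<epsilon> z * T z)" if \<epsilon>: "0 < \<epsilon>" for \<epsilon>
  proof -
    let ?\<eta> = "mollifier \<epsilon> :: 'a \<Rightarrow> real"
    obtain M where M: "0 \<le> M" "\<And>x. ?\<eta> x \<le> M" using mollifier_bounded[OF \<epsilon>, where 'a='a] by blast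
    have \<eta>0: "0 \<le> ?\<eta> x" for x by (rule mollifier_nonneg[OF \<epsilon>])
    have inner: "F x \<bullet> (\<integral>y. ?\<eta> (x - y) *\<^sub>R G y \<partial>lborel) = (\<integral>z. ?\<eta> z * (F x \<bullet> G (x - z)) \<partial>lborel)" for x
    proof -
      have "(\<integral>y. ?\<eta> (x - y) *\<^sub>R G y \<partial>lborel) = (\<integral>z. ?\<eta> z *\<^sub>R G (x - z) \<partial>lborel)"
        using integral_reflect[of "\<lambda>y. ?\<eta> (x - y) *\<^sub>R G y" x] by simp
      \<comment> \<open>Integrability of the translate of \<open>G\<close> comes from the domination
        \<open>dom\<close> at the fixed point \<open>x\<close>, divided by
        \<open>norm (F x)\<close>. Where \<open>F x = 0\<close> both sides of \<open>inner\<close>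
        vanish.\<close>
      moreover have "integrable lborel (\<lambda>z. ?\<eta> z *\<^sub>R G (x - z))" if nz: "F x \<noteq> 0"
      proof (rule Bochner_Integration.integrable_bound)
        show "integrable lborel (\<lambda>z. (?\<eta> z * A x + M * norm (B (x - z))) / norm (F x))"
          using integrable_mollifier[OF \<epsilon>, where 'a='a] integrable_reflect[OF B, of x] by auto
        show "AE z in lborel. norm (?\<eta> z *\<^sub>R G (x - z)) \<le> norm ((?\<eta> z * A x + M * norm (B (x - z))) / norm (F x))"
        proof (rule AE_I2)
          fix z
          have "?\<eta> z * (norm (F x) * norm (G (x - z))) \<le> ?\<eta> z * (A x + B (x - z))"
            by (intro mult_left_mono dom \<eta>0)
          also have "\<dots> \<le> ?\<eta> z * A x + M * norm (B (x - z))"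
          proof -
            have "?\<eta> z * B (x - z) \<le> ?\<eta> z * norm (B (x - z))" by (intro mult_left_mono \<eta>0) auto
            also have "\<dots> \<le> M * norm (B (x - z))" by (intro mult_right_mono M) auto
            finally show ?thesis by (simp add: distrib_left)
          qed
          finally have "norm (?\<eta> z *\<^sub>R G (x - z)) \<le> (?\<eta> z * A x + M * norm (B (x - z))) / norm (F x)"
            using nz \<eta>0[of z] by (simp add: pos_le_divide_eq mult_ac)
          also have "\<dots> \<le> norm ((?\<eta> z * A x + M * norm (B (x - z))) / norm (F x))"
            unfolding real_norm_def by (rule abs_ge_self)
          finally show "norm (?\<eta> z *\<^sub>R G (x - z)) \<le> norm ((?\<eta> z * A x + M * norm (B (x - z))) / norm (F x))" .
        qed
      qed measurable
      then have "(\<integral>z. F x \<bullet> (?\<eta> z *\<^sub>R G (x - z)) \<partial>lborel) = F x \<bullet> (\<integral>z. ?\<eta> z *\<^sub>R G (x - z) \<partial>lborel)"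
        by (rule integral_inner_right)
      ultimately show ?thesis by simp
    qed
    define f where "f z x = ?\<eta> z * (F x \<bullet> G (x - z))" for z x
    have fm: "case_prod f \<in> borel_measurable (lborel \<Otimes>\<^sub>M lborel)"
      unfolding f_def split_beta' by measurable
    have fz: "integrable lborel (\<lambda>x. f z x)" for z unfolding f_def by (intro integrable_mult_right integrable_inner_shift)
    have AB: "integrable lborel (\<lambda>x. A x + B (x - z))" "(\<integral>x. A x + B (x - z) \<partial>lborel) = (\<integral>x. A x \<partial>lborel) + (\<integral>x. B x \<partial>lborel)" for z
      using A integrable_shift[OF B, of z] by auto
    have fI: "integrable (lborel \<Otimes>\<^sub>M lborel) (case_prod f)"
    proof (rule lborel_pair.Fubini_integrable[OF fm])
      show "AE z in lborel. integrable lborel (\<lambda>x. case (z, x) of (z, x) \<Rightarrow> f z x)" using fz by simp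
      show "integrable lborel (\<lambda>z. \<integral>x. norm (case (z, x) of (z, x) \<Rightarrow> f z x) \<partial>lborel)"
      proof (rule Bochner_Integration.integrable_bound)
        show "integrable lborel (\<lambda>z. ?\<eta> z * ((\<integral>x. A x \<partial>lborel) + (\<integral>x. B x \<partial>lborel)))"
          using integrable_mollifier[OF \<epsilon>, where 'a='a] by auto
        have "(\<lambda>(z, x). norm (f z x)) \<in> borel_measurable (lborel \<Otimes>\<^sub>M lborel)"
          using fm unfolding split_beta' by measurable
        then show "(\<lambda>z. \<integral>x. norm (case (z, x) of (z, x) \<Rightarrow> f z x) \<partial>lborel) \<in> borel_measurable lborel"
          using lborel.borel_measurable_lebesgue_integral[of "\<lambda>z x. norm (f z x)" lborel] by simp
        show "AE z in lborel. norm (\<integral>x. norm (case (z, x) of (z, x) \<Rightarrow> f z x) \<partial>lborel)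
            \<le> norm (?\<eta> z * ((\<integral>x. A x \<partial>lborel) + (\<integral>x. B x \<partial>lborel)))"
        proof (rule AE_I2)
          fix z
          have "(\<integral>x. norm (f z x) \<partial>lborel) \<le> (\<integral>x. ?\<eta> z * (A x + B (x - z)) \<partial>lborel)"
          proof (rule integral_mono)
            fix x
            have "norm (F x \<bullet> G (x - z)) \<le> A x + B (x - z)"
              using dom[of x "x - z"] Cauchy_Schwarz_ineq2[of "F x" "G (x - z)"] by simp
            then show "norm (f z x) \<le> ?\<eta> z * (A x + B (x - z))"
              unfolding f_def using \<eta>0[of z] by (simp add: abs_mult mult_left_mono)
          qed (use fz AB in auto)
          also have "\<dots> = ?\<eta> z * ((\<integral>x. A x \<partial>lborel) + (\<integral>x. B x \<partial>lborel))" using AB(2)[of z] by simp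
          finally show "norm (\<integral>x. norm (case (z, x) of (z, x) \<Rightarrow> f z x) \<partial>lborel)
            \<le> norm (?\<eta> z * ((\<integral>x. A x \<partial>lborel) + (\<integral>x. B x \<partial>lborel)))" by simp
        qed
      qed
    qed
    have "(\<integral>x. F x \<bullet> (\<integral>y. ?\<eta> (x - y) *\<^sub>R G y \<partial>lborel) \<partial>lborel) = (\<integral>x. (\<integral>z. f z x \<partial>lborel) \<partial>lborel)"
      unfolding inner f_def ..
    also have "\<dots> = (\<integral>z. (\<integral>x. f z x \<partial>lborel) \<partial>lborel)" by (rule lborel_pair.Fubini_integral[OF fI])
    finally show "(\<integral>x. F x \<bullet> (\<integral>y. ?\<eta> (x - y) *\<^sub>R G y \<partial>lborel) \<partial>lborel) = (\<integral>z. ?\<eta> z * T z \<partial>lborel)"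
      unfolding f_def T_def by simp
    show "integrable lborel (\<lambda>z. ?\<eta> z * T z)"
      using lborel_pair.integrable_fst'[OF fI] unfolding f_def T_def by simp
  qed
  show ?thesis
  proof (rule LIMSEQ_I)
    fix d :: real assume d: "0 < d"
    obtain \<delta> where \<delta>: "0 < \<delta>" "\<And>z. dist z 0 < \<delta> \<Longrightarrow> dist (T z) (T 0) < d / 2"
      using cont d unfolding continuous_at_eps_delta by (metis half_gt_zero)
    obtain N where N: "\<And>j. N \<le> j \<Longrightarrow> norm (e j - 0) < \<delta>" using LIMSEQ_D[OF e(2) \<delta>(1)] by blast
    have "norm ((\<integral>z. mollifier (e j) z * T z \<partial>lborel) - T 0) < d" if j: "N \<le> j" for j
    proof -
      let ?\<eta> = "mollifier (e j) :: 'a \<Rightarrow> real"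
      note m = integrable_mollifier[OF e(1)[of j], where 'a='a] and m1 = integral_mollifier[OF e(1)[of j], where 'a='a]
      have "(\<integral>z. ?\<eta> z * T z \<partial>lborel) - T 0 = (\<integral>z. ?\<eta> z * T z - ?\<eta> z * T 0 \<partial>lborel)"
        using intT[OF e(1)[of j]] m m1 by simp
      also have "norm \<dots> \<le> (\<integral>z. ?\<eta> z * (d / 2) \<partial>lborel)"
      proof (rule Bochner_Integration.integral_norm_bound_integral)
        fix z
        show "norm (?\<eta> z * T z - ?\<eta> z * T 0) \<le> ?\<eta> z * (d / 2)"
        proof (cases "norm z < e j")
          case True
          then have "norm z < \<delta>" using N[OF j] by simp
          then have "\<bar>T z - T 0\<bar> \<le> d / 2" using \<delta>(2)[of z] by (simp add: dist_real_def)
          then have "?\<eta> z * \<bar>T z - T 0\<bar> \<le> ?\<eta> z * (d / 2)"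
            using mollifier_nonneg[OF e(1)[of j]] by (intro mult_left_mono) auto
          then show ?thesis
            using mollifier_nonneg[OF e(1)[of j], of z] by (simp add: abs_mult right_diff_distrib[symmetric] del: right_diff_distrib)
        next
          case False
          then show ?thesis using mollifier_outside[OF e(1)[of j], of z] by simp
        qed
      qed (use intT[OF e(1)[of j]] m in auto)
      also have "\<dots> = d / 2" using m1 by simp
      finally show ?thesis using d by simp
    qed
    then show "\<exists>N. \<forall>j\<ge>N. norm ((\<integral>x. F x \<bullet> (\<integral>y. mollifier (e j) (x - y) *\<^sub>R G y \<partial>lborel) \<partial>lborel) - (\<integral>x. F x \<bullet> G x \<partial>lborel)) < d"
      unfolding main[OF e(1)] T0 by blast
  qed
qed

end

section \<open>Convolution of continuous functions with smooth kernels\<close>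

definition convolution :: "('a::euclidean_space \<Rightarrow> real) \<Rightarrow> ('a \<Rightarrow> real) \<Rightarrow> 'a \<Rightarrow> real" where
  "convolution u \<rho> x = (\<integral>y. u y * \<rho> (x - y) \<partial>lborel)"

lemma integral_compact_support:
  fixes f :: "'a::euclidean_space \<Rightarrow> 'b::euclidean_space"
  assumes f: "continuous_on UNIV f" and K: "compact K" "\<And>x. x \<notin> K \<Longrightarrow> f x = 0"
  shows "integrable lborel f" and "K = cbox a b \<Longrightarrow> (\<integral>x. f x \<partial>lborel) = integral (cbox a b) f"
proof -
  have eq: "(\<lambda>x. indicator K x *\<^sub>R f x) = f" using K(2) by (auto simp: fun_eq_iff indicator_def)
  have i: "integrable lborel (\<lambda>x. indicator K x *\<^sub>R f x)"
    by (rule borel_integrable_compact[OF K(1)]) (use f continuous_on_subset in blast)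
  then show "integrable lborel f" by (simp only: eq)
  assume "K = cbox a b"
  with i have "set_integrable lborel (cbox a b) f" by (simp add: set_integrable_def)
  from set_borel_integral_eq_integral(2)[OF this] show "(\<integral>x. f x \<partial>lborel) = integral (cbox a b) f"
    using eq \<open>K = cbox a b\<close> by (simp add: set_lebesgue_integral_def)
qed

lemma convolution_has_derivative:
  fixes u :: "'a::euclidean_space \<Rightarrow> real"
  assumes u: "continuous_on UNIV u" "\<And>x. x \<notin> cbox a b \<Longrightarrow> u x = 0" and \<rho>: "smooth_on UNIV \<rho>"
  shows "(convolution u \<rho> has_derivative (\<lambda>h. convolution u (\<lambda>x. grad \<rho> x \<bullet> h) x)) (at x)"
proof -
  have g: "continuous_on UNIV (grad \<rho>)" by (rule continuous_on_grad[OF \<rho>])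
  have sh: "continuous_on UNIV (\<lambda>y. f (x - y))" if "continuous_on UNIV f" for f :: "'a \<Rightarrow> 'b::euclidean_space" and x
    by (rule continuous_on_compose2[OF that]) (auto intro!: continuous_intros)
  have conv: "convolution u \<sigma> x = integral (cbox a b) (\<lambda>y. u y * \<sigma> (x - y))" if "continuous_on UNIV \<sigma>" for \<sigma> x
    unfolding convolution_def
    by (rule integral_compact_support(2)[of _ "cbox a b"]) (use u sh[OF that] in \<open>auto intro: continuous_intros\<close>)
  have "((\<lambda>x. integral (cbox a b) (\<lambda>y. u y * \<rho> (x - y))) has_derivative
      blinfun_apply (integral (cbox a b) (\<lambda>y. u y *\<^sub>R blinfun_inner_right (grad \<rho> (x - y))))) (at x within UNIV)"
  proof (rule leibniz_rule)
    fix x t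
    have "(\<rho> has_derivative (\<lambda>h. grad \<rho> (x - t) \<bullet> h)) (at (x - t))" by (rule smooth_has_derivative_grad[OF \<rho>]) simp
    moreover have "((\<lambda>x. x - t) has_derivative (\<lambda>h. h)) (at x)" by (auto intro!: derivative_eq_intros)
    ultimately have "((\<lambda>x. \<rho> (x - t)) has_derivative (\<lambda>h. grad \<rho> (x - t) \<bullet> h)) (at x)"
      using has_derivative_compose[of "\<lambda>x. x - t" "\<lambda>h. h" x UNIV \<rho>] by blast
    from has_derivative_mult_right[OF this, of "u t"]
    have "((\<lambda>x. u t * \<rho> (x - t)) has_derivative (\<lambda>h. u t * (grad \<rho> (x - t) \<bullet> h))) (at x)" .
    moreover have "blinfun_apply (u t *\<^sub>R blinfun_inner_right (grad \<rho> (x - t))) = (\<lambda>h. u t * (grad \<rho> (x - t) \<bullet> h))"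
      by (simp add: fun_eq_iff blinfun.scaleR_left)
    ultimately show "((\<lambda>x. u t * \<rho> (x - t)) has_derivative blinfun_apply (u t *\<^sub>R blinfun_inner_right (grad \<rho> (x - t)))) (at x within UNIV)"
      by simp
  next
    show "(\<lambda>y. u y * \<rho> (x - y)) integrable_on cbox a b" for x
      using u(1) sh[OF smooth_on_continuous[OF \<rho>]]
      by (intro integrable_continuous continuous_intros) (auto intro: continuous_on_subset)
    have "continuous_on (UNIV \<times> cbox a b) (\<lambda>p. u (snd p) *\<^sub>R blinfun_inner_right (grad \<rho> (fst p - snd p)))"
    proof (intro continuous_intros bounded_linear.continuous_on[OF bounded_linear_blinfun_inner_right])
      show "continuous_on (UNIV \<times> cbox a b) (\<lambda>p. u (snd p))"
        by (rule continuous_on_compose2[OF u(1)]) (auto intro!: continuous_intros)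
      show "continuous_on (UNIV \<times> cbox a b) (\<lambda>p. grad \<rho> (fst p - snd p))"
        by (rule continuous_on_compose2[OF g]) (auto intro!: continuous_intros)
    qed
    then show "continuous_on (UNIV \<times> cbox a b) (\<lambda>(x, y). u y *\<^sub>R blinfun_inner_right (grad \<rho> (x - y)))"
      by (simp add: split_beta')
  qed auto
  moreover have ap: "blinfun_apply (integral (cbox a b) (\<lambda>y. u y *\<^sub>R blinfun_inner_right (grad \<rho> (x - y)))) h
      = convolution u (\<lambda>x. grad \<rho> x \<bullet> h) x" for h
  proof -
    have "(\<lambda>y. u y *\<^sub>R blinfun_inner_right (grad \<rho> (x - y))) integrable_on cbox a b"
      using u(1) sh[OF g]
      by (intro integrable_continuous continuous_intros bounded_linear.continuous_on[OF bounded_linear_blinfun_inner_right])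
         (auto intro: continuous_on_subset)
    then have "blinfun_apply (integral (cbox a b) (\<lambda>y. u y *\<^sub>R blinfun_inner_right (grad \<rho> (x - y)))) h
      = integral (cbox a b) (\<lambda>y. u y * (grad \<rho> (x - y) \<bullet> h))"
      by (simp add: blinfun_apply_integral blinfun.scaleR_left)
    also have "\<dots> = convolution u (\<lambda>x. grad \<rho> x \<bullet> h) x"
      by (rule conv[symmetric]) (intro continuous_intros g)
    finally show ?thesis .
  qed
  moreover have cu: "convolution u \<rho> = (\<lambda>x. integral (cbox a b) (\<lambda>y. u y * \<rho> (x - y)))"
    using conv[OF smooth_on_continuous[OF \<rho>]] by (simp add: fun_eq_iff)
  moreover from ap have "blinfun_apply (integral (cbox a b) (\<lambda>y. u y *\<^sub>R blinfun_inner_right (grad \<rho> (x - y))))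
      = (\<lambda>h. convolution u (\<lambda>x. grad \<rho> x \<bullet> h) x)" by (intro ext)
  ultimately show ?thesis by simp
qed

text \<open>All derivatives fall on the kernel: a partial derivative of the convolution is the
  convolution with a partial derivative of \<open>\<rho>\<close>. Hence the induction keeps the
  merely continuous \<open>u\<close> fixed and varies \<open>\<rho>\<close>.\<close>

lemma smooth_on_convolution:
  fixes u :: "'a::euclidean_space \<Rightarrow> real"
  assumes u: "continuous_on UNIV u" "\<And>x. x \<notin> cbox a b \<Longrightarrow> u x = 0" and \<rho>: "smooth_on UNIV \<rho>"
  shows "smooth_on UNIV (convolution u \<rho>)"
proof (rule smooth_onI)
  fix k show "Ck_on k UNIV (convolution u \<rho>)"
    using \<rho>
  proof (induction k arbitrary: \<rho>)
    case 0
    have "continuous_on UNIV (convolution u \<rho>)"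
      by (intro continuous_at_imp_continuous_on ballI has_derivative_continuous[OF convolution_has_derivative[where a = a and b = b, OF u 0]])
    then show ?case by simp
  next
    case (Suc k)
    show ?case
    proof (rule Ck_on_SucI[OF open_UNIV convolution_has_derivative[where a = a and b = b, OF u Suc.prems]])
      fix b :: 'a assume b: "b \<in> Basis"
      have "(\<lambda>x. grad \<rho> x \<bullet> b) = (\<lambda>x. frechet_derivative \<rho> (at x) b)"
        using grad_inner[OF smooth_on_has_derivative[OF Suc.prems]] by (simp add: fun_eq_iff)
      then have "smooth_on UNIV (\<lambda>x. grad \<rho> x \<bullet> b)" using smooth_on_deriv[OF Suc.prems b] by simp
      then show "Ck_on k UNIV (\<lambda>x. convolution u (\<lambda>x. grad \<rho> x \<bullet> b) x)" by (rule Suc.IH)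
    qed
  qed
qed

lemma grad_convolution:
  fixes u :: "'a::euclidean_space \<Rightarrow> real"
  assumes u: "continuous_on UNIV u" "\<And>x. x \<notin> cbox a b \<Longrightarrow> u x = 0" and \<rho>: "smooth_on UNIV \<rho>"
  shows "grad (convolution u \<rho>) x = (\<integral>y. u y *\<^sub>R grad \<rho> (x - y) \<partial>lborel)"
proof (rule grad_eqI)
  have g: "continuous_on UNIV (grad \<rho>)" by (rule continuous_on_grad[OF \<rho>])
  have "continuous_on UNIV (\<lambda>y. grad \<rho> (x - y))"
    by (rule continuous_on_compose2[OF g]) (auto intro!: continuous_intros)
  then have "continuous_on UNIV (\<lambda>y. u y *\<^sub>R grad \<rho> (x - y))" using u(1) by (intro continuous_intros)
  then have i: "integrable lborel (\<lambda>y. u y *\<^sub>R grad \<rho> (x - y))"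
    by (rule integral_compact_support(1)[of _ "cbox a b"]) (use u(2) in auto)
  have "convolution u (\<lambda>x. grad \<rho> x \<bullet> h) x = (\<integral>y. u y *\<^sub>R grad \<rho> (x - y) \<partial>lborel) \<bullet> h" for h
    using integral_inner_left[of h lborel "\<lambda>y. u y *\<^sub>R grad \<rho> (x - y)"] i by (simp add: convolution_def)
  then show "(convolution u \<rho> has_derivative (\<lambda>h. (\<integral>y. u y *\<^sub>R grad \<rho> (x - y) \<partial>lborel) \<bullet> h)) (at x)"
    using convolution_has_derivative[where a = a and b = b, OF u \<rho>, where x = x] by simp
qed

lemma convolution_mollifier_close:
  fixes u :: "'a::euclidean_space \<Rightarrow> real"
  assumes u: "continuous_on UNIV u" and e: "0 < e" and d: "\<And>y. norm (x - y) < e \<Longrightarrow> \<bar>u y - u x\<bar> \<le> d"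
  shows "\<bar>convolution u (mollifier e) x - u x\<bar> \<le> d"
proof -
  have [measurable]: "u \<in> borel_measurable borel" using u by (rule borel_measurable_continuous_onI)
  let ?m = "mollifier e :: 'a \<Rightarrow> real"
  note m = integrable_reflect[OF integrable_mollifier[OF e], of x] and m0 = mollifier_nonneg[OF e]
  have m1: "(\<integral>y. ?m (x - y) \<partial>lborel) = 1"
    using integral_reflect[of ?m x] integral_mollifier[OF e, where 'a='a] by simp
  have pt: "norm (u y * ?m (x - y) - u x * ?m (x - y)) \<le> d * ?m (x - y)" for y
  proof (cases "norm (x - y) < e")
    case True
    from mult_right_mono[OF d[OF True] m0] show ?thesis using m0[of "x - y"]
      by (simp add: abs_mult left_diff_distrib[symmetric] del: left_diff_distrib)
  next
    case False
    then show ?thesis using mollifier_outside[OF e, of "x - y"] by simp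
  qed
  have i: "integrable lborel (\<lambda>y. u y * ?m (x - y) - u x * ?m (x - y))"
  proof (rule Bochner_Integration.integrable_bound)
    show "integrable lborel (\<lambda>y. d * ?m (x - y))" using m by simp
    show "AE y in lborel. norm (u y * ?m (x - y) - u x * ?m (x - y)) \<le> norm (d * ?m (x - y))"
      using pt by (intro AE_I2) (metis abs_ge_self order_trans real_norm_def)
  qed measurable
  have i2: "integrable lborel (\<lambda>y. u x * ?m (x - y))" using m by simp
  from Bochner_Integration.integrable_add[OF i i2] have i3: "integrable lborel (\<lambda>y. u y * ?m (x - y))" by simp
  have "convolution u ?m x - u x = (\<integral>y. u y * ?m (x - y) - u x * ?m (x - y) \<partial>lborel)"
    unfolding convolution_def using i2 i3 m1 by simp
  also have "\<bar>\<dots>\<bar> \<le> (\<integral>y. d * ?m (x - y) \<partial>lborel)"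
    using Bochner_Integration.integral_norm_bound_integral[OF i, of "\<lambda>y. d * ?m (x - y)"] m pt by simp
  also have "\<dots> = d" using m1 by simp
  finally show ?thesis .
qed

lemma mollification_uniform:
  fixes u :: "'a::euclidean_space \<Rightarrow> real"
  assumes u: "continuous_on UNIV u" and K: "compact K" "\<And>x. x \<notin> K \<Longrightarrow> u x = 0" and d: "0 < d"
  obtains \<delta> where "0 < \<delta>" "\<And>e x. 0 < e \<Longrightarrow> e < \<delta> \<Longrightarrow> \<bar>convolution u (mollifier e) x - u x\<bar> \<le> d"
proof -
  obtain R where R: "K \<subseteq> cball 0 R" 
    using bounded_subset_ballD[OF compact_imp_bounded[OF K(1)], of 0] ball_subset_cball by (metis order_trans)
  \<comment> \<open>The two unit margins, with \<open>e < 1\<close>: if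
    \<open>norm x \<le> R + 1\<close>, then the points near \<open>x\<close> stay in the ball of
    radius \<open>R + 2\<close>; otherwise \<open>x\<close> and these points lie outside
    \<open>K\<close>, where \<open>u\<close> vanishes.\<close>
  have "uniformly_continuous_on (cball 0 (R + 2)) u"
    using u by (intro compact_uniformly_continuous) (auto intro: continuous_on_subset)
  then obtain \<delta> where \<delta>: "0 < \<delta>" "\<And>x y. x \<in> cball 0 (R + 2) \<Longrightarrow> y \<in> cball 0 (R + 2) \<Longrightarrow> dist y x < \<delta> \<Longrightarrow> dist (u y) (u x) < d"
    unfolding uniformly_continuous_on_def using d by metis
  show ?thesis
  proof (rule that[of "min \<delta> 1"])
    fix e x assume e: "0 < e" "e < min \<delta> 1"
    show "\<bar>convolution u (mollifier e) x - u x\<bar> \<le> d"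
    proof (rule convolution_mollifier_close[OF u e(1)])
      fix y assume y: "norm (x - y) < e"
      show "\<bar>u y - u x\<bar> \<le> d"
      proof (cases "norm x \<le> R + 1")
        case True
        have "norm y \<le> norm x + norm (x - y)" using norm_triangle_sub[of y x] by (simp add: norm_minus_commute)
        then have "dist (u y) (u x) < d" using True y e by (intro \<delta>(2)) (auto simp: dist_norm norm_minus_commute)
        then show ?thesis by (simp add: dist_real_def)
      next
        case False
        have "norm x \<le> norm y + norm (x - y)" using norm_triangle_sub[of x y] by simp
        then have "x \<notin> K" "y \<notin> K" using False y e R by (auto simp: subset_eq)
        then show ?thesis using K(2) d by simp
      qed
    qed
  qed (use \<delta>(1) in auto)
qed

lemma convolution_mollifier_support:
  fixes u :: "'a::euclidean_space \<Rightarrow> real"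
  assumes e: "0 < e" and K: "\<And>x. x \<notin> K \<Longrightarrow> u x = 0" and x: "\<And>y. y \<in> K \<Longrightarrow> e \<le> dist y x"
  shows "convolution u (mollifier e) x = 0"
proof -
  have "u y * mollifier e (x - y) = 0" for y
    using K[of y] x[of y] mollifier_outside[OF e, of "x - y"] by (cases "y \<in> K") (auto simp: dist_norm norm_minus_commute)
  then have eq: "(\<lambda>y. u y * mollifier e (x - y)) = (\<lambda>y. 0)" by (intro ext)
  show ?thesis unfolding convolution_def eq by simp
qed

lemma convolution_test_function:
  fixes u :: "'a::euclidean_space \<Rightarrow> real"
  assumes u: "continuous_on UNIV u" and K: "compact K" "K \<subseteq> \<Omega>" "\<And>x. x \<notin> K \<Longrightarrow> u x = 0" and "open \<Omega>"
  obtains \<delta> where "0 < \<delta>" "\<And>e. 0 < e \<Longrightarrow> e < \<delta> \<Longrightarrow> convolution u (mollifier e) \<in> test_functions \<Omega>"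
proof -
  obtain \<delta> where \<delta>: "0 < \<delta>" "(\<Union>x\<in>K. cball x \<delta>) \<subseteq> \<Omega>"
    using compact_subset_open_imp_cball_epsilon_subset[OF K(1) assms(5) K(2)] by blast
  obtain a b where ab: "K \<subseteq> cbox a b" using compact_imp_bounded[OF K(1)] bounded_subset_cbox_symmetric by blast
  show ?thesis
  proof (rule that[OF \<delta>(1)])
    fix e assume e: "0 < e" "e < \<delta>"
    let ?C = "{x + y |x y. x \<in> K \<and> y \<in> cball 0 e}"
    have C: "compact ?C" by (intro compact_sums K) auto
    have "{x. convolution u (mollifier e) x \<noteq> 0} \<subseteq> ?C"
    proof
      fix x assume x: "x \<in> {x. convolution u (mollifier e) x \<noteq> 0}"
      have "\<not> (\<forall>y\<in>K. e \<le> dist y x)"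
        using convolution_mollifier_support[where x = x and K = K and u = u, OF e(1) K(3)] x by blast
      then obtain y where "y \<in> K" "dist y x < e" by (auto simp: not_le)
      then show "x \<in> ?C" by (intro CollectI exI[of _ y] exI[of _ "x - y"]) (auto simp: dist_norm norm_minus_commute)
    qed
    then have cl: "closure {x. convolution u (mollifier e) x \<noteq> 0} \<subseteq> ?C"
      using compact_imp_closed[OF C] by (rule closure_minimal)
    have "?C \<subseteq> \<Omega>"
    proof
      fix z assume "z \<in> ?C"
      then obtain x y where "z = x + y" "x \<in> K" "norm y \<le> e" by auto
      then have "z \<in> cball x \<delta>" using e by (simp add: dist_norm)
      then show "z \<in> \<Omega>" using \<delta>(2) \<open>x \<in> K\<close> by blast
    qed
    moreover have "smooth_on UNIV (convolution u (mollifier e))"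
      by (rule smooth_on_convolution[OF u _ smooth_on_mollifier, of a b]) (use K(3) ab in blast)
    moreover have "compact (closure {x. convolution u (mollifier e) x \<noteq> 0})"
      unfolding compact_closure
      by (rule bounded_subset[OF compact_imp_bounded[OF C] order_trans[OF closure_subset cl]])
    ultimately show "convolution u (mollifier e) \<in> test_functions \<Omega>"
      using cl by (auto simp: test_functions_def)
  qed
qed

section \<open>The Gauss-Green formula for divergence-measure fields\<close>

text \<open>A real-valued countably additive function has bounded range. Otherwise sets of unbounded
  variation can be nested so that each difference has mass above 1 in absolute value; these
  differences are disjoint and contradict convergence of the series.\<close>

lemma real_radon_measure_bounded:
  assumes "real_radon_measure \<Omega> \<mu>"
  obtains c where "\<And>A. A \<in> sets (restrict_space borel \<Omega>) \<Longrightarrow> \<bar>\<mu> A\<bar> \<le> c"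
proof -
  let ?S = "sets (restrict_space borel \<Omega>)"
  have empty: "\<mu> {} = 0" using assms by (simp add: real_radon_measure_def)
  have sums: "(\<lambda>i. \<mu> (A i)) sums \<mu> (\<Union>i. A i)" if "range A \<subseteq> ?S" "disjoint_family A" for A :: "nat \<Rightarrow> 'a set"
    using assms that by (simp add: real_radon_measure_def)
  have add: "\<mu> (A \<union> B) = \<mu> A + \<mu> B" if AB: "A \<in> ?S" "B \<in> ?S" "A \<inter> B = {}" for A B
  proof -
    let ?F = "\<lambda>i::nat. if i = 0 then A else if i = 1 then B else {}"
    have "range ?F \<subseteq> ?S" using AB by auto
    moreover have "disjoint_family ?F" using AB(3) by (auto simp: disjoint_family_on_def)
    ultimately have "(\<lambda>i. \<mu> (?F i)) sums \<mu> (\<Union>i. ?F i)" by (rule sums)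
    moreover have "(\<Union>i. ?F i) = A \<union> B" by (auto split: if_splits)
    moreover have "(\<lambda>i. \<mu> (?F i)) sums (\<Sum>i\<in>{0, 1}. \<mu> (?F i))" by (rule sums_finite) (auto simp: empty)
    ultimately show ?thesis using sums_unique2 by fastforce
  qed
  define unb where "unb X \<longleftrightarrow> X \<in> ?S \<and> (\<forall>c. \<exists>A\<in>?S. A \<subseteq> X \<and> c < \<bar>\<mu> A\<bar>)" for X
  have step: "\<exists>Y. unb Y \<and> Y \<subseteq> X \<and> 1 < \<bar>\<mu> (X - Y)\<bar>" if X: "unb X" for X
  proof -
    \<comment> \<open>The excess over \<open>\<bar>\<mu> X\<bar> + 1\<close> makes both
      \<open>A\<close> and \<open>X - A\<close> have mass above 1 in absolute value. At least one of
      them is again unbounded and is kept, the other is split off.\<close>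
    obtain A where A: "A \<in> ?S" "A \<subseteq> X" "\<bar>\<mu> X\<bar> + 1 < \<bar>\<mu> A\<bar>" using X unfolding unb_def by blast
    have XS: "X \<in> ?S" using X by (simp add: unb_def)
    have B: "X - A \<in> ?S" using XS A(1) by (rule sets.Diff)
    have "\<mu> X = \<mu> A + \<mu> (X - A)" using add[OF A(1) B] A(2) by (simp add: Un_absorb1)
    then have Bl: "1 < \<bar>\<mu> (X - A)\<bar>" using A(3) by linarith
    have Al: "1 < \<bar>\<mu> A\<bar>" using A(3) by linarith
    have "unb A \<or> unb (X - A)"
    proof (rule ccontr)
      assume "\<not> ?thesis"
      then obtain c1 c2 where c: "\<And>C. C \<in> ?S \<Longrightarrow> C \<subseteq> A \<Longrightarrow> \<bar>\<mu> C\<bar> \<le> c1" "\<And>C. C \<in> ?S \<Longrightarrow> C \<subseteq> X - A \<Longrightarrow> \<bar>\<mu> C\<bar> \<le> c2"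
        using A(1) B unfolding unb_def not_less[symmetric] by metis
      obtain C where C: "C \<in> ?S" "C \<subseteq> X" "c1 + c2 < \<bar>\<mu> C\<bar>" using X unfolding unb_def by blast
      have s: "C \<inter> A \<in> ?S" "C - A \<in> ?S" using C(1) A(1) by auto
      have "\<mu> ((C \<inter> A) \<union> (C - A)) = \<mu> (C \<inter> A) + \<mu> (C - A)" by (rule add[OF s]) auto
      moreover have "(C \<inter> A) \<union> (C - A) = C" by auto
      ultimately have "\<bar>\<mu> C\<bar> \<le> \<bar>\<mu> (C \<inter> A)\<bar> + \<bar>\<mu> (C - A)\<bar>" by simp
      moreover have "\<bar>\<mu> (C \<inter> A)\<bar> \<le> c1" "\<bar>\<mu> (C - A)\<bar> \<le> c2" using c s C(2) by blast+
      ultimately show False using C(3) by linarith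
    qed
    moreover have "X - (X - A) = A" using A(2) by auto
    ultimately show ?thesis using A(2) Al Bl by (metis Diff_subset)
  qed
  have "\<not> unb \<Omega>"
  proof
    assume "unb \<Omega>"
    then obtain X where X: "\<And>n. unb (X n)" "\<And>n. X (Suc n) \<subseteq> X n \<and> 1 < \<bar>\<mu> (X n - X (Suc n))\<bar>"
      using dependent_nat_choice[of "\<lambda>_. unb" "\<lambda>_ X Y. Y \<subseteq> X \<and> 1 < \<bar>\<mu> (X - Y)\<bar>"] step by blast
    define D where "D n = X n - X (Suc n)" for n
    have mono: "X m \<subseteq> X n" if "n \<le> m" for m n using lift_Suc_antimono_le[of X n m] X(2) that by blast
    have "disjoint_family D"
    proof -
      have *: "D m \<inter> D n = {}" if "m < n" for m n
        using mono[of "Suc m" n] that by (auto simp: D_def)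
      have "D m \<inter> D n = {}" if "m \<noteq> n" for m n
        using *[of m n] *[of n m] that by (cases "m < n") auto
      then show ?thesis by (auto simp: disjoint_family_on_def)
    qed
    moreover have "range D \<subseteq> ?S" using X(1) by (auto simp: D_def unb_def)
    ultimately have "(\<lambda>n. \<mu> (D n)) sums \<mu> (\<Union>n. D n)" by (intro sums)
    then have "(\<lambda>n. \<mu> (D n)) \<longlonglongrightarrow> 0" using sums_summable summable_LIMSEQ_zero by blast
    then obtain n where "norm (\<mu> (D n) - 0) < 1" using LIMSEQ_D[of _ 0 1] by (metis le_refl zero_less_one)
    then show False using X(2)[of n] by (simp add: D_def)
  qed
  moreover have "\<Omega> \<in> ?S" using sets.top[of "restrict_space borel \<Omega>"] by (simp add: space_restrict_space)
  ultimately obtain c where c: "\<And>A. A \<in> ?S \<Longrightarrow> A \<subseteq> \<Omega> \<Longrightarrow> \<bar>\<mu> A\<bar> \<le> c" unfolding unb_def by (meson not_less)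
  show ?thesis
  proof (rule that)
    fix A assume A: "A \<in> ?S"
    then have "A \<subseteq> \<Omega>" using sets.sets_into_space[OF A] by (simp add: space_restrict_space)
    then show "\<bar>\<mu> A\<bar> \<le> c" using c A by blast
  qed
qed

lemma space_pos_part: "space (pos_part \<Omega> \<mu>) = \<Omega>"
  and sets_pos_part: "sets (pos_part \<Omega> \<mu>) = sets (restrict_space borel \<Omega>)"
proof -
  interpret sigma_algebra \<Omega> "sets (restrict_space borel \<Omega>)"
    using sets.sigma_algebra_axioms[of "restrict_space borel \<Omega>"] by (simp add: space_restrict_space)
  show "space (pos_part \<Omega> \<mu>) = \<Omega>" "sets (pos_part \<Omega> \<mu>) = sets (restrict_space borel \<Omega>)"
    by (simp_all add: pos_part_def space_closed)
qed

lemma finite_measure_pos_part: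
  assumes "real_radon_measure \<Omega> \<mu>"
  shows "finite_measure (pos_part \<Omega> \<mu>)"
proof (rule finite_measureI)
  obtain c where c: "\<And>A. A \<in> sets (restrict_space borel \<Omega>) \<Longrightarrow> \<bar>\<mu> A\<bar> \<le> c"
    using real_radon_measure_bounded[OF assms] by blast
  have "(SUP A\<in>{A \<in> sets (restrict_space borel \<Omega>). A \<subseteq> \<Omega>}. ennreal (\<mu> A)) \<le> ennreal c"
    by (rule SUP_least) (use c in \<open>force intro: ennreal_leI\<close>)
  also have "\<dots> < top" by simp
  \<comment> \<open>\<open>measure_of\<close> gives \<open>\<Omega>\<close> either this supremum or
    the default value \<open>0\<close>; both are finite.\<close>
  finally have "emeasure (pos_part \<Omega> \<mu>) \<Omega> < top"
    unfolding pos_part_def emeasure_measure_of_conv by simp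
  then show "emeasure (pos_part \<Omega> \<mu>) (space (pos_part \<Omega> \<mu>)) \<noteq> \<infinity>" by (simp add: space_pos_part less_top)
qed

lemma real_radon_measure_uminus: "real_radon_measure \<Omega> \<mu> \<Longrightarrow> real_radon_measure \<Omega> (\<lambda>A. - \<mu> A)"
  by (auto simp: real_radon_measure_def intro: sums_minus)

lemma finite_measure_neg_part: "real_radon_measure \<Omega> \<mu> \<Longrightarrow> finite_measure (neg_part \<Omega> \<mu>)"
  unfolding neg_part_def by (rule finite_measure_pos_part[OF real_radon_measure_uminus])

lemma space_neg_part: "space (neg_part \<Omega> \<mu>) = \<Omega>"
  and sets_neg_part: "sets (neg_part \<Omega> \<mu>) = sets (restrict_space borel \<Omega>)"
  by (simp_all add: neg_part_def space_pos_part sets_pos_part)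

section \<open>Borel representatives and conjugate exponents\<close>

definition Lp_borel :: "ennreal \<Rightarrow> ('a::euclidean_space \<Rightarrow> 'a) \<Rightarrow> bool" where
  "Lp_borel p F \<longleftrightarrow> F \<in> borel_measurable borel \<and>
     (if p = \<infinity> then \<exists>C. \<forall>x. norm (F x) \<le> C else integrable lborel (\<lambda>x. norm (F x) powr enn2real p))"

lemma lebesgue_ex_borel:
  fixes F :: "'a::euclidean_space \<Rightarrow> 'b::euclidean_space"
  assumes "F \<in> borel_measurable lebesgue"
  obtains F' where "F' \<in> borel_measurable borel" "AE x in lborel. F x = F' x"
proof -
  have "\<exists>f\<in>borel_measurable lborel. AE x in lborel. F x \<bullet> b = f x" for b
    using assms by (intro completion_ex_borel_measurable_real) auto
  then obtain f where f: "\<And>b. f b \<in> borel_measurable lborel" "\<And>b. AE x in lborel. F x \<bullet> b = f b x" by metis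
  show ?thesis
  proof
    show "(\<lambda>x. \<Sum>b\<in>Basis. f b x *\<^sub>R b) \<in> borel_measurable borel" using f(1) by simp
    have "AE x in lborel. \<forall>b\<in>Basis. F x \<bullet> b = f b x" using f(2) by (intro AE_finite_allI) auto
    then show "AE x in lborel. F x = (\<Sum>b\<in>Basis. f b x *\<^sub>R b)"
    proof eventually_elim
      case (elim x)
      have "F x = (\<Sum>b\<in>Basis. (F x \<bullet> b) *\<^sub>R b)" by (simp add: euclidean_representation)
      also have "\<dots> = (\<Sum>b\<in>Basis. f b x *\<^sub>R b)" using elim by (intro sum.cong) auto
      finally show ?case .
    qed
  qed
qed

text \<open>The representative is Borel on the whole space and zero outside \<open>\<Omega>\<close>,
  so that translations make sense. For \<open>p = \<infinity>\<close> it is bounded at every point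
  and not just almost everywhere, because \<open>dominated_pair\<close> asks for a bound at all
  pairs of points.\<close>

lemma Lp_ex_borel:
  assumes "open \<Omega>" and F: "F \<in> Lp p \<Omega>"
  obtains F' where "Lp_borel p F'" "AE x in lborel. indicator \<Omega> x *\<^sub>R F x = F' x" "\<And>x. x \<notin> \<Omega> \<Longrightarrow> F' x = 0"
    "(\<lambda>x. indicator \<Omega> x *\<^sub>R F x) \<in> borel_measurable lebesgue"
proof -
  have Om: "\<Omega> \<in> sets borel" "\<Omega> \<inter> space lebesgue \<in> sets lebesgue" using assms(1) by auto
  have Fm: "F \<in> borel_measurable (lebesgue_on \<Omega>)" using F by (simp add: Lp_def)
  have m: "(\<lambda>x. indicator \<Omega> x *\<^sub>R F x) \<in> borel_measurable lebesgue"
    using borel_measurable_restrict_space_iff[OF Om(2), of F] Fm by simp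
  obtain F1 where F1: "F1 \<in> borel_measurable borel" "AE x in lborel. indicator \<Omega> x *\<^sub>R F x = F1 x"
    using lebesgue_ex_borel[OF m] by blast
  show ?thesis
  proof (cases "p = \<infinity>")
    case True
    then obtain C where C: "AE x in lebesgue_on \<Omega>. norm (F x) \<le> C" using F by (auto simp: Lp_def)
    then have "AE x in lebesgue. x \<in> \<Omega> \<longrightarrow> norm (F x) \<le> C" using AE_restrict_space_iff[OF Om(2)] by simp
    then have C': "AE x in lborel. x \<in> \<Omega> \<longrightarrow> norm (F x) \<le> C" by (simp add: AE_completion_iff)
    define F' where "F' x = (if x \<in> \<Omega> \<and> norm (F1 x) \<le> C then F1 x else 0)" for x
    have [measurable]: "F1 \<in> borel_measurable borel" "\<Omega> \<in> sets borel" by fact+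
    show ?thesis
    proof (rule that[of F'])
      have "F' \<in> borel_measurable borel" unfolding F'_def by measurable
      moreover have "norm (F' x) \<le> \<bar>C\<bar>" for x by (auto simp: F'_def)
      ultimately show "Lp_borel p F'" using True by (auto simp: Lp_borel_def)
      show "AE x in lborel. indicator \<Omega> x *\<^sub>R F x = F' x"
        using F1(2) C'
      proof eventually_elim
        case (elim x)
        show ?case by (cases "x \<in> \<Omega>") (use elim in \<open>auto simp: F'_def\<close>)
      qed
    qed (auto simp: F'_def m)
  next
    case False
    define F' where "F' x = indicator \<Omega> x *\<^sub>R F1 x" for x
    have [measurable]: "F1 \<in> borel_measurable borel" "\<Omega> \<in> sets borel" by fact+
    have F'm [measurable]: "F' \<in> borel_measurable borel" unfolding F'_def by measurable
    have ae: "AE x in lborel. indicator \<Omega> x *\<^sub>R F x = F' x"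
      using F1(2) by eventually_elim (auto simp: F'_def indicator_def)
    have "integrable (lebesgue_on \<Omega>) (\<lambda>x. norm (F x) powr enn2real p)" using F False by (simp add: Lp_def)
    then have i: "integrable lebesgue (\<lambda>x. indicator \<Omega> x *\<^sub>R (norm (F x) powr enn2real p))"
      by (rule integrable_restrict_space[OF Om(2), THEN iffD1])
    have "integrable lebesgue (\<lambda>x. norm (F' x) powr enn2real p)"
    proof (rule integrable_cong_AE_imp[OF i])
      show "(\<lambda>x. norm (F' x) powr enn2real p) \<in> borel_measurable lebesgue"
        by (rule measurable_completion) measurable
      have "AE x in lborel. indicator \<Omega> x *\<^sub>R (norm (F x) powr enn2real p) = norm (F' x) powr enn2real p"
        using ae
      proof eventually_elim
        case (elim x)
        show ?case unfolding elim[symmetric] by (cases "x \<in> \<Omega>") auto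
      qed
      then show "AE x in lebesgue. indicator \<Omega> x *\<^sub>R (norm (F x) powr enn2real p) = norm (F' x) powr enn2real p"
        by (simp add: AE_completion_iff)
    qed
    then have "integrable lborel (\<lambda>x. norm (F' x) powr enn2real p)"
      by (subst (asm) integrable_completion) measurable
    then have "Lp_borel p F'" using False F'm by (simp add: Lp_borel_def)
    then show ?thesis using ae _ m by (rule that) (simp add: F'_def)
  qed
qed

lemma Lp_borel_bounded_compact:
  fixes G :: "'a::euclidean_space \<Rightarrow> 'a"
  assumes [measurable]: "G \<in> borel_measurable borel" and c: "\<And>x. norm (G x) \<le> c" and K: "compact K" "\<And>x. x \<notin> K \<Longrightarrow> G x = 0"
  shows "Lp_borel p G"
proof -
  have "integrable lborel (\<lambda>x. norm (G x) powr enn2real p)"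
  proof (rule Bochner_Integration.integrable_bound)
    show "integrable lborel (\<lambda>x. indicator K x *\<^sub>R (c powr enn2real p))"
      by (rule borel_integrable_compact[OF K(1)]) auto
    show "AE x in lborel. norm (norm (G x) powr enn2real p) \<le> norm (indicator K x *\<^sub>R (c powr enn2real p))"
      using c K(2) by (intro AE_I2) (auto simp: indicator_def intro!: powr_mono2)
  qed measurable
  then show ?thesis using assms(1) c by (auto simp: Lp_borel_def)
qed

lemma Lp_borel_scale:
  assumes G: "Lp_borel p G" and [measurable]: "\<psi> \<in> borel_measurable borel" and \<psi>: "\<And>x. \<bar>\<psi> x\<bar> \<le> 1"
  shows "Lp_borel p (\<lambda>x. \<psi> x *\<^sub>R G x)"
proof -
  have [measurable]: "G \<in> borel_measurable borel" using G by (simp add: Lp_borel_def)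
  have le: "norm (\<psi> x *\<^sub>R G x) \<le> norm (G x)" for x using \<psi>[of x] by (simp add: mult_left_le_one_le)
  show ?thesis
  proof (cases "p = \<infinity>")
    case True
    then obtain C where "\<And>x. norm (G x) \<le> C" using G by (auto simp: Lp_borel_def)
    then have "norm (\<psi> x *\<^sub>R G x) \<le> C" for x using le order_trans by blast
    then show ?thesis using True by (auto simp: Lp_borel_def)
  next
    case False
    have "integrable lborel (\<lambda>x. norm (\<psi> x *\<^sub>R G x) powr enn2real p)"
    proof (rule Bochner_Integration.integrable_bound)
      show "integrable lborel (\<lambda>x. norm (G x) powr enn2real p)" using G False by (simp add: Lp_borel_def)
      show "AE x in lborel. norm (norm (\<psi> x *\<^sub>R G x) powr enn2real p) \<le> norm (norm (G x) powr enn2real p)"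
        using le by (intro AE_I2) (auto intro!: powr_mono2)
    qed measurable
    then show ?thesis using False by (simp add: Lp_borel_def)
  qed
qed

text \<open>Young's inequality bounds the product by a sum in which \<open>x\<close> and
  \<open>y\<close> are separated, so the bound survives a translation of \<open>G\<close> alone,
  unlike a bound for the product at a common point. At the endpoint exponents the bounded factor
  becomes a constant.\<close>

lemma dominated_pair_conj_exponent:
  assumes p: "1 \<le> p" and F: "Lp_borel p F" and G: "Lp_borel (conj_exponent p) G"
  obtains A B where "dominated_pair F G A B"
proof -
  have m: "F \<in> borel_measurable borel" "G \<in> borel_measurable borel" using F G by (auto simp: Lp_borel_def)
  consider "p = \<infinity>" | "p = 1" | "1 < p" "p < \<infinity>" using p by (auto simp: less_top[symmetric] less_le)
  then show ?thesis
  proof cases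
    case 1
    then obtain C where C: "\<And>x. norm (F x) \<le> C" using F by (auto simp: Lp_borel_def)
    have "integrable lborel (\<lambda>x. norm (G x))" using G 1 by (simp add: Lp_borel_def conj_exponent_def powr_one')
    then have "dominated_pair F G (\<lambda>_. 0) (\<lambda>x. C * norm (G x))"
      using m C by unfold_locales (auto intro: mult_right_mono)
    then show ?thesis by (rule that)
  next
    case 2
    then obtain C where C: "\<And>x. norm (G x) \<le> C" using G by (auto simp: Lp_borel_def conj_exponent_def)
    have "integrable lborel (\<lambda>x. norm (F x))" using F 2 by (simp add: Lp_borel_def powr_one')
    then have "dominated_pair F G (\<lambda>x. C * norm (F x)) (\<lambda>_. 0)"
      using m C by unfold_locales (auto intro: mult_left_mono simp: mult.commute[of C])
    then show ?thesis by (rule that)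
  next
    case 3
    obtain P where P: "p = ennreal P" "0 \<le> P" using 3(2) by (cases p) auto
    have P1: "1 < P" using 3(1) P by (simp add: ennreal_1[symmetric] ennreal_less_iff del: ennreal_1)
    define Q where "Q = P / (P - 1)"
    have Q1: "1 < Q" using P1 by (simp add: Q_def field_simps)
    have "p - 1 = ennreal (P - 1)" unfolding P(1) ennreal_1[symmetric] by (rule ennreal_minus) simp
    then have "p / (p - 1) = ennreal Q" using P P1 by (simp add: Q_def divide_ennreal)
    then have conj: "conj_exponent p = ennreal Q"
      using 3(1) less_imp_neq[OF 3(2)] by (auto simp: conj_exponent_def)
    have iF: "integrable lborel (\<lambda>x. norm (F x) powr P)" using F P 3(2) by (simp add: Lp_borel_def)
    have iG: "integrable lborel (\<lambda>x. norm (G x) powr Q)" using G conj Q1 by (simp add: Lp_borel_def)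
    have "1 / P + 1 / Q = 1" using P1 by (simp add: Q_def field_simps)
    then have "norm (F x) * norm (G y) \<le> norm (F x) powr P / P + norm (G y) powr Q / Q" for x y
      using Youngs_inequality[OF P1 Q1] by simp
    then have "dominated_pair F G (\<lambda>x. norm (F x) powr P / P) (\<lambda>y. norm (G y) powr Q / Q)"
      using m iF iG by unfold_locales auto
    then show ?thesis by (rule that)
  qed
qed

lemma dominated_pair_add:
  assumes "dominated_pair F G1 A1 B1" "dominated_pair F G2 A2 B2"
  shows "dominated_pair F (\<lambda>x. G1 x + G2 x) (\<lambda>x. A1 x + A2 x) (\<lambda>x. B1 x + B2 x)"
proof -
  interpret a: dominated_pair F G1 A1 B1 by fact
  interpret b: dominated_pair F G2 A2 B2 by fact
  show ?thesis
  proof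
    fix x y
    have "norm (F x) * norm (G1 y + G2 y) \<le> norm (F x) * norm (G1 y) + norm (F x) * norm (G2 y)"
      unfolding distrib_left[symmetric] by (intro mult_left_mono norm_triangle_ineq) auto
    then show "norm (F x) * norm (G1 y + G2 y) \<le> A1 x + A2 x + (B1 y + B2 y)"
      using a.dom[of x y] b.dom[of x y] by linarith
  qed (use a.A a.B b.A b.B a.F a.G b.G in auto)
qed

lemma integral_lebesgue_eq_lborel:
  fixes f g :: "'a::euclidean_space \<Rightarrow> 'b::{banach, second_countable_topology}"
  assumes f: "f \<in> borel_measurable lebesgue" and g: "g \<in> borel_measurable borel" and ae: "AE x in lborel. f x = g x"
  shows "integral\<^sup>L lebesgue f = integral\<^sup>L lborel g" and "integrable lebesgue f \<longleftrightarrow> integrable lborel g"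
proof -
  have g': "g \<in> borel_measurable lebesgue" using g by (intro measurable_completion) simp
  have ae': "AE x in lebesgue. f x = g x" using ae by (simp add: AE_completion_iff)
  have "integral\<^sup>L lebesgue f = integral\<^sup>L lebesgue g" by (rule integral_cong_AE[OF f g' ae'])
  also have "\<dots> = integral\<^sup>L lborel g" using g by (intro integral_completion) simp
  finally show "integral\<^sup>L lebesgue f = integral\<^sup>L lborel g" .
  have "integrable lebesgue f \<longleftrightarrow> integrable lebesgue g" by (rule integrable_cong_AE[OF f g' ae'])
  also have "\<dots> \<longleftrightarrow> integrable lborel g" using g by (intro integrable_completion) simp
  finally show "integrable lebesgue f \<longleftrightarrow> integrable lborel g" .
qed

lemma real_measure_integral_uniform_limit:
  fixes u :: "'a::euclidean_space \<Rightarrow> real"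
  assumes \<mu>: "real_radon_measure \<Omega> \<mu>"
    and u: "continuous_on UNIV u" "\<And>x. \<bar>u x\<bar> \<le> c" and v: "\<And>j. continuous_on UNIV (v j)"
    and lim: "\<And>d. 0 < d \<Longrightarrow> eventually (\<lambda>j. \<forall>x. \<bar>v j x - u x\<bar> \<le> d) sequentially"
  shows "(\<lambda>j. real_measure_integral \<Omega> \<mu> \<Omega> (v j)) \<longlonglongrightarrow> real_measure_integral \<Omega> \<mu> \<Omega> u"
proof -
  have part: "(\<lambda>j. LINT x:\<Omega>|N. v j x) \<longlonglongrightarrow> (LINT x:\<Omega>|N. u x)"
    if N: "finite_measure N" "space N = \<Omega>" "sets N = sets (restrict_space borel \<Omega>)" for N :: "'a measure"
  proof -
    interpret finite_measure N by fact
    have meas: "f \<in> borel_measurable N" if "continuous_on UNIV f" for f :: "'a \<Rightarrow> real"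
    proof -
      have "f \<in> borel_measurable (restrict_space borel \<Omega>)"
        using borel_measurable_continuous_onI[OF that] by (rule measurable_restrict_space1)
      then show ?thesis by (simp only: measurable_cong_sets[OF N(3) refl])
    qed
    have set_eq: "(LINT x:\<Omega>|N. f x) = (\<integral>x. f x \<partial>N)" for f :: "'a \<Rightarrow> real"
      unfolding set_lebesgue_integral_def by (rule Bochner_Integration.integral_cong) (auto simp: N(2))
    have iu: "integrable N u" using u meas[OF u(1)] by (intro integrable_const_bound[of _ c]) auto
    show ?thesis
    proof (rule LIMSEQ_I)
      fix e :: real assume e: "0 < e"
      define d where "d = e / (measure N (space N) + 1)"
      have pos: "0 < measure N (space N) + 1" by (simp add: add_nonneg_pos)
      then have d: "0 < d" using e by (simp add: d_def)
      have "d * measure N (space N) < d * (measure N (space N) + 1)" using d by (intro mult_strict_left_mono) auto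
      then have de: "d * measure N (space N) < e" using pos by (simp add: d_def)
      obtain n where n: "\<And>j x. n \<le> j \<Longrightarrow> \<bar>v j x - u x\<bar> \<le> d" using lim[OF d] by (auto simp: eventually_sequentially)
      have "norm ((LINT x:\<Omega>|N. v j x) - (LINT x:\<Omega>|N. u x)) < e" if j: "n \<le> j" for j
      proof -
        have vu: "integrable N (\<lambda>x. v j x - u x)"
          using meas[OF u(1)] meas[OF v[of j]] n[OF j] by (intro integrable_const_bound[of _ d]) auto
        then have "integrable N (\<lambda>x. (v j x - u x) + u x)" using iu by (rule Bochner_Integration.integrable_add)
        then have iv: "integrable N (v j)" by simp
        have "norm ((\<integral>x. v j x \<partial>N) - (\<integral>x. u x \<partial>N)) = norm (\<integral>x. v j x - u x \<partial>N)" using iv iu by simp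
        also have "\<dots> \<le> (\<integral>x. d \<partial>N)"
          by (rule Bochner_Integration.integral_norm_bound_integral[OF vu]) (use n[OF j] in auto)
        also have "\<dots> < e" using de by (simp add: mult.commute)
        finally show ?thesis by (simp add: set_eq)
      qed
      then show "\<exists>n. \<forall>j\<ge>n. norm ((LINT x:\<Omega>|N. v j x) - (LINT x:\<Omega>|N. u x)) < e" by blast
    qed
  qed
  show ?thesis unfolding real_measure_integral_def
    by (intro tendsto_diff part finite_measure_pos_part finite_measure_neg_part \<mu>)
       (simp_all add: space_pos_part sets_pos_part space_neg_part sets_neg_part)
qed

text \<open>The product \<open>u\<close> of \<open>\<phi>\<close> and \<open>\<psi>\<close> has
  compact support in \<open>\<Omega>\<close>, so its mollifications are test functions. Their
  gradients are the mollifications of \<open>\<psi> g + \<phi> grad \<psi>\<close>. The measure side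
  converges by uniform convergence, the other side by \<open>mollified_pairing\<close>, which covers
  all exponents including the endpoints.\<close>

lemma gauss_green:
  fixes \<phi> \<psi> :: "'a::euclidean_space \<Rightarrow> real"
  assumes "open \<Omega>" and p: "1 \<le> p" and F: "F \<in> Lp p \<Omega>" and div: "has_divergence_measure \<Omega> F \<mu>"
    and \<phi>: "continuous_on \<Omega> \<phi>" and wg: "has_weak_gradient \<Omega> \<phi> g" and g: "g \<in> Lp (conj_exponent p) \<Omega>"
    and \<psi>: "smooth_on UNIV \<psi>" "\<And>x. \<bar>\<psi> x\<bar> \<le> 1" "closure {x. \<psi> x \<noteq> 0} \<subseteq> \<Omega>"
    and K: "compact K" "K \<subseteq> \<Omega>" and z: "\<And>x. x \<in> \<Omega> - K \<Longrightarrow> \<phi> x * \<psi> x = 0" "\<And>x. x \<in> \<Omega> - K \<Longrightarrow> \<phi> x *\<^sub>R grad \<psi> x = 0"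
  shows "set_integrable lebesgue \<Omega> (\<lambda>x. F x \<bullet> (\<psi> x *\<^sub>R g x))"
    and "set_integrable lebesgue \<Omega> (\<lambda>x. F x \<bullet> (\<phi> x *\<^sub>R grad \<psi> x))"
    and "real_measure_integral \<Omega> \<mu> \<Omega> (\<lambda>x. \<phi> x * \<psi> x) =
      - (LINT x:\<Omega>|lebesgue. F x \<bullet> (\<psi> x *\<^sub>R g x)) - (LINT x:\<Omega>|lebesgue. F x \<bullet> (\<phi> x *\<^sub>R grad \<psi> x))"
proof -
  obtain F' where F': "Lp_borel p F'" "AE x in lborel. indicator \<Omega> x *\<^sub>R F x = F' x" "\<And>x. x \<notin> \<Omega> \<Longrightarrow> F' x = 0"
    "(\<lambda>x. indicator \<Omega> x *\<^sub>R F x) \<in> borel_measurable lebesgue"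
    using Lp_ex_borel[OF assms(1) F] by blast
  obtain g' where g': "Lp_borel (conj_exponent p) g'" "AE x in lborel. indicator \<Omega> x *\<^sub>R g x = g' x" "\<And>x. x \<notin> \<Omega> \<Longrightarrow> g' x = 0"
    "(\<lambda>x. indicator \<Omega> x *\<^sub>R g x) \<in> borel_measurable lebesgue"
    using Lp_ex_borel[OF assms(1) g] by blast
  have [measurable]: "F' \<in> borel_measurable borel" "g' \<in> borel_measurable borel" using F'(1) g'(1) by (auto simp: Lp_borel_def)
  have [measurable]: "\<psi> \<in> borel_measurable borel"
    using smooth_on_continuous[OF \<psi>(1)] by (rule borel_measurable_continuous_onI)
  have \<psi>leb: "\<psi> \<in> borel_measurable lebesgue" by (rule measurable_completion) measurable
  have opK: "open (- K)" using compact_imp_closed[OF K(1)] by auto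
  have cover: "\<Omega> \<union> - K = UNIV" using K(2) by auto
  \<comment> \<open>Extended by zero, \<open>u\<close> and \<open>R\<close> are continuous
    everywhere: they are continuous on \<open>\<Omega>\<close> and vanish on the complement of
    \<open>K\<close>, and these two open sets cover the space.\<close>
  define u where "u x = (if x \<in> \<Omega> then \<phi> x * \<psi> x else 0)" for x
  define R where "R x = (if x \<in> \<Omega> then \<phi> x *\<^sub>R grad \<psi> x else 0)" for x
  have u0: "u x = 0" if "x \<notin> K" for x using z(1)[of x] that by (auto simp: u_def)
  have R0: "R x = 0" if "x \<notin> K" for x using z(2)[of x] that by (auto simp: R_def)
  have u_cont: "continuous_on UNIV u"
  proof -
    have "continuous_on \<Omega> (\<lambda>x. \<phi> x * \<psi> x)"
      using \<phi> smooth_on_continuous[OF \<psi>(1)] by (intro continuous_intros) (auto intro: continuous_on_subset)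
    then have "continuous_on \<Omega> u" by (subst continuous_on_cong[OF refl, of _ _ "\<lambda>x. \<phi> x * \<psi> x"]) (auto simp: u_def)
    moreover have "continuous_on (- K) u" by (subst continuous_on_cong[OF refl, of _ _ "\<lambda>_. 0"]) (auto simp: u0)
    ultimately have "continuous_on (\<Omega> \<union> - K) u" using assms(1) opK by (intro continuous_on_open_Un)
    then show ?thesis by (simp add: cover)
  qed
  have R_cont: "continuous_on UNIV R"
  proof -
    have "continuous_on \<Omega> (\<lambda>x. \<phi> x *\<^sub>R grad \<psi> x)"
      using \<phi> continuous_on_grad[OF \<psi>(1)] by (intro continuous_intros) (auto intro: continuous_on_subset)
    then have "continuous_on \<Omega> R" by (subst continuous_on_cong[OF refl, of _ _ "\<lambda>x. \<phi> x *\<^sub>R grad \<psi> x"]) (auto simp: R_def)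
    moreover have "continuous_on (- K) R" by (subst continuous_on_cong[OF refl, of _ _ "\<lambda>_. 0"]) (auto simp: R0)
    ultimately have "continuous_on (\<Omega> \<union> - K) R" using assms(1) opK by (intro continuous_on_open_Un)
    then show ?thesis by (simp add: cover)
  qed
  have [measurable]: "R \<in> borel_measurable borel" using R_cont by (rule borel_measurable_continuous_onI)
  have bounded_ex: "\<exists>c. \<forall>x. norm (f x) \<le> c" if "continuous_on UNIV f" "\<And>x. x \<notin> K \<Longrightarrow> f x = 0" for f :: "'a \<Rightarrow> 'b::real_normed_vector"
  proof -
    have "compact (f ` K)" using that(1) K(1) by (intro compact_continuous_image) (auto intro: continuous_on_subset)
    then obtain c where "\<And>x. x \<in> K \<Longrightarrow> norm (f x) \<le> c" using compact_imp_bounded by (force simp: bounded_iff)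
    then have "norm (f x) \<le> max c 0" for x using that(2)[of x] by (cases "x \<in> K") (auto simp: le_max_iff_disj)
    then show ?thesis by blast
  qed
  obtain cu where cu: "\<And>x. \<bar>u x\<bar> \<le> cu" using bounded_ex[OF u_cont u0] by auto
  obtain cR where cR: "\<And>x. norm (R x) \<le> cR" using bounded_ex[OF R_cont R0] by blast
  \<comment> \<open>The two terms of the product rule are paired with \<open>F'\<close> for
    different reasons: \<open>G1\<close> inherits the conjugate exponent from \<open>g'\<close>
    because \<open>\<bar>\<psi> x\<bar> \<le> 1\<close>, while \<open>R\<close> is bounded with
    compact support and thus has every exponent.\<close>
  define G1 where "G1 x = \<psi> x *\<^sub>R g' x" for x
  define G where "G x = G1 x + R x" for x
  have [measurable]: "G1 \<in> borel_measurable borel" "G \<in> borel_measurable borel" unfolding G1_def G_def by measurable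
  have "Lp_borel (conj_exponent p) G1" unfolding G1_def by (rule Lp_borel_scale[OF g'(1) _ \<psi>(2)]) measurable
  from dominated_pair_conj_exponent[OF p F'(1) this] obtain A1 B1 where d1: "dominated_pair F' G1 A1 B1" by blast
  have "Lp_borel (conj_exponent p) R" by (rule Lp_borel_bounded_compact[OF _ cR K(1) R0]) measurable
  from dominated_pair_conj_exponent[OF p F'(1) this] obtain A2 B2 where d2: "dominated_pair F' R A2 B2" by blast
  interpret G: dominated_pair F' G "\<lambda>x. A1 x + A2 x" "\<lambda>x. B1 x + B2 x"
    unfolding G_def using dominated_pair_add[OF d1 d2] .
  have grad_conv: "grad (convolution u (mollifier e)) x = (\<integral>y. mollifier e (x - y) *\<^sub>R G y \<partial>lborel)" if e: "0 < e" for e x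
  proof -
    let ?\<eta> = "mollifier e :: 'a \<Rightarrow> real"
    \<comment> \<open>The weak gradient of \<open>\<phi>\<close> is tested with
      \<open>\<psi>\<close> times a reflected and translated mollifier. This has compact support in
      \<open>\<Omega>\<close> even where the support of \<open>\<psi>\<close> is unbounded, and its
      gradient produces both the kernel of \<open>grad (convolution u _)\<close> and the term
      \<open>R\<close>.\<close>
    define \<zeta> where "\<zeta> y = \<psi> y * ?\<eta> (x + (-1) *\<^sub>R y)" for y
    have sm\<eta>: "smooth_on UNIV (\<lambda>y. ?\<eta> (x + (-1) *\<^sub>R y))" by (rule smooth_on_compose_affine[OF smooth_on_mollifier])
    have sm: "smooth_on UNIV \<zeta>" unfolding \<zeta>_def by (intro smooth_on_mult open_UNIV \<psi>(1) sm\<eta>)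
    let ?C = "closure {y. \<zeta> y \<noteq> 0}"
    have "{y. \<zeta> y \<noteq> 0} \<subseteq> cball x e"
    proof
      fix y assume "y \<in> {y. \<zeta> y \<noteq> 0}"
      then have "\<not> e \<le> norm (x + (-1) *\<^sub>R y)" using mollifier_outside[OF e, of "x + (-1) *\<^sub>R y"] by (auto simp: \<zeta>_def)
      then show "y \<in> cball x e" by (simp add: dist_norm)
    qed
    then have C: "compact ?C" unfolding compact_closure by (rule bounded_subset[OF bounded_cball])
    have "{y. \<zeta> y \<noteq> 0} \<subseteq> {y. \<psi> y \<noteq> 0}" by (auto simp: \<zeta>_def)
    then have CO: "?C \<subseteq> \<Omega>" using \<psi>(3) closure_mono by blast
    have test: "\<zeta> \<in> test_functions \<Omega>" using sm C CO by (simp add: test_functions_def)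
    have grad\<zeta>: "grad \<zeta> y = ?\<eta> (x - y) *\<^sub>R grad \<psi> y - \<psi> y *\<^sub>R grad ?\<eta> (x - y)" for y
    proof -
      have h: "(?\<eta> has_derivative (\<lambda>h. grad ?\<eta> (x + (-1) *\<^sub>R y) \<bullet> h)) (at (x + (-1) *\<^sub>R y))"
        by (rule smooth_has_derivative_grad[OF smooth_on_mollifier]) simp
      have "((\<lambda>y. x + (-1) *\<^sub>R y) has_derivative (\<lambda>h. (-1) *\<^sub>R h)) (at y)" by (auto intro!: derivative_eq_intros)
      from has_derivative_compose[OF this h]
      have "((\<lambda>y. ?\<eta> (x + (-1) *\<^sub>R y)) has_derivative (\<lambda>h. (- grad ?\<eta> (x + (-1) *\<^sub>R y)) \<bullet> h)) (at y)" by simp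
      from grad_mult[OF smooth_has_derivative_grad[OF \<psi>(1)] this] show ?thesis unfolding \<zeta>_def[abs_def] by simp
    qed
    have \<eta>cont: "continuous_on UNIV (\<lambda>y. ?\<eta> (x - y))" "continuous_on UNIV (\<lambda>y. grad ?\<eta> (x - y))"
      by (rule continuous_on_compose2[OF continuous_mollifier] continuous_on_compose2[OF continuous_on_grad[OF smooth_on_mollifier]];
          auto intro!: continuous_intros)+
    have [measurable]: "(\<lambda>y. ?\<eta> (x - y)) \<in> borel_measurable borel" "(\<lambda>y. grad ?\<eta> (x - y)) \<in> borel_measurable borel"
      using \<eta>cont by (auto intro: borel_measurable_continuous_onI)
    have i1: "integrable lborel (\<lambda>y. u y *\<^sub>R grad ?\<eta> (x - y))"
      by (rule integral_compact_support(1)[OF _ K(1)]) (use u_cont \<eta>cont u0 in \<open>auto intro!: continuous_intros\<close>)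
    have i2: "integrable lborel (\<lambda>y. ?\<eta> (x - y) *\<^sub>R R y)"
      by (rule integral_compact_support(1)[OF _ K(1)]) (use R_cont \<eta>cont R0 in \<open>auto intro!: continuous_intros\<close>)
    have um: "u \<in> borel_measurable borel" using u_cont by (rule borel_measurable_continuous_onI)
    have lhs: "(LINT y:\<Omega>|lebesgue. \<phi> y *\<^sub>R grad \<zeta> y) = (\<integral>y. ?\<eta> (x - y) *\<^sub>R R y \<partial>lborel) - (\<integral>y. u y *\<^sub>R grad ?\<eta> (x - y) \<partial>lborel)"
    proof -
      have "(\<lambda>y. indicator \<Omega> y *\<^sub>R (\<phi> y *\<^sub>R grad \<zeta> y)) = (\<lambda>y. ?\<eta> (x - y) *\<^sub>R R y - u y *\<^sub>R grad ?\<eta> (x - y))"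
        by (auto simp: fun_eq_iff indicator_def R_def u_def grad\<zeta> scaleR_diff_right mult.commute)
      then have "(LINT y:\<Omega>|lebesgue. \<phi> y *\<^sub>R grad \<zeta> y) = (\<integral>y. ?\<eta> (x - y) *\<^sub>R R y - u y *\<^sub>R grad ?\<eta> (x - y) \<partial>lebesgue)"
        by (simp add: set_lebesgue_integral_def)
      also have "\<dots> = (\<integral>y. ?\<eta> (x - y) *\<^sub>R R y - u y *\<^sub>R grad ?\<eta> (x - y) \<partial>lborel)"
        by (intro integral_completion borel_measurable_integrable Bochner_Integration.integrable_diff i1 i2)
      finally show ?thesis using i1 i2 by simp
    qed
    have gC: "AE y in lborel. indicator ?C y *\<^sub>R g y = indicator ?C y *\<^sub>R g' y"
      using g'(2)
    proof eventually_elim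
      case (elim y) then show ?case using CO by (cases "y \<in> ?C") auto
    qed
    have "set_integrable lebesgue ?C g" using wg C CO by (simp add: has_weak_gradient_def locally_integrable_on_def)
    then have iC: "integrable lebesgue (\<lambda>y. indicator ?C y *\<^sub>R g y)" by (simp add: set_integrable_def)
    have Cm [measurable]: "?C \<in> sets borel" by simp
    have ig': "integrable lborel (\<lambda>y. indicator ?C y *\<^sub>R g' y)"
      using iC integral_lebesgue_eq_lborel(2)[OF borel_measurable_integrable[OF iC] _ gC] by simp
    obtain M where M: "0 \<le> M" "\<And>x::'a. mollifier e x \<le> M" by (rule mollifier_bounded[OF e]) blast
    have i3: "integrable lborel (\<lambda>y. ?\<eta> (x - y) *\<^sub>R G1 y)"
    proof (rule Bochner_Integration.integrable_bound[of lborel "\<lambda>y. M *\<^sub>R (indicator ?C y *\<^sub>R g' y)"], goal_cases)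
      case 1 show ?case by (rule integrable_scaleR_right) (use ig' in simp)
    next
      case 2 show ?case by measurable
    next
      case 3 show ?case
      proof (rule AE_I2)
      fix y
      have "norm (?\<eta> (x - y) *\<^sub>R G1 y) = norm (\<zeta> y) * norm (g' y)" by (simp add: \<zeta>_def G1_def abs_mult mult.commute)
      also have "\<dots> \<le> (M * indicator ?C y) * norm (g' y)"
      proof (rule mult_right_mono)
        show "norm (\<zeta> y) \<le> M * indicator ?C y"
        proof (cases "\<zeta> y = 0")
          case False
          then have "y \<in> ?C" by (intro subsetD[OF closure_subset]) simp
          have "\<bar>\<psi> y\<bar> \<le> 1" by (rule \<psi>(2))
          moreover have "\<bar>?\<eta> (x + (-1) *\<^sub>R y)\<bar> \<le> M"
            using M(2)[of "x + (-1) *\<^sub>R y"] mollifier_nonneg[OF e, of "x + (-1) *\<^sub>R y"] by simp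
          ultimately have "norm (\<zeta> y) \<le> 1 * M"
            unfolding \<zeta>_def real_norm_def abs_mult by (intro mult_mono) simp_all
          then show ?thesis using \<open>y \<in> ?C\<close> by simp
        qed (use M in \<open>auto simp: indicator_def\<close>)
      qed auto
      also have "\<dots> = norm (M *\<^sub>R (indicator ?C y *\<^sub>R g' y))" using M by simp
      finally show "norm (?\<eta> (x - y) *\<^sub>R G1 y) \<le> norm (M *\<^sub>R (indicator ?C y *\<^sub>R g' y))" .
      qed
    qed
    have \<zeta>_fold: "?\<eta> (x - y) *\<^sub>R G1 y = \<zeta> y *\<^sub>R g' y" for y by (simp add: \<zeta>_def G1_def mult.commute)
    have rhs: "(LINT y:\<Omega>|lebesgue. \<zeta> y *\<^sub>R g y) = (\<integral>y. ?\<eta> (x - y) *\<^sub>R G1 y \<partial>lborel)"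
      unfolding set_lebesgue_integral_def
    proof (rule integral_lebesgue_eq_lborel(1))
      have "\<zeta> \<in> borel_measurable lebesgue"
        using borel_measurable_continuous_onI[OF smooth_on_continuous[OF sm]] by (intro measurable_completion) simp
      then have "(\<lambda>y. \<zeta> y *\<^sub>R (indicator \<Omega> y *\<^sub>R g y)) \<in> borel_measurable lebesgue"
        using g'(4) by (rule borel_measurable_scaleR)
      then show "(\<lambda>y. indicator \<Omega> y *\<^sub>R (\<zeta> y *\<^sub>R g y)) \<in> borel_measurable lebesgue" by (simp add: mult.commute)
      show "AE y in lborel. indicator \<Omega> y *\<^sub>R (\<zeta> y *\<^sub>R g y) = ?\<eta> (x - y) *\<^sub>R G1 y"
        using g'(2)
      proof eventually_elim
        case (elim y)
        have "indicator \<Omega> y *\<^sub>R (\<zeta> y *\<^sub>R g y) = \<zeta> y *\<^sub>R (indicator \<Omega> y *\<^sub>R g y)" by (simp add: mult.commute)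
        then show ?case by (simp only: elim \<zeta>_fold)
      qed
    qed measurable
    let ?a = "\<integral>y. ?\<eta> (x - y) *\<^sub>R R y \<partial>lborel" and ?b = "\<integral>y. u y *\<^sub>R grad ?\<eta> (x - y) \<partial>lborel"
    have "(LINT y:\<Omega>|lebesgue. \<phi> y *\<^sub>R grad \<zeta> y) = - (LINT y:\<Omega>|lebesgue. \<zeta> y *\<^sub>R g y)"
      using wg test unfolding has_weak_gradient_def by blast
    then have ab: "?a - ?b = - (\<integral>y. ?\<eta> (x - y) *\<^sub>R G1 y \<partial>lborel)" by (simp only: lhs rhs)
    have "?b = ?a - (?a - ?b)" by simp
    also have "\<dots> = ?a + (\<integral>y. ?\<eta> (x - y) *\<^sub>R G1 y \<partial>lborel)" by (simp only: ab diff_minus_eq_add)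
    also have "\<dots> = (\<integral>y. ?\<eta> (x - y) *\<^sub>R G y \<partial>lborel)"
      unfolding G_def using i2 i3 by (simp add: scaleR_add_right add.commute)
    finally have eq: "(\<integral>y. u y *\<^sub>R grad ?\<eta> (x - y) \<partial>lborel) = (\<integral>y. ?\<eta> (x - y) *\<^sub>R G y \<partial>lborel)" .
    obtain a where a: "K \<subseteq> cbox (-a) a" using bounded_subset_cbox_symmetric[OF compact_imp_bounded[OF K(1)]] by blast
    have "u y = 0" if "y \<notin> cbox (-a) a" for y using u0 a that by blast
    then have "grad (convolution u (mollifier e)) x = (\<integral>y. u y *\<^sub>R grad ?\<eta> (x - y) \<partial>lborel)" by (intro grad_convolution[OF u_cont _ smooth_on_mollifier])
    then show ?thesis using eq by simp
  qed
  obtain \<delta> where \<delta>: "0 < \<delta>" "\<And>e. 0 < e \<Longrightarrow> e < \<delta> \<Longrightarrow> convolution u (mollifier e) \<in> test_functions \<Omega>"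
    using convolution_test_function[OF u_cont K u0 assms(1)] by blast
  \<comment> \<open>The shift by 2 keeps the first radius strictly below
    \<open>\<delta>\<close>.\<close>
  define e where "e j = \<delta> / real (j + 2)" for j
  have e0: "0 < e j" "e j < \<delta>" for j using \<delta>(1) by (auto simp: e_def divide_less_eq)
  have e_lim: "e \<longlonglongrightarrow> 0"
    unfolding e_def using LIMSEQ_ignore_initial_segment[OF lim_const_over_n[of \<delta>], of 2] by simp
  have \<mu>: "real_radon_measure \<Omega> \<mu>" using div by (simp add: has_divergence_measure_def)
  define v where "v j = convolution u (mollifier (e j))" for j
  have v_test: "v j \<in> test_functions \<Omega>" for j unfolding v_def by (rule \<delta>(2)[OF e0])
  have v_cont: "continuous_on UNIV (v j)" for j using v_test[of j] smooth_on_continuous by (auto simp: test_functions_def)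
  have lim1: "(\<lambda>j. real_measure_integral \<Omega> \<mu> \<Omega> (v j)) \<longlonglongrightarrow> real_measure_integral \<Omega> \<mu> \<Omega> u"
  proof (rule real_measure_integral_uniform_limit[OF \<mu> u_cont cu v_cont])
    fix d :: real assume "0 < d"
    obtain \<delta>' where \<delta>': "0 < \<delta>'" "\<And>e x. 0 < e \<Longrightarrow> e < \<delta>' \<Longrightarrow> \<bar>convolution u (mollifier e) x - u x\<bar> \<le> d"
      by (rule mollification_uniform[OF u_cont K(1) u0 \<open>0 < d\<close>], assumption, rule that)
    have "eventually (\<lambda>j. e j < \<delta>') sequentially" using e_lim \<delta>'(1) by (rule order_tendstoD)
    then show "eventually (\<lambda>j. \<forall>x. \<bar>v j x - u x\<bar> \<le> d) sequentially"
      by eventually_elim (use \<delta>'(2) e0 in \<open>auto simp: v_def\<close>)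
  qed
  have "real_measure_integral \<Omega> \<mu> \<Omega> (v j) = - (\<integral>x. F' x \<bullet> (\<integral>y. mollifier (e j) (x - y) *\<^sub>R G y \<partial>lborel) \<partial>lborel)" for j
  proof -
    have gm: "grad (v j) \<in> borel_measurable borel"
      using v_test[of j] continuous_on_grad by (intro borel_measurable_continuous_onI) (auto simp: test_functions_def)
    have "real_measure_integral \<Omega> \<mu> \<Omega> (v j) = - (LINT x:\<Omega>|lebesgue. F x \<bullet> grad (v j) x)"
      using div v_test[of j] by (simp add: has_divergence_measure_def)
    also have "(LINT x:\<Omega>|lebesgue. F x \<bullet> grad (v j) x) = (\<integral>x. F' x \<bullet> grad (v j) x \<partial>lborel)"
      unfolding set_lebesgue_integral_def
    proof (rule integral_lebesgue_eq_lborel(1))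
      have "grad (v j) \<in> borel_measurable lebesgue" using gm by (intro measurable_completion) simp
      then have "(\<lambda>x. (indicator \<Omega> x *\<^sub>R F x) \<bullet> grad (v j) x) \<in> borel_measurable lebesgue"
        using F'(4) by (intro borel_measurable_inner)
      then show "(\<lambda>x. indicator \<Omega> x *\<^sub>R (F x \<bullet> grad (v j) x)) \<in> borel_measurable lebesgue" by simp
      show "AE x in lborel. indicator \<Omega> x *\<^sub>R (F x \<bullet> grad (v j) x) = F' x \<bullet> grad (v j) x"
        using F'(2)
      proof eventually_elim
        case (elim x)
        have "indicator \<Omega> x *\<^sub>R (F x \<bullet> grad (v j) x) = (indicator \<Omega> x *\<^sub>R F x) \<bullet> grad (v j) x" by simp
        then show ?case by (simp only: elim)
      qed
    qed (use gm in measurable)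
    finally show ?thesis unfolding v_def grad_conv[OF e0(1)] .
  qed
  with lim1 have "(\<lambda>j. - (\<integral>x. F' x \<bullet> (\<integral>y. mollifier (e j) (x - y) *\<^sub>R G y \<partial>lborel) \<partial>lborel)) \<longlonglongrightarrow> real_measure_integral \<Omega> \<mu> \<Omega> u"
    by simp
  moreover have "(\<lambda>j. - (\<integral>x. F' x \<bullet> (\<integral>y. mollifier (e j) (x - y) *\<^sub>R G y \<partial>lborel) \<partial>lborel)) \<longlonglongrightarrow> - (\<integral>x. F' x \<bullet> G x \<partial>lborel)"
    by (intro tendsto_minus G.mollified_pairing e0 e_lim)
  ultimately have main: "real_measure_integral \<Omega> \<mu> \<Omega> u = - (\<integral>x. F' x \<bullet> G x \<partial>lborel)" by (rule LIMSEQ_unique)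
  have int1: "integrable lborel (\<lambda>x. F' x \<bullet> G1 x)" using dominated_pair.integrable_inner_shift[OF d1, of 0] by simp
  have int2: "integrable lborel (\<lambda>x. F' x \<bullet> R x)" using dominated_pair.integrable_inner_shift[OF d2, of 0] by simp
  have meas1: "(\<lambda>x. indicator \<Omega> x *\<^sub>R (F x \<bullet> (\<psi> x *\<^sub>R g x))) \<in> borel_measurable lebesgue"
  proof -
    have "(\<lambda>x. (indicator \<Omega> x *\<^sub>R F x) \<bullet> (\<psi> x *\<^sub>R (indicator \<Omega> x *\<^sub>R g x))) \<in> borel_measurable lebesgue"
      using F'(4) g'(4) \<psi>leb by (intro borel_measurable_inner borel_measurable_scaleR[OF \<psi>leb])
    moreover have "(\<lambda>x. (indicator \<Omega> x *\<^sub>R F x) \<bullet> (\<psi> x *\<^sub>R (indicator \<Omega> x *\<^sub>R g x))) = (\<lambda>x. indicator \<Omega> x *\<^sub>R (F x \<bullet> (\<psi> x *\<^sub>R g x)))"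
      by (auto simp: fun_eq_iff indicator_def)
    ultimately show ?thesis by simp
  qed
  have ae1: "AE x in lborel. indicator \<Omega> x *\<^sub>R (F x \<bullet> (\<psi> x *\<^sub>R g x)) = F' x \<bullet> G1 x"
    using F'(2) g'(2)
  proof eventually_elim
    case (elim x)
    have "indicator \<Omega> x *\<^sub>R (F x \<bullet> (\<psi> x *\<^sub>R g x)) = (indicator \<Omega> x *\<^sub>R F x) \<bullet> (\<psi> x *\<^sub>R (indicator \<Omega> x *\<^sub>R g x))"
      by (auto simp: indicator_def)
    then show ?case by (simp only: elim G1_def)
  qed
  have meas2: "(\<lambda>x. indicator \<Omega> x *\<^sub>R (F x \<bullet> (\<phi> x *\<^sub>R grad \<psi> x))) \<in> borel_measurable lebesgue"
  proof -
    have "R \<in> borel_measurable lebesgue" by (rule measurable_completion) measurable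
    then have "(\<lambda>x. (indicator \<Omega> x *\<^sub>R F x) \<bullet> R x) \<in> borel_measurable lebesgue" using F'(4) by (intro borel_measurable_inner)
    moreover have "(\<lambda>x. (indicator \<Omega> x *\<^sub>R F x) \<bullet> R x) = (\<lambda>x. indicator \<Omega> x *\<^sub>R (F x \<bullet> (\<phi> x *\<^sub>R grad \<psi> x)))"
      by (auto simp: fun_eq_iff indicator_def R_def)
    ultimately show ?thesis by simp
  qed
  have ae2: "AE x in lborel. indicator \<Omega> x *\<^sub>R (F x \<bullet> (\<phi> x *\<^sub>R grad \<psi> x)) = F' x \<bullet> R x"
    using F'(2)
  proof eventually_elim
    case (elim x)
    have "indicator \<Omega> x *\<^sub>R (F x \<bullet> (\<phi> x *\<^sub>R grad \<psi> x)) = (indicator \<Omega> x *\<^sub>R F x) \<bullet> R x"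
      by (auto simp: indicator_def R_def)
    then show ?case by (simp only: elim)
  qed
  have m1: "(\<lambda>x. F' x \<bullet> G1 x) \<in> borel_measurable borel" and m2: "(\<lambda>x. F' x \<bullet> R x) \<in> borel_measurable borel" by measurable
  show "set_integrable lebesgue \<Omega> (\<lambda>x. F x \<bullet> (\<psi> x *\<^sub>R g x))"
    unfolding set_integrable_def using integral_lebesgue_eq_lborel(2)[OF meas1 m1 ae1] int1 by blast
  show "set_integrable lebesgue \<Omega> (\<lambda>x. F x \<bullet> (\<phi> x *\<^sub>R grad \<psi> x))"
    unfolding set_integrable_def using integral_lebesgue_eq_lborel(2)[OF meas2 m2 ae2] int2 by blast
  have "(\<integral>x. F' x \<bullet> G x \<partial>lborel) = (\<integral>x. F' x \<bullet> G1 x \<partial>lborel) + (\<integral>x. F' x \<bullet> R x \<partial>lborel)"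
    unfolding G_def inner_add_right using int1 int2 by (rule Bochner_Integration.integral_add)
  also have "\<dots> = (LINT x:\<Omega>|lebesgue. F x \<bullet> (\<psi> x *\<^sub>R g x)) + (LINT x:\<Omega>|lebesgue. F x \<bullet> (\<phi> x *\<^sub>R grad \<psi> x))"
    unfolding set_lebesgue_integral_def
    using integral_lebesgue_eq_lborel(1)[OF meas1 m1 ae1] integral_lebesgue_eq_lborel(1)[OF meas2 m2 ae2] by simp
  moreover have "real_measure_integral \<Omega> \<mu> \<Omega> u = real_measure_integral \<Omega> \<mu> \<Omega> (\<lambda>x. \<phi> x * \<psi> x)"
  proof -
    have "(\<lambda>x. indicator \<Omega> x *\<^sub>R u x) = (\<lambda>x. indicator \<Omega> x *\<^sub>R (\<phi> x * \<psi> x))" by (auto simp: fun_eq_iff indicator_def u_def)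
    then show ?thesis by (simp only: real_measure_integral_def set_lebesgue_integral_def)
  qed
  ultimately show "real_measure_integral \<Omega> \<mu> \<Omega> (\<lambda>x. \<phi> x * \<psi> x) =
      - (LINT x:\<Omega>|lebesgue. F x \<bullet> (\<psi> x *\<^sub>R g x)) - (LINT x:\<Omega>|lebesgue. F x \<bullet> (\<phi> x *\<^sub>R grad \<psi> x))"
    using main by simp
qed

section \<open>Superlevel sets of smooth functions\<close>

lemma has_derivative_increase:
  assumes "(w has_derivative (\<lambda>h. g \<bullet> h)) (at x)" "0 < g \<bullet> h"
  shows "\<exists>d>0. \<forall>s>0. s < d \<longrightarrow> w x < (w (x + s *\<^sub>R h) :: real)"
proof -
  have 1: "((\<lambda>s. x + s *\<^sub>R h) has_derivative (\<lambda>s. s *\<^sub>R h)) (at 0)" by (auto intro!: derivative_eq_intros)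
  have "(w has_derivative (\<lambda>h. g \<bullet> h)) (at (x + 0 *\<^sub>R h))" using assms(1) by simp
  from has_derivative_compose[OF 1 this]
  have "((\<lambda>s. w (x + s *\<^sub>R h)) has_derivative (\<lambda>s. s * (g \<bullet> h))) (at 0)" by simp
  moreover have "(\<lambda>s. s * (g \<bullet> h)) = (*) (g \<bullet> h)" by (rule ext) (rule mult.commute)
  ultimately have "((\<lambda>s. w (x + s *\<^sub>R h)) has_real_derivative (g \<bullet> h)) (at 0)"
    by (simp add: has_field_derivative_def)
  from DERIV_pos_inc_right[OF this assms(2)] show ?thesis by simp
qed

text \<open>At a regular point of the level, a small step along the gradient enters the superlevel
  set. Hence every point of the level is a limit of the open superlevel set without belonging to
  it.\<close>

lemma frontier_superlevel:
  assumes w: "smooth_on UNIV w" and reg: "\<And>x. w x = t \<Longrightarrow> grad w x \<noteq> 0"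
  shows "frontier {x. t < w x} = {x. w x = t}"
proof -
  have cont: "continuous_on UNIV w" by (rule smooth_on_continuous[OF w])
  have op: "open {x. t < w x}" using cont by (intro open_Collect_less continuous_intros)
  have cl: "closed {x. t \<le> w x}" using cont by (intro closed_Collect_le continuous_intros)
  have "closure {x. t < w x} \<subseteq> {x. t \<le> w x}" by (rule closure_minimal[OF _ cl]) auto
  moreover have "x \<in> closure {x. t < w x}" if x: "w x = t" for x
  proof -
    have "0 < grad w x \<bullet> grad w x" using reg[OF x] by simp
    from has_derivative_increase[OF smooth_has_derivative_grad[OF w UNIV_I] this]
    obtain d where d: "0 < d" "\<And>s. 0 < s \<Longrightarrow> s < d \<Longrightarrow> w x < w (x + s *\<^sub>R grad w x)" by blast
    show ?thesis
      unfolding closure_approachable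
    proof (intro allI impI)
      fix e :: real assume e: "0 < e"
      define s where "s = min (d / 2) (e / (2 * norm (grad w x)))"
      have n: "0 < norm (grad w x)" using reg[OF x] by simp
      have s: "0 < s" "s < d" using d(1) e n by (auto simp: s_def)
      have "s * norm (grad w x) \<le> e / (2 * norm (grad w x)) * norm (grad w x)"
        using n by (intro mult_right_mono) (auto simp: s_def)
      also have "\<dots> < e" using n e by simp
      finally have "dist (x + s *\<^sub>R grad w x) x < e" using s by (simp add: dist_norm)
      then show "\<exists>y\<in>{x. t < w x}. dist y x < e" using d(2)[OF s] x by auto
    qed
  qed
  ultimately have "closure {x. t < w x} = {x. t \<le> w x}"
    using closure_subset[of "{x. t < w x}"] by (auto simp: le_less)
  then show ?thesis unfolding frontier_def interior_open[OF op] by auto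
qed

text \<open>The definition does not state that \<open>\<rho>\<close> vanishes at the centre. An open
  \<open>V\<close> excludes its frontier, which rules out a positive value, and a negative value
  would keep a neighbourhood of \<open>x\<close> free of \<open>V\<close>.\<close>

lemma local_defining_function_eq_0:
  assumes V: "open V" "x \<in> frontier V" and ld: "local_defining_function V x r \<rho>"
  shows "\<rho> x = 0"
proof (rule ccontr)
  assume "\<rho> x \<noteq> 0"
  have r: "0 < r" "smooth_on (ball x r) \<rho>" and eq: "V \<inter> ball x r = {y \<in> ball x r. 0 < \<rho> y}"
    using ld by (auto simp: local_defining_function_def)
  have "x \<notin> V" using V by (auto simp: frontier_def interior_open)
  have "\<not> 0 < \<rho> x"
  proof
    assume "0 < \<rho> x"
    then have "x \<in> {y \<in> ball x r. 0 < \<rho> y}" using r(1) by simp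
    then show False using \<open>x \<notin> V\<close> unfolding eq[symmetric] by simp
  qed
  then have neg: "\<rho> x < 0" using \<open>\<rho> x \<noteq> 0\<close> by simp
  have "continuous_on (ball x r) \<rho>" using r(2) by (rule smooth_on_continuous)
  then have op: "open (ball x r \<inter> \<rho> -` {..<0})" by (intro continuous_open_preimage) auto
  have "x \<in> closure V" using V by (simp add: frontier_def)
  then have "x \<in> (ball x r \<inter> \<rho> -` {..<0}) \<inter> closure V" using neg r(1) by simp
  then have "(ball x r \<inter> \<rho> -` {..<0}) \<inter> V \<noteq> {}"
    using open_Int_closure_eq_empty[OF op, of V] by blast
  then obtain y where y: "y \<in> ball x r" "\<rho> y < 0" "y \<in> V" by auto
  then have "y \<in> {y \<in> ball x r. 0 < \<rho> y}" unfolding eq[symmetric] by simp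
  then show False using y(2) by simp
qed

text \<open>This justifies the \<open>THE\<close> in \<open>inner_unit_normal\<close>. If two unit
  normals differ, then a small step along their difference increases one defining function from 0
  and decreases the other, so the same point would lie both inside and outside
  \<open>V\<close>.\<close>

lemma local_defining_function_normal_unique:
  assumes V: "open V" "x \<in> frontier V"
    and ld: "local_defining_function V x r \<rho>" "local_defining_function V x r' \<rho>'"
  shows "grad \<rho> x /\<^sub>R norm (grad \<rho> x) = grad \<rho>' x /\<^sub>R norm (grad \<rho>' x)"
proof (rule ccontr)
  define n where "n = grad \<rho> x /\<^sub>R norm (grad \<rho> x)"
  define n' where "n' = grad \<rho>' x /\<^sub>R norm (grad \<rho>' x)"
  assume "\<not> ?thesis"
  then have ne: "n - n' \<noteq> 0" by (simp add: n_def n'_def)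
  have r: "0 < r" "0 < r'" "smooth_on (ball x r) \<rho>" "smooth_on (ball x r') \<rho>'"
    and eq: "V \<inter> ball x r = {y \<in> ball x r. 0 < \<rho> y}" "V \<inter> ball x r' = {y \<in> ball x r'. 0 < \<rho>' y}"
    and nz: "0 < norm (grad \<rho> x)" "0 < norm (grad \<rho>' x)"
    using ld by (auto simp: local_defining_function_def)
  have u: "n \<bullet> n = 1" "n' \<bullet> n' = 1" using nz by (simp_all add: n_def n'_def power2_norm_eq_inner[symmetric] power2_eq_square)
  have "0 < (n - n') \<bullet> (n - n')" using ne by simp
  then have "n \<bullet> n' < 1" using u by (simp add: inner_diff_left inner_diff_right inner_commute)
  then have "0 < n \<bullet> (n - n')" "0 < n' \<bullet> (n' - n)" using u by (simp_all add: inner_diff_right inner_commute)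
  then have "0 < norm (grad \<rho> x) * (n \<bullet> (n - n'))" "0 < norm (grad \<rho>' x) * (n' \<bullet> (n' - n))"
    using nz by simp_all
  then have "0 < (norm (grad \<rho> x) *\<^sub>R n) \<bullet> (n - n')" "0 < (norm (grad \<rho>' x) *\<^sub>R n') \<bullet> (n' - n)" by simp_all
  moreover have "norm (grad \<rho> x) *\<^sub>R n = grad \<rho> x" "norm (grad \<rho>' x) *\<^sub>R n' = grad \<rho>' x"
    using nz by (simp_all add: n_def n'_def)
  ultimately have pos: "0 < grad \<rho> x \<bullet> (n - n')" "0 < (- grad \<rho>' x) \<bullet> (n - n')"
    by (simp_all add: inner_diff_right)
  have "(\<rho> has_derivative (\<lambda>h. grad \<rho> x \<bullet> h)) (at x)" using r by (intro smooth_has_derivative_grad) auto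
  from has_derivative_increase[OF this pos(1)]
  obtain d where d: "0 < d" "\<And>s. 0 < s \<Longrightarrow> s < d \<Longrightarrow> \<rho> x < \<rho> (x + s *\<^sub>R (n - n'))" by blast
  have "(\<rho>' has_derivative (\<lambda>h. grad \<rho>' x \<bullet> h)) (at x)" using r by (intro smooth_has_derivative_grad) auto
  then have "((\<lambda>y. - \<rho>' y) has_derivative (\<lambda>h. (- grad \<rho>' x) \<bullet> h)) (at x)"
    by (auto intro!: derivative_eq_intros)
  from has_derivative_increase[OF this pos(2)]
  obtain d' where d': "0 < d'" "\<And>s. 0 < s \<Longrightarrow> s < d' \<Longrightarrow> - \<rho>' x < - \<rho>' (x + s *\<^sub>R (n - n'))" by blast
  define m where "m = min r r' / norm (n - n')"
  obtain s where s: "0 < s" "s < d" "s < d'" "s < m"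
  proof
    have "0 < m" using r ne by (simp add: m_def)
    then have "0 < min (min d d') m" using d(1) d'(1) by simp
    moreover have "min (min d d') m \<le> d" "min (min d d') m \<le> d'" "min (min d d') m \<le> m" by simp_all
    ultimately show "0 < min (min d d') m / 2" "min (min d d') m / 2 < d" "min (min d d') m / 2 < d'" "min (min d d') m / 2 < m"
      by linarith+
  qed
  then have "s * norm (n - n') < min r r'" using ne by (simp add: m_def less_divide_eq)
  then have "x + s *\<^sub>R (n - n') \<in> ball x r" "x + s *\<^sub>R (n - n') \<in> ball x r'" using s(1) by (auto simp: dist_norm)
  moreover have "0 < \<rho> (x + s *\<^sub>R (n - n'))"
    using d(2)[OF s(1,2)] local_defining_function_eq_0[OF V ld(1)] by simp
  moreover have "\<not> 0 < \<rho>' (x + s *\<^sub>R (n - n'))"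
    using d'(2)[OF s(1,3)] local_defining_function_eq_0[OF V ld(2)] by simp
  ultimately have "x + s *\<^sub>R (n - n') \<in> V \<inter> ball x r" "x + s *\<^sub>R (n - n') \<notin> V \<inter> ball x r'" "x + s *\<^sub>R (n - n') \<in> ball x r'"
    unfolding eq by auto
  then show False by blast
qed

lemma inner_unit_normal_eq:
  assumes "open V" "x \<in> frontier V" "local_defining_function V x r \<rho>"
  shows "inner_unit_normal V x = grad \<rho> x /\<^sub>R norm (grad \<rho> x)"
  unfolding inner_unit_normal_def
proof (rule the_equality)
  fix \<nu> assume "\<exists>r \<rho>. local_defining_function V x r \<rho> \<and> \<nu> = grad \<rho> x /\<^sub>R norm (grad \<rho> x)"
  then show "\<nu> = grad \<rho> x /\<^sub>R norm (grad \<rho> x)"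
    using local_defining_function_normal_unique[OF assms(1,2) _ assms(3)] by blast
qed (use assms(3) in blast)

lemma superlevel_local_defining_function:
  assumes w: "smooth_on UNIV w" and x: "grad w x \<noteq> 0"
  obtains r where "local_defining_function {y. t < w y} x r (\<lambda>y. w y - t)"
    "grad (\<lambda>y. w y - t) x = grad w x"
proof -
  have "((\<lambda>y. w y - t) has_derivative (\<lambda>h. grad w y \<bullet> h)) (at y)" for y
    using smooth_has_derivative_grad[OF w UNIV_I, of y] by (auto intro!: derivative_eq_intros)
  then have g: "grad (\<lambda>y. w y - t) y = grad w y" for y by (rule grad_eqI)
  have "open (UNIV \<inter> grad w -` (- {0}))" using continuous_on_grad[OF w] by (intro continuous_open_preimage) auto
  then obtain r where r: "0 < r" "ball x r \<subseteq> grad w -` (- {0})" using x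
    unfolding open_contains_ball by (auto dest!: bspec[where x = x])
  have "smooth_on UNIV (\<lambda>y. w y - t)" using w by (intro smooth_on_minus smooth_on_const) auto
  then have "smooth_on (ball x r) (\<lambda>y. w y - t)" by (rule smooth_on_subset) simp
  then have "local_defining_function {y. t < w y} x r (\<lambda>y. w y - t)"
    using r by (auto simp: local_defining_function_def g)
  then show ?thesis using that g by blast
qed

lemma superlevel_smooth_boundary:
  assumes w: "smooth_on UNIV w" and reg: "\<And>x. w x = t \<Longrightarrow> grad w x \<noteq> 0"
  shows "smooth_boundary {x. t < w x}"
    and "w x = t \<Longrightarrow> inner_unit_normal {x. t < w x} x = grad w x /\<^sub>R norm (grad w x)"
proof -
  have op: "open {x. t < w x}" using smooth_on_continuous[OF w] by (intro open_Collect_less continuous_intros)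
  have fr: "frontier {x. t < w x} = {x. w x = t}" by (rule frontier_superlevel[OF w reg])
  have ex: "\<exists>r. local_defining_function {y. t < w y} x r (\<lambda>y. w y - t) \<and> grad (\<lambda>y. w y - t) x = grad w x"
    if "w x = t" for x
    using superlevel_local_defining_function[OF w reg[OF that]] by blast
  then show "smooth_boundary {x. t < w x}" unfolding smooth_boundary_def fr by blast
  show "inner_unit_normal {x. t < w x} x = grad w x /\<^sub>R norm (grad w x)" if x: "w x = t"
  proof -
    obtain r where r: "local_defining_function {y. t < w y} x r (\<lambda>y. w y - t)" "grad (\<lambda>y. w y - t) x = grad w x"
      using ex[OF x] by blast
    from inner_unit_normal_eq[OF op _ r(1)] show ?thesis unfolding r(2) fr using x by simp
  qed
qed

section \<open>Smooth transitions on the real line\<close>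

lemma smooth_transition:
  fixes c :: "real \<Rightarrow> real"
  assumes c: "smooth_on UNIV c" "\<And>t. 0 \<le> c t" "\<And>t. t \<notin> ball 0 r \<Longrightarrow> c t = 0"
    and I: "(\<integral>t. c t \<partial>lborel) = 1" and r: "0 < r"
  obtains h where "smooth_on UNIV h" "\<And>t. (h has_real_derivative c t) (at t)"
    "\<And>t. t \<le> - r \<Longrightarrow> h t = 0" "\<And>t. r \<le> t \<Longrightarrow> h t = 1" "\<And>t. 0 \<le> h t" "\<And>t. h t \<le> 1"
proof -
  have cont: "continuous_on UNIV c" by (rule smooth_on_continuous[OF c(1)])
  have [measurable]: "c \<in> borel_measurable borel" using cont by (rule borel_measurable_continuous_onI)
  have int: "integrable lborel c"
    by (rule integral_compact_support(1)[OF cont compact_cball[of 0 r]]) (use c(3) in \<open>auto simp: dist_norm\<close>)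
  define h where "h t = (\<integral>s. indicator {..t} s * c s \<partial>lborel)" for t
  have inti: "integrable lborel (\<lambda>s. indicator {..t} s * c s)" for t
    using integrable_mult_indicator[OF _ int, of "{..t}"] by simp
  have c0: "c s = 0" if "s \<le> - r \<or> r \<le> s" for s using that c(3)[of s] by (auto simp: dist_norm)
  have h0: "h t = 0" if "t \<le> - r" for t
  proof -
    have "(\<lambda>s. indicator {..t} s * c s) = (\<lambda>_. 0)" using c0 that by (auto simp: fun_eq_iff indicator_def)
    then show ?thesis by (simp add: h_def)
  qed
  have h1: "h t = 1" if "r \<le> t" for t
  proof -
    have "(\<lambda>s. indicator {..t} s * c s) = c" using c0 that by (auto simp: fun_eq_iff indicator_def)
    then show ?thesis using I by (simp add: h_def)
  qed
  have nn: "0 \<le> h t" for t unfolding h_def using c(2) by (intro integral_nonneg_AE AE_I2) auto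
  have le1: "h t \<le> 1" for t
    unfolding h_def I[symmetric] using c(2) by (intro integral_mono inti int) (auto simp: indicator_def)
  have eq: "h t = integral {-b..t} c" if "r \<le> b" for b t
  proof -
    have "(\<lambda>s. indicator {..t} s * c s) = (\<lambda>s. indicator {-b..t} s *\<^sub>R c s)"
      using c0 that by (auto simp: fun_eq_iff indicator_def)
    then have "h t = (LINT s:{-b..t}|lborel. c s)" by (simp add: h_def set_lebesgue_integral_def)
    also have "\<dots> = integral {-b..t} c"
      using integrable_mult_indicator[OF _ int, of "{-b..t}"]
      by (intro set_borel_integral_eq_integral(2)) (simp add: set_integrable_def)
    finally show ?thesis .
  qed
  have der: "(h has_real_derivative c t) (at t)" for t
  proof -
    define b where "b = r + \<bar>t\<bar> + 1"
    have t: "t \<in> {-b<..<b}" using r by (auto simp: b_def)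
    have "((\<lambda>s. integral {-b..s} c) has_real_derivative c t) (at t within {-b..b})"
      using t by (intro integral_has_real_derivative continuous_on_subset[OF cont]) auto
    then have "((\<lambda>s. integral {-b..s} c) has_real_derivative c t) (at t)"
      using t at_within_Icc_at[of "-b" t b] by simp
    moreover have "h = (\<lambda>s. integral {-b..s} c)" by (rule ext, rule eq) (simp add: b_def)
    ultimately show ?thesis by simp
  qed
  have "smooth_on UNIV h"
  proof (rule smooth_onI)
    fix k
    have "Ck_on (Suc k) UNIV h" by (rule Ck_on_real_SucI[OF der smooth_onD[OF c(1)]])
    then show "Ck_on k UNIV h" by (rule Ck_on_Suc_imp)
  qed
  then show ?thesis by (rule that[OF _ der h0 h1 nn le1])
qed

text \<open>The explicit form of \<open>c\<close> is exported besides its properties as a density: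
  it makes \<open>c\<close> strictly positive on the whole ball and transfers integrability to the
  weight \<open>ball_bump\<close> of the localisation argument.\<close>

lemma ball_bump_normalized:
  fixes r :: real
  assumes r: "0 < r"
  obtains c :: "real \<Rightarrow> real" and k where "smooth_on UNIV c" "\<And>t. 0 \<le> c t" "\<And>t. t \<notin> ball 0 r \<Longrightarrow> c t = 0"
    "(\<integral>t. c t \<partial>lborel) = 1" "0 < k" "c = (\<lambda>t. k * ball_bump 0 r t)"
proof
  let ?I = "\<integral>y. ball_bump 0 r (y::real) \<partial>lborel"
  have I: "0 < ?I" by (rule integral_ball_bump_pos[OF r])
  show "smooth_on UNIV (\<lambda>t::real. (1 / ?I) * ball_bump 0 r t)"
    by (intro smooth_on_mult smooth_on_const smooth_on_ball_bump) auto
  show "0 \<le> (1 / ?I) * ball_bump 0 r t" for t :: real using I ball_bump_nonneg[of 0 r t] by simp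
  show "(1 / ?I) * ball_bump 0 r t = 0" if "t \<notin> ball 0 r" for t :: real using ball_bump_outside[OF r that] by simp
  show "(\<integral>t. (1 / ?I) * ball_bump 0 r (t::real) \<partial>lborel) = 1" using I by simp
  show "0 < 1 / ?I" using I by simp
qed (rule refl)

section \<open>Sections of shrinking neighbourhoods and one-dimensional localisation\<close>

lemma shrinking_neighbourhood:
  fixes A :: "'a::euclidean_space set"
  assumes "closed A" "x \<notin> A"
  shows "eventually (\<lambda>j. x \<notin> (\<Union>a\<in>A. ball a (1 / real (Suc j)))) sequentially"
proof -
  have "open (- A)" "x \<in> - A" using assms by auto
  then obtain e where e: "0 < e" "ball x e \<subseteq> - A" by (rule openE)
  have "(\<lambda>j. 1 / real (Suc j)) \<longlonglongrightarrow> 0" by (rule LIMSEQ_Suc[OF lim_const_over_n])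
  then have "eventually (\<lambda>j. 1 / real (Suc j) < e) sequentially" using e(1) by (rule order_tendstoD)
  then show ?thesis
  proof eventually_elim
    case (elim j)
    have "\<not> dist a x < 1 / real (Suc j)" if "a \<in> A" for a
    proof
      assume "dist a x < 1 / real (Suc j)"
      then have "a \<in> ball x e" using elim by (simp add: dist_commute)
      then show False using e(2) that by auto
    qed
    then show ?case by (simp del: of_nat_Suc)
  qed
qed

text \<open>Indicators of compact sets are pointwise limits of smooth tests with values in
  \<open>[0, 1]\<close>, so \<open>Y\<close> has nonpositive integral over every compact set. Inner
  regularity extends this to the set where \<open>Y\<close> is positive, which must therefore be
  null.\<close>

lemma AE_nonpos_if_smooth_tests_nonpos:
  fixes Y :: "'a::euclidean_space \<Rightarrow> real"
  assumes int: "integrable lborel Y"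
    and test: "\<And>s. smooth_on UNIV s \<Longrightarrow> (\<And>x. 0 \<le> s x) \<Longrightarrow> (\<And>x. s x \<le> 1) \<Longrightarrow> (\<integral>x. s x * Y x \<partial>lborel) \<le> 0"
  shows "AE x in lborel. Y x \<le> 0"
proof -
  have [measurable]: "Y \<in> borel_measurable borel" using borel_measurable_integrable[OF int] by simp
  obtain c :: "real \<Rightarrow> real" where c: "smooth_on UNIV c" "\<And>t. 0 \<le> c t" "\<And>t. t \<notin> ball 0 (1/4) \<Longrightarrow> c t = 0"
    "(\<integral>t. c t \<partial>lborel) = 1" by (rule ball_bump_normalized[of "1/4"]) simp_all
  obtain h where h: "smooth_on UNIV h" "\<And>t. (h has_real_derivative c t) (at t)"
    "\<And>t. t \<le> - (1/4) \<Longrightarrow> h t = 0" "\<And>t. 1/4 \<le> t \<Longrightarrow> h t = 1" "\<And>t. 0 \<le> h t" "\<And>t. h t \<le> 1"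
    by (rule smooth_transition[of c "1/4"]) (use c in auto)
  have K0: "(\<integral>x. indicator K x * Y x \<partial>lborel) \<le> 0" if K: "compact K" for K
  proof -
    define U where "U j = (\<Union>a\<in>K. ball a (1 / real (Suc j)))" for j
    have "\<exists>f. smooth_on UNIV f \<and> (\<forall>x. 0 \<le> f x) \<and> (\<forall>x\<in>K. 1 \<le> f x) \<and> (\<forall>x. x \<notin> U j \<longrightarrow> f x = (0::real))" for j
    proof -
      have "open (U j)" "K \<subseteq> U j" by (auto simp: U_def)
      from smooth_cutoff_compact[OF K this]
      obtain f where "smooth_on UNIV f" "\<And>x. 0 \<le> f x" "\<And>x. x \<in> K \<Longrightarrow> 1 \<le> f x" "\<And>x. x \<notin> U j \<Longrightarrow> f x = (0::real)" by blast
      then show ?thesis by (intro exI[of _ f] conjI allI ballI impI)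
    qed
    then have "\<exists>f. \<forall>j. smooth_on UNIV (f j) \<and> (\<forall>x. 0 \<le> f j x) \<and> (\<forall>x\<in>K. 1 \<le> f j x) \<and> (\<forall>x. x \<notin> U j \<longrightarrow> f j x = (0::real))"
      by (intro choice allI)
    then obtain f where f: "\<And>j. smooth_on UNIV (f j)" "\<And>j x. x \<in> K \<Longrightarrow> 1 \<le> f j x" "\<And>j x. x \<notin> U j \<Longrightarrow> f j x = (0::real)"
      by blast
    \<comment> \<open>After the shift by \<open>1/2\<close> the argument of \<open>h\<close> is at
      least \<open>1/2\<close> on \<open>K\<close> and equals \<open>- 1/2\<close> outside
      \<open>U j\<close>. Both lie beyond the transition zone of half-width \<open>1/4\<close>, so
      \<open>s j\<close> is 1 on \<open>K\<close> and 0 outside \<open>U j\<close>.\<close>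
    define s where "s j x = h (f j x + (- (1/2)))" for j x
    have s_smooth: "smooth_on UNIV (s j)" for j
      unfolding s_def by (intro smooth_on_compose_real[OF open_UNIV h(1)] smooth_on_add f smooth_on_const open_UNIV)
    have s_test: "(\<integral>x. s j x * Y x \<partial>lborel) \<le> 0" for j
      by (rule test[OF s_smooth]) (simp_all add: s_def h(5,6))
    have [measurable]: "s j \<in> borel_measurable borel" for j
      by (rule borel_measurable_continuous_onI[OF smooth_on_continuous[OF s_smooth]])
    have [measurable]: "K \<in> sets borel" using K by (simp add: borel_compact)
    have "(\<lambda>j. \<integral>x. s j x * Y x \<partial>lborel) \<longlonglongrightarrow> (\<integral>x. indicator K x * Y x \<partial>lborel)"
    proof (rule integral_dominated_convergence)
      show "integrable lborel (\<lambda>x. \<bar>Y x\<bar>)" using int by (rule integrable_abs)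
      show "AE x in lborel. (\<lambda>j. s j x * Y x) \<longlonglongrightarrow> indicator K x * Y x"
      proof (rule AE_I2)
        fix x
        have "(\<lambda>j. s j x) \<longlonglongrightarrow> indicator K x"
        proof (cases "x \<in> K")
          case True
          then have "s j x = 1" for j using f(2)[of x j] by (auto simp: s_def intro!: h(4))
          then show ?thesis using True by simp
        next
          case False
          have "eventually (\<lambda>j. x \<notin> U j) sequentially"
            unfolding U_def by (rule shrinking_neighbourhood[OF compact_imp_closed[OF K] False])
          then have "eventually (\<lambda>j. s j x = 0) sequentially"
            by eventually_elim (simp add: s_def f(3) h(3))
          then show ?thesis using False by (simp add: tendsto_eventually)
        qed
        then show "(\<lambda>j. s j x * Y x) \<longlonglongrightarrow> indicator K x * Y x" by (intro tendsto_intros)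
      qed
      show "AE x in lborel. norm (s j x * Y x) \<le> \<bar>Y x\<bar>" for j
      proof (rule AE_I2)
        fix x
        have "\<bar>s j x\<bar> * \<bar>Y x\<bar> \<le> 1 * \<bar>Y x\<bar>" by (rule mult_right_mono) (simp_all add: s_def h(5,6))
        then show "norm (s j x * Y x) \<le> \<bar>Y x\<bar>" by (simp add: abs_mult)
      qed
    qed measurable
    then show ?thesis by (rule LIMSEQ_le_const2) (use s_test in blast)
  qed
  \<comment> \<open>\<open>ennreal\<close> discards the negative part of \<open>Y\<close>. What
    remains is a finite Borel measure, to which inner regularity by compact sets applies.\<close>
  define M where "M = density lborel (\<lambda>x. ennreal (Y x))"
  have sM: "sets M = sets borel" by (simp add: M_def)
  have eM: "emeasure M B = (\<integral>\<^sup>+x. ennreal (indicator B x * Y x) \<partial>lborel)" if "B \<in> sets borel" for B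
    unfolding M_def using that
    by (subst emeasure_density) (auto intro!: nn_integral_cong simp: indicator_def)
  have fin: "(\<integral>\<^sup>+x. ennreal (Y x) \<partial>lborel) < \<infinity>"
    using integrableD(2)[OF int] by (auto simp: real_integrable_def less_top)
  then have "emeasure M (space M) \<noteq> \<infinity>" using eM[of UNIV] by (simp add: M_def)
  note reg = inner_regular[OF sM this]
  have Pm: "{x. 0 < Y x} \<in> sets borel" by measurable
  have "emeasure M {x. 0 < Y x} = 0"
    unfolding reg[OF Pm]
  proof (intro antisym SUP_least)
    fix K assume "K \<in> {K. K \<subseteq> {x. 0 < Y x} \<and> compact K}"
    then have K: "K \<subseteq> {x. 0 < Y x}" "compact K" by auto
    then have Kb: "K \<in> sets borel" by (simp add: borel_compact)
    have "integrable lborel (\<lambda>x. indicator K x * Y x)" using integrable_mult_indicator[OF _ int, of K] Kb by simp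
    then have "(\<integral>\<^sup>+x. ennreal (indicator K x * Y x) \<partial>lborel) = ennreal (\<integral>x. indicator K x * Y x \<partial>lborel)"
      using K(1) by (intro nn_integral_eq_integral AE_I2) (auto simp: indicator_def dest!: subsetD)
    then show "emeasure M K \<le> 0" using K0[OF K(2)] eM[OF Kb] by (simp add: ennreal_neg)
  qed simp
  then have "(\<integral>\<^sup>+x. ennreal (indicator {x. 0 < Y x} x * Y x) \<partial>lborel) = 0" using eM[OF Pm] by simp
  then have "AE x in lborel. ennreal (indicator {x. 0 < Y x} x * Y x) = 0"
    by (subst (asm) nn_integral_0_iff_AE) auto
  then show ?thesis
  proof eventually_elim
    case (elim x) then show ?case by (cases "0 < Y x") (auto simp: indicator_def ennreal_eq_0_iff)
  qed
qed

text \<open>Multiplying the fixed bump by any smooth \<open>s\<close> with values in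
  \<open>[0, 1]\<close> and normalising gives an admissible density. The hypothesis thus bounds
  \<open>\<Phi> t + T\<close>, weighted by the bump, against all such \<open>s\<close>; the bump is
  positive on the ball and drops out of the sign.\<close>

lemma AE_bound_if_smooth_averages_bounded:
  fixes \<Phi> :: "real \<Rightarrow> real"
  assumes r: "0 < r" and [measurable]: "\<Phi> \<in> borel_measurable borel"
    and int: "integrable lborel (\<lambda>t. ball_bump 0 r t * \<Phi> t)"
    and test: "\<And>c. smooth_on UNIV c \<Longrightarrow> (\<And>t. 0 \<le> c t) \<Longrightarrow> (\<And>t. t \<notin> ball 0 r \<Longrightarrow> c t = 0) \<Longrightarrow>
      (\<integral>t. c t \<partial>lborel) = 1 \<Longrightarrow> \<bar>(\<integral>t. c t * \<Phi> t \<partial>lborel) + T\<bar> \<le> \<epsilon>"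
  shows "AE t in lborel. t \<in> ball 0 r \<longrightarrow> \<bar>\<Phi> t + T\<bar> \<le> \<epsilon>"
proof -
  let ?c = "ball_bump (0::real) r"
  have [measurable]: "?c \<in> borel_measurable borel" by (rule borel_measurable_continuous_onI[OF continuous_ball_bump])
  have ic: "integrable lborel ?c" by (rule integrable_ball_bump[OF r])
  \<comment> \<open>The two bounds hidden in the absolute value are the cases
    \<open>\<sigma> = 1\<close> and \<open>\<sigma> = - 1\<close>.\<close>
  have half: "AE t in lborel. ?c t * (\<sigma> * (\<Phi> t + T) - \<epsilon>) \<le> 0" if \<sigma>: "\<bar>\<sigma>\<bar> = 1" for \<sigma> :: real
  proof (rule AE_nonpos_if_smooth_tests_nonpos)
    have "integrable lborel (\<lambda>t. \<sigma> * (?c t * \<Phi> t) + (\<sigma> * T - \<epsilon>) * ?c t)"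
      using int ic by (intro Bochner_Integration.integrable_add integrable_mult_right)
    then show "integrable lborel (\<lambda>t. ?c t * (\<sigma> * (\<Phi> t + T) - \<epsilon>))" by (simp add: algebra_simps)
    fix s :: "real \<Rightarrow> real" assume s: "smooth_on UNIV s" "\<And>x. 0 \<le> s x" "\<And>x. s x \<le> 1"
    have [measurable]: "s \<in> borel_measurable borel" by (rule borel_measurable_continuous_onI[OF smooth_on_continuous[OF s(1)]])
    have b: "\<bar>s t * a\<bar> \<le> \<bar>a\<bar>" for t a
    proof -
      have "\<bar>s t\<bar> * \<bar>a\<bar> \<le> 1 * \<bar>a\<bar>" using s(2,3)[of t] by (intro mult_right_mono) auto
      then show ?thesis by (simp add: abs_mult)
    qed
    have i1: "integrable lborel (\<lambda>t. s t * ?c t)" by (rule Bochner_Integration.integrable_bound[OF ic]) (auto intro: AE_I2 b)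
    have i2: "integrable lborel (\<lambda>t. s t * (?c t * \<Phi> t))" by (rule Bochner_Integration.integrable_bound[OF int]) (auto intro!: AE_I2 b simp del: abs_mult)
    \<comment> \<open>The mass by which the product of \<open>s\<close> and the bump is divided to
      become a probability density. If it is 0, the product vanishes almost everywhere and the claim
      is trivial.\<close>
    define k where "k = (\<integral>t. s t * ?c t \<partial>lborel)"
    have split: "(\<integral>t. s t * (?c t * (\<sigma> * (\<Phi> t + T) - \<epsilon>)) \<partial>lborel) = \<sigma> * ((\<integral>t. s t * (?c t * \<Phi> t) \<partial>lborel) + T * k) - \<epsilon> * k"
    proof -
      have "(\<integral>t. s t * (?c t * (\<sigma> * (\<Phi> t + T) - \<epsilon>)) \<partial>lborel) = (\<integral>t. \<sigma> * (s t * (?c t * \<Phi> t)) + (\<sigma> * T - \<epsilon>) * (s t * ?c t) \<partial>lborel)"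
        by (intro Bochner_Integration.integral_cong) (auto simp: algebra_simps)
      also have "\<dots> = \<sigma> * (\<integral>t. s t * (?c t * \<Phi> t) \<partial>lborel) + (\<sigma> * T - \<epsilon>) * k"
        unfolding k_def using i1 i2 by (subst Bochner_Integration.integral_add) (auto intro!: integrable_mult_right)
      finally show ?thesis by (simp add: algebra_simps)
    qed
    have k0: "0 \<le> k" unfolding k_def by (intro integral_nonneg_AE AE_I2 mult_nonneg_nonneg s(2) ball_bump_nonneg)
    show "(\<integral>t. s t * (?c t * (\<sigma> * (\<Phi> t + T) - \<epsilon>)) \<partial>lborel) \<le> 0"
    proof (cases "k = 0")
      case True
      have "AE t in lborel. s t * ?c t = 0"
        using integral_nonneg_eq_0_iff_AE[OF i1 AE_I2[OF mult_nonneg_nonneg[OF s(2) ball_bump_nonneg]]] True by (simp add: k_def)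
      then have "AE t in lborel. s t * (?c t * \<Phi> t) = 0" by eventually_elim auto
      then have "(\<integral>t. s t * (?c t * \<Phi> t) \<partial>lborel) = (\<integral>t. 0 \<partial>(lborel :: real measure))" by (intro integral_cong_AE) simp_all
      then show ?thesis unfolding split using True by simp
    next
      case False
      then have k: "0 < k" using k0 by simp
      have "\<bar>(\<integral>t. ((1 / k) * (s t * ?c t)) * \<Phi> t \<partial>lborel) + T\<bar> \<le> \<epsilon>"
      proof (rule test)
        show "smooth_on UNIV (\<lambda>t. (1 / k) * (s t * ?c t))"
          by (intro smooth_on_mult smooth_on_const smooth_on_ball_bump s open_UNIV)
        show "0 \<le> (1 / k) * (s t * ?c t)" for t using k s(2)[of t] ball_bump_nonneg[of 0 r t] by simp
        show "(1 / k) * (s t * ?c t) = 0" if "t \<notin> ball 0 r" for t using ball_bump_outside[OF r that] by simp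
        show "(\<integral>t. (1 / k) * (s t * ?c t) \<partial>lborel) = 1" using k by (simp add: k_def)
      qed
      moreover have "(\<integral>t. ((1 / k) * (s t * ?c t)) * \<Phi> t \<partial>lborel) = (1 / k) * (\<integral>t. s t * (?c t * \<Phi> t) \<partial>lborel)"
        unfolding mult.assoc by (rule integral_mult_right_zero)
      ultimately have bound: "\<bar>(1 / k) * (\<integral>t. s t * (?c t * \<Phi> t) \<partial>lborel) + T\<bar> \<le> \<epsilon>" by (simp only:)
      have "\<sigma> * ((1 / k) * (\<integral>t. s t * (?c t * \<Phi> t) \<partial>lborel) + T) \<le> \<bar>\<sigma>\<bar> * \<bar>(1 / k) * (\<integral>t. s t * (?c t * \<Phi> t) \<partial>lborel) + T\<bar>"
        unfolding abs_mult[symmetric] by (rule abs_ge_self)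
      then have "k * (\<sigma> * ((1 / k) * (\<integral>t. s t * (?c t * \<Phi> t) \<partial>lborel) + T)) \<le> k * \<epsilon>"
        using bound k \<sigma> by (intro mult_left_mono) auto
      also have "k * (\<sigma> * ((1 / k) * (\<integral>t. s t * (?c t * \<Phi> t) \<partial>lborel) + T)) = \<sigma> * ((\<integral>t. s t * (?c t * \<Phi> t) \<partial>lborel) + T * k)"
        using k by (simp add: field_simps)
      finally show ?thesis unfolding split by (simp add: mult.commute)
    qed
  qed
  have "AE t in lborel. ?c t * (1 * (\<Phi> t + T) - \<epsilon>) \<le> 0" by (rule half) simp
  moreover have "AE t in lborel. ?c t * ((-1) * (\<Phi> t + T) - \<epsilon>) \<le> 0" by (rule half) simp
  ultimately show ?thesis
  proof eventually_elim
    case (elim t)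
    show ?case
    proof
      assume "t \<in> ball 0 r"
      then have "0 < ?c t" using ball_bump_pos_iff[OF r, of 0 t] by simp
      then have "\<Phi> t + T - \<epsilon> \<le> 0" "- T - \<Phi> t - \<epsilon> \<le> 0" using elim by (auto simp: mult_le_0_iff)
      then show "\<bar>\<Phi> t + T\<bar> \<le> \<epsilon>" by simp
    qed
  qed
qed

section \<open>Fluxes through level sets\<close>

context regular_function begin

text \<open>\<open>ennreal\<close> cuts off the negative values of \<open>b\<close>; the integral of
  a signed \<open>b\<close> over a level is recovered from the slices of \<open>b\<close> and of its
  negative.\<close>

definition slice :: "('a \<Rightarrow> real) \<Rightarrow> real \<Rightarrow> ennreal" where
  "slice b t = (\<integral>\<^sup>+x. ennreal (b x) * indicator (Z \<inter> {x. w x = t}) x \<partial>hausdorff_measure (DIM('a) - 1))"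

lemma slice_borel: "b \<in> borel_measurable borel \<Longrightarrow> slice b \<in> borel_measurable borel"
  unfolding slice_def[abs_def] using coarea[of "\<lambda>x. ennreal (b x)"] by simp

text \<open>On the level \<open>w x = t\<close> the factor \<open>c t\<close> equals
  \<open>c (w x)\<close>, so it moves into the inner integral and the coarea formula applies to the
  product.\<close>

lemma slice_integral:
  fixes c :: "real \<Rightarrow> real"
  assumes b [measurable]: "b \<in> borel_measurable borel" and c [measurable]: "c \<in> borel_measurable borel" and c0: "\<And>t. 0 \<le> c t"
  shows "(\<integral>\<^sup>+t. ennreal (c t) * slice b t \<partial>lborel) = (\<integral>\<^sup>+x. ennreal (c (w x) * b x * (norm (G x) * indicator Z x)) \<partial>lborel)"
proof -
  note w_borel [measurable]
  have bH: "(\<lambda>x. ennreal (b x) * indicator (Z \<inter> {x. w x = t}) x) \<in> borel_measurable (hausdorff_measure (DIM('a) - 1))" for t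
    by (rule hausdorff_measurable_of_borel) (use borel_Z level_borel in measurable)
  have fm: "(\<lambda>x. ennreal (c (w x)) * ennreal (b x)) \<in> borel_measurable borel" by measurable
  have "(\<integral>\<^sup>+t. ennreal (c t) * slice b t \<partial>lborel) =
      (\<integral>\<^sup>+t. (\<integral>\<^sup>+x. (ennreal (c (w x)) * ennreal (b x)) * indicator (Z \<inter> {x. w x = t}) x \<partial>hausdorff_measure (DIM('a) - 1)) \<partial>lborel)"
  proof (rule nn_integral_cong)
    fix t
    have "ennreal (c t) * slice b t = (\<integral>\<^sup>+x. ennreal (c t) * (ennreal (b x) * indicator (Z \<inter> {x. w x = t}) x) \<partial>hausdorff_measure (DIM('a) - 1))"
      unfolding slice_def by (rule nn_integral_cmult[OF bH, symmetric])
    also have "\<dots> = (\<integral>\<^sup>+x. (ennreal (c (w x)) * ennreal (b x)) * indicator (Z \<inter> {x. w x = t}) x \<partial>hausdorff_measure (DIM('a) - 1))"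
      by (rule nn_integral_cong) (simp add: indicator_def mult.assoc)
    finally show "ennreal (c t) * slice b t = \<dots>" .
  qed
  also have "\<dots> = (\<integral>\<^sup>+x. (ennreal (c (w x)) * ennreal (b x)) * (ennreal (norm (G x)) * indicator Z x) \<partial>lborel)"
    using coarea[OF fm] by (rule conjunct2)
  also have "\<dots> = (\<integral>\<^sup>+x. ennreal (c (w x) * b x * (norm (G x) * indicator Z x)) \<partial>lborel)"
  proof (rule nn_integral_cong)
    fix x
    show "(ennreal (c (w x)) * ennreal (b x)) * (ennreal (norm (G x)) * indicator Z x) = ennreal (c (w x) * b x * (norm (G x) * indicator Z x))"
    proof (cases "0 \<le> b x")
      case True
      then show ?thesis using c0[of "w x"] by (cases "x \<in> Z") (simp_all add: ennreal_mult)
    next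
      case False
      then have "ennreal (b x) = 0" by (simp add: ennreal_neg)
      moreover have "c (w x) * b x * (norm (G x) * indicator Z x) \<le> 0"
        using False c0[of "w x"] by (intro mult_nonpos_nonneg mult_nonneg_nonpos) auto
      ultimately show ?thesis by (simp add: ennreal_neg)
    qed
  qed
  finally show ?thesis .
qed

text \<open>One sign of the weighted coarea identity. \<open>enn2real\<close> turns an infinite
  slice into 0; this does not change the integral, since integrability makes slices finite at almost
  every level with positive weight.\<close>

lemma slice_half:
  fixes c :: "real \<Rightarrow> real"
  assumes b: "b \<in> borel_measurable borel" and c [measurable]: "c \<in> borel_measurable borel" and c0: "\<And>t. 0 \<le> c t"
    and int: "integrable lborel (\<lambda>x. c (w x) * b x * (norm (G x) * indicator Z x))"
  shows "integrable lborel (\<lambda>t. c t * enn2real (slice b t))"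
    and "(\<integral>t. c t * enn2real (slice b t) \<partial>lborel) = enn2real (\<integral>\<^sup>+x. ennreal (c (w x) * b x * (norm (G x) * indicator Z x)) \<partial>lborel)"
    and "AE t in lborel. 0 < c t \<longrightarrow> slice b t < \<infinity>"
proof -
  note [measurable] = slice_borel[OF b]
  have fin: "(\<integral>\<^sup>+t. ennreal (c t) * slice b t \<partial>lborel) < \<infinity>"
    unfolding slice_integral[OF b c c0] using integrableD(2)[OF int] by (simp add: less_top)
  then have "AE t in lborel. ennreal (c t) * slice b t \<noteq> \<infinity>" by (intro nn_integral_PInf_AE) auto
  then show ae: "AE t in lborel. 0 < c t \<longrightarrow> slice b t < \<infinity>"
  proof eventually_elim
    case (elim t) then show ?case by (auto simp: ennreal_mult_eq_top_iff less_top[symmetric])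
  qed
  have eq: "(\<integral>\<^sup>+t. ennreal (c t * enn2real (slice b t)) \<partial>lborel) = (\<integral>\<^sup>+t. ennreal (c t) * slice b t \<partial>lborel)"
    using ae
  proof (intro nn_integral_cong_AE, eventually_elim)
    case (elim t)
    show ?case
    proof (cases "c t = 0")
      case False
      then have "slice b t < \<infinity>" using elim c0[of t] by simp
      then show ?thesis using c0[of t] by (simp add: ennreal_mult less_top)
    qed simp
  qed
  show i: "integrable lborel (\<lambda>t. c t * enn2real (slice b t))"
    using fin c0 unfolding eq[symmetric] by (intro integrableI_nonneg AE_I2) auto
  have "(\<integral>t. c t * enn2real (slice b t) \<partial>lborel) = enn2real (\<integral>\<^sup>+t. ennreal (c t * enn2real (slice b t)) \<partial>lborel)"
    using c0 by (intro integral_eq_nn_integral AE_I2) auto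
  then show "(\<integral>t. c t * enn2real (slice b t) \<partial>lborel) = enn2real (\<integral>\<^sup>+x. ennreal (c (w x) * b x * (norm (G x) * indicator Z x)) \<partial>lborel)"
    unfolding eq slice_integral[OF b c c0] .
qed

lemma slice_real:
  fixes c :: "real \<Rightarrow> real"
  assumes b [measurable]: "b \<in> borel_measurable borel" and c: "c \<in> borel_measurable borel" "\<And>t. 0 \<le> c t"
    and int: "integrable lborel (\<lambda>x. c (w x) * b x * (norm (G x) * indicator Z x))"
  shows "integrable lborel (\<lambda>t. c t * (enn2real (slice b t) - enn2real (slice (\<lambda>x. - b x) t)))"
    and "(\<integral>t. c t * (enn2real (slice b t) - enn2real (slice (\<lambda>x. - b x) t)) \<partial>lborel)
      = (\<integral>x. c (w x) * b x * (norm (G x) * indicator Z x) \<partial>lborel)"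
    and "AE t in lborel. 0 < c t \<longrightarrow> slice b t < \<infinity> \<and> slice (\<lambda>x. - b x) t < \<infinity>"
proof -
  have b': "(\<lambda>x. - b x) \<in> borel_measurable borel" by measurable
  have neg: "(\<lambda>x. c (w x) * - b x * (norm (G x) * indicator Z x)) = (\<lambda>x. - (c (w x) * b x * (norm (G x) * indicator Z x)))" by simp
  then have int': "integrable lborel (\<lambda>x. c (w x) * - b x * (norm (G x) * indicator Z x))" using int by simp
  note p = slice_half[OF b c int] and n = slice_half[OF b' c int']
  show "integrable lborel (\<lambda>t. c t * (enn2real (slice b t) - enn2real (slice (\<lambda>x. - b x) t)))"
    unfolding right_diff_distrib by (rule Bochner_Integration.integrable_diff[OF p(1) n(1)])
  show "(\<integral>t. c t * (enn2real (slice b t) - enn2real (slice (\<lambda>x. - b x) t)) \<partial>lborel)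
      = (\<integral>x. c (w x) * b x * (norm (G x) * indicator Z x) \<partial>lborel)"
    unfolding right_diff_distrib Bochner_Integration.integral_diff[OF p(1) n(1)] p(2) n(2) real_lebesgue_integral_def[OF int]
    by (simp only: mult_minus_left mult_minus_right)
  show "AE t in lborel. 0 < c t \<longrightarrow> slice b t < \<infinity> \<and> slice (\<lambda>x. - b x) t < \<infinity>"
    using p(3) n(3) by eventually_elim auto
qed

lemma slice_integrable:
  assumes b [measurable]: "b \<in> borel_measurable borel" and fin: "slice b t < \<infinity>" "slice (\<lambda>x. - b x) t < \<infinity>"
  shows "integrable (hausdorff_measure (DIM('a) - 1)) (\<lambda>x. b x * indicator (Z \<inter> {x. w x = t}) x)"
    and "(\<integral>x. b x * indicator (Z \<inter> {x. w x = t}) x \<partial>hausdorff_measure (DIM('a) - 1)) = enn2real (slice b t) - enn2real (slice (\<lambda>x. - b x) t)"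
proof -
  let ?H = "hausdorff_measure (DIM('a) - 1) :: 'a measure" and ?f = "\<lambda>x. b x * indicator (Z \<inter> {x. w x = t}) x"
  have m: "?f \<in> borel_measurable ?H"
    by (rule hausdorff_measurable_of_borel) (use borel_Z level_borel in measurable)
  have e: "(\<integral>\<^sup>+x. ennreal (?f x) \<partial>?H) = slice b t" "(\<integral>\<^sup>+x. ennreal (- ?f x) \<partial>?H) = slice (\<lambda>x. - b x) t"
    unfolding slice_def by (auto intro!: nn_integral_cong simp: indicator_def)
  show i: "integrable ?H ?f" unfolding real_integrable_def e using m fin by (simp add: less_top)
  show "integral\<^sup>L ?H ?f = enn2real (slice b t) - enn2real (slice (\<lambda>x. - b x) t)"
    unfolding real_lebesgue_integral_def[OF i] e ..
qed

end

text \<open>The values of \<open>F\<close> on a surface need not form a Borel function. They agree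
  with a Borel representative off a set of surface measure zero, and since all subsets of such a set
  are measurable, measurability carries over.\<close>

lemma hausdorff_integral_cong_null:
  fixes q r :: "'a::euclidean_space \<Rightarrow> real"
  assumes r: "integrable (hausdorff_measure d) r" and E: "hausdorff_outer_measure d E = 0"
    and eq: "\<And>x. x \<notin> E \<Longrightarrow> q x = r x"
  shows "integrable (hausdorff_measure d) q" "integral\<^sup>L (hausdorff_measure d) q = integral\<^sup>L (hausdorff_measure d) r"
proof -
  let ?H = "hausdorff_measure d :: 'a measure"
  have null: "B \<in> sets ?H" if "B \<subseteq> E" for B
  proof -
    have "hausdorff_outer_measure d B \<le> hausdorff_outer_measure d E" by (rule hausdorff_outer_mono[OF that])
    then show ?thesis using hausdorff_null_sets[of d B] E by (auto simp: null_sets_def)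
  qed
  have rm: "r \<in> borel_measurable ?H" by (rule borel_measurable_integrable[OF r])
  have qm: "q \<in> borel_measurable ?H"
  proof (rule measurableI)
    fix S :: "real set" assume "S \<in> sets borel"
    then have "r -` S \<inter> space ?H \<in> sets ?H" using rm by (intro measurable_sets)
    then have "(r -` S \<inter> space ?H - E) \<union> (q -` S \<inter> E) \<in> sets ?H" by (intro sets.Un[OF sets.Diff[OF _ null] null]) auto
    moreover have "(r -` S \<inter> space ?H - E) \<union> (q -` S \<inter> E) = q -` S \<inter> space ?H"
    proof (rule set_eqI)
      fix x show "x \<in> (r -` S \<inter> space ?H - E) \<union> (q -` S \<inter> E) \<longleftrightarrow> x \<in> q -` S \<inter> space ?H"
        using eq[of x] by (cases "x \<in> E") auto
    qed
    ultimately show "q -` S \<inter> space ?H \<in> sets ?H" by simp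
  qed simp
  have "AE x in ?H. x \<notin> E" by (rule AE_not_in[OF hausdorff_null_sets[OF E]])
  then have ae: "AE x in ?H. q x = r x" by eventually_elim (rule eq)
  show "integrable ?H q" using integrable_cong_AE[OF qm rm ae] r by simp
  show "integral\<^sup>L ?H q = integral\<^sup>L ?H r" by (rule integral_cong_AE[OF qm rm ae])
qed

text \<open>The two integrands agree on \<open>A\<close> and outside \<open>W\<close>, and on
  \<open>W - A\<close> they differ by at most \<open>\<bar>f x\<bar>\<close>. The resulting bound
  does not see the shape of \<open>\<psi>\<close>.\<close>

lemma cutoff_integral_difference:
  fixes f \<psi> :: "'a::euclidean_space \<Rightarrow> real"
  assumes f: "set_integrable N W f" and sets: "A \<in> sets N" "W \<in> sets N" and sub: "A \<subseteq> W" "W \<subseteq> \<Omega>"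
    and \<psi>: "\<psi> \<in> borel_measurable N" "\<And>x. 0 \<le> \<psi> x" "\<And>x. \<psi> x \<le> 1" "\<And>x. x \<in> A \<Longrightarrow> \<psi> x = 1" "\<And>x. x \<notin> W \<Longrightarrow> \<psi> x = 0"
  shows "\<bar>(LINT x:A|N. f x) - (LINT x:\<Omega>|N. \<psi> x * f x)\<bar> \<le> (LINT x:W-A|N. \<bar>f x\<bar>)"
proof -
  have iW: "integrable N (\<lambda>x. indicator W x * f x)" using f by (simp add: set_integrable_def)
  have iA: "integrable N (\<lambda>x. indicator A x * f x)"
    using set_integrable_subset[OF f sets(1) sub(1)] by (simp add: set_integrable_def)
  have eq: "indicator \<Omega> x * (\<psi> x * f x) = \<psi> x * (indicator W x * f x)" for x
    using \<psi>(5)[of x] sub(2) by (cases "x \<in> W") (auto simp: indicator_def)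
  have b: "\<bar>\<psi> x * a\<bar> \<le> \<bar>a\<bar>" for x a
  proof -
    have "\<bar>\<psi> x\<bar> * \<bar>a\<bar> \<le> 1 * \<bar>a\<bar>" using \<psi>(2,3)[of x] by (intro mult_right_mono) auto
    then show ?thesis by (simp add: abs_mult)
  qed
  have i\<psi>: "integrable N (\<lambda>x. indicator \<Omega> x * (\<psi> x * f x))"
    unfolding eq
    by (rule Bochner_Integration.integrable_bound[OF iW borel_measurable_times[OF \<psi>(1) borel_measurable_integrable[OF iW]] AE_I2])
      (simp only: real_norm_def b)
  have iD: "integrable N (\<lambda>x. indicator (W - A) x * \<bar>f x\<bar>)"
  proof -
    have "integrable N (\<lambda>x. \<bar>indicator (W - A) x *\<^sub>R (indicator W x * f x)\<bar>)"
      by (intro integrable_abs integrable_mult_indicator iW sets.Diff sets)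
    moreover have "(\<lambda>x. \<bar>indicator (W - A) x *\<^sub>R (indicator W x * f x)\<bar>) = (\<lambda>x. indicator (W - A) x * \<bar>f x\<bar>)"
      by (auto simp: fun_eq_iff indicator_def)
    ultimately show ?thesis by simp
  qed
  have "\<bar>(LINT x:A|N. f x) - (LINT x:\<Omega>|N. \<psi> x * f x)\<bar> = \<bar>\<integral>x. indicator A x * f x - indicator \<Omega> x * (\<psi> x * f x) \<partial>N\<bar>"
    using iA i\<psi> by (simp add: set_lebesgue_integral_def)
  also have "\<dots> \<le> (\<integral>x. indicator (W - A) x * \<bar>f x\<bar> \<partial>N)"
  proof -
    have "norm (indicator A x * f x - indicator \<Omega> x * (\<psi> x * f x)) \<le> indicator (W - A) x * \<bar>f x\<bar>" for x
      unfolding eq using \<psi>(4)[of x] sub b[of x "f x"] by (cases "x \<in> A"; cases "x \<in> W") (auto simp: indicator_def)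
    from Bochner_Integration.integral_norm_bound_integral[OF Bochner_Integration.integrable_diff[OF iA i\<psi>] iD this]
    show ?thesis by simp
  qed
  finally show ?thesis by (simp add: set_lebesgue_integral_def)
qed

text \<open>The measure and the weak gradient are parameters, so the arguments hold for any
  representatives. The \<open>SOME\<close> choices in \<open>div_measure\<close> and
  \<open>weak_grad\<close> appear only at the final interpretation.\<close>

locale divergence_pairing =
  fixes \<Omega> :: "'a::euclidean_space set" and F g :: "'a \<Rightarrow> 'a" and \<phi> :: "'a \<Rightarrow> real" and p :: ennreal and \<mu> :: "'a set \<Rightarrow> real"
  assumes open_\<Omega>: "open \<Omega>" and p: "1 \<le> p" and F: "F \<in> Lp p \<Omega>" and div: "has_divergence_measure \<Omega> F \<mu>"
    and \<phi>: "continuous_on \<Omega> \<phi>" and wg: "has_weak_gradient \<Omega> \<phi> g" and g: "g \<in> Lp (conj_exponent p) \<Omega>"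
begin

definition trace :: "'a set \<Rightarrow> real" where
  "trace A = real_measure_integral \<Omega> \<mu> A \<phi> + (LINT x:A|lebesgue. F x \<bullet> g x)"

text \<open>The integrals against the two parts of \<open>\<mu>\<close>, each with
  \<open>\<bar>\<phi> x\<bar>\<close>, take the role of an integral against the total
  variation.\<close>

definition trace_error :: "'a set \<Rightarrow> real" where
  "trace_error D = (LINT x:D|pos_part \<Omega> \<mu>. \<bar>\<phi> x\<bar>) + (LINT x:D|neg_part \<Omega> \<mu>. \<bar>\<phi> x\<bar>) + (LINT x:D|lebesgue. \<bar>F x \<bullet> g x\<bar>)"

lemma radon: "real_radon_measure \<Omega> \<mu>" using div by (simp add: has_divergence_measure_def)

lemma set_integrable_inner: "set_integrable lebesgue \<Omega> (\<lambda>x. F x \<bullet> g x)"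
proof -
  obtain F' where F': "Lp_borel p F'" "AE x in lborel. indicator \<Omega> x *\<^sub>R F x = F' x"
    "(\<lambda>x. indicator \<Omega> x *\<^sub>R F x) \<in> borel_measurable lebesgue"
    using Lp_ex_borel[OF open_\<Omega> F] by blast
  obtain g' where g': "Lp_borel (conj_exponent p) g'" "AE x in lborel. indicator \<Omega> x *\<^sub>R g x = g' x"
    "(\<lambda>x. indicator \<Omega> x *\<^sub>R g x) \<in> borel_measurable lebesgue"
    using Lp_ex_borel[OF open_\<Omega> g] by blast
  obtain A B where d: "dominated_pair F' g' A B" using dominated_pair_conj_exponent[OF p F'(1) g'(1)] by blast
  have [measurable]: "F' \<in> borel_measurable borel" "g' \<in> borel_measurable borel" using F'(1) g'(1) by (auto simp: Lp_borel_def)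
  have int: "integrable lborel (\<lambda>x. F' x \<bullet> g' x)" using dominated_pair.integrable_inner_shift[OF d, of 0] by simp
  have eq: "indicator \<Omega> x *\<^sub>R (F x \<bullet> g x) = (indicator \<Omega> x *\<^sub>R F x) \<bullet> (indicator \<Omega> x *\<^sub>R g x)" for x
    by (simp add: indicator_def)
  have "(\<lambda>x. indicator \<Omega> x *\<^sub>R (F x \<bullet> g x)) \<in> borel_measurable lebesgue"
    unfolding eq by (rule borel_measurable_inner[OF F'(3) g'(3)])
  moreover have "AE x in lborel. indicator \<Omega> x *\<^sub>R (F x \<bullet> g x) = F' x \<bullet> g' x"
    using F'(2) g'(2) by eventually_elim (simp only: eq)
  moreover have "(\<lambda>x. F' x \<bullet> g' x) \<in> borel_measurable borel" by measurable
  ultimately show ?thesis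
    unfolding set_integrable_def using integral_lebesgue_eq_lborel(2) int by blast
qed

text \<open>The compact set \<open>S\<close> unifies the two halves of the theorem: it is either a
  compact neighbourhood that contains \<open>W\<close>, or the support of \<open>\<phi>\<close>
  while \<open>W\<close> may be unbounded. In both cases \<open>\<phi>\<close> is bounded on
  \<open>W\<close>.\<close>

lemma \<phi>_bounded:
  assumes "W \<subseteq> \<Omega>" "compact S" "S \<subseteq> \<Omega>" "\<And>x. x \<in> W - S \<Longrightarrow> \<phi> x = 0"
  obtains c where "\<And>x. x \<in> W \<Longrightarrow> \<bar>\<phi> x\<bar> \<le> c"
proof -
  have "compact (\<phi> ` S)" using \<phi> assms(2,3) by (intro compact_continuous_image) (auto intro: continuous_on_subset)
  then obtain c where c: "\<And>x. x \<in> S \<Longrightarrow> \<bar>\<phi> x\<bar> \<le> c" using compact_imp_bounded by (force simp: bounded_iff)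
  have "\<bar>\<phi> x\<bar> \<le> max c 0" if "x \<in> W" for x using c[of x] assms(4)[of x] that by (cases "x \<in> S") (auto simp: le_max_iff_disj)
  then show ?thesis by (rule that)
qed

lemma set_integrable_\<phi>:
  assumes N: "finite_measure N" "sets N = sets (restrict_space borel \<Omega>)" and W: "W \<in> sets borel" "W \<subseteq> \<Omega>"
    and c: "\<And>x. x \<in> W \<Longrightarrow> \<bar>\<phi> x\<bar> \<le> c"
  shows "set_integrable N W \<phi>"
proof -
  interpret finite_measure N by fact
  have "\<phi> \<in> borel_measurable (restrict_space borel \<Omega>)" by (rule borel_measurable_continuous_on_restrict[OF \<phi>])
  then have \<phi>m: "\<phi> \<in> borel_measurable N" by (simp only: measurable_cong_sets[OF N(2) refl])
  have "W \<in> sets N" using W open_\<Omega> by (simp add: N(2) sets_restrict_space_iff)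
  then have "(\<lambda>x. indicator W x *\<^sub>R \<phi> x) \<in> borel_measurable N" using \<phi>m by measurable
  then show ?thesis
    unfolding set_integrable_def
    by (rule integrable_const_bound[of _ "max c 0", rotated]) (auto intro!: AE_I2 simp: indicator_def le_max_iff_disj c)
qed

lemma pairing_cutoff_estimate:
  assumes A: "closed A" "A \<subseteq> W" and W: "open W" "W \<subseteq> \<Omega>" and S: "compact S" "S \<subseteq> \<Omega>" "\<And>x. x \<in> W - S \<Longrightarrow> \<phi> x = 0"
    and \<psi>: "smooth_on UNIV \<psi>" "\<And>x. 0 \<le> \<psi> x" "\<And>x. \<psi> x \<le> 1" "\<And>x. x \<in> A \<Longrightarrow> \<psi> x = 1" "\<And>x. x \<notin> W \<Longrightarrow> \<psi> x = 0"
      "closure {x. \<psi> x \<noteq> 0} \<subseteq> W" "\<And>x. x \<notin> W \<Longrightarrow> grad \<psi> x = 0"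
  shows "set_integrable lebesgue \<Omega> (\<lambda>x. F x \<bullet> (\<phi> x *\<^sub>R grad \<psi> x))"
    and "\<bar>(LINT x:\<Omega>|lebesgue. F x \<bullet> (\<phi> x *\<^sub>R grad \<psi> x)) + trace A\<bar> \<le> trace_error (W - A)"
proof -
  have abs1: "\<bar>\<psi> x\<bar> \<le> 1" for x using \<psi>(2,3)[of x] by simp
  have clO: "closure {x. \<psi> x \<noteq> 0} \<subseteq> \<Omega>" using \<psi>(6) W(2) by simp
  have z1: "\<phi> x * \<psi> x = 0" if "x \<in> \<Omega> - S" for x using that S(3)[of x] \<psi>(5)[of x] by (cases "x \<in> W") auto
  have z2: "\<phi> x *\<^sub>R grad \<psi> x = 0" if "x \<in> \<Omega> - S" for x using that S(3)[of x] \<psi>(7)[of x] by (cases "x \<in> W") auto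
  note gg = gauss_green[OF open_\<Omega> p F div \<phi> wg g \<psi>(1) abs1 clO S(1,2) z1 z2]
  show "set_integrable lebesgue \<Omega> (\<lambda>x. F x \<bullet> (\<phi> x *\<^sub>R grad \<psi> x))" by (rule gg(2))
  obtain c where c: "\<And>x. x \<in> W \<Longrightarrow> \<bar>\<phi> x\<bar> \<le> c" using \<phi>_bounded[OF W(2) S] by blast
  have Wb: "W \<in> sets borel" and Ab: "A \<in> sets borel" using A W by auto
  have \<psi>b: "\<psi> \<in> borel_measurable borel" by (rule borel_measurable_continuous_onI[OF smooth_on_continuous[OF \<psi>(1)]])
  have part: "\<bar>(LINT x:A|N. \<phi> x) - (LINT x:\<Omega>|N. \<phi> x * \<psi> x)\<bar> \<le> (LINT x:W-A|N. \<bar>\<phi> x\<bar>)"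
    if N: "finite_measure N" "sets N = sets (restrict_space borel \<Omega>)" for N
  proof -
    have "A \<in> sets N" "W \<in> sets N" using Wb Ab A W open_\<Omega> by (auto simp: N(2) sets_restrict_space_iff)
    moreover have "\<psi> \<in> borel_measurable N"
      unfolding measurable_cong_sets[OF N(2) refl] using \<psi>b by (rule measurable_restrict_space1)
    moreover have "(\<lambda>x. \<phi> x * \<psi> x) = (\<lambda>x. \<psi> x * \<phi> x)" by (simp add: mult.commute)
    ultimately show ?thesis
      using cutoff_integral_difference[where \<psi> = \<psi>, OF set_integrable_\<phi>[OF N Wb W(2) c] _ _ A(2) W(2) _ \<psi>(2-5)]
      by simp
  qed
  have pos: "\<bar>(LINT x:A|pos_part \<Omega> \<mu>. \<phi> x) - (LINT x:\<Omega>|pos_part \<Omega> \<mu>. \<phi> x * \<psi> x)\<bar> \<le> (LINT x:W-A|pos_part \<Omega> \<mu>. \<bar>\<phi> x\<bar>)"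
    by (rule part[OF finite_measure_pos_part[OF radon] sets_pos_part])
  have neg: "\<bar>(LINT x:A|neg_part \<Omega> \<mu>. \<phi> x) - (LINT x:\<Omega>|neg_part \<Omega> \<mu>. \<phi> x * \<psi> x)\<bar> \<le> (LINT x:W-A|neg_part \<Omega> \<mu>. \<bar>\<phi> x\<bar>)"
    by (rule part[OF finite_measure_neg_part[OF radon] sets_neg_part])
  have leb: "\<bar>(LINT x:A|lebesgue. F x \<bullet> g x) - (LINT x:\<Omega>|lebesgue. \<psi> x * (F x \<bullet> g x))\<bar> \<le> (LINT x:W-A|lebesgue. \<bar>F x \<bullet> g x\<bar>)"
  proof (rule cutoff_integral_difference[where \<psi> = \<psi>, OF _ _ _ A(2) W(2) _ \<psi>(2-5)])
    show "W \<in> sets lebesgue" "A \<in> sets lebesgue" using Wb Ab by auto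
    then show "set_integrable lebesgue W (\<lambda>x. F x \<bullet> g x)" by (intro set_integrable_subset[OF set_integrable_inner _ W(2)])
    show "\<psi> \<in> borel_measurable lebesgue" using \<psi>b by (intro measurable_completion) simp
  qed
  have "(LINT x:\<Omega>|lebesgue. F x \<bullet> (\<phi> x *\<^sub>R grad \<psi> x)) =
      - (LINT x:\<Omega>|lebesgue. \<psi> x * (F x \<bullet> g x)) - ((LINT x:\<Omega>|pos_part \<Omega> \<mu>. \<phi> x * \<psi> x) - (LINT x:\<Omega>|neg_part \<Omega> \<mu>. \<phi> x * \<psi> x))"
    using gg(3) by (simp add: real_measure_integral_def)
  then show "\<bar>(LINT x:\<Omega>|lebesgue. F x \<bullet> (\<phi> x *\<^sub>R grad \<psi> x)) + trace A\<bar> \<le> trace_error (W - A)"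
    unfolding trace_def trace_error_def real_measure_integral_def using pos neg leb by linarith
qed

end

lemma AE_ball_ex:
  assumes "AE t in lborel. t \<in> ball (0::real) r \<longrightarrow> P t" "0 < r"
  obtains t where "t \<in> ball 0 r" "P t"
proof (rule ccontr)
  note P = that
  assume "\<not> thesis"
  then have "\<not> P t" if "t \<in> ball 0 r" for t using P that by blast
  then have "AE t in lborel. t \<notin> ball (0::real) r" using assms(1) by (auto elim!: AE_mp)
  then have "ball (0::real) r \<in> null_sets lborel" by (subst AE_iff_null_sets) auto
  moreover have "ball (0::real) r = {-r<..<r}" by (auto simp: dist_norm)
  ultimately show False using assms(2) by (simp add: null_sets_def)
qed

lemma tendsto_integral_vanishing_sets:
  fixes f :: "'a \<Rightarrow> real"
  assumes f: "set_integrable N W f" and D: "\<And>k. D k \<in> sets N" "\<And>k. D k \<subseteq> W"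
    and ev: "\<And>x. eventually (\<lambda>k. x \<notin> D k) sequentially"
  shows "(\<lambda>k. LINT x:D k|N. \<bar>f x\<bar>) \<longlonglongrightarrow> 0"
proof -
  have iW: "integrable N (\<lambda>x. indicator W x * f x)" using f by (simp add: set_integrable_def)
  have eq: "indicator (D k) x *\<^sub>R \<bar>f x\<bar> = indicator (D k) x * \<bar>indicator W x * f x\<bar>" for k x
    using D(2)[of k] by (auto simp: indicator_def)
  have "(\<lambda>k. \<integral>x. indicator (D k) x * \<bar>indicator W x * f x\<bar> \<partial>N) \<longlonglongrightarrow> (\<integral>x. 0 \<partial>N)"
  proof (rule integral_dominated_convergence)
    show "integrable N (\<lambda>x. \<bar>indicator W x * f x\<bar>)" by (rule integrable_abs[OF iW])
    show "(\<lambda>x. indicator (D k) x * \<bar>indicator W x * f x\<bar>) \<in> borel_measurable N" for k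
      using borel_measurable_integrable[OF iW] D(1)[of k] by measurable
    show "AE x in N. norm (indicator (D k) x * \<bar>indicator W x * f x\<bar>) \<le> \<bar>indicator W x * f x\<bar>" for k
      by (rule AE_I2) (simp add: indicator_def)
    show "AE x in N. (\<lambda>k. indicator (D k) x * \<bar>indicator W x * f x\<bar>) \<longlonglongrightarrow> 0"
    proof (rule AE_I2)
      fix x
      have "eventually (\<lambda>k. indicator (D k) x * \<bar>indicator W x * f x\<bar> = 0) sequentially"
        using ev[of x] by eventually_elim simp
      then show "(\<lambda>k. indicator (D k) x * \<bar>indicator W x * f x\<bar>) \<longlonglongrightarrow> 0" by (rule tendsto_eventually)
    qed
  qed simp
  then show ?thesis unfolding set_lebesgue_integral_def eq by simp
qed

context divergence_pairing begin

lemma smooth_superlevel_approximation: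
  assumes A: "closed A" "A \<subseteq> W" and W: "open W" "W \<subseteq> \<Omega>" and S: "compact S" "S \<subseteq> \<Omega>" "\<And>x. x \<in> W - S \<Longrightarrow> \<phi> x = 0"
  obtains V where "open V" "smooth_boundary V" "A \<subseteq> V" "V \<subseteq> W" "boundary_flux_exists \<Omega> F \<phi> V"
    "\<bar>boundary_flux F \<phi> V + trace A\<bar> \<le> trace_error (W - A)"
proof -
  obtain u where u: "smooth_on UNIV u" "\<And>x. 0 \<le> u x" "\<And>x. x \<in> A \<Longrightarrow> 1 \<le> u x" "\<And>x. x \<notin> W \<Longrightarrow> u x = (0::real)"
    by (rule smooth_cutoff_closed[OF A(1) W(1) A(2)]) blast
  \<comment> \<open>After the shift the function is at least \<open>1/2\<close> on \<open>A\<close>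
    and \<open>- 1/2\<close> outside \<open>W\<close>. A perturbation below \<open>1/4\<close>
    leaves every level in the interval from \<open>- 1/4\<close> to \<open>1/4\<close> between
    \<open>A\<close> and the complement of \<open>W\<close>.\<close>
  have "smooth_on UNIV (\<lambda>x. u x + (- (1/2)))" by (intro smooth_on_add u(1) smooth_on_const open_UNIV)
  then obtain v where v: "smooth_on UNIV v" "\<And>x. \<bar>v x - (u x + (- (1/2)))\<bar> < 1/4"
    "AE t in lborel. \<forall>x. v x = t \<longrightarrow> grad v x \<noteq> 0"
    by (rule regular_perturbation[where \<delta> = "1/4"]) (simp, blast)
  have vA: "1/4 < v x" if "x \<in> A" for x using v(2)[of x] u(3)[OF that] by linarith
  have vW: "v x < - (1/4)" if "x \<notin> W" for x using v(2)[of x] u(4)[OF that] by linarith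
  have v_cont: "continuous_on UNIV v" by (rule smooth_on_continuous[OF v(1)])
  have G_cont: "continuous_on UNIV (grad v)" by (rule continuous_on_grad[OF v(1)])
  define Z where "Z = {x. grad v x \<noteq> 0}"
  interpret R: regular_function v "grad v" Z
  proof
    have "open (UNIV \<inter> grad v -` (- {0}))" using G_cont by (intro continuous_open_preimage) auto
    moreover have "UNIV \<inter> grad v -` (- {0}) = Z" by (auto simp: Z_def)
    ultimately show "open Z" by simp
    show "continuous_on Z (grad v)" by (rule continuous_on_subset[OF G_cont]) simp
    show "v \<in> borel_measurable borel" by (rule borel_measurable_continuous_onI[OF v_cont])
    show "(v has_derivative (\<lambda>h. grad v x \<bullet> h)) (at x)" for x by (rule smooth_has_derivative_grad[OF v(1) UNIV_I])
    show "grad v x \<noteq> 0" if "x \<in> Z" for x using that by (simp add: Z_def)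
  qed
  obtain F' where F': "Lp_borel p F'" "AE x in lborel. indicator \<Omega> x *\<^sub>R F x = F' x"
    using Lp_ex_borel[OF open_\<Omega> F] by blast
  have F'm [measurable]: "F' \<in> borel_measurable borel" using F'(1) by (simp add: Lp_borel_def)
  \<comment> \<open>The flux uses the actual values of \<open>F\<close>, not those of
    \<open>F'\<close>. The set where they differ is enclosed in a Borel null set so that the coarea
    formula can be applied to it.\<close>
  obtain N0 where N0: "{x \<in> space lborel. \<not> indicator \<Omega> x *\<^sub>R F x = F' x} \<subseteq> N0" "emeasure lborel N0 = 0" "N0 \<in> sets lborel"
    by (rule AE_E[OF F'(2)])
  have F_eq: "F x = F' x" if "x \<in> \<Omega>" "x \<notin> N0" for x
  proof -
    have "x \<notin> {x \<in> space lborel. \<not> indicator \<Omega> x *\<^sub>R F x = F' x}" using N0(1) that(2) by blast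
    then show ?thesis using that(1) by simp
  qed
  have [measurable]: "grad v \<in> borel_measurable borel" by (rule borel_measurable_continuous_onI[OF G_cont])
  have [measurable]: "(\<lambda>x. indicator W x *\<^sub>R \<phi> x) \<in> borel_measurable borel"
    using W \<phi> by (intro borel_measurable_continuous_on_indicator) (auto intro: continuous_on_subset)
  \<comment> \<open>The flux integrand in Borel form. The indicator of \<open>W\<close> extends
    \<open>\<phi>\<close> to the whole space, and division by zero gives 0 at critical points, so
    multiplying by \<open>norm (grad v x)\<close> in the coarea formula exactly undoes the
    normalisation of the normal.\<close>
  define b where "b x = (indicator W x *\<^sub>R \<phi> x) * (F' x \<bullet> (grad v x /\<^sub>R norm (grad v x)))" for x
  have bm [measurable]: "b \<in> borel_measurable borel" unfolding b_def by measurable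
  have b_norm: "b x * (norm (grad v x) * indicator Z x) = (indicator W x *\<^sub>R \<phi> x) * (F' x \<bullet> grad v x)" for x
    by (cases "grad v x = 0") (simp_all add: b_def Z_def)
  define \<Phi> where "\<Phi> t = enn2real (R.slice b t) - enn2real (R.slice (\<lambda>x. - b x) t)" for t
  have avg: "integrable lborel (\<lambda>x. c (v x) * b x * (norm (grad v x) * indicator Z x))"
      "\<bar>(\<integral>x. c (v x) * b x * (norm (grad v x) * indicator Z x) \<partial>lborel) + trace A\<bar> \<le> trace_error (W - A)"
    if c: "smooth_on UNIV c" "\<And>t. 0 \<le> c t" "\<And>t. t \<notin> ball 0 (1/4) \<Longrightarrow> c t = 0" "(\<integral>t. c t \<partial>lborel) = 1" for c :: "real \<Rightarrow> real"
  proof -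
    obtain h where h: "smooth_on UNIV h" "\<And>t. (h has_real_derivative c t) (at t)"
      "\<And>t. t \<le> - (1/4) \<Longrightarrow> h t = 0" "\<And>t. 1/4 \<le> t \<Longrightarrow> h t = 1" "\<And>t. 0 \<le> h t" "\<And>t. h t \<le> 1"
      by (rule smooth_transition[of c "1/4"]) (use c in auto)
    define \<psi> where "\<psi> x = h (v x)" for x
    have \<psi>s: "smooth_on UNIV \<psi>" unfolding \<psi>_def by (rule smooth_on_compose_real[OF open_UNIV h(1) v(1)])
    have grad\<psi>: "grad \<psi> x = c (v x) *\<^sub>R grad v x" for x
    proof (rule grad_eqI)
      have "(h has_derivative (*) (c (v x))) (at (v x))" using h(2)[of "v x"] by (simp add: has_field_derivative_def)
      from has_derivative_compose[OF smooth_has_derivative_grad[OF v(1) UNIV_I] this]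
      show "(\<psi> has_derivative (\<lambda>y. (c (v x) *\<^sub>R grad v x) \<bullet> y)) (at x)" unfolding \<psi>_def[abs_def] by simp
    qed
    have cW: "c (v x) = 0" if "x \<notin> W" for x using vW[OF that] by (intro c(3)) (simp add: dist_norm)
    have cl: "closure {x. \<psi> x \<noteq> 0} \<subseteq> W"
    proof -
      have "closed {x. - (1/4) \<le> v x}" using v_cont by (intro closed_Collect_le continuous_intros)
      moreover have "{x. \<psi> x \<noteq> 0} \<subseteq> {x. - (1/4) \<le> v x}"
      proof
        fix x assume "x \<in> {x. \<psi> x \<noteq> 0}"
        then have "\<not> v x \<le> - (1/4)" using h(3)[of "v x"] by (auto simp: \<psi>_def)
        then show "x \<in> {x. - (1/4) \<le> v x}" by simp
      qed
      ultimately have "closure {x. \<psi> x \<noteq> 0} \<subseteq> {x. - (1/4) \<le> v x}" by (intro closure_minimal)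
      also have "\<dots> \<subseteq> W"
      proof
        fix x assume "x \<in> {x. - (1/4) \<le> v x}"
        then show "x \<in> W" using vW[of x] by (cases "x \<in> W") simp_all
      qed
      finally show ?thesis .
    qed
    have \<psi>A: "\<psi> x = 1" if "x \<in> A" for x unfolding \<psi>_def using vA[OF that] by (intro h(4)) simp
    have \<psi>W: "\<psi> x = 0" if "x \<notin> W" for x unfolding \<psi>_def using vW[OF that] by (intro h(3)) simp
    have \<psi>01: "0 \<le> \<psi> x" "\<psi> x \<le> 1" for x unfolding \<psi>_def by (rule h(5), rule h(6))
    have gW: "grad \<psi> x = 0" if "x \<notin> W" for x using cW[OF that] by (simp add: grad\<psi>)
    note est = pairing_cutoff_estimate[OF A W S \<psi>s \<psi>01 \<psi>A \<psi>W cl gW]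
    let ?q = "\<lambda>x. c (v x) * b x * (norm (grad v x) * indicator Z x)"
    have m1: "(\<lambda>x. indicator \<Omega> x *\<^sub>R (F x \<bullet> (\<phi> x *\<^sub>R grad \<psi> x))) \<in> borel_measurable lebesgue"
      using est(1) unfolding set_integrable_def by (rule borel_measurable_integrable)
    have [measurable]: "c \<in> borel_measurable borel" "v \<in> borel_measurable borel" "Z \<in> sets borel"
      using R.borel_Z borel_measurable_continuous_onI[OF v_cont] borel_measurable_continuous_onI[OF smooth_on_continuous[OF c(1)]] by auto
    have m2: "?q \<in> borel_measurable borel" by measurable
    have ae: "AE x in lborel. indicator \<Omega> x *\<^sub>R (F x \<bullet> (\<phi> x *\<^sub>R grad \<psi> x)) = ?q x"
      using F'(2)
    proof eventually_elim
      case (elim x)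
      show ?case
      proof (cases "x \<in> W")
        case True
        then have "x \<in> \<Omega>" using W(2) by blast
        then have "F x = F' x" using elim by simp
        then show ?thesis unfolding mult.assoc b_norm using True \<open>x \<in> \<Omega>\<close> by (simp add: grad\<psi> mult.left_commute)
      next
        case False
        then show ?thesis by (simp add: grad\<psi> cW)
      qed
    qed
    show "integrable lborel ?q" using integral_lebesgue_eq_lborel(2)[OF m1 m2 ae] est(1) by (simp add: set_integrable_def)
    show "\<bar>integral\<^sup>L lborel ?q + trace A\<bar> \<le> trace_error (W - A)"
      using integral_lebesgue_eq_lborel(1)[OF m1 m2 ae] est(2) by (simp add: set_lebesgue_integral_def)
  qed
  have c_borel: "c \<in> borel_measurable borel" if "smooth_on UNIV c" for c :: "real \<Rightarrow> real"
    by (rule borel_measurable_continuous_onI[OF smooth_on_continuous[OF that]])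
  \<comment> \<open>One concrete density, positive on the whole interval of levels. It provides
    integrability of \<open>\<Phi>\<close> against the bump and finiteness of the slices at almost
    every level in the interval.\<close>
  obtain c k where c: "smooth_on UNIV c" "\<And>t. 0 \<le> c t" "\<And>t. t \<notin> ball 0 (1/4) \<Longrightarrow> c t = 0" "(\<integral>t. c t \<partial>lborel) = 1"
    and k: "0 < k" "c = (\<lambda>t::real. k * ball_bump 0 (1/4) t)"
    by (rule ball_bump_normalized[of "1/4"]) simp_all
  have "integrable lborel (\<lambda>x. c (v x) * b x * (norm (grad v x) * indicator Z x))" by (rule avg(1)[OF c])
  note sl = R.slice_real[OF bm c_borel[OF c(1)] c(2) this]
  have \<Phi>m: "\<Phi> \<in> borel_measurable borel"
    unfolding \<Phi>_def[abs_def] by (intro borel_measurable_diff borel_measurable_enn2real R.slice_borel bm borel_measurable_uminus)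
  have "integrable lborel (\<lambda>t. (1 / k) * (c t * \<Phi> t))" using sl(1) unfolding \<Phi>_def by (rule integrable_mult_right)
  moreover have "(\<lambda>t. (1 / k) * (c t * \<Phi> t)) = (\<lambda>t. ball_bump 0 (1/4) t * \<Phi> t)" using k by (simp add: fun_eq_iff)
  ultimately have int: "integrable lborel (\<lambda>t. ball_bump 0 (1/4) t * \<Phi> t)" by simp
  have bound: "AE t in lborel. t \<in> ball 0 (1/4) \<longrightarrow> \<bar>\<Phi> t + trace A\<bar> \<le> trace_error (W - A)"
  proof (rule AE_bound_if_smooth_averages_bounded[OF _ \<Phi>m int])
    fix c :: "real \<Rightarrow> real"
    assume c: "smooth_on UNIV c" "\<And>t. 0 \<le> c t" "\<And>t. t \<notin> ball 0 (1/4) \<Longrightarrow> c t = 0" "(\<integral>t. c t \<partial>lborel) = 1"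
    have "(\<integral>t. c t * \<Phi> t \<partial>lborel) = (\<integral>x. c (v x) * b x * (norm (grad v x) * indicator Z x) \<partial>lborel)"
      unfolding \<Phi>_def by (rule R.slice_real(2)[OF bm c_borel[OF c(1)] c(2) avg(1)[OF c]])
    then show "\<bar>(\<integral>t. c t * \<Phi> t \<partial>lborel) + trace A\<bar> \<le> trace_error (W - A)" using avg(2)[OF c] by simp
  qed simp
  let ?H = "hausdorff_outer_measure (DIM('a) - 1) :: 'a set \<Rightarrow> ennreal"
  have N0Z: "N0 \<inter> Z \<in> sets borel" "N0 \<inter> Z \<subseteq> Z" using N0(3) R.borel_Z by auto
  \<comment> \<open>The coarea formula for \<open>N0 \<inter> Z\<close> has right-hand side 0, so
    almost every level meets the exceptional set of \<open>F\<close> in a set of surface measure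
    zero.\<close>
  have "AE t in lborel. ?H (N0 \<inter> Z \<inter> {x. v x = t}) = 0"
  proof -
    have "AE x in lborel. x \<notin> N0" using N0 by (intro AE_not_in) (auto simp: null_sets_def)
    then have "AE x in lborel. ennreal (norm (grad v x)) * indicator (N0 \<inter> Z) x = 0" by eventually_elim simp
    then have "(\<integral>\<^sup>+x. ennreal (norm (grad v x)) * indicator (N0 \<inter> Z) x \<partial>lborel) = (\<integral>\<^sup>+x. 0 \<partial>(lborel :: 'a measure))"
      by (rule nn_integral_cong_AE)
    then have "(\<integral>\<^sup>+t. ?H (N0 \<inter> Z \<inter> {x. v x = t}) \<partial>lborel) = 0" using R.coarea_set(2)[OF N0Z] by simp
    then show ?thesis using R.coarea_set(1)[OF N0Z] by (subst (asm) nn_integral_0_iff_AE) auto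
  qed
  \<comment> \<open>Each requirement on the level fails only on a null set of the interval. The
    interval has positive length, so a single level satisfies all of them.\<close>
  then have "AE t in lborel. t \<in> ball 0 (1/4) \<longrightarrow> (\<forall>x. v x = t \<longrightarrow> grad v x \<noteq> 0) \<and> \<bar>\<Phi> t + trace A\<bar> \<le> trace_error (W - A)
      \<and> ?H (N0 \<inter> Z \<inter> {x. v x = t}) = 0 \<and> R.slice b t < \<infinity> \<and> R.slice (\<lambda>x. - b x) t < \<infinity>"
    using v(3) bound sl(3)
  proof eventually_elim
    case (elim t)
    show ?case
    proof
      assume t: "t \<in> ball 0 (1/4)"
      then have "0 < c t" using k ball_bump_pos_iff[of "1/4" 0 t] by simp
      then show "(\<forall>x. v x = t \<longrightarrow> grad v x \<noteq> 0) \<and> \<bar>\<Phi> t + trace A\<bar> \<le> trace_error (W - A)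
        \<and> ?H (N0 \<inter> Z \<inter> {x. v x = t}) = 0 \<and> R.slice b t < \<infinity> \<and> R.slice (\<lambda>x. - b x) t < \<infinity>"
        using elim t by blast
    qed
  qed
  from AE_ball_ex[OF this] obtain t where t: "t \<in> ball 0 (1/4)" and reg: "\<And>x. v x = t \<Longrightarrow> grad v x \<noteq> 0"
    and bd: "\<bar>\<Phi> t + trace A\<bar> \<le> trace_error (W - A)" and null: "?H (N0 \<inter> Z \<inter> {x. v x = t}) = 0"
    and fin: "R.slice b t < \<infinity>" "R.slice (\<lambda>x. - b x) t < \<infinity>"
    by auto
  define V where "V = {x. t < v x}"
  have tt: "- (1/4) < t" "t < 1/4" using t by (auto simp: dist_norm)
  have fr: "frontier V = {x. v x = t}" unfolding V_def by (rule frontier_superlevel[OF v(1) reg])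
  have VW: "x \<in> W" if "t \<le> v x" for x using vW[of x] tt that by (cases "x \<in> W") auto
  have op: "open V" unfolding V_def using v_cont by (intro open_Collect_less continuous_intros)
  have nu: "inner_unit_normal V x = grad v x /\<^sub>R norm (grad v x)" if "v x = t" for x
    unfolding V_def by (rule superlevel_smooth_boundary(2)[OF v(1) reg that])
  let ?M = "hausdorff_measure (DIM('a) - 1) :: 'a measure"
  let ?f = "\<lambda>x. indicator (frontier V) x *\<^sub>R (\<phi> x * (F x \<bullet> inner_unit_normal V x))"
  \<comment> \<open>The whole frontier lies in \<open>W\<close> and consists of regular points, so
    off the exceptional set the flux integrand is \<open>b\<close>, and outside the frontier both
    sides vanish.\<close>
  have eqf: "?f x = b x * indicator (Z \<inter> {x. v x = t}) x" if "x \<notin> N0 \<inter> Z \<inter> {x. v x = t}" for x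
  proof (cases "v x = t")
    case True
    then have "x \<in> W" "x \<in> Z" using VW[of x] reg[of x] by (auto simp: Z_def)
    moreover from this have "F x = F' x" using that True W(2) by (intro F_eq) auto
    ultimately show ?thesis using True by (simp add: fr nu b_def)
  qed (simp add: fr)
  note si = R.slice_integrable[OF bm fin]
  have fl: "integrable ?M ?f" by (rule hausdorff_integral_cong_null(1)[OF si(1) null eqf])
  have fl': "integral\<^sup>L ?M ?f = integral\<^sup>L ?M (\<lambda>x. b x * indicator (Z \<inter> {x. v x = t}) x)"
    by (rule hausdorff_integral_cong_null(2)[OF si(1) null eqf])
  have "boundary_flux F \<phi> V = \<Phi> t"
    unfolding boundary_flux_def set_lebesgue_integral_def fl' si(2) \<Phi>_def ..
  moreover have "boundary_flux_exists \<Omega> F \<phi> V"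
    unfolding boundary_flux_exists_def set_integrable_def using fl VW W(2) by (auto simp: fr)
  moreover have "smooth_boundary V" unfolding V_def by (rule superlevel_smooth_boundary(1)[OF v(1) reg])
  moreover have "A \<subseteq> V" using vA tt by (force simp: V_def)
  moreover have "V \<subseteq> W" using VW by (auto simp: V_def)
  ultimately show ?thesis using that[OF op] bd by simp
qed

text \<open>For each \<open>k\<close> a single superlevel set is selected inside the neighbourhood
  of \<open>A\<close> of radius \<open>1 / (k + 1)\<close>, and its flux misses the negative trace
  by at most \<open>trace_error\<close> of the remaining collar. The selected sets may come from
  unrelated functions.\<close>

lemma smooth_approximation_sequence:
  assumes A: "closed A" "A \<subseteq> W" and W: "open W" "W \<subseteq> \<Omega>" and S: "compact S" "S \<subseteq> \<Omega>" "\<forall>x\<in>W - S. \<phi> x = 0"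
  shows "\<exists>V::nat \<Rightarrow> 'a set.
    (\<forall>k. open (V k) \<and> smooth_boundary (V k) \<and> A \<subseteq> V k \<and> V k \<subseteq> W \<and> boundary_flux_exists \<Omega> F \<phi> (V k)) \<and>
    (\<Inter>k. V k) = A \<and> (\<lambda>k. - boundary_flux F \<phi> (V k)) \<longlonglongrightarrow> trace A"
proof -
  define Wk where "Wk k = W \<inter> (\<Union>a\<in>A. ball a (1 / real (Suc k)))" for k
  have opWk: "open (Wk k)" for k unfolding Wk_def using W(1) by (intro open_Int open_UN ballI open_ball)
  have AWk: "A \<subseteq> Wk k" for k using A(2) by (auto simp: Wk_def simp del: of_nat_Suc)
  have WkW: "Wk k \<subseteq> W" for k by (simp add: Wk_def)
  \<comment> \<open>Since \<open>A\<close> is closed, each point eventually leaves the collars. This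
    drives the dominated convergence of the error and also shows that the intersection of the
    selected sets is no larger than \<open>A\<close>.\<close>
  have ev: "eventually (\<lambda>k. x \<notin> Wk k - A) sequentially" for x
  proof (cases "x \<in> A")
    case False
    from shrinking_neighbourhood[OF A(1) this] show ?thesis by eventually_elim (auto simp: Wk_def)
  qed simp
  have "\<exists>V. open V \<and> smooth_boundary V \<and> A \<subseteq> V \<and> V \<subseteq> Wk k \<and> boundary_flux_exists \<Omega> F \<phi> V
      \<and> \<bar>boundary_flux F \<phi> V + trace A\<bar> \<le> trace_error (Wk k - A)" for k
  proof -
    have "\<phi> x = 0" if "x \<in> Wk k - S" for x using that WkW[of k] S(3) by blast
    then obtain V where "open V" "smooth_boundary V" "A \<subseteq> V" "V \<subseteq> Wk k" "boundary_flux_exists \<Omega> F \<phi> V"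
      "\<bar>boundary_flux F \<phi> V + trace A\<bar> \<le> trace_error (Wk k - A)"
      by (rule smooth_superlevel_approximation[OF A(1) AWk opWk order_trans[OF WkW W(2)] S(1,2)])
    then show ?thesis by (intro exI[of _ V] conjI)
  qed
  then have "\<exists>V. \<forall>k. open (V k) \<and> smooth_boundary (V k) \<and> A \<subseteq> V k \<and> V k \<subseteq> Wk k \<and> boundary_flux_exists \<Omega> F \<phi> (V k)
      \<and> \<bar>boundary_flux F \<phi> (V k) + trace A\<bar> \<le> trace_error (Wk k - A)" by (intro choice allI)
  then obtain V where V: "\<And>k. open (V k)" "\<And>k. smooth_boundary (V k)" "\<And>k. A \<subseteq> V k" "\<And>k. V k \<subseteq> Wk k"
    "\<And>k. boundary_flux_exists \<Omega> F \<phi> (V k)" "\<And>k. \<bar>boundary_flux F \<phi> (V k) + trace A\<bar> \<le> trace_error (Wk k - A)"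
    by blast
  have Wb: "W \<in> sets borel" "Wk k - A \<in> sets borel" for k using W(1) A(1) opWk by auto
  obtain c where c: "\<And>x. x \<in> W \<Longrightarrow> \<bar>\<phi> x\<bar> \<le> c" using \<phi>_bounded[OF W(2) S(1,2) bspec[OF S(3)]] by blast
  have DW: "Wk k - A \<subseteq> W" for k using WkW by blast
  have part: "(\<lambda>k. LINT x:Wk k - A|N. \<bar>\<phi> x\<bar>) \<longlonglongrightarrow> 0"
    if N: "finite_measure N" "sets N = sets (restrict_space borel \<Omega>)" for N
  proof (rule tendsto_integral_vanishing_sets[OF set_integrable_\<phi>[OF N Wb(1) W(2) c] _ DW ev])
    show "Wk k - A \<in> sets N" for k
      using Wb(2)[of k] DW[of k] W(2) open_\<Omega> by (auto simp: N(2) sets_restrict_space_iff)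
  qed
  have iW: "set_integrable lebesgue W (\<lambda>x. F x \<bullet> g x)"
    using Wb(1) by (intro set_integrable_subset[OF set_integrable_inner _ W(2)]) auto
  have leb: "(\<lambda>k. LINT x:Wk k - A|lebesgue. \<bar>F x \<bullet> g x\<bar>) \<longlonglongrightarrow> 0"
    by (rule tendsto_integral_vanishing_sets[OF iW _ DW ev]) (use Wb(2) in auto)
  have "(\<lambda>k. trace_error (Wk k - A)) \<longlonglongrightarrow> 0 + 0 + 0"
    unfolding trace_error_def
    by (intro tendsto_add part leb finite_measure_pos_part finite_measure_neg_part radon sets_pos_part sets_neg_part)
  then have "(\<lambda>k. trace_error (Wk k - A)) \<longlonglongrightarrow> 0" by simp
  then have "(\<lambda>k. boundary_flux F \<phi> (V k) + trace A) \<longlonglongrightarrow> 0"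
    by (rule Lim_null_comparison[rotated]) (use V(6) in simp)
  then have "(\<lambda>k. trace A - (boundary_flux F \<phi> (V k) + trace A)) \<longlonglongrightarrow> trace A - 0" by (intro tendsto_diff tendsto_const)
  then have lim: "(\<lambda>k. - boundary_flux F \<phi> (V k)) \<longlonglongrightarrow> trace A" by simp
  have "(\<Inter>k. V k) = A"
  proof
    show "A \<subseteq> (\<Inter>k. V k)" using V(3) by blast
    show "(\<Inter>k. V k) \<subseteq> A"
    proof
      fix x assume x: "x \<in> (\<Inter>k. V k)"
      obtain k where "x \<notin> Wk k - A" using eventually_happens'[OF sequentially_bot ev[of x]] by blast
      then show "x \<in> A" using x V(4)[of k] by blast
    qed
  qed
  then show ?thesis using lim V(1-3,5) order_trans[OF V(4) WkW] by (intro exI[of _ V] conjI allI) simp_all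
qed

end

theorem theorem7p2:
  fixes \<Omega> U :: "'a::euclidean_space set"
    and F :: "'a \<Rightarrow> 'a" and \<phi> :: "'a \<Rightarrow> real" and p :: ennreal
  assumes "open \<Omega>" and "open U" and "1 \<le> p" and "F \<in> DM p \<Omega>"
    and "continuous_on \<Omega> \<phi>"
    and "weakly_differentiable_on \<Omega> \<phi>" and "weak_grad \<Omega> \<phi> \<in> Lp (conj_exponent p) \<Omega>"
  shows "(U \<Subset> \<Omega> \<longrightarrow>
           (\<exists>V :: nat \<Rightarrow> 'a set.
              (\<forall>k. open (V k) \<and> bounded (V k) \<and> smooth_boundary (V k) \<and>
                   U \<Subset> V k \<and> V k \<subseteq> \<Omega> \<and> boundary_flux_exists \<Omega> F \<phi> (V k)) \<and>
              (\<Inter>k. V k) = closure U \<and>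
              (\<lambda>k. - boundary_flux F \<phi> (V k)) \<longlonglongrightarrow> normal_trace \<Omega> F (closure U) \<phi>))
       \<and> (closure U \<subseteq> \<Omega> \<and> compact (supp_on \<Omega> \<phi>) \<and> supp_on \<Omega> \<phi> \<subseteq> \<Omega> \<longrightarrow>
           (\<exists>V :: nat \<Rightarrow> 'a set.
              (\<forall>k. open (V k) \<and> smooth_boundary (V k) \<and>
                   closure U \<subseteq> V k \<and> V k \<subseteq> \<Omega> \<and> boundary_flux_exists \<Omega> F \<phi> (V k)) \<and>
              (\<Inter>k. V k) = closure U \<and>
              (\<lambda>k. - boundary_flux F \<phi> (V k)) \<longlonglongrightarrow> normal_trace \<Omega> F (closure U) \<phi>))"
proof -
  have "\<exists>\<mu>. has_divergence_measure \<Omega> F \<mu>" using assms(4) by (simp add: DM_def)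
  then have div: "has_divergence_measure \<Omega> F (div_measure \<Omega> F)" unfolding div_measure_def by (rule someI_ex)
  have wg: "has_weak_gradient \<Omega> \<phi> (weak_grad \<Omega> \<phi>)"
    using assms(6) unfolding weakly_differentiable_on_def weak_grad_def by (rule someI_ex)
  have F: "F \<in> Lp p \<Omega>" using assms(4) by (simp add: DM_def)
  interpret divergence_pairing \<Omega> F "weak_grad \<Omega> \<phi>" \<phi> p "div_measure \<Omega> F"
    by (rule divergence_pairing.intro[OF assms(1,3) F div assms(5) wg assms(7)])
  have trace: "normal_trace \<Omega> F A \<phi> = trace A" for A by (simp add: normal_trace_def trace_def)
  show ?thesis
  proof (intro conjI impI)
    assume U: "U \<Subset> \<Omega>"
    then have A: "compact (closure U)" "closure U \<subseteq> \<Omega>" by (auto simp: compactly_contained_def)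
    obtain e where e: "0 < e" "(\<Union>x\<in>closure U. cball x e) \<subseteq> \<Omega>"
      by (rule compact_subset_open_imp_cball_epsilon_subset[OF A(1) assms(1) A(2)])
    \<comment> \<open>The closed neighbourhood of radius \<open>e\<close> is compact in
      \<open>\<Omega>\<close> and contains the open one. With these choices the vanishing condition
      on \<open>?W - ?S\<close> is empty, and all selected sets are bounded.\<close>
    let ?S = "\<Union>x\<in>closure U. cball x e" and ?W = "\<Union>x\<in>closure U. ball x e"
    have S: "compact ?S" by (rule compact_minkowski_sum_cball[OF A(1)])
    have WS: "?W \<subseteq> ?S" by (intro UN_mono ball_subset_cball order_refl)
    have W: "open ?W" by blast
    have AW: "closure U \<subseteq> ?W" using e(1) by auto
    have z: "\<forall>x\<in>?W - ?S. \<phi> x = 0" using WS by blast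
    from smooth_approximation_sequence[OF closed_closure AW W order_trans[OF WS e(2)] S e(2) z]
    obtain V where V: "\<And>k. open (V k) \<and> smooth_boundary (V k) \<and> closure U \<subseteq> V k \<and> V k \<subseteq> ?W \<and> boundary_flux_exists \<Omega> F \<phi> (V k)"
      "(\<Inter>k. V k) = closure U" "(\<lambda>k. - boundary_flux F \<phi> (V k)) \<longlonglongrightarrow> trace (closure U)"
      by blast
    have "V k \<subseteq> ?S" for k using V(1)[of k] WS by (meson order_trans)
    then have "bounded (V k)" "V k \<subseteq> \<Omega>" for k
      using bounded_subset[OF compact_imp_bounded[OF S]] order_trans[OF _ e(2)] by simp_all
    then show "\<exists>V :: nat \<Rightarrow> 'a set.
              (\<forall>k. open (V k) \<and> bounded (V k) \<and> smooth_boundary (V k) \<and>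
                   U \<Subset> V k \<and> V k \<subseteq> \<Omega> \<and> boundary_flux_exists \<Omega> F \<phi> (V k)) \<and>
              (\<Inter>k. V k) = closure U \<and>
              (\<lambda>k. - boundary_flux F \<phi> (V k)) \<longlonglongrightarrow> normal_trace \<Omega> F (closure U) \<phi>"
      using V A(1) by (intro exI[of _ V]) (simp add: trace compactly_contained_def)
  next
    assume "closure U \<subseteq> \<Omega> \<and> compact (supp_on \<Omega> \<phi>) \<and> supp_on \<Omega> \<phi> \<subseteq> \<Omega>"
    then have A: "closure U \<subseteq> \<Omega>" and S: "compact (supp_on \<Omega> \<phi>)" "supp_on \<Omega> \<phi> \<subseteq> \<Omega>" by auto
    \<comment> \<open>Here \<open>W\<close> is all of \<open>\<Omega>\<close> and the support of
      \<open>\<phi>\<close> serves as the compact set, so \<open>closure U\<close> may be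
      unbounded.\<close>
    have z: "\<forall>x\<in>\<Omega> - supp_on \<Omega> \<phi>. \<phi> x = 0"
      using closure_subset[of "{x \<in> \<Omega>. \<phi> x \<noteq> 0}"] unfolding supp_on_def by blast
    from smooth_approximation_sequence[OF closed_closure A assms(1) order_refl S z]
    obtain V where V: "\<And>k. open (V k) \<and> smooth_boundary (V k) \<and> closure U \<subseteq> V k \<and> V k \<subseteq> \<Omega> \<and> boundary_flux_exists \<Omega> F \<phi> (V k)"
      "(\<Inter>k. V k) = closure U" "(\<lambda>k. - boundary_flux F \<phi> (V k)) \<longlonglongrightarrow> trace (closure U)"
      by blast
    then show "\<exists>V :: nat \<Rightarrow> 'a set.
              (\<forall>k. open (V k) \<and> smooth_boundary (V k) \<and>
                   closure U \<subseteq> V k \<and> V k \<subseteq> \<Omega> \<and> boundary_flux_exists \<Omega> F \<phi> (V k)) \<and>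
              (\<Inter>k. V k) = closure U \<and>
              (\<lambda>k. - boundary_flux F \<phi> (V k)) \<longlonglongrightarrow> normal_trace \<Omega> F (closure U) \<phi>"
      by (intro exI[of _ V]) (simp add: trace)
  qed
qed

end
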